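(* For any SIRSN, as $\lambda\to\infty$ the number of singly infinite geodesics in $\mathcal S^*(\lambda)$ from $\mathbf 0$ increases to a finite limit number $G$ (possibly a random number, with finite mean). Moreover, if $G>1$ then these geodesics branch at $\mathbf 0$.
   Context: $\mathbf 0$ is the origin of $\mathbb{R}^2$, $\mathbf 1=(1,0)$, $\mathrm{disc}(z,r)$ is the closed disc, $\mathrm{len}$ is length, $\sigma_c(z)=cz$. A (feasible) route $\mathsf r(z,z')$ is a non-self-intersecting path from $z$ to $z'$ made of straight line segments between successive points $(z_i)$, with finite, semi-infinite or doubly infinite index set (with $z_i\to z$ as $i\to-\infty$, $z_i\to z'$ as $i\to\infty$ in the infinite directions), of finite total length; $\mathsf r(z',z)$ is the reversal of $\mathsf r(z,z')$. Routes are pairwise compatible if whenever two routes meet at two points they coincide on the subroute between these points. A feasible subnetwork on a locally finite configuration $(z_i)$ is the union $\mathsf s$ of pairwise compatible routes $\mathsf r(z_i,z_j)$, one for each pair (with marks recording which edges are in which routes), with $\mathrm{len}(\mathsf s\cap \mathrm{disc}(\mathbf 0,r))<\infty$ for all $r<\infty$. A process of random routes $\mathcal R(z_1,z_2)$, $z_1,z_2\in\mathbb R^2$, is specified by its finite-dimensional distributions: for each finite set $z_1,\dots,z_k$, the distribution $\mu_{z_1,\dots,z_k}$ of the random feasible subnetwork $\mathrm{span}(z_1,\dots,z_k)$ formed by the routes $\mathcal R(z_i,z_j)$. These are required to be consistent, invariant under translation and rotation, invariant under scaling (the image of $\mathrm{span}(z_1,\dots,z_k)$ under $\sigma_c$ is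 distributed as $\mathrm{span}(cz_1,\dots,cz_k)$, for all $c>0$), and with $(z_1,\dots,z_k)\mapsto\mu_{z_1,\dots,z_k}$ measurable. Let $(\Xi(\lambda),0<\lambda<\infty)$ be the positions of the points arriving during time $[0,\lambda]$ in a rate-one space-time Poisson point process on $\mathbb R^2\times[0,\infty)$, independent of the routes, and let $\mathcal S(\lambda)$ be the subnetwork on $\Xi(\lambda)$ consisting of the routes $\mathcal R(\xi,\xi')$, $\xi,\xi'\in\Xi(\lambda)$. The edge-intensity of a translation-invariant random edge process $\mathcal E$ is the $\iota\in[0,\infty]$ with $\mathbb E\,\mathrm{len}(\mathcal E\cap A)=\iota\cdot\mathrm{area}(A)$. Put $D_1=\mathrm{len}\,\mathcal R(\mathbf 0,\mathbf 1)$, $\mathcal E(\lambda,r)=\bigcup_{\xi,\xi'\in\Xi(\lambda)}\mathcal R(\xi,\xi')\setminus(\mathrm{disc}(\xi,r)\cup\mathrm{disc}(\xi',r))$, $p(\lambda,r)=$ edge-intensity of $\mathcal E(\lambda,r)$, $p(r)=\lim_{\lambda\to\infty}p(\lambda,r)$. The process is a SIRSN if its finite-dimensional distributions are distributions of random feasible subnetworks which are consistent, invariant under translation, rotation and scaling, and depend measurably on $(z_1,\dots,z_k)$, and moreover $1<\mathbb E D_1<\infty$ and $p(1)<\infty$ (this implies that the edge-intensity of $\mathcal S(1)$ is finite). Let $\mathcal S^*(\lambda)$ be the subnetwork obtained from $\mathcal S(\lambda)$ by adding the point $\mathbf 0$ and the routes $\mathcal R(\mathbf 0,\xi)$, $\xi\in\Xi(\lambda)$.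 A singly infinite geodesic in $\mathcal S^*(\lambda)$ from $\mathbf 0$ is an infinite path starting from $\mathbf 0$ such that any finite portion of it is a subroute of $\mathcal R(\mathbf 0,\xi)$ for some $\xi\in\Xi(\lambda)$. By compatibility, two distinct such geodesics share a common initial subroute and, once they branch, cannot re-join; they branch at $\mathbf 0$ if their only common point is $\mathbf 0$. In the second sentence of the claim, "these geodesics" are the $G$ geodesics from $\mathbf 0$ obtained in the limit $\lambda\to\infty$. The statements hold almost surely. *)

theory Defs
  imports "HOL-Probability.Probability"
begin

text \<open>
  Length of a planar set is one-dimensional Hausdorff measure, so that overlapping edges of
  several routes are counted once.
\<close>

definition len :: "'a::metric_space set \<Rightarrow> ennreal" where
  "len A = (SUP d\<in>{0<..}.
     INF U\<in>{U :: nat \<Rightarrow> 'a set. A \<subseteq> (\<Union>n. U n) \<and> (\<forall>n. bounded (U n) \<and> diameter (U n) \<le> d)}.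
       (\<Sum>n. ennreal (diameter (U n))))"

section \<open>Routes and feasible subnetworks\<close>

type_synonym point = "real ^ 2"
type_synonym route = "real \<Rightarrow> point"

text \<open>
  A route is represented by its constant-speed parametrization over \<open>[0,1]\<close>; the speed \<open>v\<close> is
  then its total length, so finiteness of the length is built in.  The corners are the points
  \<open>g (\<tau> i)\<close>; finite and semi-infinite index sets are the cases where \<open>\<tau>\<close> is eventually
  constant in one or both directions.
\<close>

definition is_route :: "route \<Rightarrow> bool" where
  "is_route g \<longleftrightarrow> arc g \<and>
     (\<exists>v. \<exists>\<tau> :: int \<Rightarrow> real. mono \<tau> \<and> (\<tau> \<longlongrightarrow> 0) at_bot \<and> (\<tau> \<longlongrightarrow> 1) at_top \<and>
        (\<forall>i. \<exists>a b. norm b = v \<and> (\<forall>t\<in>{\<tau> i..\<tau> (i + 1)}. g t = a + t *\<^sub>R b)))"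

text \<open>
  The routes themselves form the space (continuity is not a measurable event for the product
  sigma-algebra over \<open>{0..1}\<close>); elements of the space are \<open>undefined\<close> outside \<open>{0..1}\<close>.
\<close>

definition route_space :: "route measure" where
  "route_space = restrict_space (\<Pi>\<^sub>M t\<in>{0..1}. borel) {g. is_route g}"

definition compatible :: "route \<Rightarrow> route \<Rightarrow> bool" where
  "compatible g h \<longleftrightarrow>
     (\<forall>s\<in>{0..1}. \<forall>t\<in>{0..1}. \<forall>s'\<in>{0..1}. \<forall>t'\<in>{0..1}. g s = h s' \<and> g t = h t' \<longrightarrow>
        path_image (subpath s t g) = path_image (subpath s' t' h))"

definition pairs :: "nat set \<Rightarrow> (nat \<times> nat) set" where
  "pairs I = {(i, j). i \<in> I \<and> j \<in> I \<and> i \<noteq> j}"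

text \<open>
  A subnetwork together with the marks recording which edges belong to which routes is the
  family \<open>r\<close> of its routes: \<open>r (i, j)\<close> is the route from \<open>z i\<close> to \<open>z j\<close>.
\<close>

definition feasible_subnetwork ::
    "nat set \<Rightarrow> (nat \<Rightarrow> point) \<Rightarrow> (nat \<times> nat \<Rightarrow> route) \<Rightarrow> bool" where
  "feasible_subnetwork I z r \<longleftrightarrow>
     inj_on z I \<and> (\<forall>\<rho>. finite {i \<in> I. norm (z i) \<le> \<rho>}) \<and>
     (\<forall>(i, j)\<in>pairs I. is_route (r (i, j)) \<and>
        pathstart (r (i, j)) = z i \<and> pathfinish (r (i, j)) = z j \<and>
        r (j, i) = reversepath (r (i, j))) \<and>
     (\<forall>p\<in>pairs I. \<forall>q\<in>pairs I. compatible (r p) (r q)) \<and>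
     (\<forall>\<rho>. len ((\<Union>p\<in>pairs I. path_image (r p)) \<inter> cball 0 \<rho>) < \<infinity>)"

section \<open>Processes of random routes\<close>

definition config_space :: "nat \<Rightarrow> (nat \<Rightarrow> point) measure" where
  "config_space k = restrict_space (\<Pi>\<^sub>M i\<in>{..<k}. borel) {z. inj_on z {..<k}}"

definition net_space :: "nat \<Rightarrow> (nat \<times> nat \<Rightarrow> route) measure" where
  "net_space k = (\<Pi>\<^sub>M p\<in>pairs {..<k}. route_space)"

definition invariant_under ::
    "(nat \<Rightarrow> (nat \<Rightarrow> point) \<Rightarrow> (nat \<times> nat \<Rightarrow> route) measure) \<Rightarrow> (point \<Rightarrow> point) \<Rightarrow> bool" where
  "invariant_under \<mu> f \<longleftrightarrow>
     (\<forall>k. \<forall>z\<in>space (config_space k).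
        distr (\<mu> k z) (net_space k) (\<lambda>r. \<lambda>p\<in>pairs {..<k}. compose {0..1} f (r p)) =
        \<mu> k (\<lambda>i\<in>{..<k}. f (z i)))"

text \<open>
  \<open>\<mu> k z\<close> is the law of the subnetwork spanned by the distinct points \<open>z 0, \<dots>, z (k - 1)\<close>.
  Consistency under injections of the index sets comprises both passing to subsets and
  independence of the order in which the points are listed.
\<close>

locale random_routes =
  fixes \<mu> :: "nat \<Rightarrow> (nat \<Rightarrow> point) \<Rightarrow> (nat \<times> nat \<Rightarrow> route) measure"
  assumes kernel: "\<mu> k \<in> config_space k \<rightarrow>\<^sub>M prob_algebra (net_space k)"
    and feasible: "z \<in> space (config_space k) \<Longrightarrow>
      AE r in \<mu> k z. feasible_subnetwork {..<k} z r"
    and consistent: "z \<in> space (config_space k) \<Longrightarrow> inj_on f {..<m} \<Longrightarrow> f ` {..<m} \<subseteq> {..<k} \<Longrightarrow>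
      distr (\<mu> k z) (net_space m) (\<lambda>r. \<lambda>(i, j)\<in>pairs {..<m}. r (f i, f j)) =
      \<mu> m (\<lambda>i\<in>{..<m}. z (f i))"
    and translation: "invariant_under \<mu> (\<lambda>x. x + a)"
    and rotation: "orthogonal_transformation U \<Longrightarrow> det (matrix U) = 1 \<Longrightarrow> invariant_under \<mu> U"
    and scaling: "0 < c \<Longrightarrow> invariant_under \<mu> (\<lambda>x. c *\<^sub>R x)"

section \<open>Sampling the routes at a Poisson process\<close>

definition poisson_points :: "'w measure \<Rightarrow> 'a measure \<Rightarrow> (nat \<Rightarrow> 'w \<Rightarrow> 'a) \<Rightarrow> bool" where
  "poisson_points M \<nu> Y \<longleftrightarrow>
     (\<forall>n. Y n \<in> M \<rightarrow>\<^sub>M \<nu>) \<and>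
     (\<forall>A\<in>sets \<nu>. emeasure \<nu> A < \<infinity> \<longrightarrow> (\<forall>k.
        measure M {\<omega> \<in> space M. finite {n. Y n \<omega> \<in> A} \<and> card {n. Y n \<omega> \<in> A} = k} =
        measure \<nu> A ^ k / fact k * exp (- measure \<nu> A))) \<and>
     (\<forall>(J :: nat set) A. finite J \<and> disjoint_family_on A J \<and>
        (\<forall>j\<in>J. A j \<in> sets \<nu> \<and> emeasure \<nu> (A j) < \<infinity>) \<longrightarrow>
        prob_space.indep_vars M (\<lambda>_. count_space UNIV) (\<lambda>j \<omega>. card {n. Y n \<omega> \<in> A j}) J)"

definition space_time :: "(point \<times> real) measure" where
  "space_time = density lborel (indicator (UNIV \<times> {0..}))"

text \<open>
  \<open>Y n = (position, arrival time)\<close>.  Site \<open>0\<close> is the origin, site \<open>Suc n\<close> the position of \<open>Y n\<close>.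
\<close>

definition site :: "(nat \<Rightarrow> 'w \<Rightarrow> point \<times> real) \<Rightarrow> nat \<Rightarrow> 'w \<Rightarrow> point" where
  "site Y i \<omega> = (case i of 0 \<Rightarrow> 0 | Suc n \<Rightarrow> fst (Y n \<omega>))"

text \<open>The site indices of the points of \<open>\<Xi>(l)\<close>.\<close>

definition arrived :: "(nat \<Rightarrow> 'w \<Rightarrow> point \<times> real) \<Rightarrow> real \<Rightarrow> 'w \<Rightarrow> nat set" where
  "arrived Y l \<omega> = {Suc n |n. snd (Y n \<omega>) \<le> l}"

text \<open>
  Only the finite-dimensional laws of the route process are given, so evaluating it at random
  points independent of it means: conditionally on all the Poisson points, the routes between
  the first \<open>k\<close> sites have law \<open>\<mu> k\<close> of these sites.
\<close>

locale sampled_routes = random_routes \<mu> + prob_space M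
  for \<mu> and M :: "'w measure" +
  fixes Y :: "nat \<Rightarrow> 'w \<Rightarrow> point \<times> real"
    and R :: "nat \<times> nat \<Rightarrow> 'w \<Rightarrow> route"
  assumes poisson: "poisson_points M space_time Y"
    and route_measurable: "i \<noteq> j \<Longrightarrow> R (i, j) \<in> M \<rightarrow>\<^sub>M route_space"
    and conditional_law: "A \<in> sets (\<Pi>\<^sub>M n\<in>UNIV. borel) \<Longrightarrow> B \<in> sets (net_space k) \<Longrightarrow>
      emeasure M {\<omega> \<in> space M. (\<lambda>n. Y n \<omega>) \<in> A \<and> (\<lambda>p\<in>pairs {..<k}. R p \<omega>) \<in> B} =
      (\<integral>\<^sup>+ \<omega>. indicator A (\<lambda>n. Y n \<omega>) * emeasure (\<mu> k (\<lambda>i\<in>{..<k}. site Y i \<omega>)) B \<partial>M)"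

section \<open>SIRSNs\<close>

definition has_edge_intensity :: "'w measure \<Rightarrow> ('w \<Rightarrow> (point) set) \<Rightarrow> ennreal \<Rightarrow> bool" where
  "has_edge_intensity M E \<iota> \<longleftrightarrow>
     (\<forall>A\<in>sets borel. (\<integral>\<^sup>+ \<omega>. len (E \<omega> \<inter> A) \<partial>M) = \<iota> * emeasure lborel A)"

definition long_range_edges ::
    "(nat \<Rightarrow> 'w \<Rightarrow> point \<times> real) \<Rightarrow> (nat \<times> nat \<Rightarrow> 'w \<Rightarrow> route) \<Rightarrow>
     real \<Rightarrow> real \<Rightarrow> 'w \<Rightarrow> (point) set" where
  "long_range_edges Y R l r \<omega> =
     (\<Union>(i, j)\<in>pairs (arrived Y l \<omega>).
        path_image (R (i, j) \<omega>) - (cball (site Y i \<omega>) r \<union> cball (site Y j \<omega>) r))"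

text \<open>\<open>p(r) = x\<close>, where \<open>p(r)\<close> is the limit of the intensities \<open>p(l, r)\<close> as \<open>l \<rightarrow> \<infinity>\<close>.\<close>

definition has_limit_intensity ::
    "'w measure \<Rightarrow> (nat \<Rightarrow> 'w \<Rightarrow> point \<times> real) \<Rightarrow> (nat \<times> nat \<Rightarrow> 'w \<Rightarrow> route) \<Rightarrow>
     real \<Rightarrow> ennreal \<Rightarrow> bool" where
  "has_limit_intensity M Y R r x \<longleftrightarrow>
     (\<exists>p. (\<forall>l>0. has_edge_intensity M (long_range_edges Y R l r) (p l)) \<and> (p \<longlongrightarrow> x) at_top)"

definition mean_unit_route_length ::
    "(nat \<Rightarrow> (nat \<Rightarrow> point) \<Rightarrow> (nat \<times> nat \<Rightarrow> route) measure) \<Rightarrow> ennreal" where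
  "mean_unit_route_length \<mu> =
     (\<integral>\<^sup>+ r. len (path_image (r (0, 1))) \<partial>\<mu> 2 (\<lambda>i\<in>{..<2}. if i = 0 then 0 else vector [1, 0]))"

locale sirsn = sampled_routes \<mu> M Y R
  for \<mu> and M :: "'w measure" and Y R +
  assumes mean_gt_1: "1 < mean_unit_route_length \<mu>"
    and mean_finite: "mean_unit_route_length \<mu> < \<infinity>"
    and limit_intensity_finite: "\<exists>x<\<infinity>. has_limit_intensity M Y R 1 x"

section \<open>Singly infinite geodesics from the origin\<close>

text \<open>The portion of \<open>\<gamma>\<close> over \<open>[s,t]\<close> is a subroute of \<open>g\<close>, traversed in the same direction.\<close>

definition is_subroute :: "(real \<Rightarrow> point) \<Rightarrow> real \<Rightarrow> real \<Rightarrow> route \<Rightarrow> bool" where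
  "is_subroute \<gamma> s t g \<longleftrightarrow>
     (\<exists>u v. 0 \<le> u \<and> u \<le> v \<and> v \<le> 1 \<and> \<gamma> s = g u \<and> \<gamma> t = g v \<and>
        \<gamma> ` {s..t} = path_image (subpath u v g))"

text \<open>
  Geodesics are identified with their traces, so that reparametrizations are not counted
  twice.  An infinite path is one of infinite length.
\<close>

definition infinite_geodesics ::
    "(nat \<Rightarrow> 'w \<Rightarrow> point \<times> real) \<Rightarrow> (nat \<times> nat \<Rightarrow> 'w \<Rightarrow> route) \<Rightarrow>
     real \<Rightarrow> 'w \<Rightarrow> (point) set set" where
  "infinite_geodesics Y R l \<omega> =
     {\<gamma> ` {0..} |\<gamma>. continuous_on {0..} \<gamma> \<and> inj_on \<gamma> {0..} \<and> \<gamma> 0 = 0 \<and> len (\<gamma> ` {0..}) = \<infinity> \<and>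
        (\<forall>s t. 0 \<le> s \<and> s < t \<longrightarrow> (\<exists>j\<in>arrived Y l \<omega>. is_subroute \<gamma> s t (R (0, j) \<omega>)))}"

end

theory Submission
  imports Defs "HOL-Library.Ramsey"
begin

text \<open>
  Compatibility makes the routes from the origin agree, when parametrized by length, up to their
  last common point, so that they form a tree.  Group the routes from \<open>0\<close> to the points of \<open>\<Xi>(l)\<close>
  beyond radius \<open>4\<rho>\<close> by whether they meet beyond \<open>\<rho>\<close>: routes of different groups cross the annulus
  between \<open>\<rho>\<close> and \<open>2\<rho>\<close> disjointly, and each infinite geodesic follows a group with infinitely many
  routes.  The length of the far routes inside that annulus thus bounds \<open>\<rho>\<close> times the number of
  geodesics.

  Its mean is finite for \<open>\<rho> = 1\<close>, uniformly in \<open>l\<close>: replace the origin by a point arriving during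
  \<open>(l,l+1]\<close> near it, so that the far routes become part of \<open>\<E>(l + 1, 1)\<close>, whose intensity is bounded by
  assumption.  By scaling the mean is then at most \<open>C\<rho>\<close> for all \<open>\<rho>\<close> and \<open>l\<close>.  So the number of
  geodesics has mean at most \<open>C\<close>; being monotone in \<open>l\<close> with a law that, by scaling, does not
  depend on \<open>l\<close>, it is almost surely constant, and so is the set of geodesics.  The distance from \<open>0\<close> at which two
  geodesics branch is finite, and scaling makes its law invariant under dilations, so it is \<open>0\<close>.
\<close>

section \<open>Length\<close>

text \<open>The intensity bound speaks only of edges more than 1 away from both ends of a route
  between two Poisson points. This dictates the geometry: with \<rho> = 1 the annulus lies outside
  the unit disc about its centre, and a route end beyond radius 4 is more than 1 away from it. As 0
  is not a Poisson point, the centre has to be moved to one. Infinite length alone does not make a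
  geodesic leave every disc. The linear bound, summed over repeatedly halved radii, leaves only a
  finite length for far routes inside a disc, which excludes geodesics winding forever in a bounded
  region. Sets of geodesics carry no evident measurable structure, so events are expressed by
  countable conditions on the routes, with rational radii, and laws are compared for such events
  only. The enumeration of the Poisson points is arbitrary. Equality in law after scaling or a
  change of centre is meaningful only once the points are listed by increasing distance; the law of
  that list is determined by counts in bounded sets.\<close>

lemma len_leI:
  assumes "\<And>d. 0 < d \<Longrightarrow> \<exists>U. A \<subseteq> (\<Union>n. U n) \<and> (\<forall>n. bounded (U n) \<and> diameter (U n) \<le> d) \<and>
    (\<Sum>n. ennreal (diameter (U n))) \<le> L"
  shows "len A \<le> L"
  unfolding len_def
proof (intro SUP_least)
  fix d :: real assume "d \<in> {0<..}"
  then obtain U where "A \<subseteq> (\<Union>n. U n) \<and> (\<forall>n. bounded (U n) \<and> diameter (U n) \<le> d)"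
    "(\<Sum>n. ennreal (diameter (U n))) \<le> L" using assms[of d] by auto
  then show "(INF U\<in>{U. A \<subseteq> (\<Union>n. U n) \<and> (\<forall>n. bounded (U n) \<and> diameter (U n) \<le> d)}.
      \<Sum>n. ennreal (diameter (U n))) \<le> L"
    by (intro INF_lower2[of U]) auto
qed

lemma len_geI:
  assumes "0 < d" "\<And>U. A \<subseteq> (\<Union>n. U n) \<Longrightarrow> (\<And>n. bounded (U n)) \<Longrightarrow> (\<And>n. diameter (U n) \<le> d) \<Longrightarrow>
    L \<le> (\<Sum>n. ennreal (diameter (U n)))"
  shows "L \<le> len A"
  unfolding len_def using assms by (intro SUP_upper2[of d] INF_greatest) auto

lemma len_mono: "A \<subseteq> B \<Longrightarrow> len A \<le> len B"
  unfolding len_def by (intro SUP_mono' INF_superset_mono) auto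

text \<open>A covering of the translate, shifted back, has the same diameters. This allows the
  centre of a family of routes to be moved away from 0.\<close>

lemma len_translation_le:
  fixes A :: "'a::real_normed_vector set"
  shows "len A \<le> len ((+) a ` A)"
proof -
  have "len A \<le> (SUP d\<in>{0<..}. INF U\<in>{U. (+) a ` A \<subseteq> (\<Union>n. U n) \<and>
      (\<forall>n. bounded (U n) \<and> diameter (U n) \<le> d)}. (\<Sum>n. ennreal (diameter (U n))))"
    unfolding len_def
  proof (intro SUP_mono' INF_mono)
    fix d :: real and U :: "nat \<Rightarrow> 'a set"
    assume U: "U \<in> {U. (+) a ` A \<subseteq> (\<Union>n. U n) \<and> (\<forall>n. bounded (U n) \<and> diameter (U n) \<le> d)}"
    let ?W = "\<lambda>n. (+) (- a) ` U n"
    have "A \<subseteq> (\<Union>n. ?W n)"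
    proof
      fix x assume "x \<in> A"
      then have "a + x \<in> (\<Union>n. U n)" using U by auto
      then obtain n where "a + x \<in> U n" by auto
      then have "- a + (a + x) \<in> ?W n" by (rule imageI)
      then show "x \<in> (\<Union>n. ?W n)" by auto
    qed
    moreover have "diameter (?W n) = diameter (U n)" for n
      by (simp add: diameter_def image_image case_prod_beta SUP_image dist_norm flip: image_paired_Times)
    moreover have "bounded (?W n)" for n using U by (intro bounded_translation) auto
    ultimately show "\<exists>W\<in>{W. A \<subseteq> (\<Union>n. W n) \<and> (\<forall>n. bounded (W n) \<and> diameter (W n) \<le> d)}.
        (\<Sum>n. ennreal (diameter (W n))) \<le> (\<Sum>n. ennreal (diameter (U n)))"
      using U by (intro bexI[of _ ?W]) auto
  qed
  then show ?thesis unfolding len_def .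
qed

text \<open>Slabs of the parameter range of width \<open>(b - a) / n\<close> have images of diameter
  at most \<open>L * (b - a) / n\<close>, and these diameters add up to the bound. The parameter
  \<open>h\<close> is kept apart from the variable of \<open>f\<close>: for a route it is time
  itself, for an arbitrary curve it will be the arc length reached so far.\<close>

lemma len_image_le:
  fixes f :: "'b \<Rightarrow> 'a::real_normed_vector" and h :: "'b \<Rightarrow> real"
  assumes lip: "\<And>s t. s \<in> T \<Longrightarrow> t \<in> T \<Longrightarrow> dist (f s) (f t) \<le> L * dist (h s) (h t)"
    and h: "h ` T \<subseteq> {a..b}" and "0 \<le> L" "a \<le> b"
  shows "len (f ` T) \<le> ennreal (L * (b - a))"
proof (rule len_leI)
  fix d :: real assume "0 < d"
  obtain n :: nat where n: "L * (b - a) / d < n" using reals_Archimedean2 by blast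
  have "0 \<le> L * (b - a) / d" using assms \<open>0 < d\<close> by simp
  then have n0: "0 < n" using n by (cases n) auto
  let ?w = "(b - a) / n"
  have w: "L * ?w \<le> d" using n n0 \<open>0 < d\<close> by (simp add: field_simps)
  have w0: "0 \<le> L * ?w" using assms by simp
  define w where "w = ?w"
  define B where "B i = {t\<in>T. i < n \<and> a + real i * w \<le> h t \<and> h t \<le> a + (real i + 1) * w}" for i
  let ?U = "\<lambda>i. f ` B i"
  have cov: "f ` T \<subseteq> (\<Union>i. ?U i)"
  proof
    fix x assume "x \<in> f ` T"
    then obtain t where t: "t \<in> T" "x = f t" by auto
    have ht: "a \<le> h t" "h t \<le> b" using h t by auto
    show "x \<in> (\<Union>i. ?U i)"
    \<comment> \<open>The floor would give the top value \<open>b\<close> the index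
      \<open>n\<close>, so it is put into the last slab. This case also absorbs
      \<open>a = b\<close>, where the slabs have width 0.\<close>
    proof (cases "h t = b")
      case True
      have "a + real (n - 1) * ?w \<le> b" "a + (real (n - 1) + 1) * ?w = b"
        using n0 \<open>a \<le> b\<close> by (auto simp: field_simps of_nat_diff)
      then have "t \<in> B (n - 1)" unfolding B_def w_def using t True n0 by auto
      then show ?thesis using t by blast
    next
      case False
      then have ab: "h t < b" "a < b" using ht by auto
      let ?i = "nat \<lfloor>(h t - a) / ?w\<rfloor>"
      have w1: "0 < ?w" using ab n0 by simp
      have q: "0 \<le> (h t - a) / ?w" "(h t - a) / ?w < n"
        using ht ab n0 w1 by (auto simp: field_simps)
      then have i: "real ?i \<le> (h t - a) / ?w" "(h t - a) / ?w \<le> real ?i + 1" "?i < n"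
        by linarith+
      have "real ?i * ?w \<le> h t - a" using i(1) w1 by (simp only: pos_le_divide_eq)
      moreover have "h t - a \<le> (real ?i + 1) * ?w" using i(2) w1 by (simp only: pos_divide_le_eq)
      ultimately have "t \<in> B ?i" unfolding B_def w_def using t i(3) by auto
      then show ?thesis using t by blast
    qed
  qed
  have dd: "dist x y \<le> L * w" if xy: "x \<in> ?U i" "y \<in> ?U i" for x y i
  proof -
    obtain s t where st: "s \<in> B i" "t \<in> B i" "x = f s" "y = f t" using xy by blast
    then have "\<bar>h s - h t\<bar> \<le> w" unfolding B_def by (auto simp: abs_if algebra_simps)
    then have "L * dist (h s) (h t) \<le> L * w" using \<open>0 \<le> L\<close>
      by (intro mult_left_mono) (auto simp: dist_real_def)
    then show ?thesis using lip[of s t] st unfolding B_def by auto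
  qed
  have dm: "diameter (?U i) \<le> L * w" for i
    by (rule diameter_le) (use dd w0 in \<open>auto simp: dist_norm w_def\<close>)
  have bd: "bounded (?U i)" for i
  proof (cases "?U i = {}")
    case False
    then obtain x where x: "x \<in> ?U i" by blast
    show ?thesis unfolding bounded_def using dd[OF x] by blast
  qed simp
  have "(\<Sum>i. ennreal (diameter (?U i))) = (\<Sum>i<n. ennreal (diameter (?U i)))"
    by (rule suminf_finite) (auto simp: B_def)
  also have "\<dots> \<le> (\<Sum>i<n. ennreal (L * w))" by (intro sum_mono ennreal_leI dm)
  also have "\<dots> = ennreal (real n * (L * w))"
    using w0 unfolding w_def[symmetric]
    by (simp add: ennreal_of_nat_eq_real_of_nat ennreal_mult[symmetric] del: times_divide_eq_right)
  also have "real n * (L * w) = L * (b - a)" unfolding w_def using n0 by simp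
  finally have sm: "(\<Sum>i. ennreal (diameter (?U i))) \<le> ennreal (L * (b - a))" .
  have "diameter (?U i) \<le> d" for i using order_trans[OF dm, of d] w unfolding w_def by simp
  then show "\<exists>U. f ` T \<subseteq> (\<Union>n. U n) \<and> (\<forall>n. bounded (U n) \<and> diameter (U n) \<le> d) \<and>
    (\<Sum>n. ennreal (diameter (U n))) \<le> ennreal (L * (b - a))"
    using cov bd sm by (intro exI[of _ ?U]) blast
qed

section \<open>Lower bounds for the length of a union of pieces\<close>

lemma sum_one_le:
  fixes c :: ennreal
  assumes "finite P" "\<And>p q. p \<in> P \<Longrightarrow> q \<in> P \<Longrightarrow> h p \<Longrightarrow> h q \<Longrightarrow> p = q"
  shows "(\<Sum>p\<in>P. if h p then c else 0) \<le> c"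
proof (cases "\<exists>p\<in>P. h p")
  case True
  then obtain p where p: "p \<in> P" "h p" by auto
  have "(\<Sum>q\<in>P. if h q then c else 0) = (\<Sum>q\<in>P. if q = p then c else 0)"
    using assms p by (intro sum.cong) auto
  then show ?thesis using assms p by simp
next
  case False
  then have "(\<Sum>p\<in>P. if h p then c else 0) = 0" by (intro sum.neutral) auto
  then show ?thesis by simp
qed

text \<open>Disjoint compact pieces are a positive distance \<open>d\<close> apart, so a set of
  diameter at most \<open>d / 2\<close> hits at most one of them and its diameter is charged once.
  Since \<open>f p\<close> expands by \<open>v p\<close>, the times at which it visits
  \<open>U n\<close> span at most \<open>diameter (U n) / v p\<close>; intervals of this length
  cover \<open>K p\<close> and bound its Lebesgue measure.\<close>

lemma len_ge_compact:
  fixes f :: "'i \<Rightarrow> real \<Rightarrow> 'a::heine_borel"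
  assumes fin: "finite P" and K: "\<And>p. p \<in> P \<Longrightarrow> compact (K p)"
    and cont: "\<And>p. p \<in> P \<Longrightarrow> continuous_on (K p) (f p)"
    and expand: "\<And>p s t. p \<in> P \<Longrightarrow> s \<in> K p \<Longrightarrow> t \<in> K p \<Longrightarrow> v p * dist s t \<le> dist (f p s) (f p t)"
    and v: "\<And>p. p \<in> P \<Longrightarrow> 0 < v p"
    and disj: "\<And>p q. p \<in> P \<Longrightarrow> q \<in> P \<Longrightarrow> p \<noteq> q \<Longrightarrow> f p ` K p \<inter> f q ` K q = {}"
    and sub: "\<And>p. p \<in> P \<Longrightarrow> f p ` K p \<subseteq> E"
  shows "(\<Sum>p\<in>P. ennreal (v p) * emeasure lborel (K p)) \<le> len E"
proof -
  have "\<forall>p\<in>P. \<forall>q\<in>P. \<exists>d>0. p \<noteq> q \<longrightarrow> (\<forall>x\<in>f p ` K p. \<forall>y\<in>f q ` K q. d \<le> dist x y)"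
  proof (intro ballI)
    fix p q assume pq: "p \<in> P" "q \<in> P"
    show "\<exists>d>0. p \<noteq> q \<longrightarrow> (\<forall>x\<in>f p ` K p. \<forall>y\<in>f q ` K q. d \<le> dist x y)"
    proof (cases "p = q")
      case False
      then have "\<exists>d>0. \<forall>x\<in>f p ` K p. \<forall>y\<in>f q ` K q. d \<le> dist x y"
        using pq by (intro separate_compact_closed compact_imp_closed compact_continuous_image)
          (auto simp: K cont disj)
      then show ?thesis by blast
    qed (auto intro: exI[of _ 1])
  qed
  then obtain D where D: "\<And>p q. p \<in> P \<Longrightarrow> q \<in> P \<Longrightarrow> 0 < D p q"
    "\<And>p q x y. p \<in> P \<Longrightarrow> q \<in> P \<Longrightarrow> p \<noteq> q \<Longrightarrow> x \<in> f p ` K p \<Longrightarrow> y \<in> f q ` K q \<Longrightarrow> D p q \<le> dist x y"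
    by metis
  \<comment> \<open>The inserted 1 keeps the minimum meaningful when \<open>P\<close> is
    empty.\<close>
  define d where "d = Min (insert 1 ((\<lambda>(p, q). D p q) ` (P \<times> P)))"
  have d0: "0 < d" unfolding d_def using D fin by (subst Min_gr_iff) auto
  have d: "d \<le> dist x y" if "p \<in> P" "q \<in> P" "p \<noteq> q" "x \<in> f p ` K p" "y \<in> f q ` K q" for p q x y
  proof -
    have "d \<le> D p q" unfolding d_def using fin that by (intro Min_le) auto
    then show ?thesis using D(2)[OF that] by simp
  qed
  show ?thesis
  proof (rule len_geI[of "d / 2"])
    show "0 < d / 2" using d0 by simp
    fix U :: "nat \<Rightarrow> 'a set"
    assume U: "E \<subseteq> (\<Union>n. U n)" "\<And>n. bounded (U n)" "\<And>n. diameter (U n) \<le> d / 2"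
    define hit where "hit n p \<longleftrightarrow> U n \<inter> f p ` K p \<noteq> {}" for n p
    have one: "p = q" if pq: "p \<in> P" "q \<in> P" "hit n p" "hit n q" for n p q
    proof (rule ccontr)
      assume "p \<noteq> q"
      from pq obtain x y where xy: "x \<in> U n" "y \<in> U n" "x \<in> f p ` K p" "y \<in> f q ` K q"
        unfolding hit_def by blast
      have "dist x y \<le> d / 2" using diameter_bounded_bound[OF U(2) xy(1,2)] U(3)[of n] by simp
      then show False using d[OF pq(1,2) \<open>p \<noteq> q\<close> xy(3,4)] d0 by simp
    qed
    have piece: "ennreal (v p) * emeasure lborel (K p) \<le> (\<Sum>n. if hit n p then ennreal (diameter (U n)) else 0)"
      if p: "p \<in> P" for p
    proof -
      define S where "S n = {s\<in>K p. f p s \<in> U n}" for n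
      \<comment> \<open>The interval starts at the infimum of the visiting times. Sets that miss the
        piece get the empty interval, so that their diameters are not charged to it.\<close>
      define I where "I n = (if hit n p then {Inf (S n)..Inf (S n) + diameter (U n) / v p} else {})" for n
      have close: "\<bar>s - t\<bar> \<le> diameter (U n) / v p" if "s \<in> S n" "t \<in> S n" for s t n
      proof -
        have "v p * dist s t \<le> diameter (U n)"
          using that expand[OF p, of s t] diameter_bounded_bound[OF U(2), of "f p s" n "f p t"]
          unfolding S_def by auto
        then show ?thesis using v[OF p] by (simp add: dist_real_def field_simps)
      qed
      have "K p \<subseteq> (\<Union>n. I n)"
      proof
        fix s assume s: "s \<in> K p"
        then have "f p s \<in> E" using sub[OF p] by auto
        then obtain n where n: "f p s \<in> U n" using U(1) by auto
        then have sS: "s \<in> S n" and h: "hit n p" using s unfolding S_def hit_def by auto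
        have bb: "bdd_below (S n)"
        proof (rule bdd_belowI)
          fix t assume "t \<in> S n" then show "s - diameter (U n) / v p \<le> t"
            using close[OF sS, of t] by (auto simp: abs_le_iff)
        qed
        have "Inf (S n) \<le> s" using cInf_lower[OF sS bb] .
        moreover have "s - diameter (U n) / v p \<le> Inf (S n)"
        proof (rule cInf_greatest)
          show "S n \<noteq> {}" using sS by auto
          fix t assume "t \<in> S n" then show "s - diameter (U n) / v p \<le> t"
            using close[OF sS, of t] by (auto simp: abs_le_iff)
        qed
        ultimately have "s \<in> I n" unfolding I_def using h by auto
        then show "s \<in> (\<Union>n. I n)" by blast
      qed
      then have "emeasure lborel (K p) \<le> emeasure lborel (\<Union>n. I n)"
        by (intro emeasure_mono) (auto simp: I_def)
      also have "\<dots> \<le> (\<Sum>n. emeasure lborel (I n))"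
        by (rule emeasure_subadditive_countably) (auto simp: I_def)
      finally have "ennreal (v p) * emeasure lborel (K p) \<le> ennreal (v p) * (\<Sum>n. emeasure lborel (I n))"
        by (rule mult_left_mono) simp
      also have "\<dots> = (\<Sum>n. ennreal (v p) * emeasure lborel (I n))" by simp
      also have "\<dots> = (\<Sum>n. if hit n p then ennreal (diameter (U n)) else 0)"
      proof (intro suminf_cong)
        fix n
        have "0 \<le> diameter (U n)" by (rule diameter_ge_0[OF U(2)])
        then show "ennreal (v p) * emeasure lborel (I n) = (if hit n p then ennreal (diameter (U n)) else 0)"
          using v[OF p] unfolding I_def by (auto simp: ennreal_mult[symmetric])
      qed
      finally show ?thesis .
    qed
    have "(\<Sum>p\<in>P. ennreal (v p) * emeasure lborel (K p)) \<le>
        (\<Sum>p\<in>P. \<Sum>n. if hit n p then ennreal (diameter (U n)) else 0)"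
      by (intro sum_mono piece)
    also have "\<dots> = (\<Sum>n. \<Sum>p\<in>P. if hit n p then ennreal (diameter (U n)) else 0)"
      by (rule suminf_sum[symmetric]) simp
    also have "\<dots> \<le> (\<Sum>n. ennreal (diameter (U n)))"
      using one fin by (intro suminf_le sum_one_le) auto
    finally show "(\<Sum>p\<in>P. ennreal (v p) * emeasure lborel (K p)) \<le> (\<Sum>n. ennreal (diameter (U n)))" .
  qed
qed

text \<open>Inner regularity of Lebesgue measure reduces Borel sets of times to compact ones, at an
  arbitrarily small cost.\<close>

lemma len_ge_borel:
  fixes f :: "'i \<Rightarrow> real \<Rightarrow> 'a::heine_borel"
  assumes fin: "finite P" and S: "\<And>p. p \<in> P \<Longrightarrow> S p \<in> sets borel" "\<And>p. p \<in> P \<Longrightarrow> bounded (S p)"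
    and cont: "\<And>p. p \<in> P \<Longrightarrow> continuous_on (S p) (f p)"
    and expand: "\<And>p s t. p \<in> P \<Longrightarrow> s \<in> S p \<Longrightarrow> t \<in> S p \<Longrightarrow> v p * dist s t \<le> dist (f p s) (f p t)"
    and v: "\<And>p. p \<in> P \<Longrightarrow> 0 < v p"
    and disj: "\<And>p q. p \<in> P \<Longrightarrow> q \<in> P \<Longrightarrow> p \<noteq> q \<Longrightarrow> f p ` S p \<inter> f q ` S q = {}"
    and sub: "\<And>p. p \<in> P \<Longrightarrow> f p ` S p \<subseteq> E"
  shows "(\<Sum>p\<in>P. ennreal (v p) * emeasure lborel (S p)) \<le> len E"
proof (rule ennreal_le_epsilon)
  fix e :: real assume e: "0 < e"
  \<comment> \<open>Losing measure \<open>e / V\<close> at each piece costs length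
    \<open>v p * (e / V)\<close>, in total at most \<open>e\<close>; the summand 1 keeps
    \<open>V\<close> positive when \<open>P\<close> is empty.\<close>
  define V where "V = 1 + (\<Sum>p\<in>P. v p)"
  have V: "0 < V" unfolding V_def using v by (intro add_pos_nonneg sum_nonneg) (auto intro: less_imp_le)
  have "\<exists>K. closed K \<and> K \<subseteq> S p \<and> emeasure lborel (S p) \<le> emeasure lborel K + ennreal (e / V)"
    if p: "p \<in> P" for p
  proof -
    have "S p \<in> sets lebesgue" using S(1)[OF p] by (simp add: sets_completionI_sets)
    moreover have "0 < e / V" using e V by simp
    ultimately obtain K where K: "closed K" "K \<subseteq> S p" "emeasure lebesgue (S p - K) < ennreal (e / V)"
      by (rule sets_lebesgue_inner_closed)
    have Kb: "K \<in> sets borel" using K(1) by (rule borel_closed)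
    have "emeasure lborel (S p) = emeasure lborel (K \<union> (S p - K))" using K(2) by (simp add: Un_absorb1)
    also have "\<dots> \<le> emeasure lborel K + emeasure lborel (S p - K)"
      using Kb S(1)[OF p] by (intro emeasure_subadditive) auto
    also have "emeasure lborel (S p - K) = emeasure lebesgue (S p - K)"
      using Kb S(1)[OF p] by simp
    finally have "emeasure lborel (S p) \<le> emeasure lborel K + emeasure lebesgue (S p - K)" .
    also have "\<dots> \<le> emeasure lborel K + ennreal (e / V)" using K(3) by (intro add_left_mono less_imp_le)
    finally show ?thesis using K(1,2) by blast
  qed
  then obtain K where K: "\<And>p. p \<in> P \<Longrightarrow> closed (K p)" "\<And>p. p \<in> P \<Longrightarrow> K p \<subseteq> S p"
     "\<And>p. p \<in> P \<Longrightarrow> emeasure lborel (S p) \<le> emeasure lborel (K p) + ennreal (e / V)"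
    by metis
  have "(\<Sum>p\<in>P. ennreal (v p) * emeasure lborel (S p)) \<le>
      (\<Sum>p\<in>P. ennreal (v p) * emeasure lborel (K p) + ennreal (v p * (e / V)))"
  proof (intro sum_mono)
    fix p assume p: "p \<in> P"
    have "ennreal (v p) * emeasure lborel (S p) \<le> ennreal (v p) * (emeasure lborel (K p) + ennreal (e / V))"
      by (intro mult_left_mono K p) simp
    also have "\<dots> = ennreal (v p) * emeasure lborel (K p) + ennreal (v p * (e / V))"
      using v[OF p] e V by (simp add: distrib_left ennreal_mult[symmetric])
    finally show "ennreal (v p) * emeasure lborel (S p) \<le>
      ennreal (v p) * emeasure lborel (K p) + ennreal (v p * (e / V))" .
  qed
  also have "\<dots> = (\<Sum>p\<in>P. ennreal (v p) * emeasure lborel (K p)) + (\<Sum>p\<in>P. ennreal (v p * (e / V)))"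
    by (rule sum.distrib)
  also have "(\<Sum>p\<in>P. ennreal (v p * (e / V))) = ennreal (\<Sum>p\<in>P. v p * (e / V))"
    using v e V by (intro sum_ennreal) (auto intro!: mult_nonneg_nonneg less_imp_le)
  also have "(\<Sum>p\<in>P. v p * (e / V)) \<le> e"
  proof -
    have "(\<Sum>p\<in>P. v p * (e / V)) = (V - 1) * (e / V)" unfolding V_def by (simp only: sum_distrib_right add_diff_cancel_left')
    also have "\<dots> \<le> e" using e V by (simp add: field_simps)
    finally show ?thesis .
  qed
  also have "(\<Sum>p\<in>P. ennreal (v p) * emeasure lborel (K p)) \<le> len E"
  proof (rule len_ge_compact[OF fin, where f = f])
    fix p assume p: "p \<in> P"
    show "compact (K p)" using K[OF p] S(2)[OF p] bounded_subset compact_eq_bounded_closed by blast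
    show "continuous_on (K p) (f p)" using cont[OF p] K(2)[OF p] continuous_on_subset by blast
    show "f p ` K p \<subseteq> E" using sub[OF p] K(2)[OF p] by auto
    fix q assume "q \<in> P" "p \<noteq> q" then show "f p ` K p \<inter> f q ` K q = {}"
      using disj[OF p] K(2)[OF p] K(2)[of q] by blast
  qed (use expand v K in \<open>auto simp: subset_iff\<close>)
  finally show "(\<Sum>p\<in>P. ennreal (v p) * emeasure lborel (S p)) \<le> len E + ennreal e"
    by (simp add: add_mono ennreal_leI)
qed

section \<open>Routes\<close>

text \<open>Of the straight segments only the metric content is kept: on each of them the path is an
  isometry up to the factor \<open>v\<close>. Degenerate segments are allowed, which covers finite
  index sets.\<close>

definition segmented :: "real \<Rightarrow> (int \<Rightarrow> real) \<Rightarrow> (real \<Rightarrow> 'a::metric_space) \<Rightarrow> bool" where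
  "segmented v \<tau> g \<longleftrightarrow> 0 < v \<and> mono \<tau> \<and> (\<tau> \<longlongrightarrow> 0) at_bot \<and> (\<tau> \<longlongrightarrow> 1) at_top \<and>
     (\<forall>i. \<forall>s\<in>{\<tau> i..\<tau> (i + 1)}. \<forall>t\<in>{\<tau> i..\<tau> (i + 1)}. dist (g s) (g t) = v * dist s t)"

lemma breaks_in_unit:
  fixes \<tau> :: "int \<Rightarrow> real"
  assumes "mono \<tau>" "(\<tau> \<longlongrightarrow> 0) at_bot" "(\<tau> \<longlongrightarrow> 1) at_top"
  shows "0 \<le> \<tau> i" "\<tau> i \<le> 1"
proof -
  have "\<forall>\<^sub>F j in at_bot. \<tau> j \<le> \<tau> i" using eventually_le_at_bot[of i]
    by eventually_elim (rule monoD[OF assms(1)])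
  then show "0 \<le> \<tau> i" by (intro tendsto_upperbound[OF assms(2)]) auto
  have "\<forall>\<^sub>F j in at_top. \<tau> i \<le> \<tau> j" using eventually_ge_at_top[of i]
    by eventually_elim (rule monoD[OF assms(1)])
  then show "\<tau> i \<le> 1" by (intro tendsto_lowerbound[OF assms(3)]) auto
qed

text \<open>Breakpoints can accumulate only at 0 and 1, so finitely many segments cover any compact
  part of the open unit interval.\<close>

lemma breaks_around:
  fixes \<tau> :: "int \<Rightarrow> real"
  assumes "mono \<tau>" "(\<tau> \<longlongrightarrow> 0) at_bot" "(\<tau> \<longlongrightarrow> 1) at_top" "0 < s" "t < 1"
  shows "\<exists>n. \<tau> (- int n) \<le> s \<and> t < \<tau> (int n)"
proof -
  have "\<forall>\<^sub>F j in at_bot. \<tau> j < s" by (rule order_tendstoD(2)[OF assms(2,4)])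
  then obtain a where a: "\<And>j. j \<le> a \<Longrightarrow> \<tau> j < s" unfolding eventually_at_bot_linorder by auto
  have "\<forall>\<^sub>F j in at_top. t < \<tau> j" by (rule order_tendstoD(1)[OF assms(3,5)])
  then obtain b where b: "\<And>j. b \<le> j \<Longrightarrow> t < \<tau> j" unfolding eventually_at_top_linorder by auto
  let ?n = "nat (\<bar>a\<bar> + \<bar>b\<bar>)"
  have "- int ?n \<le> a" "b \<le> int ?n" by auto
  then show ?thesis using a[of "- int ?n"] b[of "int ?n"] by (intro exI[of _ ?n]) auto
qed

text \<open>The point is that \<open>v\<close> is positive. If every segment were degenerate, \<tau>
  would be constant and could not have the limits 0 and 1; on a nondegenerate segment injectivity
  excludes speed 0.\<close>

lemma route_segmented:
  assumes "is_route g"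
  shows "\<exists>v \<tau>. segmented v \<tau> g"
proof -
  from assms obtain v and \<tau> :: "int \<Rightarrow> real" where \<tau>: "mono \<tau>" "(\<tau> \<longlongrightarrow> 0) at_bot" "(\<tau> \<longlongrightarrow> 1) at_top"
    and seg: "\<And>i. \<exists>a b. norm b = v \<and> (\<forall>t\<in>{\<tau> i..\<tau> (i + 1)}. g t = a + t *\<^sub>R b)"
    and arc: "arc g" unfolding is_route_def by blast
  have iso: "dist (g s) (g t) = v * dist s t" if "s \<in> {\<tau> i..\<tau> (i + 1)}" "t \<in> {\<tau> i..\<tau> (i + 1)}" for s t i
  proof -
    obtain a b where ab: "norm b = v" "\<forall>t\<in>{\<tau> i..\<tau> (i + 1)}. g t = a + t *\<^sub>R b" using seg by blast
    then have "dist (g s) (g t) = norm ((s - t) *\<^sub>R b)"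
      using that by (simp add: dist_norm scaleR_left_diff_distrib)
    then show ?thesis using ab by (simp add: dist_real_def)
  qed
  have "\<exists>i. \<tau> i \<noteq> \<tau> (i + 1)"
  proof (rule ccontr)
    assume "\<nexists>i. \<tau> i \<noteq> \<tau> (i + 1)"
    then have eq: "\<tau> (i + 1) = \<tau> i" for i by metis
    have "\<tau> i = \<tau> 0" for i
    proof (induction i rule: int_induct[where k = 0])
      case (step1 i) then show ?case using eq[of i] by simp
    next
      case (step2 i) then show ?case using eq[of "i - 1"] by simp
    qed simp
    then have "\<tau> = (\<lambda>_. \<tau> 0)" by auto
    then have "(\<tau> \<longlongrightarrow> \<tau> 0) at_bot" "(\<tau> \<longlongrightarrow> \<tau> 0) at_top" by (metis tendsto_const)+
    then have "\<tau> 0 = 0" "\<tau> 0 = 1" using \<tau> by (auto intro: tendsto_unique[rotated])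
    then show False by simp
  qed
  then obtain i where i: "\<tau> i \<noteq> \<tau> (i + 1)" by blast
  then have lt: "\<tau> i < \<tau> (i + 1)" using monoD[OF \<tau>(1), of i "i + 1"] by auto
  have "g (\<tau> i) \<noteq> g (\<tau> (i + 1))"
    using arc breaks_in_unit[OF \<tau>] i unfolding arc_def inj_on_def by auto
  then have "0 < dist (g (\<tau> i)) (g (\<tau> (i + 1)))" by simp
  then have "0 < v * dist (\<tau> i) (\<tau> (i + 1))" using iso[of "\<tau> i" i "\<tau> (i + 1)"] lt by auto
  then have "0 < v" using i by (auto simp: zero_less_mult_iff)
  then show ?thesis unfolding segmented_def using \<tau> iso by blast
qed

text \<open>Chaining finitely many segments by the triangle inequality settles times in the open
  interval; continuity extends the bound to 0 and 1, where infinitely many segments may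
  accumulate.\<close>

lemma segmented_lipschitz:
  assumes seg: "segmented v \<tau> g" and cont: "continuous_on {0..1} g" and "s \<in> {0..1}" "t \<in> {0..1}"
  shows "dist (g s) (g t) \<le> v * dist s t"
proof -
  have \<tau>: "mono \<tau>" "(\<tau> \<longlongrightarrow> 0) at_bot" "(\<tau> \<longlongrightarrow> 1) at_top" and v: "0 < v"
    and iso: "\<And>i s t. s \<in> {\<tau> i..\<tau> (i + 1)} \<Longrightarrow> t \<in> {\<tau> i..\<tau> (i + 1)} \<Longrightarrow> dist (g s) (g t) = v * dist s t"
    using seg unfolding segmented_def by blast+
  have chain: "dist (g s) (g t) \<le> v * (t - s)" if "\<tau> a \<le> s" "s \<le> t" "t \<le> \<tau> (a + int m)" for a m s t
    using that
  proof (induction m arbitrary: s t)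
    case 0
    then have "s = t" by simp
    then show ?case by simp
  next
    case (Suc m)
    let ?c = "\<tau> (a + int m)"
    have "a + int (Suc m) = a + int m + 1" by simp
    then have tm: "t \<le> \<tau> (a + int m + 1)" using Suc.prems(3) by metis
    consider "t \<le> ?c" | "?c \<le> s" | "s \<le> ?c" "?c \<le> t" by linarith
    then show ?case
    proof cases
      case 1 then show ?thesis using Suc by blast
    next
      case 2
      then have "dist (g s) (g t) = v * dist s t" using Suc.prems tm 2 by (intro iso[of _ "a + int m"]) auto
      then show ?thesis using Suc.prems by (simp add: dist_real_def)
    next
      case 3
      have "dist (g ?c) (g t) = v * dist ?c t" using Suc.prems tm 3 by (intro iso[of _ "a + int m"]) auto
      moreover have "dist (g s) (g ?c) \<le> v * (?c - s)" using Suc 3 by auto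
      moreover have "dist (g s) (g t) \<le> dist (g s) (g ?c) + dist (g ?c) (g t)" by (rule dist_triangle)
      ultimately show ?thesis using 3 by (simp add: dist_real_def algebra_simps)
    qed
  qed
  have inner: "dist (g s) (g t) \<le> v * (t - s)" if st: "0 < s" "s \<le> t" "t < 1" for s t
  proof -
    obtain n where "\<tau> (- int n) \<le> s" "t < \<tau> (int n)" using breaks_around[OF \<tau> st(1,3)] by blast
    then show ?thesis using chain[of "- int n" s t "2 * n"] st by auto
  qed
  have "v-lipschitz_on {0<..<1} g"
  proof (rule lipschitz_onI)
    fix s t :: real assume st: "s \<in> {0<..<1}" "t \<in> {0<..<1}"
    then show "dist (g s) (g t) \<le> v * dist s t"
    proof (cases "s \<le> t")
      case True then show ?thesis using inner[of s t] st by (auto simp: dist_real_def)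
    next
      case False then show ?thesis using inner[of t s] st by (auto simp: dist_real_def dist_commute)
    qed
  qed (use v in simp)
  moreover have "closure {0<..<1} = {0..1::real}" by simp
  ultimately have "v-lipschitz_on {0..1} g"
    using lipschitz_on_closure[of v "{0<..<1}" g] cont by metis
  then show ?thesis using assms by (auto dest: lipschitz_onD)
qed

lemma breaks_UN:
  fixes \<tau> :: "int \<Rightarrow> real"
  assumes "mono \<tau>"
  shows "(\<Union>i\<in>{a..<a + int n}. {\<tau> i..<\<tau> (i + 1)}) = {\<tau> a..<\<tau> (a + int n)}"
proof (induction n)
  case (Suc n)
  have "{a..<a + int (Suc n)} = insert (a + int n) {a..<a + int n}" by auto
  then have "(\<Union>i\<in>{a..<a + int (Suc n)}. {\<tau> i..<\<tau> (i + 1)}) =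
      {\<tau> a..<\<tau> (a + int n)} \<union> {\<tau> (a + int n)..<\<tau> (a + int n + 1)}"
    using Suc.IH by auto
  also have "\<dots> = {\<tau> a..<\<tau> (a + int n + 1)}"
    using monoD[OF assms, of a "a + int n"] monoD[OF assms, of "a + int n" "a + int n + 1"]
    by (intro ivl_disj_un_two) auto
  finally show ?case by (simp add: add_ac)
qed simp

text \<open>Cut at its breakpoints, a path falls into pieces on which the expansion bound is an
  equality; half-open pieces of one path have disjoint images by injectivity. The segments with
  indices from \<open>- n\<close> to \<open>n - 1\<close> exhaust the open unit interval as
  \<open>n\<close> grows, and the times 0 and 1 form a null set.\<close>

lemma len_ge_segmented:
  fixes f :: "'i \<Rightarrow> real \<Rightarrow> 'a::heine_borel"
  assumes fin: "finite P" and seg: "\<And>p. p \<in> P \<Longrightarrow> segmented (v p) (\<tau> p) (f p)"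
    and cont: "\<And>p. p \<in> P \<Longrightarrow> continuous_on {0..1} (f p)"
    and inj: "\<And>p. p \<in> P \<Longrightarrow> inj_on (f p) {0..1}"
    and T: "\<And>p. p \<in> P \<Longrightarrow> T p \<in> sets borel" "\<And>p. p \<in> P \<Longrightarrow> T p \<subseteq> {0..1}"
    and disj: "\<And>p q. p \<in> P \<Longrightarrow> q \<in> P \<Longrightarrow> p \<noteq> q \<Longrightarrow> f p ` T p \<inter> f q ` T q = {}"
    and sub: "\<And>p. p \<in> P \<Longrightarrow> f p ` T p \<subseteq> E"
  shows "(\<Sum>p\<in>P. ennreal (v p) * emeasure lborel (T p)) \<le> len E"
proof -
  let ?I = "\<lambda>n. {- int n..<- int n + int (2 * n)}"
  let ?S = "\<lambda>(p, i). T p \<inter> {\<tau> p i..<\<tau> p (i + 1)}"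
  define X where "X n p = T p \<inter> {\<tau> p (- int n)..<\<tau> p (int n)}" for n p
  have \<tau>: "mono (\<tau> p)" "(\<tau> p \<longlongrightarrow> 0) at_bot" "(\<tau> p \<longlongrightarrow> 1) at_top" and v: "0 < v p"
    and iso: "\<And>i s t. s \<in> {\<tau> p i..\<tau> p (i + 1)} \<Longrightarrow> t \<in> {\<tau> p i..\<tau> p (i + 1)} \<Longrightarrow>
      dist (f p s) (f p t) = v p * dist s t"
    if "p \<in> P" for p
    using seg[OF that] unfolding segmented_def by blast+
  have disjS: "?S (p, i) \<inter> ?S (p, j) = {}" if "p \<in> P" "i \<noteq> j" for p i j
  proof -
    have "\<tau> p (i + 1) \<le> \<tau> p j \<or> \<tau> p (j + 1) \<le> \<tau> p i"
      using that monoD[OF \<tau>(1)[OF that(1)], of "i + 1" j] monoD[OF \<tau>(1)[OF that(1)], of "j + 1" i]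
      by linarith
    then show ?thesis by auto
  qed
  have bound: "(\<Sum>p\<in>P. ennreal (v p) * emeasure lborel (X n p)) \<le> len E" for n
  proof -
    have "(\<Sum>p\<in>P. ennreal (v p) * emeasure lborel (X n p)) =
        (\<Sum>p\<in>P. \<Sum>i\<in>?I n. ennreal (v p) * emeasure lborel (?S (p, i)))"
    proof (intro sum.cong refl)
      fix p assume p: "p \<in> P"
      have "X n p = (\<Union>i\<in>?I n. ?S (p, i))"
        using breaks_UN[OF \<tau>(1)[OF p], of "- int n" "2 * n"] unfolding X_def by auto
      then have "emeasure lborel (X n p) = (\<Sum>i\<in>?I n. emeasure lborel (?S (p, i)))"
        using T(1)[OF p] disjS[OF p]
        by (subst sum_emeasure) (auto simp: disjoint_family_on_def)
      then show "ennreal (v p) * emeasure lborel (X n p) = (\<Sum>i\<in>?I n. ennreal (v p) * emeasure lborel (?S (p, i)))"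
        by (simp add: sum_distrib_left)
    qed
    also have "\<dots> = (\<Sum>q\<in>P \<times> ?I n. ennreal (v (fst q)) * emeasure lborel (?S q))"
      by (subst sum.cartesian_product) (auto intro!: sum.cong)
    also have "\<dots> \<le> len E"
    proof (rule len_ge_borel[where f = "\<lambda>q. f (fst q)"])
      fix q assume q: "q \<in> P \<times> ?I n"
      then obtain p i where pi: "q = (p, i)" "p \<in> P" by auto
      show "?S q \<in> sets borel" using pi T by auto
      have S01: "?S q \<subseteq> {0..1}" using pi T(2)[OF pi(2)] by auto
      then show "bounded (?S q)" by (rule bounded_subset[OF bounded_closed_interval])
      show "continuous_on (?S q) (f (fst q))"
        using continuous_on_subset[OF cont[OF pi(2)] S01] pi(1) by simp
      show "0 < v (fst q)" using pi v by auto
      show "f (fst q) ` ?S q \<subseteq> E" using sub[OF pi(2)] pi(1) by auto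
      show "v (fst q) * dist s t \<le> dist (f (fst q) s) (f (fst q) t)" if "s \<in> ?S q" "t \<in> ?S q" for s t
        using that iso[OF pi(2), of s i t] pi(1) by auto
      fix r assume r: "r \<in> P \<times> ?I n" "q \<noteq> r"
      then obtain p' j where pj: "r = (p', j)" "p' \<in> P" by auto
      show "f (fst q) ` ?S q \<inter> f (fst r) ` ?S r = {}"
      proof (cases "p = p'")
        case True
        then have "?S q \<inter> ?S r = {}" using disjS[OF pi(2), of i j] r pi pj by auto
        moreover have "?S r \<subseteq> {0..1}" using pj T(2)[OF pj(2)] by auto
        ultimately show ?thesis
          using inj_on_image_Int[OF inj[OF pi(2)] S01, of "?S r"] pi pj True by simp
      next
        case False then show ?thesis using disj[OF pi(2) pj(2)] pi pj by auto
      qed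
    qed (use fin in auto)
    finally show ?thesis .
  qed
  have "(\<lambda>n. \<Sum>p\<in>P. ennreal (v p) * emeasure lborel (X n p)) \<longlonglongrightarrow>
      (\<Sum>p\<in>P. ennreal (v p) * emeasure lborel (T p))"
  proof (intro tendsto_sum ennreal_tendsto_cmult)
    fix p assume p: "p \<in> P"
    have Xb: "range (\<lambda>n. X n p) \<subseteq> sets lborel" unfolding X_def using T(1)[OF p] by auto
    have inc: "incseq (\<lambda>n. X n p)"
    proof (rule incseq_SucI)
      fix n show "X n p \<subseteq> X (Suc n) p"
        using monoD[OF \<tau>(1)[OF p], of "- int (Suc n)" "- int n"] monoD[OF \<tau>(1)[OF p], of "int n" "int (Suc n)"]
        unfolding X_def by auto
    qed
    have "(\<lambda>n. emeasure lborel (X n p)) \<longlonglongrightarrow> emeasure lborel (\<Union>n. X n p)"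
      by (rule Lim_emeasure_incseq[OF Xb inc])
    also have "emeasure lborel (\<Union>n. X n p) = emeasure lborel (T p)"
    proof (rule emeasure_eq_AE)
      have "AE t in lborel. t \<noteq> (0::real)" "AE t in lborel. t \<noteq> (1::real)" by (auto intro!: AE_lborel_singleton)
      then show "AE t in lborel. t \<in> (\<Union>n. X n p) \<longleftrightarrow> t \<in> T p"
      proof eventually_elim
        case (elim t)
        show ?case
        proof
          assume t: "t \<in> T p"
          then have "0 < t" "t < 1" using T(2)[OF p] elim by fastforce+
          then obtain n where "\<tau> p (- int n) \<le> t" "t < \<tau> p (int n)" using breaks_around[OF \<tau>[OF p]] by blast
          then show "t \<in> (\<Union>n. X n p)" using t unfolding X_def by auto
        qed (auto simp: X_def)
      qed
    qed (use Xb T(1)[OF p] in auto)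
    finally show "(\<lambda>n. emeasure lborel (X n p)) \<longlonglongrightarrow> emeasure lborel (T p)" .
  qed (simp_all)
  then show ?thesis by (rule LIMSEQ_le_const2) (use bound in blast)
qed

text \<open>Taken from the trace, hence free of any choice of \<open>v\<close> and \<tau>;
  \<open>segmented_speed\<close> identifies it with the factor \<open>v\<close>.\<close>

definition speed :: "route \<Rightarrow> real" where
  "speed g = enn2real (len (path_image g))"

lemma route_cont: "is_route g \<Longrightarrow> continuous_on {0..1} g"
  and route_inj: "is_route g \<Longrightarrow> inj_on g {0..1}"
  unfolding is_route_def arc_def path_def by auto

text \<open>The Lipschitz property gives at most \<open>v\<close>; the lower bound for disjoint
  pieces, applied to the whole path as a single piece, gives at least \<open>v\<close>.\<close>

lemma segmented_speed:
  assumes g: "is_route g" and seg: "segmented v \<tau> g"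
  shows "speed g = v"
proof -
  have v: "0 < v" using seg unfolding segmented_def by simp
  have "len (g ` {0..1}) \<le> ennreal (v * (1 - 0))"
    using v segmented_lipschitz[OF seg route_cont[OF g]] by (intro len_image_le[where h = "\<lambda>t. t"]) auto
  moreover have "(\<Sum>p\<in>{()}. ennreal v * emeasure lborel {0..1::real}) \<le> len (g ` {0..1})"
    by (rule len_ge_segmented[where \<tau> = "\<lambda>_. \<tau>" and f = "\<lambda>_. g"])
      (use g seg route_cont route_inj in auto)
  ultimately have "len (g ` {0..1}) = ennreal v" by (simp add: antisym)
  then show ?thesis using v unfolding speed_def path_image_def by simp
qed

lemma route_speed_segmented: "is_route g \<Longrightarrow> \<exists>\<tau>. segmented (speed g) \<tau> g"
  using route_segmented segmented_speed by metis

lemma route_speed_pos: "is_route g \<Longrightarrow> 0 < speed g"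
  using route_speed_segmented unfolding segmented_def by blast

lemma route_lipschitz:
  "is_route g \<Longrightarrow> s \<in> {0..1} \<Longrightarrow> t \<in> {0..1} \<Longrightarrow> dist (g s) (g t) \<le> speed g * dist s t"
  using route_speed_segmented segmented_lipschitz route_cont by blast

lemma len_ge_routes:
  assumes "finite P" "\<And>p. p \<in> P \<Longrightarrow> is_route (f p)"
    and "\<And>p. p \<in> P \<Longrightarrow> T p \<in> sets borel" "\<And>p. p \<in> P \<Longrightarrow> T p \<subseteq> {0..1}"
    and "\<And>p q. p \<in> P \<Longrightarrow> q \<in> P \<Longrightarrow> p \<noteq> q \<Longrightarrow> f p ` T p \<inter> f q ` T q = {}"
    and "\<And>p. p \<in> P \<Longrightarrow> f p ` T p \<subseteq> E"
  shows "(\<Sum>p\<in>P. ennreal (speed (f p)) * emeasure lborel (T p)) \<le> len E"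
proof -
  have "\<forall>p. \<exists>\<tau>. p \<in> P \<longrightarrow> segmented (speed (f p)) \<tau> (f p)"
    using route_speed_segmented assms(2) by blast
  then obtain \<tau> where "\<And>p. p \<in> P \<Longrightarrow> segmented (speed (f p)) (\<tau> p) (f p)" by metis
  then show ?thesis
    by (rule len_ge_segmented[OF assms(1) _ _ _ assms(3-6)])
      (use assms(2) route_cont route_inj in blast)+
qed

lemma route_len:
  assumes g: "is_route g" and "0 \<le> a" "a \<le> b" "b \<le> 1"
  shows "len (g ` {a..b}) = ennreal (speed g * (b - a))"
proof (rule antisym)
  show "len (g ` {a..b}) \<le> ennreal (speed g * (b - a))"
    using assms route_lipschitz[OF g] route_speed_pos[OF g]
    by (intro len_image_le[where h = "\<lambda>t. t"]) auto
  have "(\<Sum>p\<in>{()}. ennreal (speed g) * emeasure lborel {a..b}) \<le> len (g ` {a..b})"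
    by (rule len_ge_routes[where f = "\<lambda>_. g"]) (use assms in auto)
  then show "ennreal (speed g * (b - a)) \<le> len (g ` {a..b})"
    using assms route_speed_pos[OF g] by (simp add: ennreal_mult)
qed

text \<open>One nondegenerate segment already shows the full speed, and it contains rational times.
  Testing rational times only is what will make \<open>speed\<close> measurable.\<close>

lemma speed_leI:
  assumes g: "is_route g"
    and le: "\<And>s t. s \<in> \<rat> \<Longrightarrow> t \<in> \<rat> \<Longrightarrow> s \<in> {0..1} \<Longrightarrow> t \<in> {0..1} \<Longrightarrow> dist (g s) (g t) \<le> c * dist s t"
  shows "speed g \<le> c"
proof -
  obtain \<tau> where seg: "segmented (speed g) \<tau> g" using route_speed_segmented[OF g] by blast
  then have \<tau>: "mono \<tau>" "(\<tau> \<longlongrightarrow> 0) at_bot" "(\<tau> \<longlongrightarrow> 1) at_top"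
    and iso: "\<And>i s t. s \<in> {\<tau> i..\<tau> (i + 1)} \<Longrightarrow> t \<in> {\<tau> i..\<tau> (i + 1)} \<Longrightarrow> dist (g s) (g t) = speed g * dist s t"
    unfolding segmented_def by blast+
  \<comment> \<open>The time \<open>1/3\<close> stands for any interior time: a half-open segment
    containing it is nondegenerate.\<close>
  obtain n where n: "\<tau> (- int n) \<le> 1/3" "1/2 < \<tau> (int n)" using breaks_around[OF \<tau>, of "1/3" "1/2"] by auto
  have "1/3 \<in> {\<tau> (- int n)..<\<tau> (- int n + int (2 * n))}" using n by auto
  then have "1/3 \<in> (\<Union>i\<in>{- int n..<- int n + int (2 * n)}. {\<tau> i..<\<tau> (i + 1)})"
    unfolding breaks_UN[OF \<tau>(1)] .
  then obtain i where "1/3 \<in> {\<tau> i..<\<tau> (i + 1)}" by blast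
  then have lt: "\<tau> i < \<tau> (i + 1)" by auto
  obtain s where s: "s \<in> \<rat>" "\<tau> i < s" "s < \<tau> (i + 1)" using Rats_dense_in_real[OF lt] by blast
  obtain t where t: "t \<in> \<rat>" "s < t" "t < \<tau> (i + 1)" using Rats_dense_in_real[OF s(3)] by blast
  have "speed g * dist s t = dist (g s) (g t)" using s t iso[of s i t] by auto
  also have "\<dots> \<le> c * dist s t"
    using s t breaks_in_unit[OF \<tau>, of i] breaks_in_unit[OF \<tau>, of "i + 1"] by (intro le) auto
  finally show ?thesis using t by simp
qed

text \<open>The pointwise form of agreement up to a common point, for routes with a common start.
  Unlike an equality of sets it can be tested at rational times.\<close>

definition aligned :: "route \<Rightarrow> route \<Rightarrow> bool" where
  "aligned g h \<longleftrightarrow> (\<forall>s\<in>{0..1}. \<forall>s'\<in>{0..1}. g s = h s' \<longrightarrow> (\<forall>\<theta>\<in>{0..1}. g (\<theta> * s) = h (\<theta> * s')))"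

text \<open>Compatibility gives equality of initial segments as sets only; comparing their lengths
  identifies the constant-speed parametrizations.\<close>

lemma compatible_aligned:
  assumes g: "is_route g" and h: "is_route h" and start: "g 0 = h 0" and c: "compatible g h"
  shows "aligned g h"
proof -
  have img: "g ` {0..s} = h ` {0..s'}" if "s \<in> {0..1}" "s' \<in> {0..1}" "g s = h s'" for s s'
  proof -
    have "path_image (subpath 0 s g) = path_image (subpath 0 s' h)"
      using c[unfolded compatible_def, rule_format, of 0 s 0 s'] that start by auto
    then show ?thesis using that by (simp add: path_image_subpath)
  qed
  have len: "speed g * s = speed h * s'" if "s \<in> {0..1}" "s' \<in> {0..1}" "g s = h s'" for s s'
  proof -
    have "ennreal (speed g * (s - 0)) = ennreal (speed h * (s' - 0))"
      using img[OF that] route_len[OF g, of 0 s] route_len[OF h, of 0 s'] that by simp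
    then show ?thesis using route_speed_pos[OF g] route_speed_pos[OF h] that by (simp add: ennreal_inj)
  qed
  show ?thesis unfolding aligned_def
  proof (intro ballI impI)
    fix s s' \<theta> :: real assume s: "s \<in> {0..1}" "s' \<in> {0..1}" "g s = h s'" and \<theta>: "\<theta> \<in> {0..1}"
    have ts: "\<theta> * s \<in> {0..s}" using s \<theta> by (auto intro: mult_left_le_one_le)
    then have "g (\<theta> * s) \<in> h ` {0..s'}" using img[OF s] by blast
    then obtain u where u: "u \<in> {0..s'}" "g (\<theta> * s) = h u" by auto
    have "speed g * (\<theta> * s) = speed h * u" using len[of "\<theta> * s" u] ts u s by auto
    then have "\<theta> * (speed h * s') = speed h * u" using len[OF s] by (simp add: algebra_simps)
    then have "u = \<theta> * s'" using route_speed_pos[OF h] by simp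
    then show "g (\<theta> * s) = h (\<theta> * s')" using u by simp
  qed
qed

section \<open>Rays in a family of routes from the origin\<close>

text \<open>The parametrization by arc length, meaningful for arguments between 0 and
  \<open>speed h\<close>.\<close>

definition hat :: "route \<Rightarrow> real \<Rightarrow> point" where
  "hat h a = h (a / speed h)"

text \<open>The factor 4 leaves room on both sides: the route crosses the annulus between \<rho> and
  2\<rho>, and every point of that annulus is more than 2\<rho> away from the end of the
  route.\<close>

definition far :: "real \<Rightarrow> (nat \<Rightarrow> route) \<Rightarrow> nat set" where
  "far \<rho> g = {n. 4 * \<rho> < norm (g n 1)}"

text \<open>On far routes an equivalence relation, whose classes group the routes that have not yet
  separated at radius \<rho>. The bound on the norm is closed, so that compactness of the time
  intervals makes the relation a countable condition.\<close>

definition meets :: "real \<Rightarrow> (nat \<Rightarrow> route) \<Rightarrow> nat \<Rightarrow> nat \<Rightarrow> bool" where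
  "meets \<rho> g i j \<longleftrightarrow> (\<exists>x. x \<in> path_image (g i) \<and> x \<in> path_image (g j) \<and> \<rho> \<le> norm x)"

text \<open>Half-open, so that annuli with successively halved radii tile a punctured disc.\<close>

definition annulus_time :: "real \<Rightarrow> route \<Rightarrow> real set" where
  "annulus_time \<rho> h = {t\<in>{0..1}. \<rho> < norm (h t) \<and> norm (h t) \<le> 2 * \<rho>}"

definition annulus_length :: "real \<Rightarrow> route \<Rightarrow> ennreal" where
  "annulus_length \<rho> h = ennreal (speed h) * emeasure lborel (annulus_time \<rho> h)"

definition apart :: "real \<Rightarrow> (nat \<Rightarrow> route) \<Rightarrow> nat set \<Rightarrow> bool" where
  "apart \<rho> g S \<longleftrightarrow> (\<forall>i\<in>S. \<forall>j\<in>S. i \<noteq> j \<longrightarrow> \<not> meets \<rho> g i j)"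

text \<open>A lower bound for the length of the union of the far routes within an annulus that is,
  unlike that length, evidently measurable.\<close>

definition crossing_length :: "real \<Rightarrow> (nat \<Rightarrow> route) \<Rightarrow> ennreal" where
  "crossing_length \<rho> g = (SUP S\<in>{S. finite S}.
     if S \<subseteq> far \<rho> g \<and> apart \<rho> g S then \<Sum>n\<in>S. annulus_length \<rho> (g n) else 0)"

text \<open>An infinite geodesic parametrized by arc length. The bound on \<open>speed (g j)\<close>
  keeps \<open>hat (g j)\<close> within its range of validity.\<close>

definition ray :: "(nat \<Rightarrow> route) \<Rightarrow> (real \<Rightarrow> point) \<Rightarrow> bool" where
  "ray g \<phi> \<longleftrightarrow> (\<forall>a\<ge>0. \<exists>j. a \<le> speed (g j) \<and> (\<forall>b\<in>{0..a}. \<phi> b = hat (g j) b))"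

text \<open>For a ray, the far routes with this property make up a single class of
  \<open>meets \<rho> g\<close>: the class that the ray follows.\<close>

definition thru :: "real \<Rightarrow> (nat \<Rightarrow> route) \<Rightarrow> (real \<Rightarrow> point) \<Rightarrow> nat \<Rightarrow> bool" where
  "thru \<rho> g \<phi> i \<longleftrightarrow> i \<in> far \<rho> g \<and> (\<exists>b\<ge>0. \<phi> b \<in> path_image (g i) \<and> \<rho> \<le> norm (\<phi> b))"

text \<open>In tame families the infinite classes are exactly those followed by rays
  (\<open>thru_inf_class\<close> and \<open>inf_class_ray\<close>).\<close>

definition inf_class :: "real \<Rightarrow> (nat \<Rightarrow> route) \<Rightarrow> nat \<Rightarrow> bool" where
  "inf_class \<rho> g i \<longleftrightarrow> i \<in> far \<rho> g \<and> infinite {j\<in>far \<rho> g. meets \<rho> g i j}"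

text \<open>A measurable stand-in for the existence of \<open>n\<close> geodesics. Rational radii
  suffice because finitely many geodesics are in different classes at every large radius.\<close>

definition many_classes :: "nat \<Rightarrow> (nat \<Rightarrow> route) \<Rightarrow> bool" where
  "many_classes n g \<longleftrightarrow> (\<exists>\<rho>\<in>\<rat>. 0 < \<rho> \<and> (\<exists>S. finite S \<and> card S = n \<and> (\<forall>i\<in>S. inf_class \<rho> g i) \<and> apart \<rho> g S))"

text \<open>A measurable stand-in for two different geodesics with a common point at distance
  \<open>r\<close> or more: routes followed by the two still meet beyond \<open>r\<close> but no
  longer beyond \<rho>.\<close>

definition branch_beyond :: "real \<Rightarrow> (nat \<Rightarrow> route) \<Rightarrow> bool" where
  "branch_beyond r g \<longleftrightarrow> (\<exists>\<rho>\<in>\<rat>. 0 < \<rho> \<and> (\<exists>i j. inf_class \<rho> g i \<and> inf_class \<rho> g j \<and> \<not> meets \<rho> g i j \<and> meets r g i j))"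

definition ray_traces :: "(nat \<Rightarrow> route) \<Rightarrow> point set set" where
  "ray_traces g = {\<phi> ` {0..} |\<phi>. ray g \<phi>}"

section \<open>Elementary properties of classes and annuli\<close>

lemma hat_image:
  assumes "0 < speed h"
  shows "hat h ` {a..b} = h ` {a / speed h..b / speed h}"
proof -
  have "(\<lambda>x. x / speed h) ` {a..b} = {a / speed h..b / speed h}"
  proof (intro equalityI subsetI)
    fix x assume "x \<in> {a / speed h..b / speed h}"
    then have "x * speed h \<in> {a..b}" "x = x * speed h / speed h" using assms by (auto simp: field_simps)
    then show "x \<in> (\<lambda>x. x / speed h) ` {a..b}" by (rule rev_image_eqI)
  qed (use assms in \<open>auto intro: divide_right_mono\<close>)
  then show ?thesis unfolding hat_def by (metis image_image)
qed

lemma meets_sym: "meets \<rho> g i j \<longleftrightarrow> meets \<rho> g j i"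
  unfolding meets_def by blast

lemma meets_mono: "meets \<rho> g i j \<Longrightarrow> r \<le> \<rho> \<Longrightarrow> meets r g i j"
  unfolding meets_def by (meson order_trans)

lemma far_mono: "r \<le> \<rho> \<Longrightarrow> far \<rho> g \<subseteq> far r g"
  unfolding far_def by auto

lemma annulus_time_borel:
  assumes "is_route h"
  shows "annulus_time \<rho> h \<in> sets borel"
proof -
  have c: "closed ({0..1} \<inter> (\<lambda>t. norm (h t)) -` {..r})" for r :: real
    using route_cont[OF assms] by (intro continuous_closed_preimage continuous_on_norm) auto
  have "annulus_time \<rho> h = ({0..1} \<inter> (\<lambda>t. norm (h t)) -` {..2 * \<rho>}) - ({0..1} \<inter> (\<lambda>t. norm (h t)) -` {..\<rho>})"
    unfolding annulus_time_def by auto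
  then show ?thesis using c by (simp add: borel_closed sets.Diff)
qed

text \<open>Take the first arrival at radius 2\<rho> and the last visit to the disc of radius \<rho>
  before it. In between the route stays in the annulus while its distance from 0 grows by
  \<rho>.\<close>

lemma annulus_length_ge:
  assumes h: "is_route h" "h 0 = 0" and \<rho>: "0 < \<rho>" "2 * \<rho> \<le> norm (h 1)"
  shows "ennreal \<rho> \<le> annulus_length \<rho> h"
proof -
  have cont: "continuous_on {0..1} (\<lambda>t. norm (h t))" using route_cont[OF h(1)] by (rule continuous_on_norm)
  let ?A = "{0..1} \<inter> (\<lambda>t. norm (h t)) -` {2 * \<rho>..}"
  have "compact ?A" using cont
    by (intro compact_Int_closed[of "{0..1}" ?A, simplified] continuous_closed_preimage) auto
  moreover have "1 \<in> ?A" using \<rho> by auto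
  ultimately have "\<exists>t\<in>?A. \<forall>u\<in>?A. t \<le> u" by (intro compact_attains_inf) blast+
  then obtain t where t: "t \<in> ?A" "\<And>u. u \<in> ?A \<Longrightarrow> t \<le> u" by blast
  let ?B = "{0..t} \<inter> (\<lambda>t. norm (h t)) -` {..\<rho>}"
  have "continuous_on {0..t} (\<lambda>t. norm (h t))" using t by (intro continuous_on_subset[OF cont]) auto
  then have "compact ?B"
    by (intro compact_Int_closed[of "{0..t}" ?B, simplified] continuous_closed_preimage) auto
  moreover have "0 \<in> ?B" using t \<rho> h by auto
  ultimately have "\<exists>s\<in>?B. \<forall>u\<in>?B. u \<le> s" by (intro compact_attains_sup) blast+
  then obtain s where s: "s \<in> ?B" "\<And>u. u \<in> ?B \<Longrightarrow> u \<le> s" by blast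
  have sub: "{s<..<t} \<subseteq> annulus_time \<rho> h"
  proof
    fix u assume u: "u \<in> {s<..<t}"
    then have u01: "u \<in> {0..1}" "u \<in> {0..t}" using s t by auto
    have "\<not> norm (h u) \<le> \<rho>" using s(2)[of u] u u01 by fastforce
    moreover have "\<not> 2 * \<rho> \<le> norm (h u)" using t(2)[of u] u u01 by fastforce
    ultimately show "u \<in> annulus_time \<rho> h" unfolding annulus_time_def using u01 by auto
  qed
  have "\<rho> \<le> norm (h t) - norm (h s)" using s t by auto
  also have "\<dots> \<le> dist (h t) (h s)" by (simp add: dist_norm norm_triangle_ineq2)
  also have "\<dots> \<le> speed h * (t - s)" using route_lipschitz[OF h(1), of t s] s t by (auto simp: dist_real_def)
  finally have "ennreal \<rho> \<le> ennreal (speed h) * ennreal (t - s)"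
    using route_speed_pos[OF h(1)] s by (subst ennreal_mult[symmetric]) (auto intro: ennreal_leI)
  also have "ennreal (t - s) \<le> emeasure lborel (annulus_time \<rho> h)"
    using emeasure_mono[OF sub, of lborel] annulus_time_borel[OF h(1)] s by auto
  finally show ?thesis unfolding annulus_length_def by (simp add: mult_left_mono)
qed

text \<open>The least \<open>k\<close> whose inner radius is below \<open>x\<close> works; for
  \<open>k = 0\<close> the outer radius is \<open>m\<close> itself.\<close>

lemma ex_dyadic_shell:
  fixes x m :: real
  assumes "0 < x" "x \<le> m"
  shows "\<exists>k. m / 2 ^ (k + 1) < x \<and> x \<le> 2 * (m / 2 ^ (k + 1))"
proof -
  have "\<exists>k. m / 2 ^ (k + 1) < x"
  proof -
    obtain k where "m / x < 2 ^ k" using real_arch_pow[of 2 "m / x"] by auto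
    also have "(2::real) ^ k \<le> 2 ^ (k + 1)" by simp
    finally show ?thesis using assms by (intro exI[of _ k]) (simp add: field_simps)
  qed
  then have L: "m / 2 ^ ((LEAST k. m / 2 ^ (k + 1) < x) + 1) < x" (is "m / 2 ^ (?k + 1) < x") by (rule LeastI_ex)
  have "x \<le> 2 * (m / 2 ^ (?k + 1))"
  proof (cases ?k)
    case 0 then show ?thesis using assms by simp
  next
    case (Suc l)
    then have "\<not> m / 2 ^ (l + 1) < x" by (intro not_less_Least) simp
    then show ?thesis unfolding Suc by (simp add: field_simps)
  qed
  then show ?thesis using L by blast
qed

lemma crossing_length_ge_sum:
  assumes "finite S" "S \<subseteq> far \<rho> g" "apart \<rho> g S"
  shows "(\<Sum>n\<in>S. annulus_length \<rho> (g n)) \<le> crossing_length \<rho> g"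
  unfolding crossing_length_def using assms by (intro SUP_upper2[of S]) auto

text \<open>The deterministic setting: alignment makes the routes from 0 a tree. Randomness enters
  only through the almost sure validity of these assumptions.\<close>

locale origin_routes =
  fixes g :: "nat \<Rightarrow> route"
  assumes route: "is_route (g n)"
    and start: "g n 0 = 0"
    and align: "aligned (g i) (g j)"
    and locally_finite: "finite {n. norm (g n 1) \<le> r}"
begin

section \<open>Arc length and common points of two routes\<close>

lemma speed_pos: "0 < speed (g n)"
  by (rule route_speed_pos[OF route])

lemma hat_0 [simp]: "hat (g n) 0 = 0"
  by (simp add: hat_def start)

lemma hat_lipschitz:
  assumes "a \<in> {0..speed (g n)}" "b \<in> {0..speed (g n)}"
  shows "dist (hat (g n) a) (hat (g n) b) \<le> dist a b"
proof -
  have "dist (hat (g n) a) (hat (g n) b) \<le> speed (g n) * dist (a / speed (g n)) (b / speed (g n))"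
    unfolding hat_def using assms speed_pos[of n] by (intro route_lipschitz route) auto
  also have "\<dots> = dist a b"
    using speed_pos[of n] by (simp add: dist_real_def flip: diff_divide_distrib)
  finally show ?thesis .
qed

lemma norm_hat_le:
  assumes "a \<in> {0..speed (g n)}"
  shows "norm (hat (g n) a) \<le> a"
  using hat_lipschitz[of a n 0] assms speed_pos[of n] by (auto simp: dist_real_def)

lemma hat_inj:
  assumes "hat (g n) a = hat (g n) b" "a \<in> {0..speed (g n)}" "b \<in> {0..speed (g n)}"
  shows "a = b"
  using inj_onD[OF route_inj[OF route[of n]], of "a / speed (g n)" "b / speed (g n)"] assms speed_pos[of n]
  by (auto simp: hat_def)

lemma path_image_hat: "path_image (g n) = hat (g n) ` {0..speed (g n)}"
  using hat_image[OF speed_pos[of n], of 0 "speed (g n)"] speed_pos[of n] by (simp add: path_image_def)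

lemma hat_end: "hat (g n) (speed (g n)) = g n 1"
  using speed_pos[of n] by (simp add: hat_def)

lemma hat_len:
  assumes "a \<in> {0..speed (g n)}"
  shows "len (hat (g n) ` {0..a}) = ennreal a"
  using assms speed_pos[of n] hat_image[OF speed_pos[of n], of 0 a] route_len[OF route, of 0 "a / speed (g n)" n]
  by auto

text \<open>Alignment gives agreement in proportional time. The two initial segments are then the
  same set, hence equally long, and proportional time turns into arc length. In particular routes
  that have separated never rejoin.\<close>

lemma hat_common:
  assumes a: "a \<in> {0..speed (g i)}" and b: "b \<in> {0..speed (g j)}" and eq: "hat (g i) a = hat (g j) b"
  shows "a = b" "\<And>c. c \<in> {0..a} \<Longrightarrow> hat (g i) c = hat (g j) c"
proof -
  let ?s = "a / speed (g i)" and ?t = "b / speed (g j)"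
  have s: "?s \<in> {0..1}" and t: "?t \<in> {0..1}" using a b speed_pos[of i] speed_pos[of j] by auto
  have al: "g i (\<theta> * ?s) = g j (\<theta> * ?t)" if "\<theta> \<in> {0..1}" for \<theta>
    using align[of i j] s t eq that unfolding aligned_def hat_def by blast
  have scale: "(\<lambda>\<theta>. \<theta> * u) ` {0..1} = {0..u}" if "0 \<le> u" for u :: real
  proof (cases "u = 0")
    case False
    show ?thesis
    proof (intro equalityI subsetI)
      fix x assume "x \<in> {0..u}"
      then show "x \<in> (\<lambda>\<theta>. \<theta> * u) ` {0..1}" using False by (intro rev_image_eqI[of "x / u"]) auto
    qed (use that in \<open>auto intro: mult_left_le_one_le\<close>)
  qed (auto intro: rev_image_eqI[of 0])
  have im: "f ` {0..u} = (\<lambda>\<theta>. f (\<theta> * u)) ` {0..1}" if "0 \<le> u" for u and f :: route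
    unfolding scale[OF that, symmetric] by (simp only: image_image)
  have "g i ` {0..?s} = (\<lambda>\<theta>. g i (\<theta> * ?s)) ` {0..1}" using s by (intro im) auto
  also have "\<dots> = (\<lambda>\<theta>. g j (\<theta> * ?t)) ` {0..1}" using al by (rule image_cong[OF refl])
  also have "\<dots> = g j ` {0..?t}" using t by (intro im[symmetric]) auto
  finally have "hat (g i) ` {0..a} = hat (g j) ` {0..b}" by (simp add: hat_image speed_pos)
  then have "ennreal a = ennreal b" using hat_len[OF a] hat_len[OF b] by simp
  then show ab: "a = b" using a b by (simp add: ennreal_inj)
  fix c assume c: "c \<in> {0..a}"
  show "hat (g i) c = hat (g j) c"
  proof (cases "a = 0")
    case True then show ?thesis using c by simp
  next
    case False
    then have "c / a \<in> {0..1}" using c by auto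
    from al[OF this] show ?thesis unfolding hat_def using False ab by simp
  qed
qed

text \<open>The common point is recorded by its arc length \<open>c\<close>, the same on both routes
  and at least as large as the distance from 0.\<close>

lemma meets_hat:
  assumes "meets \<rho> g i j"
  shows "\<exists>c. c \<in> {0..speed (g i)} \<and> c \<in> {0..speed (g j)} \<and> \<rho> \<le> norm (hat (g i) c) \<and> \<rho> \<le> c \<and>
    (\<forall>b\<in>{0..c}. hat (g i) b = hat (g j) b)"
proof -
  from assms obtain x where x: "x \<in> path_image (g i)" "x \<in> path_image (g j)" "\<rho> \<le> norm x"
    unfolding meets_def by blast
  then obtain c d where c: "c \<in> {0..speed (g i)}" "d \<in> {0..speed (g j)}" "x = hat (g i) c" "x = hat (g j) d"
    unfolding path_image_hat by blast
  have eq: "hat (g i) c = hat (g j) d" using c by simp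
  show ?thesis using hat_common[OF c(1,2) eq] c x norm_hat_le[OF c(1)]
    by (intro exI[of _ c]) auto
qed

lemma meetsI:
  assumes "c \<in> {0..speed (g i)}" "c \<in> {0..speed (g j)}" "\<rho> \<le> norm (hat (g i) c)" "hat (g i) c = hat (g j) c"
  shows "meets \<rho> g i j"
  unfolding meets_def path_image_hat using assms
  by (intro exI[of _ "hat (g i) c"] conjI rev_image_eqI[of c]) simp_all

lemma meets_refl: "0 \<le> \<rho> \<Longrightarrow> i \<in> far \<rho> g \<Longrightarrow> meets \<rho> g i i"
  using speed_pos[of i] by (intro meetsI[of "speed (g i)"]) (auto simp: hat_end far_def)

text \<open>Of the two common points, the one with the smaller arc length lies on all three
  routes.\<close>

lemma meets_trans:
  assumes "meets \<rho> g i j" "meets \<rho> g j k"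
  shows "meets \<rho> g i k"
proof -
  obtain c where c: "c \<in> {0..speed (g i)}" "c \<in> {0..speed (g j)}" "\<rho> \<le> norm (hat (g i) c)"
    "\<forall>b\<in>{0..c}. hat (g i) b = hat (g j) b" using meets_hat[OF assms(1)] by blast
  obtain d where d: "d \<in> {0..speed (g j)}" "d \<in> {0..speed (g k)}" "\<rho> \<le> norm (hat (g j) d)"
    "\<forall>b\<in>{0..d}. hat (g j) b = hat (g k) b" using meets_hat[OF assms(2)] by blast
  show ?thesis
  proof (cases "c \<le> d")
    case True then show ?thesis using c d by (intro meetsI[of c]) auto
  next
    case False then show ?thesis using c d by (intro meetsI[of d]) auto
  qed
qed

section \<open>Rays and the classes they follow\<close>

lemma ray_hat:
  assumes "ray g \<phi>" "0 \<le> a"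
  obtains j where "a \<le> speed (g j)" "\<And>b. b \<in> {0..a} \<Longrightarrow> \<phi> b = hat (g j) b"
  using assms unfolding ray_def by blast

text \<open>Finitely many routes have bounded length, so a longer initial portion of the ray must be
  carried by some other route.\<close>

lemma ray_avoid:
  assumes "ray g \<phi>" "0 \<le> a" "finite F"
  obtains j where "j \<notin> F" "a \<le> speed (g j)" "\<And>b. b \<in> {0..a} \<Longrightarrow> \<phi> b = hat (g j) b"
proof -
  \<comment> \<open>A length that no route of \<open>F\<close> reaches.\<close>
  define B where "B = Max (insert 0 ((\<lambda>n. speed (g n)) ` F)) + 1"
  have B: "speed (g n) < B" if "n \<in> F" for n
  proof -
    have "speed (g n) \<le> Max (insert 0 ((\<lambda>n. speed (g n)) ` F))" using assms(3) that by (intro Max_ge) auto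
    then show ?thesis unfolding B_def by simp
  qed
  have "0 \<le> max a B" using assms by auto
  then obtain j where j: "max a B \<le> speed (g j)" "\<And>b. b \<in> {0..max a B} \<Longrightarrow> \<phi> b = hat (g j) b"
    using ray_hat[OF assms(1)] by blast
  show ?thesis
  proof (rule that)
    show "j \<notin> F" using B j by fastforce
  qed (use j in auto)
qed

lemma near_finite: "finite (- far \<rho> g)"
  using locally_finite[of "4 * \<rho>"] by (simp add: far_def not_less Collect_neg_eq[symmetric])

lemma ray_far:
  assumes "ray g \<phi>" "0 \<le> a"
  obtains j where "j \<in> far \<rho> g" "a \<le> speed (g j)" "\<And>b. b \<in> {0..a} \<Longrightarrow> \<phi> b = hat (g j) b"
  using ray_avoid[OF assms near_finite[of \<rho>]] by auto

lemma ray_infinite: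
  assumes "ray g \<phi>" "0 \<le> a"
  shows "infinite {j\<in>far \<rho> g. a \<le> speed (g j) \<and> (\<forall>b\<in>{0..a}. \<phi> b = hat (g j) b)}" (is "infinite ?J")
proof
  assume "finite ?J"
  then obtain j where "j \<notin> ?J \<union> - far \<rho> g" "a \<le> speed (g j)" "\<And>b. b \<in> {0..a} \<Longrightarrow> \<phi> b = hat (g j) b"
    using ray_avoid[OF assms, of "?J \<union> - far \<rho> g"] near_finite by blast
  then show False by blast
qed

lemma ray_on_route:
  assumes "ray g \<phi>" "0 \<le> b" "\<phi> b \<in> path_image (g i)"
  shows "b \<le> speed (g i)" "\<And>c. c \<in> {0..b} \<Longrightarrow> \<phi> c = hat (g i) c"
proof -
  obtain j where j: "b \<le> speed (g j)" "\<And>c. c \<in> {0..b} \<Longrightarrow> \<phi> c = hat (g j) c" using ray_hat[OF assms(1,2)] by blast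
  obtain d where d: "d \<in> {0..speed (g i)}" "\<phi> b = hat (g i) d" using assms(3) unfolding path_image_hat by blast
  have b: "b \<in> {0..speed (g j)}" using j assms by auto
  have eq: "hat (g j) b = hat (g i) d" using j(2)[of b] d assms by simp
  note hc = hat_common[OF b d(1) eq]
  show "b \<le> speed (g i)" using hc(1) d by auto
  show "\<phi> c = hat (g i) c" if "c \<in> {0..b}" for c using hc(2)[OF that] j(2)[OF that] by simp
qed

lemma ray_norm_le: "ray g \<phi> \<Longrightarrow> 0 \<le> b \<Longrightarrow> norm (\<phi> b) \<le> b"
  using ray_hat[of \<phi> b] norm_hat_le[of b] by force

text \<open>Infinitely many far routes carry the ray past its common point with \<open>i\<close>,
  and each of them meets \<open>i\<close> there.\<close>

lemma thru_inf_class: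
  assumes "ray g \<phi>" "thru \<rho> g \<phi> i"
  shows "inf_class \<rho> g i"
proof -
  obtain b where b: "i \<in> far \<rho> g" "0 \<le> b" "\<phi> b \<in> path_image (g i)" "\<rho> \<le> norm (\<phi> b)"
    using assms(2) unfolding thru_def by blast
  have "{j\<in>far \<rho> g. b \<le> speed (g j) \<and> (\<forall>c\<in>{0..b}. \<phi> c = hat (g j) c)} \<subseteq> {j\<in>far \<rho> g. meets \<rho> g i j}"
    using b unfolding meets_def path_image_hat by fastforce
  then show ?thesis unfolding inf_class_def using b ray_infinite[OF assms(1) b(2)] infinite_super by blast
qed

lemma thru_meets:
  assumes "ray g \<phi>" "thru \<rho> g \<phi> i" "thru \<rho> g \<phi> j"
  shows "meets \<rho> g i j"
proof -
  have *: "meets \<rho> g i j"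
    if "0 \<le> b" "b \<le> c" "\<phi> b \<in> path_image (g i)" "\<phi> c \<in> path_image (g j)" "\<rho> \<le> norm (\<phi> b)" for b c i j
  proof -
    note c = ray_on_route[OF assms(1) _ that(4)]
    have "\<phi> b = hat (g j) b" "b \<le> speed (g j)" using c that by auto
    then show ?thesis unfolding meets_def using that unfolding path_image_hat[of j]
      by (intro exI[of _ "\<phi> b"]) auto
  qed
  obtain b c where "0 \<le> b" "\<phi> b \<in> path_image (g i)" "\<rho> \<le> norm (\<phi> b)" "0 \<le> c" "\<phi> c \<in> path_image (g j)" "\<rho> \<le> norm (\<phi> c)"
    using assms unfolding thru_def by blast
  then show ?thesis using *[of b c i j] *[of c b j i] meets_sym by (cases "b \<le> c") auto
qed

text \<open>The earlier of the ray's point on \<open>i\<close> and the point common to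
  \<open>i\<close> and \<open>j\<close> lies both on the ray and on \<open>j\<close>. Together with
  \<open>thru_meets\<close> this shows that the routes hit by a ray beyond \<rho> form a full
  class.\<close>

lemma thru_step:
  assumes "ray g \<phi>" "thru \<rho> g \<phi> i" "meets \<rho> g i j" "j \<in> far \<rho> g"
  shows "thru \<rho> g \<phi> j"
proof -
  obtain b where b: "0 \<le> b" "\<phi> b \<in> path_image (g i)" "\<rho> \<le> norm (\<phi> b)"
    using assms(2) unfolding thru_def by blast
  note r = ray_on_route[OF assms(1) b(1,2)]
  obtain c where c: "c \<in> {0..speed (g i)}" "c \<in> {0..speed (g j)}" "\<rho> \<le> norm (hat (g i) c)"
    "\<forall>b\<in>{0..c}. hat (g i) b = hat (g j) b" using meets_hat[OF assms(3)] by blast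
  show ?thesis
  proof (cases "b \<le> c")
    case True
    then have "\<phi> b = hat (g j) b" "b \<le> speed (g j)" using r(2)[of b] b c by auto
    then show ?thesis unfolding thru_def path_image_hat using assms(4) b by (intro conjI exI[of _ b]) auto
  next
    case False
    then have "\<phi> c = hat (g i) c" "hat (g i) c = hat (g j) c" using r(2)[of c] c by auto
    then show ?thesis unfolding thru_def path_image_hat using assms(4) c by (intro conjI exI[of _ c]) auto
  qed
qed

text \<open>Distance from 0 never exceeds arc length, so a route shared beyond radius
  \<open>m\<close> forces agreement up to arc length \<open>m\<close>.\<close>

lemma rays_eq_trace:
  assumes "ray g \<phi>" "ray g \<psi>" and "\<And>m::nat. \<exists>\<rho>\<ge>m. \<exists>i. thru \<rho> g \<phi> i \<and> thru \<rho> g \<psi> i"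
  shows "\<phi> ` {0..} = \<psi> ` {0..}"
proof -
  have "\<phi> a = \<psi> a" if "0 \<le> a" for a
  proof -
    obtain m :: nat where m: "a \<le> m" using real_arch_simple by blast
    obtain \<rho> i where i: "real m \<le> \<rho>" "thru \<rho> g \<phi> i" "thru \<rho> g \<psi> i" using assms(3)[of m] by blast
    obtain b where b: "0 \<le> b" "\<phi> b \<in> path_image (g i)" "\<rho> \<le> norm (\<phi> b)" using i unfolding thru_def by blast
    obtain c where c: "0 \<le> c" "\<psi> c \<in> path_image (g i)" "\<rho> \<le> norm (\<psi> c)" using i unfolding thru_def by blast
    have "a \<le> b" "a \<le> c" using b c m i ray_norm_le[OF assms(1) b(1)] ray_norm_le[OF assms(2) c(1)] by auto
    then have "\<phi> a = hat (g i) a" "\<psi> a = hat (g i) a"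
      using ray_on_route(2)[OF assms(1) b(1,2), of a] ray_on_route(2)[OF assms(2) c(1,2), of a] that by auto
    then show ?thesis by simp
  qed
  then show ?thesis by (intro image_cong) auto
qed

section \<open>Rays are the infinite geodesics\<close>

lemma ray_trace:
  assumes "ray g \<phi>"
  shows "continuous_on {0..} \<phi>" "inj_on \<phi> {0..}" "\<phi> 0 = 0" "len (\<phi> ` {0..}) = \<infinity>"
    "0 \<le> s \<Longrightarrow> s < t \<Longrightarrow> \<exists>j. is_subroute \<phi> s t (g j)"
proof -
  have "1-lipschitz_on {0..} \<phi>"
  proof (rule lipschitz_onI)
    fix s t :: real assume st: "s \<in> {0..}" "t \<in> {0..}"
    then have "0 \<le> max s t" by auto
    then obtain j where j: "max s t \<le> speed (g j)" "\<And>b. b \<in> {0..max s t} \<Longrightarrow> \<phi> b = hat (g j) b"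
      using ray_hat[OF assms] by blast
    then show "dist (\<phi> s) (\<phi> t) \<le> 1 * dist s t" using hat_lipschitz[of s j t] st by auto
  qed simp
  then show "continuous_on {0..} \<phi>" by (rule lipschitz_on_continuous_on)
  show "inj_on \<phi> {0..}"
  proof (rule inj_onI)
    fix s t :: real assume st: "s \<in> {0..}" "t \<in> {0..}" "\<phi> s = \<phi> t"
    then have "0 \<le> max s t" by auto
    then obtain j where j: "max s t \<le> speed (g j)" "\<And>b. b \<in> {0..max s t} \<Longrightarrow> \<phi> b = hat (g j) b"
      using ray_hat[OF assms] by blast
    then show "s = t" using hat_inj[of j s t] st by auto
  qed
  show "\<phi> 0 = 0" using ray_norm_le[OF assms, of 0] by simp
  have ge: "ennreal a \<le> len (\<phi> ` {0..})" if a: "0 \<le> a" for a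
  proof -
    obtain j where j: "a \<le> speed (g j)" "\<And>b. b \<in> {0..a} \<Longrightarrow> \<phi> b = hat (g j) b" using ray_hat[OF assms a] by blast
    have "\<phi> ` {0..a} = hat (g j) ` {0..a}" using j(2) by (rule image_cong[OF refl])
    then have "ennreal a = len (\<phi> ` {0..a})" using hat_len[of a j] j(1) a by simp
    also have "\<dots> \<le> len (\<phi> ` {0..})" by (intro len_mono image_mono) auto
    finally show ?thesis .
  qed
  show "len (\<phi> ` {0..}) = \<infinity>"
  proof (rule ccontr)
    assume "len (\<phi> ` {0..}) \<noteq> \<infinity>"
    then obtain r where r: "len (\<phi> ` {0..}) = ennreal r" "0 \<le> r" by (cases "len (\<phi> ` {0..})") auto
    then show False using ge[of "r + 1"] by (simp add: ennreal_le_iff)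
  qed
  assume st: "0 \<le> s" "s < t"
  then have "0 \<le> t" by simp
  then obtain j where j: "t \<le> speed (g j)" "\<And>b. b \<in> {0..t} \<Longrightarrow> \<phi> b = hat (g j) b" using ray_hat[OF assms] by blast
  let ?v = "speed (g j)"
  have v: "0 < ?v" by (rule speed_pos)
  have "\<phi> ` {s..t} = hat (g j) ` {s..t}" using j(2) st by (intro image_cong) auto
  also have "\<dots> = g j ` {s / ?v..t / ?v}" by (rule hat_image[OF v])
  also have "\<dots> = path_image (subpath (s / ?v) (t / ?v) (g j))"
    using st v by (simp add: path_image_subpath divide_right_mono)
  finally have "is_subroute \<phi> s t (g j)"
    unfolding is_subroute_def using st v j(1) j(2)[of s] j(2)[of t]
    by (intro exI[of _ "s / ?v"] exI[of _ "t / ?v"]) (auto simp: hat_def divide_right_mono)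
  then show "\<exists>j. is_subroute \<phi> s t (g j)" by blast
qed

text \<open>The path is reparametrized by arc length. \<open>A t\<close> is the length reached at
  time \<open>t\<close>, read off from a route carrying the path up to \<open>t\<close>. It is
  monotone, takes all values between 0 and any of its values, and is unbounded because the path has
  infinite length.\<close>

lemma trace_ray:
  assumes inf: "len (\<gamma> ` {0..}) = \<infinity>" and \<gamma>0: "\<gamma> 0 = 0"
    and sub: "\<And>s t. 0 \<le> s \<Longrightarrow> s < t \<Longrightarrow> \<exists>j. is_subroute \<gamma> s t (g j)"
  shows "\<exists>\<phi>. ray g \<phi> \<and> \<phi> ` {0..} = \<gamma> ` {0..}"
proof -
  have "\<exists>j u. u \<in> {0..speed (g j)} \<and> \<gamma> t = hat (g j) u \<and> \<gamma> ` {0..t} = hat (g j) ` {0..u}" if t: "0 \<le> t" for t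
  proof (cases "t = 0")
    case True
    then show ?thesis using \<gamma>0 speed_pos by (intro exI[of _ 0]) (auto intro: less_imp_le)
  next
    case False
    then obtain j u v where uv: "0 \<le> u" "u \<le> v" "v \<le> 1" "\<gamma> 0 = g j u" "\<gamma> t = g j v"
      "\<gamma> ` {0..t} = path_image (subpath u v (g j))" using sub[of 0 t] t unfolding is_subroute_def by auto
    \<comment> \<open>A route visits its starting point 0 only once, so a subroute that begins at 0
      is an initial one.\<close>
    have "u = 0" using inj_onD[OF route_inj[OF route[of j]], of u 0] uv \<gamma>0 start by auto
    let ?w = "speed (g j)"
    have "\<gamma> ` {0..t} = g j ` {0 / ?w..(v * ?w) / ?w}"
      using uv \<open>u = 0\<close> speed_pos[of j] by (simp add: path_image_subpath)
    also have "\<dots> = hat (g j) ` {0..v * ?w}" by (rule hat_image[OF speed_pos, symmetric])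
    finally show ?thesis using uv speed_pos[of j]
      by (intro exI[of _ j] exI[of _ "v * ?w"]) (auto simp: hat_def mult_left_le_one_le)
  qed
  then obtain J A where JA: "\<And>t. 0 \<le> t \<Longrightarrow> A t \<in> {0..speed (g (J t))}"
    "\<And>t. 0 \<le> t \<Longrightarrow> \<gamma> t = hat (g (J t)) (A t)" "\<And>t. 0 \<le> t \<Longrightarrow> \<gamma> ` {0..t} = hat (g (J t)) ` {0..A t}" by metis
  have K1: "\<gamma> s = hat (g (J t)) (A s) \<and> A s \<le> A t" if st: "0 \<le> s" "s \<le> t" for s t
  proof -
    have t: "0 \<le> t" using st by simp
    have "\<gamma> s \<in> hat (g (J t)) ` {0..A t}" using JA(3)[OF t] st by auto
    then obtain u where u: "u \<in> {0..A t}" "\<gamma> s = hat (g (J t)) u" by blast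
    have "A s = u"
      by (rule hat_common[OF JA(1)[OF st(1)]]) (use u JA(1)[OF t] JA(2)[OF st(1)] in auto)
    then show ?thesis using u by auto
  qed
  have same: "\<gamma> s = \<gamma> t" if "0 \<le> s" "0 \<le> t" "A s = A t" for s t
  proof (cases "s \<le> t")
    case True then show ?thesis using K1[of s t] JA(2)[of t] that by simp
  next
    case False then show ?thesis using K1[of t s] JA(2)[of s] that by simp
  qed
  have K2: "\<exists>s\<in>{0..t}. A s = b" if t: "0 \<le> t" and b: "b \<in> {0..A t}" for t b
  proof -
    have "hat (g (J t)) b \<in> \<gamma> ` {0..t}" using JA(3)[OF t] b by auto
    then obtain s where s: "s \<in> {0..t}" "hat (g (J t)) b = \<gamma> s" by blast
    then have "hat (g (J t)) b = hat (g (J t)) (A s)" "A s \<le> A t" using K1[of s t] by auto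
    then have "b = A s" using hat_inj[of "J t" b "A s"] b JA(1)[OF t] JA(1)[of s] s by auto
    then show ?thesis using s by blast
  qed
  have unb: "\<exists>t\<ge>0. a \<le> A t" for a
  proof (rule ccontr)
    assume "\<not> (\<exists>t\<ge>0. a \<le> A t)"
    then have lt: "\<And>t. 0 \<le> t \<Longrightarrow> A t \<le> a" by force
    \<comment> \<open>The path is 1-Lipschitz as a function of \<open>A\<close>, so a bound on
      \<open>A\<close> would bound its length.\<close>
    have "len (\<gamma> ` {0..}) \<le> ennreal (1 * (a - 0))"
    proof (rule len_image_le[where h = A])
      show "A ` {0..} \<subseteq> {0..a}" using lt JA(1) by fastforce
      then show "0 \<le> a" by (metis atLeast_iff atLeastAtMost_iff image_eqI order_refl order_trans subset_iff)
      fix s t :: real assume st: "s \<in> {0..}" "t \<in> {0..}"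
      show "dist (\<gamma> s) (\<gamma> t) \<le> 1 * dist (A s) (A t)"
      proof (cases "s \<le> t")
        case True
        then show ?thesis using K1[of s t] K1[of t t] hat_lipschitz[of "A s" "J t" "A t"] JA(1)[of s] JA(1)[of t] st by auto
      next
        case False
        then show ?thesis using K1[of t s] K1[of s s] hat_lipschitz[of "A s" "J s" "A t"] JA(1)[of s] JA(1)[of t] st by auto
      qed
    qed simp
    then show False using inf by (simp add: top_unique)
  qed
  \<comment> \<open>An inverse of \<open>A\<close>. The choice of the preimage is immaterial, as
    equal arc lengths belong to equal points.\<close>
  define T where "T a = (SOME s. 0 \<le> s \<and> A s = a)" for a
  have T: "0 \<le> T a" "A (T a) = a" if "0 \<le> a" for a
  proof -
    obtain t where t: "0 \<le> t" "a \<le> A t" using unb by blast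
    then have "\<exists>s. 0 \<le> s \<and> A s = a" using K2[of t a] that by auto
    then show "0 \<le> T a" "A (T a) = a" unfolding T_def by (metis (mono_tags, lifting) someI_ex)+
  qed
  have "ray g (\<lambda>a. \<gamma> (T a))" unfolding ray_def
  proof (intro allI impI)
    fix a :: real assume a: "0 \<le> a"
    let ?j = "J (T a)"
    have "\<gamma> (T b) = hat (g ?j) b" if b: "b \<in> {0..a}" for b
    proof -
      have Tb: "0 \<le> T b" "A (T b) = b" using T[of b] b by auto
      show ?thesis
      proof (cases "T b \<le> T a")
        case True then show ?thesis using K1[OF Tb(1) True] Tb by simp
      next
        case False
        then have "A (T a) \<le> A (T b)" using K1[of "T a" "T b"] T[OF a] by auto
        then have "b = a" using T(2)[OF a] Tb b by auto
        then show ?thesis using JA(2)[OF T(1)[OF a]] T(2)[OF a] by simp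
      qed
    qed
    then show "\<exists>j. a \<le> speed (g j) \<and> (\<forall>b\<in>{0..a}. \<gamma> (T b) = hat (g j) b)"
      using JA(1)[OF T(1)[OF a]] T(2)[OF a] by (intro exI[of _ ?j]) auto
  qed
  moreover have "(\<lambda>a. \<gamma> (T a)) ` {0..} = \<gamma> ` {0..}"
  proof (intro equalityI subsetI)
    fix x assume "x \<in> \<gamma> ` {0..}"
    then obtain s where s: "0 \<le> s" "x = \<gamma> s" by auto
    have As: "0 \<le> A s" using JA(1)[OF s(1)] by auto
    have "\<gamma> (T (A s)) = \<gamma> s" using T[OF As] s by (intro same) auto
    then show "x \<in> (\<lambda>a. \<gamma> (T a)) ` {0..}" using s As by (intro rev_image_eqI[of "A s"]) auto
  qed (use T in auto)
  ultimately show ?thesis by blast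
qed

lemma ray_traces_eq:
  "ray_traces g = {\<gamma> ` {0..} |\<gamma>. continuous_on {0..} \<gamma> \<and> inj_on \<gamma> {0..} \<and> \<gamma> 0 = 0 \<and> len (\<gamma> ` {0..}) = \<infinity> \<and>
    (\<forall>s t. 0 \<le> s \<and> s < t \<longrightarrow> (\<exists>j. is_subroute \<gamma> s t (g j)))}"
proof (intro equalityI subsetI)
  fix X assume "X \<in> ray_traces g"
  then obtain \<phi> where \<phi>: "X = \<phi> ` {0..}" "ray g \<phi>" unfolding ray_traces_def by blast
  then show "X \<in> {\<gamma> ` {0..} |\<gamma>. continuous_on {0..} \<gamma> \<and> inj_on \<gamma> {0..} \<and> \<gamma> 0 = 0 \<and> len (\<gamma> ` {0..}) = \<infinity> \<and>
      (\<forall>s t. 0 \<le> s \<and> s < t \<longrightarrow> (\<exists>j. is_subroute \<gamma> s t (g j)))}"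
    using ray_trace[OF \<phi>(2)] by blast
next
  fix X assume "X \<in> {\<gamma> ` {0..} |\<gamma>. continuous_on {0..} \<gamma> \<and> inj_on \<gamma> {0..} \<and> \<gamma> 0 = 0 \<and> len (\<gamma> ` {0..}) = \<infinity> \<and>
      (\<forall>s t. 0 \<le> s \<and> s < t \<longrightarrow> (\<exists>j. is_subroute \<gamma> s t (g j)))}"
  then obtain \<gamma> where \<gamma>: "X = \<gamma> ` {0..}" "\<gamma> 0 = 0" "len (\<gamma> ` {0..}) = \<infinity>"
    "\<forall>s t. 0 \<le> s \<and> s < t \<longrightarrow> (\<exists>j. is_subroute \<gamma> s t (g j))" by blast
  then obtain \<phi> where "ray g \<phi>" "\<phi> ` {0..} = \<gamma> ` {0..}" using trace_ray[OF \<gamma>(3,2)] by blast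
  then show "X \<in> ray_traces g" unfolding ray_traces_def using \<gamma>(1) by blast
qed

text \<open>Each far route contributes at least \<rho>, and routes that are apart contribute
  separately.\<close>

lemma card_le_crossing_length:
  assumes "0 < \<rho>" "finite S" "S \<subseteq> far \<rho> g" "apart \<rho> g S"
  shows "of_nat (card S) * ennreal \<rho> \<le> crossing_length \<rho> g"
proof -
  have "of_nat (card S) * ennreal \<rho> = (\<Sum>n\<in>S. ennreal \<rho>)" by simp
  also have "\<dots> \<le> (\<Sum>n\<in>S. annulus_length \<rho> (g n))"
    using assms(1,3) by (intro sum_mono annulus_length_ge route start) (auto simp: far_def)
  also have "\<dots> \<le> crossing_length \<rho> g" by (rule crossing_length_ge_sum[OF assms(2-4)])
  finally show ?thesis .
qed

end

text \<open>The annuli with inner radii \<open>m / 2 ^ (k + 1)\<close> tile the punctured disc of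
  radius \<open>m\<close>. The assumption thus makes crossing lengths summable within every disc; it
  will hold almost surely because their means are linear in the radius.\<close>

locale tame_routes = origin_routes +
  assumes summable_crossings: "\<And>m::nat. 0 < m \<Longrightarrow> (\<Sum>k. crossing_length (real m / 2 ^ (k + 1)) g) < \<infinity>"
begin

text \<open>Radius \<open>m\<close> is the outermost shell \<open>k = 0\<close> of the disc of
  radius \<open>2 * m\<close>.\<close>

lemma crossing_length_finite:
  assumes "0 < (m::nat)"
  shows "crossing_length (real m) g < \<infinity>"
proof -
  have "crossing_length (real (2 * m) / 2 ^ (0 + 1)) g \<le> (\<Sum>k. crossing_length (real (2 * m) / 2 ^ (k + 1)) g)"
    using sum_le_suminf[of "\<lambda>k. crossing_length (real (2 * m) / 2 ^ (k + 1)) g" "{0}"] by simp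
  also have "\<dots> < \<infinity>" using assms by (intro summable_crossings) simp
  finally show ?thesis by simp
qed

text \<open>If the ray stayed in the disc of radius \<open>m\<close>, one far route would spend an
  arbitrarily large arc length \<open>a\<close> in the dyadic shells. In each shell its length is at
  most the crossing length, and these sum to a finite number independent of
  \<open>a\<close>.\<close>

lemma ray_unbounded:
  assumes \<phi>: "ray g \<phi>"
  shows "\<exists>b\<ge>0. r \<le> norm (\<phi> b)"
proof (rule ccontr)
  assume "\<not> ?thesis"
  then have small: "\<And>b. 0 \<le> b \<Longrightarrow> norm (\<phi> b) < r" by force
  obtain m :: nat where m: "r \<le> m" "0 < m"
  proof -
    obtain m :: nat where "r \<le> m" using real_arch_simple by blast
    then show ?thesis using that[of "Suc m"] by simp
  qed
  let ?r = "\<lambda>k. real m / 2 ^ (k + 1)"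
  let ?S = "\<Sum>k. crossing_length (?r k) g"
  have le: "ennreal a \<le> ?S" if a: "0 \<le> a" for a
  proof -
    obtain j where j: "j \<in> far m g" "a \<le> speed (g j)" "\<And>b. b \<in> {0..a} \<Longrightarrow> \<phi> b = hat (g j) b"
      using ray_far[OF \<phi> a] by blast
    let ?v = "speed (g j)"
    have v: "0 < ?v" by (rule speed_pos)
    have rm: "?r k \<le> m" for k
    proof -
      have "(1::real) \<le> 2 ^ (k + 1)" by (rule one_le_power) simp
      from mult_left_mono[OF this, of "real m"] show ?thesis by (simp add: divide_le_eq)
    qed
    have far: "j \<in> far (?r k) g" for k using j(1) far_mono[OF rm] by blast
    \<comment> \<open>Time 0 is left out because no shell contains the origin; a single time has
      measure 0.\<close>
    have cover: "{0<..a / ?v} \<subseteq> (\<Union>k. annulus_time (?r k) (g j))"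
    proof
      fix t assume t: "t \<in> {0<..a / ?v}"
      then have tv: "0 < t * ?v" "t * ?v \<le> a" using v by (auto simp: field_simps)
      have gt: "g j t = \<phi> (t * ?v)" using j(3)[of "t * ?v"] tv v by (simp add: hat_def)
      have "a / ?v \<le> 1" using j(2) v by simp
      then have t01: "t \<in> {0..1}" using t by auto
      have "g j t \<noteq> g j 0" using inj_onD[OF route_inj[OF route[of j]], of t 0] t t01 by auto
      then have "0 < norm (g j t)" using start by simp
      moreover have "norm (g j t) \<le> m" using small[of "t * ?v"] gt tv m by simp
      ultimately obtain k where "?r k < norm (g j t)" "norm (g j t) \<le> 2 * ?r k"
        using ex_dyadic_shell by blast
      then show "t \<in> (\<Union>k. annulus_time (?r k) (g j))" unfolding annulus_time_def using t01 by blast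
    qed
    have "ennreal a = ennreal ?v * ennreal (a / ?v)" using v a by (simp flip: ennreal_mult)
    also have "ennreal (a / ?v) = emeasure lborel {0<..a / ?v}" using v a by simp
    also have "\<dots> \<le> emeasure lborel (\<Union>k. annulus_time (?r k) (g j))"
      using annulus_time_borel[OF route] by (intro emeasure_mono cover) auto
    also have "\<dots> \<le> (\<Sum>k. emeasure lborel (annulus_time (?r k) (g j)))"
      using annulus_time_borel[OF route] by (intro emeasure_subadditive_countably) auto
    finally have "ennreal a \<le> ennreal ?v * (\<Sum>k. emeasure lborel (annulus_time (?r k) (g j)))"
      by (simp add: mult_left_mono)
    also have "\<dots> = (\<Sum>k. annulus_length (?r k) (g j))" unfolding annulus_length_def by simp
    also have "\<dots> \<le> ?S"
    proof (intro suminf_le)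
      fix k show "annulus_length (?r k) (g j) \<le> crossing_length (?r k) g"
        using crossing_length_ge_sum[of "{j}" "?r k" g] far by (simp add: apart_def)
    qed auto
    finally show ?thesis .
  qed
  obtain s where "?S = ennreal s" "0 \<le> s" using summable_crossings[OF m(2)] by (cases ?S) auto
  then show False using le[of "s + 1"] by (simp add: ennreal_le_iff)
qed

section \<open>Correspondence between infinite classes and geodesics\<close>

lemma ray_thru_far:
  assumes \<phi>: "ray g \<phi>" and "0 \<le> a"
  shows "\<exists>i. thru \<rho> g \<phi> i \<and> (\<forall>b\<in>{0..a}. \<phi> b \<in> path_image (g i))"
proof -
  obtain b where b: "0 \<le> b" "\<rho> \<le> norm (\<phi> b)" using ray_unbounded[OF \<phi>] by blast
  have "0 \<le> max a b" using b by auto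
  then obtain j where j: "j \<in> far \<rho> g" "max a b \<le> speed (g j)" "\<And>c. c \<in> {0..max a b} \<Longrightarrow> \<phi> c = hat (g j) c"
    using ray_far[OF \<phi>] by blast
  have "\<phi> c \<in> path_image (g j)" if "c \<in> {0..max a b}" for c
    unfolding path_image_hat using j(2) j(3)[OF that] that by (intro rev_image_eqI[of c]) auto
  then show ?thesis unfolding thru_def using j(1) b by (intro exI[of _ j]) auto
qed

text \<open>Ramsey's theorem, applied to the relation of meeting: infinitely many far routes that
  pairwise avoid each other beyond \<open>m\<close> would make the crossing length at least
  \<open>n * m\<close> for every \<open>n\<close>.\<close>

lemma infinite_meeting:
  assumes "infinite A" "0 < (m::nat)"
  shows "\<exists>B\<subseteq>A. infinite B \<and> (\<forall>x\<in>B. \<forall>y\<in>B. meets (real m) g x y)"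
proof -
  define Z where "Z = A \<inter> far m g"
  have "A \<subseteq> Z \<union> - far m g" unfolding Z_def by blast
  then have infZ: "infinite Z" using assms(1) near_finite[of m] finite_subset[of A] by blast
  \<comment> \<open>Colour 0 marks the pairs that meet; symmetry of \<open>meets\<close> makes it a
    colouring of unordered pairs.\<close>
  define f :: "nat set \<Rightarrow> nat" where "f X = (if \<exists>x y. X = {x, y} \<and> meets m g x y then 0 else 1)" for X
  have f: "f {x, y} = 0 \<longleftrightarrow> meets m g x y" for x y
    unfolding f_def by (auto simp: doubleton_eq_iff meets_sym)
  have "\<forall>x\<in>Z. \<forall>y\<in>Z. x \<noteq> y \<longrightarrow> f {x, y} < 2" unfolding f_def by auto
  then obtain Y t where Y: "Y \<subseteq> Z" "infinite Y" "t < 2" "\<forall>x\<in>Y. \<forall>y\<in>Y. x \<noteq> y \<longrightarrow> f {x, y} = t"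
    using Ramsey2[OF infZ, of f 2] by blast
  have Yfar: "Y \<subseteq> far m g" using Y(1) unfolding Z_def by blast
  have "t = 0"
  proof (rule ccontr)
    assume "t \<noteq> 0"
    have ap: "apart m g Y" unfolding apart_def
    proof (intro ballI impI)
      fix x y assume "x \<in> Y" "y \<in> Y" "x \<noteq> y"
      then have "f {x, y} \<noteq> 0" using Y(4) \<open>t \<noteq> 0\<close> by simp
      then show "\<not> meets m g x y" using f[of x y] by simp
    qed
    obtain w where w: "crossing_length m g = ennreal w" "0 \<le> w"
      using crossing_length_finite[OF assms(2)] by (cases "crossing_length m g") auto
    obtain n :: nat where n: "w < n" using reals_Archimedean2 by blast
    obtain S where S: "S \<subseteq> Y" "finite S" "card S = n" using infinite_arbitrarily_large[OF Y(2)] by metis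
    have "of_nat n * ennreal (real m) \<le> ennreal w"
      using card_le_crossing_length[of m S] S Yfar ap assms(2) w unfolding apart_def by auto
    then have "real n * real m \<le> w"
      using w by (simp add: ennreal_of_nat_eq_real_of_nat flip: ennreal_mult)
    moreover have "real n * 1 \<le> real n * real m" using assms(2) by (intro mult_left_mono) auto
    ultimately show False using n by simp
  qed
  then have "meets m g x y" if "x \<in> Y" "y \<in> Y" for x y
    using Y(4) f that Yfar meets_refl[of m x] by (cases "x = y") auto
  then show ?thesis using Y Z_def by blast
qed

text \<open>A diagonal argument: nested infinite subsets \<open>B n\<close> of the class consist of
  routes that pairwise meet beyond \<open>n\<close>. Representatives \<open>j n\<close> agree with
  all later ones up to arc length \<open>n\<close> and so define a limiting ray.\<close>

lemma inf_class_ray: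
  assumes \<rho>: "0 < \<rho>" and i: "inf_class \<rho> g i"
  shows "\<exists>\<phi>. ray g \<phi> \<and> thru \<rho> g \<phi> i"
proof -
  define C where "C = {j\<in>far \<rho> g. meets \<rho> g i j}"
  have ifar: "i \<in> far \<rho> g" and infC: "infinite C" using i unfolding inf_class_def C_def by auto
  define P where "P n B \<longleftrightarrow> infinite B \<and> B \<subseteq> C \<and> (\<forall>x\<in>B. \<forall>y\<in>B. meets (real n) g x y)" for n B
  have "\<exists>B. \<forall>n. P n (B n) \<and> B (Suc n) \<subseteq> B n"
  proof (rule dependent_nat_choice[of P "\<lambda>_ B B'. B' \<subseteq> B"])
    \<comment> \<open>Level 0 demands nothing, since all routes share the point 0.\<close>
    have "meets 0 g x y" for x y
      using speed_pos[of x] speed_pos[of y] by (intro meetsI[of 0]) auto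
    then have "P 0 C" unfolding P_def using infC by auto
    then show "\<exists>B. P 0 B" by blast
    fix B n assume PB: "P n B"
    then have "infinite B" unfolding P_def by blast
    then obtain B' where "B' \<subseteq> B" "infinite B'" "\<forall>x\<in>B'. \<forall>y\<in>B'. meets (real (Suc n)) g x y"
      using infinite_meeting[of B "Suc n"] by blast
    then have "P (Suc n) B' \<and> B' \<subseteq> B" using PB unfolding P_def by blast
    then show "\<exists>B'. P (Suc n) B' \<and> B' \<subseteq> B" by blast
  qed
  then obtain B where PB: "\<And>n. P n (B n)" and Bsub: "\<And>n. B (Suc n) \<subseteq> B n" by blast
  have B: "infinite (B n)" "B n \<subseteq> C" "\<And>x y. x \<in> B n \<Longrightarrow> y \<in> B n \<Longrightarrow> meets (real n) g x y" for n
    using PB[of n] unfolding P_def by blast+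
  have Bmono: "B l \<subseteq> B k" if "k \<le> l" for k l by (rule lift_Suc_antimono_le[of B, OF Bsub that])
  have "\<exists>j. j \<in> B k" for k
  proof -
    have "B k \<noteq> {}" using B(1)[of k] by (metis finite.emptyI)
    then show ?thesis by blast
  qed
  then obtain j where j: "\<And>k. j k \<in> B k" by metis
  have agree: "real k \<le> speed (g (j k)) \<and> (\<forall>b\<in>{0..real k}. hat (g (j k)) b = hat (g (j l)) b)" if "k \<le> l" for k l
  proof -
    have "meets (real k) g (j k) (j l)" using B(3)[of "j k" k "j l"] j[of k] j[of l] Bmono[OF that] by blast
    then obtain c where "c \<in> {0..speed (g (j k))}" "real k \<le> c" "\<forall>b\<in>{0..c}. hat (g (j k)) b = hat (g (j l)) b"
      using meets_hat by blast
    then show ?thesis by auto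
  qed
  \<comment> \<open>Rounding up selects a representative that agrees with all later ones up to arc
    length \<open>a\<close>.\<close>
  define \<phi> where "\<phi> a = hat (g (j (nat \<lceil>a\<rceil>))) a" for a
  have ray: "ray g \<phi>" unfolding ray_def
  proof (intro allI impI)
    fix a :: real assume a: "0 \<le> a"
    let ?k = "nat \<lceil>a\<rceil>"
    have "\<phi> b = hat (g (j ?k)) b" if b: "b \<in> {0..a}" for b
    proof -
      have "nat \<lceil>b\<rceil> \<le> ?k" using b by (intro nat_mono ceiling_mono) auto
      moreover have "b \<in> {0..real (nat \<lceil>b\<rceil>)}" using b by (auto simp: real_nat_ceiling_ge)
      ultimately show ?thesis unfolding \<phi>_def using agree by blast
    qed
    moreover have "a \<le> speed (g (j ?k))" using agree[of ?k ?k] real_nat_ceiling_ge[of a] by linarith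
    ultimately show "\<exists>j. a \<le> speed (g j) \<and> (\<forall>b\<in>{0..a}. \<phi> b = hat (g j) b)" by blast
  qed
  let ?h = "g (j 0)"
  have jC: "j k \<in> C" for k using B(2)[of k] j[of k] by blast
  have jm: "meets \<rho> g (j 0) (j k)" for k
    using jC[of k] jC[of 0] meets_trans[of \<rho> "j 0" i "j k"] meets_sym unfolding C_def by blast
  \<comment> \<open>The least element \<open>t\<close> of this set is the arc length at which the
    route \<open>j 0\<close> first reaches radius \<rho>. Any meeting beyond \<rho> takes place at
    or after \<open>t\<close>, so the limiting ray passes through the same point.\<close>
  let ?A = "{0..speed ?h} \<inter> (\<lambda>c. norm (hat ?h c)) -` {\<rho>..}"
  have "continuous_on {0..speed ?h} (hat ?h)"
    using hat_lipschitz[of _ "j 0"] by (intro lipschitz_on_continuous_on[of 1] lipschitz_onI) auto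
  then have "compact ?A"
    by (intro compact_Int_closed[of "{0..speed ?h}" ?A, simplified] continuous_closed_preimage continuous_on_norm) auto
  moreover have "speed ?h \<in> ?A" using speed_pos[of "j 0"] jC[of 0] \<rho> unfolding C_def far_def by (auto simp: hat_end)
  ultimately have "\<exists>t\<in>?A. \<forall>u\<in>?A. t \<le> u" by (intro compact_attains_inf) blast+
  then obtain t where t: "t \<in> ?A" "\<And>u. u \<in> ?A \<Longrightarrow> t \<le> u" by blast
  have "hat ?h t = \<phi> t"
  proof -
    obtain c where "c \<in> {0..speed ?h}" "\<rho> \<le> norm (hat ?h c)" "\<forall>b\<in>{0..c}. hat ?h b = hat (g (j (nat \<lceil>t\<rceil>))) b"
      using meets_hat[OF jm] by blast
    moreover from this have "t \<le> c" by (intro t(2)) auto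
    ultimately show ?thesis unfolding \<phi>_def using t(1) by auto
  qed
  then have "thru \<rho> g \<phi> (j 0)" unfolding thru_def path_image_hat using jC[of 0] t(1) unfolding C_def
    by (intro conjI exI[of _ t] rev_image_eqI[of t]) auto
  moreover have "meets \<rho> g (j 0) i" using jC[of 0] meets_sym[of \<rho> g i "j 0"] unfolding C_def by blast
  ultimately have "thru \<rho> g \<phi> i" using ifar by (rule thru_step[OF ray])
  then show ?thesis using ray by blast
qed

lemma separation_level:
  assumes "ray g \<phi>" "ray g \<psi>" "\<phi> ` {0..} \<noteq> \<psi> ` {0..}"
  obtains m :: nat where "\<And>\<rho> i. real m \<le> \<rho> \<Longrightarrow> thru \<rho> g \<phi> i \<Longrightarrow> thru \<rho> g \<psi> i \<Longrightarrow> False"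
  using rays_eq_trace[OF assms(1,2)] assms(3) by metis

text \<open>Any two of the rays stop sharing classes from some radius on, and there are finitely
  many pairs. Validity for all \<rho> beyond \<open>m0\<close>, not just for one, is what the lower
  limit in \<open>card_traces_le\<close> requires.\<close>

lemma classes_of_traces:
  assumes fin: "finite \<X>" and sub: "\<X> \<subseteq> ray_traces g"
  shows "\<exists>m0::nat. \<forall>\<rho>\<ge>real m0.
    \<exists>S. finite S \<and> card S = card \<X> \<and> (\<forall>i\<in>S. inf_class \<rho> g i) \<and> apart \<rho> g S"
proof -
  have "\<forall>X. \<exists>\<phi>. X \<in> \<X> \<longrightarrow> ray g \<phi> \<and> X = \<phi> ` {0..}" using sub unfolding ray_traces_def by blast
  then obtain F where F: "\<And>X. X \<in> \<X> \<Longrightarrow> ray g (F X)" "\<And>X. X \<in> \<X> \<Longrightarrow> X = F X ` {0..}" by metis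
  have "\<exists>m::nat. X \<in> \<X> \<and> Y \<in> \<X> \<and> X \<noteq> Y \<longrightarrow> (\<forall>\<rho>\<ge>m. \<forall>i. \<not> (thru \<rho> g (F X) i \<and> thru \<rho> g (F Y) i))" for X Y
  proof (cases "X \<in> \<X> \<and> Y \<in> \<X> \<and> X \<noteq> Y")
    case True
    then have "F X ` {0..} \<noteq> F Y ` {0..}" using F(2) by metis
    then show ?thesis using separation_level[of "F X" "F Y"] F(1) True by metis
  qed auto
  then obtain M :: "point set \<Rightarrow> point set \<Rightarrow> nat"
    where M: "\<And>X Y \<rho> i. X \<in> \<X> \<Longrightarrow> Y \<in> \<X> \<Longrightarrow> X \<noteq> Y \<Longrightarrow> real (M X Y) \<le> \<rho> \<Longrightarrow> thru \<rho> g (F X) i \<Longrightarrow> thru \<rho> g (F Y) i \<Longrightarrow> False"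
    by metis
  define m0 where "m0 = Max (insert 0 ((\<lambda>(X, Y). M X Y) ` (\<X> \<times> \<X>)))"
  have m0: "M X Y \<le> m0" if "X \<in> \<X>" "Y \<in> \<X>" for X Y
    unfolding m0_def using fin that by (intro Max_ge) auto
  show ?thesis
  proof (intro exI[of _ m0] allI impI)
    fix \<rho> :: real assume \<rho>: "real m0 \<le> \<rho>"
    have "\<exists>i. X \<in> \<X> \<longrightarrow> thru \<rho> g (F X) i" for X using ray_thru_far[OF F(1), of X 0 \<rho>] by blast
    then obtain I where I: "\<And>X. X \<in> \<X> \<Longrightarrow> thru \<rho> g (F X) (I X)" by metis
    have sep: "\<not> meets \<rho> g (I X) (I Y)" if "X \<in> \<X>" "Y \<in> \<X>" "X \<noteq> Y" for X Y
    proof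
      assume m: "meets \<rho> g (I X) (I Y)"
      have "I Y \<in> far \<rho> g" using I[OF that(2)] unfolding thru_def by simp
      then have "thru \<rho> g (F X) (I Y)" by (rule thru_step[OF F(1)[OF that(1)] I[OF that(1)] m])
      moreover have "real (M X Y) \<le> \<rho>" using m0[OF that(1,2)] \<rho> by linarith
      ultimately show False using M[OF that] I[OF that(2)] by blast
    qed
    have "0 \<le> \<rho>" using \<rho> of_nat_0_le_iff order_trans by blast
    have "inj_on I \<X>"
    proof (rule inj_onI, rule ccontr)
      fix X Y assume XY: "X \<in> \<X>" "Y \<in> \<X>" "I X = I Y" "X \<noteq> Y"
      have "I X \<in> far \<rho> g" using I[OF XY(1)] unfolding thru_def by simp
      then show False using meets_refl[OF \<open>0 \<le> \<rho>\<close>] sep[OF XY(1,2,4)] XY(3) by simp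
    qed
    then have "card (I ` \<X>) = card \<X>" by (rule card_image)
    moreover have "\<forall>i\<in>I ` \<X>. inf_class \<rho> g i" using thru_inf_class F(1) I by blast
    moreover have "apart \<rho> g (I ` \<X>)" unfolding apart_def using sep by blast
    ultimately show "\<exists>S. finite S \<and> card S = card \<X> \<and> (\<forall>i\<in>S. inf_class \<rho> g i) \<and> apart \<rho> g S"
      using fin by (intro exI[of _ "I ` \<X>"]) auto
  qed
qed

text \<open>Rays with the same trace, started from two of the classes, would make the routes
  representing these classes meet beyond \<rho>.\<close>

lemma class_rays:
  assumes "0 < \<rho>" "\<forall>i\<in>S. inf_class \<rho> g i" "apart \<rho> g S"
  shows "\<exists>F. (\<forall>i\<in>S. ray g (F i)) \<and> (\<forall>i\<in>S. thru \<rho> g (F i) i) \<and> inj_on (\<lambda>i. F i ` {0..}) S"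
proof -
  have "\<exists>\<phi>. i \<in> S \<longrightarrow> ray g \<phi> \<and> thru \<rho> g \<phi> i" for i using inf_class_ray[OF assms(1)] assms(2) by blast
  then obtain F where F: "\<And>i. i \<in> S \<Longrightarrow> ray g (F i)" "\<And>i. i \<in> S \<Longrightarrow> thru \<rho> g (F i) i" by metis
  have "inj_on (\<lambda>i. F i ` {0..}) S"
  proof (rule inj_onI, rule ccontr)
    fix i j assume ij: "i \<in> S" "j \<in> S" "F i ` {0..} = F j ` {0..}" "i \<noteq> j"
    obtain b where b: "0 \<le> b" "F j b \<in> path_image (g j)" "\<rho> \<le> norm (F j b)" "j \<in> far \<rho> g"
      using F(2)[OF ij(2)] unfolding thru_def by blast
    then have "F j b \<in> F i ` {0..}" unfolding ij(3) by simp
    then obtain c where "0 \<le> c" "F j b = F i c" by auto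
    then have "thru \<rho> g (F i) j" unfolding thru_def using b by auto
    then have "meets \<rho> g i j" by (rule thru_meets[OF F(1)[OF ij(1)] F(2)[OF ij(1)]])
    then show False using assms(3) ij unfolding apart_def by blast
  qed
  moreover have "\<forall>i\<in>S. ray g (F i)" "\<forall>i\<in>S. thru \<rho> g (F i) i" using F by simp_all
  ultimately have "(\<forall>i\<in>S. ray g (F i)) \<and> (\<forall>i\<in>S. thru \<rho> g (F i) i) \<and> inj_on (\<lambda>i. F i ` {0..}) S" by simp
  then show ?thesis by (rule exI[where x = F])
qed

text \<open>Classes at a single radius already produce as many rays, and finitely many rays are
  separated at some integer radius. This is how the number of geodesics becomes measurable.\<close>

lemma many_classes_iff:
  "many_classes n g \<longleftrightarrow> (\<exists>\<X>. finite \<X> \<and> card \<X> = n \<and> \<X> \<subseteq> ray_traces g)"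
proof
  assume "many_classes n g"
  then obtain \<rho> where "0 < \<rho>" "\<exists>S. finite S \<and> card S = n \<and> (\<forall>i\<in>S. inf_class \<rho> g i) \<and> apart \<rho> g S"
    unfolding many_classes_def by (elim bexE conjE)
  then obtain S where S: "0 < \<rho>" "finite S" "card S = n" "\<forall>i\<in>S. inf_class \<rho> g i" "apart \<rho> g S"
    by (elim exE conjE)
  obtain F where F: "\<forall>i\<in>S. ray g (F i)" "inj_on (\<lambda>i. F i ` {0..}) S"
    using class_rays[OF S(1,4,5)] by (elim exE conjE)
  let ?X = "(\<lambda>i. F i ` {0..}) ` S"
  have "?X \<subseteq> ray_traces g" unfolding ray_traces_def using F(1) by blast
  moreover have "card ?X = n" using S(3) card_image[OF F(2)] by simp
  moreover have "finite ?X" using S(2) by simp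
  ultimately show "\<exists>\<X>. finite \<X> \<and> card \<X> = n \<and> \<X> \<subseteq> ray_traces g" by blast
next
  assume "\<exists>\<X>. finite \<X> \<and> card \<X> = n \<and> \<X> \<subseteq> ray_traces g"
  then obtain \<X> where X: "finite \<X>" "card \<X> = n" "\<X> \<subseteq> ray_traces g" by blast
  obtain m0 :: nat where m0: "\<forall>\<rho>\<ge>real m0.
    \<exists>S. finite S \<and> card S = card \<X> \<and> (\<forall>i\<in>S. inf_class \<rho> g i) \<and> apart \<rho> g S"
    using classes_of_traces[OF X(1,3)] ..
  have "\<exists>S. finite S \<and> card S = n \<and> (\<forall>i\<in>S. inf_class (real (Suc m0)) g i) \<and> apart (real (Suc m0)) g S"
    using m0[rule_format, of "real (Suc m0)"] X(2) by simp
  then show "many_classes n g" unfolding many_classes_def by (intro bexI[of _ "real (Suc m0)"] conjI) simp_all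
qed

text \<open>At every large integer radius the geodesics follow different classes, each adding at
  least that radius to the crossing length. The lower limit is the form that suits Fatou's
  lemma.\<close>

lemma card_traces_le:
  assumes "finite \<X>" "\<X> \<subseteq> ray_traces g"
  shows "of_nat (card \<X>) \<le> liminf (\<lambda>m. crossing_length (real m) g / ennreal (real m))"
proof -
  obtain m0 :: nat where m0: "\<forall>\<rho>\<ge>real m0.
    \<exists>S. finite S \<and> card S = card \<X> \<and> (\<forall>i\<in>S. inf_class \<rho> g i) \<and> apart \<rho> g S"
    using classes_of_traces[OF assms] ..
  have "of_nat (card \<X>) \<le> crossing_length (real m) g / ennreal (real m)" if m: "m0 \<le> m" "0 < m" for m
  proof -
    obtain S where S: "finite S" "card S = card \<X>" "\<forall>i\<in>S. inf_class m g i" "apart m g S"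
      using m0[rule_format, of "real m"] m by auto
    then have "of_nat (card \<X>) * ennreal (real m) \<le> crossing_length (real m) g"
      using card_le_crossing_length[of m S] m unfolding inf_class_def by auto
    then have "of_nat (card \<X>) * ennreal (real m) / ennreal (real m) \<le> crossing_length (real m) g / ennreal (real m)"
      by (rule divide_right_mono_ennreal)
    then show ?thesis using m by (simp add: mult_divide_eq_ennreal)
  qed
  then have "\<forall>\<^sub>F m in sequentially. of_nat (card \<X>) \<le> crossing_length (real m) g / ennreal (real m)"
    by (intro eventually_sequentiallyI[of "Suc m0"]) simp
  then show ?thesis by (rule Liminf_bounded)
qed

lemma branch_beyond_iff:
  assumes r: "0 < r"
  shows "branch_beyond r g \<longleftrightarrow> (\<exists>X\<in>ray_traces g. \<exists>Y\<in>ray_traces g. X \<noteq> Y \<and> (\<exists>q\<in>X \<inter> Y. r \<le> norm q))"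
proof
  assume "branch_beyond r g"
  then obtain \<rho> i j where ij: "0 < \<rho>" "inf_class \<rho> g i" "inf_class \<rho> g j" "\<not> meets \<rho> g i j" "meets r g i j"
    unfolding branch_beyond_def by blast
  have "i \<noteq> j" using ij meets_refl[of \<rho> i] unfolding inf_class_def by auto
  have "\<forall>k\<in>{i, j}. inf_class \<rho> g k" "apart \<rho> g {i, j}" using ij meets_sym unfolding apart_def by auto
  from class_rays[OF ij(1) this] obtain F where F': "\<forall>k\<in>{i, j}. ray g (F k)" "\<forall>k\<in>{i, j}. thru \<rho> g (F k) k"
    "inj_on (\<lambda>k. F k ` {0..}) {i, j}" by (elim exE conjE)
  note F = F'(1,2)[rule_format] F'(3)
  obtain c where c: "c \<in> {0..speed (g i)}" "c \<in> {0..speed (g j)}" "r \<le> norm (hat (g i) c)"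
    "\<forall>b\<in>{0..c}. hat (g i) b = hat (g j) b" using meets_hat[OF ij(5)] by blast
  have on: "hat (g i) c = F k c" if k: "k \<in> {i, j}" for k
  proof -
    obtain b where b: "0 \<le> b" "F k b \<in> path_image (g k)" "\<rho> \<le> norm (F k b)"
      using F(2)[OF k] unfolding thru_def by blast
    note on = ray_on_route[OF F(1)[OF k] b(1,2)]
    \<comment> \<open>Otherwise the ray's point beyond \<rho> would lie on the portion shared by
      \<open>i\<close> and \<open>j\<close>, and these would meet beyond \<rho>.\<close>
    have "\<not> b < c"
    proof
      assume "b < c"
      then have "hat (g i) b = hat (g j) b" "F k b = hat (g k) b" using c b on(2)[of b] by auto
      then have "meets \<rho> g i j" using b c k \<open>b < c\<close> by (intro meetsI[of b]) auto
      then show False using ij by blast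
    qed
    then have "F k c = hat (g k) c" using on(2)[of c] c by auto
    then show ?thesis using c k by auto
  qed
  have "F i ` {0..} \<noteq> F j ` {0..}" using inj_onD[OF F(3), of i j] \<open>i \<noteq> j\<close> by auto
  moreover have "hat (g i) c \<in> F k ` {0..}" if "k \<in> {i, j}" for k
    unfolding on[OF that] using c by (intro imageI) auto
  moreover have "F k ` {0..} \<in> ray_traces g" if "k \<in> {i, j}" for k
    unfolding ray_traces_def using F(1)[OF that] by blast
  ultimately show "\<exists>X\<in>ray_traces g. \<exists>Y\<in>ray_traces g. X \<noteq> Y \<and> (\<exists>q\<in>X \<inter> Y. r \<le> norm q)"
    using c(3) by (intro bexI[of _ "F i ` {0..}"] bexI[of _ "F j ` {0..}"] conjI bexI[of _ "hat (g i) c"] IntI) simp_all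
next
  assume "\<exists>X\<in>ray_traces g. \<exists>Y\<in>ray_traces g. X \<noteq> Y \<and> (\<exists>q\<in>X \<inter> Y. r \<le> norm q)"
  then obtain \<phi> \<psi> q where *: "ray g \<phi>" "ray g \<psi>" "\<phi> ` {0..} \<noteq> \<psi> ` {0..}" "q \<in> \<phi> ` {0..}" "q \<in> \<psi> ` {0..}" "r \<le> norm q"
    unfolding ray_traces_def by blast
  obtain m :: nat where m: "\<And>\<rho> i. real m \<le> \<rho> \<Longrightarrow> thru \<rho> g \<phi> i \<Longrightarrow> thru \<rho> g \<psi> i \<Longrightarrow> False"
    using separation_level[OF *(1-3)] by blast
  obtain b where b: "0 \<le> b" "q = \<phi> b" using *(4) by auto
  obtain c where c: "0 \<le> c" "q = \<psi> c" using *(5) by auto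
  let ?\<rho> = "real (Suc m)"
  obtain i where i: "thru ?\<rho> g \<phi> i" "\<forall>a\<in>{0..b}. \<phi> a \<in> path_image (g i)"
    using ray_thru_far[OF *(1) b(1), of ?\<rho>] by (elim exE conjE)
  obtain j where j: "thru ?\<rho> g \<psi> j" "\<forall>a\<in>{0..c}. \<psi> a \<in> path_image (g j)"
    using ray_thru_far[OF *(2) c(1), of ?\<rho>] by (elim exE conjE)
  have q: "q \<in> path_image (g i)" "q \<in> path_image (g j)"
    using i(2)[rule_format, of b] j(2)[rule_format, of c] b c by simp_all
  have "\<not> meets ?\<rho> g i j"
  proof
    assume "meets ?\<rho> g i j"
    moreover have "j \<in> far ?\<rho> g" using j(1) unfolding thru_def by blast
    ultimately have "thru ?\<rho> g \<phi> j" by (rule thru_step[OF *(1) i(1)])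
    then show False using m[of ?\<rho> j] j by simp
  qed
  moreover have "meets r g i j" unfolding meets_def using q *(6) by blast
  ultimately have "\<exists>i j. inf_class ?\<rho> g i \<and> inf_class ?\<rho> g j \<and> \<not> meets ?\<rho> g i j \<and> meets r g i j"
    using thru_inf_class[OF *(1) i(1)] thru_inf_class[OF *(2) j(1)] by blast
  then show "branch_beyond r g" unfolding branch_beyond_def by (intro bexI[of _ ?\<rho>] conjI) simp_all
qed

text \<open>A far route carrying one ray past a common point also hits the other ray there, so both
  would follow one class at that radius; beyond the separation level this is impossible.\<close>

lemma common_points_bounded:
  assumes "X \<in> ray_traces g" "Y \<in> ray_traces g" "X \<noteq> Y"
  obtains m :: nat where "\<And>q. q \<in> X \<Longrightarrow> q \<in> Y \<Longrightarrow> norm q < m"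
proof -
  obtain \<phi> \<psi> where *: "ray g \<phi>" "ray g \<psi>" "X = \<phi> ` {0..}" "Y = \<psi> ` {0..}"
    using assms unfolding ray_traces_def by blast
  obtain m :: nat where m: "\<And>\<rho> i. real m \<le> \<rho> \<Longrightarrow> thru \<rho> g \<phi> i \<Longrightarrow> thru \<rho> g \<psi> i \<Longrightarrow> False"
    using separation_level[OF *(1,2)] assms(3) * by blast
  show ?thesis
  proof (rule that[of m], rule ccontr)
    fix q assume q: "q \<in> X" "q \<in> Y" "\<not> norm q < m"
    then obtain b c where bc: "0 \<le> b" "q = \<phi> b" "0 \<le> c" "q = \<psi> c" using * by auto
    obtain i where "thru m g \<phi> i" "q \<in> path_image (g i)" using ray_thru_far[OF *(1) bc(1), of m] bc by auto
    moreover from this have "thru m g \<psi> i" unfolding thru_def using bc q by auto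
    ultimately show False using m[of m i] by simp
  qed
qed

lemma zero_in_trace: "X \<in> ray_traces g \<Longrightarrow> 0 \<in> X"
  unfolding ray_traces_def using ray_trace(3) by (auto intro!: rev_image_eqI[of 0])

end

section \<open>Similarities\<close>

text \<open>\<open>compose {0..1}\<close> leaves the result undefined outside the unit interval, as
  membership in \<open>route_space\<close> demands; the same holds for
  \<open>rebase\<close>.\<close>

definition scale :: "real \<Rightarrow> route \<Rightarrow> route" where
  "scale c h = compose {0..1} (\<lambda>x. c *\<^sub>R x) h"

definition rebase :: "route \<Rightarrow> route" where
  "rebase h = compose {0..1} (\<lambda>x. x - h 0) h"

lemma scale_eval: "t \<in> {0..1} \<Longrightarrow> scale c h t = c *\<^sub>R h t"
  and rebase_eval: "t \<in> {0..1} \<Longrightarrow> rebase h t = h t - h 0"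
  by (auto simp: scale_def rebase_def compose_def)

lemma is_route_similarity:
  assumes h: "is_route h" and c: "0 < c" and k: "\<And>t. t \<in> {0..1} \<Longrightarrow> k t = c *\<^sub>R h t + a"
  shows "is_route k"
proof -
  obtain v and \<tau> :: "int \<Rightarrow> real" where \<tau>: "mono \<tau>" "(\<tau> \<longlongrightarrow> 0) at_bot" "(\<tau> \<longlongrightarrow> 1) at_top"
    and seg: "\<And>i. \<exists>a b. norm b = v \<and> (\<forall>t\<in>{\<tau> i..\<tau> (i + 1)}. h t = a + t *\<^sub>R b)"
    using h unfolding is_route_def by blast
  have "continuous_on {0..1} (\<lambda>t. c *\<^sub>R h t + a)" by (intro continuous_intros route_cont[OF h])
  then have "continuous_on {0..1} k" by (rule continuous_on_eq) (simp add: k)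
  moreover have "inj_on k {0..1}"
    using inj_onD[OF route_inj[OF h]] c by (intro inj_onI) (simp add: k)
  ultimately have "arc k" unfolding arc_def path_def by simp
  moreover have "\<exists>a' b'. norm b' = c * v \<and> (\<forall>t\<in>{\<tau> i..\<tau> (i + 1)}. k t = a' + t *\<^sub>R b')" for i
  proof -
    obtain a0 b where ab: "norm b = v" "\<forall>t\<in>{\<tau> i..\<tau> (i + 1)}. h t = a0 + t *\<^sub>R b" using seg by blast
    have "k t = (c *\<^sub>R a0 + a) + t *\<^sub>R (c *\<^sub>R b)" if t: "t \<in> {\<tau> i..\<tau> (i + 1)}" for t
    proof -
      have "t \<in> {0..1}" using t breaks_in_unit[OF \<tau>, of i] breaks_in_unit[OF \<tau>, of "i + 1"] by auto
      then show ?thesis using ab(2)[rule_format, OF t] by (simp add: k algebra_simps)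
    qed
    moreover have "norm (c *\<^sub>R b) = c * v" using ab c by simp
    ultimately show ?thesis by blast
  qed
  ultimately show ?thesis unfolding is_route_def using \<tau> by blast
qed

lemma is_route_scale: "is_route h \<Longrightarrow> 0 < c \<Longrightarrow> is_route (scale c h)"
  by (rule is_route_similarity[of h c _ 0]) (simp_all add: scale_eval)

lemma is_route_rebase: "is_route h \<Longrightarrow> is_route (rebase h)"
  by (rule is_route_similarity[of h 1 _ "- h 0"]) (simp_all add: rebase_eval)

lemma speed_mult:
  assumes h: "is_route h" and k: "is_route k" and c: "0 < c"
    and d: "\<And>s t. s \<in> {0..1} \<Longrightarrow> t \<in> {0..1} \<Longrightarrow> dist (k s) (k t) = c * dist (h s) (h t)"
  shows "speed k = c * speed h"
proof (rule antisym)
  show "speed k \<le> c * speed h"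
  proof (rule speed_leI[OF k])
    fix s t :: real assume st: "s \<in> {0..1}" "t \<in> {0..1}"
    have "c * dist (h s) (h t) \<le> c * (speed h * dist s t)"
      using route_lipschitz[OF h st] c by (intro mult_left_mono) auto
    then show "dist (k s) (k t) \<le> c * speed h * dist s t" using d[OF st] by (simp add: mult.assoc)
  qed
  have "speed h \<le> speed k / c"
  proof (rule speed_leI[OF h])
    fix s t :: real assume st: "s \<in> {0..1}" "t \<in> {0..1}"
    show "dist (h s) (h t) \<le> speed k / c * dist s t"
      using route_lipschitz[OF k st] d[OF st] c by (simp add: field_simps)
  qed
  then show "c * speed h \<le> speed k" using c by (simp add: field_simps)
qed

lemma speed_scale: "is_route h \<Longrightarrow> 0 < c \<Longrightarrow> speed (scale c h) = c * speed h"
  by (rule speed_mult) (simp_all add: is_route_scale scale_eval flip: scaleR_diff_right add: dist_norm)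

lemma path_image_scale: "path_image (scale c h) = (*\<^sub>R) c ` path_image h"
  unfolding path_image_def image_image by (intro image_cong) (simp_all add: scale_eval)

lemma far_scale: "0 < c \<Longrightarrow> far (c * \<rho>) (\<lambda>n. scale c (g n)) = far \<rho> g"
  unfolding far_def by (simp add: scale_eval mult.left_commute)

lemma meets_scale:
  assumes "0 < c"
  shows "meets (c * \<rho>) (\<lambda>n. scale c (g n)) i j \<longleftrightarrow> meets \<rho> g i j"
proof
  assume "meets (c * \<rho>) (\<lambda>n. scale c (g n)) i j"
  then obtain z where z: "z \<in> (*\<^sub>R) c ` path_image (g i)" "z \<in> (*\<^sub>R) c ` path_image (g j)" "c * \<rho> \<le> norm z"
    unfolding meets_def path_image_scale by (elim exE conjE)
  obtain x where x: "x \<in> path_image (g i)" "z = c *\<^sub>R x" using z(1) by (elim imageE)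
  obtain y where y: "y \<in> path_image (g j)" "z = c *\<^sub>R y" using z(2) by (elim imageE)
  have "x = y" "\<rho> \<le> norm x" using x y z(3) assms by simp_all
  then show "meets \<rho> g i j" unfolding meets_def using x y by blast
next
  assume "meets \<rho> g i j"
  then obtain x where "x \<in> path_image (g i)" "x \<in> path_image (g j)" "\<rho> \<le> norm x" unfolding meets_def by blast
  then show "meets (c * \<rho>) (\<lambda>n. scale c (g n)) i j" unfolding meets_def path_image_scale using assms
    by (intro exI[of _ "c *\<^sub>R x"] conjI imageI) simp_all
qed

lemma inf_class_scale:
  "0 < c \<Longrightarrow> inf_class (c * \<rho>) (\<lambda>n. scale c (g n)) i \<longleftrightarrow> inf_class \<rho> g i"
  unfolding inf_class_def by (simp add: far_scale meets_scale)

lemma apart_scale: "0 < c \<Longrightarrow> apart (c * \<rho>) (\<lambda>n. scale c (g n)) S \<longleftrightarrow> apart \<rho> g S"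
  unfolding apart_def by (simp add: meets_scale)

text \<open>Radii range over the rationals, so only rational dilations preserve these events. This
  is why the later arguments scale by integers and their reciprocals.\<close>

lemma ex_pos_Rats_scale:
  fixes c :: real
  assumes "0 < c" "c \<in> \<rat>" "\<And>\<rho>. P (c * \<rho>) \<longleftrightarrow> Q \<rho>"
  shows "(\<exists>\<rho>\<in>\<rat>. 0 < \<rho> \<and> P \<rho>) \<longleftrightarrow> (\<exists>\<rho>\<in>\<rat>. 0 < \<rho> \<and> Q \<rho>)"
proof
  assume "\<exists>\<rho>\<in>\<rat>. 0 < \<rho> \<and> P \<rho>"
  then obtain \<rho> where \<rho>: "\<rho> \<in> \<rat>" "0 < \<rho>" "P \<rho>" by blast
  have "Q (\<rho> / c)" using assms(3)[of "\<rho> / c"] assms(1) \<rho> by simp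
  then show "\<exists>\<rho>\<in>\<rat>. 0 < \<rho> \<and> Q \<rho>" using \<rho> assms(1,2) by (intro bexI[of _ "\<rho> / c"] conjI) simp_all
next
  assume "\<exists>\<rho>\<in>\<rat>. 0 < \<rho> \<and> Q \<rho>"
  then obtain \<rho> where \<rho>: "\<rho> \<in> \<rat>" "0 < \<rho>" "Q \<rho>" by blast
  then have "P (c * \<rho>)" using assms(3) by simp
  then show "\<exists>\<rho>\<in>\<rat>. 0 < \<rho> \<and> P \<rho>" using \<rho> assms(1,2) by (intro bexI[of _ "c * \<rho>"] conjI) simp_all
qed

lemma many_classes_scale:
  assumes "0 < c" "c \<in> \<rat>"
  shows "many_classes n (\<lambda>n. scale c (g n)) \<longleftrightarrow> many_classes n g"
  unfolding many_classes_def
proof (rule ex_pos_Rats_scale[OF assms])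
  fix \<rho> :: real
  show "(\<exists>S. finite S \<and> card S = n \<and> (\<forall>i\<in>S. inf_class (c * \<rho>) (\<lambda>n. scale c (g n)) i) \<and>
      apart (c * \<rho>) (\<lambda>n. scale c (g n)) S) \<longleftrightarrow>
    (\<exists>S. finite S \<and> card S = n \<and> (\<forall>i\<in>S. inf_class \<rho> g i) \<and> apart \<rho> g S)"
    by (simp only: inf_class_scale[OF assms(1)] apart_scale[OF assms(1)])
qed

lemma branch_beyond_scale:
  assumes "0 < c" "c \<in> \<rat>"
  shows "branch_beyond (c * r) (\<lambda>n. scale c (g n)) \<longleftrightarrow> branch_beyond r g"
  unfolding branch_beyond_def
proof (rule ex_pos_Rats_scale[OF assms])
  fix \<rho> :: real
  show "(\<exists>i j. inf_class (c * \<rho>) (\<lambda>n. scale c (g n)) i \<and> inf_class (c * \<rho>) (\<lambda>n. scale c (g n)) j \<and>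
      \<not> meets (c * \<rho>) (\<lambda>n. scale c (g n)) i j \<and> meets (c * r) (\<lambda>n. scale c (g n)) i j) \<longleftrightarrow>
    (\<exists>i j. inf_class \<rho> g i \<and> inf_class \<rho> g j \<and> \<not> meets \<rho> g i j \<and> meets r g i j)"
    by (simp only: inf_class_scale[OF assms(1)] meets_scale[OF assms(1)])
qed

lemma annulus_length_scale:
  assumes "is_route h" "0 < c"
  shows "annulus_length (c * \<rho>) (scale c h) = ennreal c * annulus_length \<rho> h"
proof -
  have "annulus_time (c * \<rho>) (scale c h) = annulus_time \<rho> h"
    unfolding annulus_time_def using assms by (intro Collect_cong) (auto simp: scale_eval)
  then show ?thesis unfolding annulus_length_def
    using assms route_speed_pos[OF assms(1)] by (simp add: speed_scale ennreal_mult mult.assoc)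
qed

lemma crossing_length_scale:
  assumes "\<And>n. is_route (g n)" "0 < c"
  shows "crossing_length (c * \<rho>) (\<lambda>n. scale c (g n)) = ennreal c * crossing_length \<rho> g"
proof -
  have "crossing_length (c * \<rho>) (\<lambda>n. scale c (g n)) = (SUP S\<in>{S. finite S}. ennreal c *
     (if S \<subseteq> far \<rho> g \<and> apart \<rho> g S then \<Sum>n\<in>S. annulus_length \<rho> (g n) else 0))"
    unfolding crossing_length_def
    by (intro SUP_cong) (simp_all add: far_scale apart_scale assms annulus_length_scale sum_distrib_left)
  also have "\<dots> = ennreal c * crossing_length \<rho> g"
    unfolding crossing_length_def by (rule SUP_mult_left_ennreal[symmetric])
  finally show ?thesis .
qed

section \<open>Measurability\<close>

text \<open>Turns every real into an admissible time, so that countable quantifiers may range over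
  the whole type \<open>rat\<close>.\<close>

definition clip :: "real \<Rightarrow> real" where "clip t = max 0 (min 1 t)"

lemma clip_in [simp]: "clip t \<in> {0..1}" "0 \<le> clip t" "clip t \<le> 1"
  by (auto simp: clip_def)

lemma clip_id: "t \<in> {0..1} \<Longrightarrow> clip t = t"
  by (auto simp: clip_def)

lemma rat_seq: "\<exists>p :: nat \<Rightarrow> rat. (\<lambda>n. real_of_rat (p n)) \<longlonglongrightarrow> s"
proof -
  have "\<exists>p. s < real_of_rat p \<and> real_of_rat p < s + 1 / Suc n" for n :: nat by (rule of_rat_dense) simp
  then obtain p where p: "\<And>n. s < real_of_rat (p n)" "\<And>n. real_of_rat (p n) < s + 1 / Suc n" by metis
  have "(\<lambda>n. s + 1 / Suc n) \<longlonglongrightarrow> s + 0" by (intro tendsto_intros LIMSEQ_Suc[OF lim_1_over_n])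
  then have up: "(\<lambda>n. s + 1 / Suc n) \<longlonglongrightarrow> s" by simp
  have "(\<lambda>n. real_of_rat (p n)) \<longlonglongrightarrow> s"
  proof (rule tendsto_sandwich[OF _ _ tendsto_const up])
    show "\<forall>\<^sub>F n in sequentially. s \<le> real_of_rat (p n)"
      using p(1) by (intro always_eventually allI less_imp_le)
    show "\<forall>\<^sub>F n in sequentially. real_of_rat (p n) \<le> s + 1 / Suc n"
      using p(2) by (intro always_eventually allI less_imp_le)
  qed
  then show ?thesis by blast
qed

lemma clip_tendsto: "(f \<longlongrightarrow> s) F \<Longrightarrow> s \<in> {0..1} \<Longrightarrow> ((\<lambda>n. clip (f n)) \<longlongrightarrow> s) F"
  unfolding clip_def using tendsto_max[OF tendsto_const tendsto_min[OF tendsto_const, of f s F 1], of 0]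
  by auto

text \<open>By compactness, a continuous function attains a value at most \<open>0\<close> iff it has arbitrarily
  small values at rational points; this makes existence of coincidences a countable condition.\<close>

lemma ex_nonpos_iff_rat:
  fixes f :: "real \<times> real \<times> real \<Rightarrow> real"
  assumes f: "continuous_on ({0..1} \<times> {0..1} \<times> {0..1}) f"
  shows "(\<exists>s\<in>{0..1}. \<exists>t\<in>{0..1}. \<exists>u\<in>{0..1}. f (s, t, u) \<le> 0) \<longleftrightarrow>
    (\<forall>n::nat. \<exists>p q r :: rat. f (clip (of_rat p), clip (of_rat q), clip (of_rat r)) < 1 / Suc n)"
proof
  assume "\<exists>s\<in>{0..1}. \<exists>t\<in>{0..1}. \<exists>u\<in>{0..1}. f (s, t, u) \<le> 0"
  then obtain s t u where stu: "s \<in> {0..1}" "t \<in> {0..1}" "u \<in> {0..1}" "f (s, t, u) \<le> 0" by blast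
  obtain p q r :: "nat \<Rightarrow> rat" where pqr: "(\<lambda>n. real_of_rat (p n)) \<longlonglongrightarrow> s" "(\<lambda>n. real_of_rat (q n)) \<longlonglongrightarrow> t"
    "(\<lambda>n. real_of_rat (r n)) \<longlonglongrightarrow> u" using rat_seq by metis
  have "(\<lambda>n. (clip (of_rat (p n)), clip (of_rat (q n)), clip (of_rat (r n)))) \<longlonglongrightarrow> (s, t, u)"
    using stu pqr by (intro tendsto_Pair clip_tendsto)
  then have lim: "(\<lambda>n. f (clip (of_rat (p n)), clip (of_rat (q n)), clip (of_rat (r n)))) \<longlonglongrightarrow> f (s, t, u)"
    using stu by (intro continuous_on_tendsto_compose[OF f]) auto
  show "\<forall>n::nat. \<exists>p q r :: rat. f (clip (of_rat p), clip (of_rat q), clip (of_rat r)) < 1 / Suc n"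
  proof
    fix n :: nat
    have "f (s, t, u) < 1 / Suc n" using stu(4) by (rule le_less_trans) simp
    from order_tendstoD(2)[OF lim this] obtain k where
      "f (clip (of_rat (p k)), clip (of_rat (q k)), clip (of_rat (r k))) < 1 / Suc n"
      by (auto dest: eventually_happens)
    then show "\<exists>p q r :: rat. f (clip (of_rat p), clip (of_rat q), clip (of_rat r)) < 1 / Suc n" by blast
  qed
next
  assume *: "\<forall>n::nat. \<exists>p q r :: rat. f (clip (of_rat p), clip (of_rat q), clip (of_rat r)) < 1 / Suc n"
  let ?K = "{0..1} \<times> {0..1} \<times> {0..1} :: (real \<times> real \<times> real) set"
  have "compact ?K" by (intro compact_Times) auto
  moreover have "(0, 0, 0) \<in> ?K" by simp
  ultimately have "\<exists>x\<in>?K. \<forall>y\<in>?K. f x \<le> f y" by (intro continuous_attains_inf f) blast+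
  then obtain x where x: "x \<in> ?K" "\<And>y. y \<in> ?K \<Longrightarrow> f x \<le> f y" by blast
  have "f x \<le> 0"
  proof (rule ccontr)
    assume "\<not> f x \<le> 0"
    then have "0 < f x" by simp
    then obtain n where n: "inverse (real (Suc n)) < f x" using reals_Archimedean by blast
    obtain p q r :: rat where "f (clip (of_rat p), clip (of_rat q), clip (of_rat r)) < 1 / Suc n" using * by blast
    moreover have "f x \<le> f (clip (of_rat p), clip (of_rat q), clip (of_rat r))" by (rule x(2)) simp
    ultimately show False using n by (simp add: inverse_eq_divide)
  qed
  then show "\<exists>s\<in>{0..1}. \<exists>t\<in>{0..1}. \<exists>u\<in>{0..1}. f (s, t, u) \<le> 0"
    using x(1) by (cases x) (metis mem_Sigma_iff)
qed

section \<open>Measurability of evaluation, length and coincidence of routes\<close>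

lemma space_route_space: "h \<in> space route_space \<Longrightarrow> is_route h"
  by (simp add: route_space_def space_restrict_space)

lemma space_route_space_eq: "space route_space = {h \<in> extensional {0..1}. is_route h}"
  by (auto simp: route_space_def space_restrict_space space_PiM PiE_def)

lemma eval_measurable [measurable]: "t \<in> {0..1} \<Longrightarrow> (\<lambda>h. h t) \<in> route_space \<rightarrow>\<^sub>M borel"
  unfolding route_space_def by (rule measurable_restrict_space1[OF measurable_component_singleton])

lemma eval_clip_measurable [measurable]: "(\<lambda>h. h (clip t)) \<in> route_space \<rightarrow>\<^sub>M borel"
  by (rule eval_measurable) simp

lemma measurable_into_route_space:
  assumes "\<And>\<omega>. \<omega> \<in> space M \<Longrightarrow> F \<omega> \<in> extensional {0..1}" "\<And>\<omega>. \<omega> \<in> space M \<Longrightarrow> is_route (F \<omega>)"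
    and "\<And>t. t \<in> {0..1} \<Longrightarrow> (\<lambda>\<omega>. F \<omega> t) \<in> M \<rightarrow>\<^sub>M borel"
  shows "F \<in> M \<rightarrow>\<^sub>M route_space"
  unfolding route_space_def
proof (rule measurable_restrict_space2)
  show "F \<in> M \<rightarrow>\<^sub>M (\<Pi>\<^sub>M t\<in>{0..1}. borel)"
    using measurable_PiM_single'[of "{0..1}" "\<lambda>t \<omega>. F \<omega> t" M "\<lambda>_. borel"] assms(1,3) by (auto simp: PiE_def)
qed (use assms(2) in auto)

lemma scale_measurable [measurable]: "0 < c \<Longrightarrow> scale c \<in> route_space \<rightarrow>\<^sub>M route_space"
proof (rule measurable_into_route_space)
  fix t :: real assume t: "t \<in> {0..1}"
  have "(\<lambda>h. c *\<^sub>R h t) \<in> route_space \<rightarrow>\<^sub>M borel" using t by measurable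
  then show "(\<lambda>h. scale c h t) \<in> route_space \<rightarrow>\<^sub>M borel" using t by (simp add: scale_eval)
qed (auto simp: scale_def compose_def is_route_scale[unfolded scale_def compose_def] space_route_space)

lemma rebase_measurable [measurable]: "rebase \<in> route_space \<rightarrow>\<^sub>M route_space"
proof (rule measurable_into_route_space)
  fix t :: real assume t: "t \<in> {0..1}"
  have "(\<lambda>h. h t - h 0) \<in> route_space \<rightarrow>\<^sub>M borel" using t by measurable
  then show "(\<lambda>h. rebase h t) \<in> route_space \<rightarrow>\<^sub>M borel" using t by (simp add: rebase_eval)
qed (auto simp: rebase_def compose_def is_route_rebase[unfolded rebase_def compose_def] space_route_space)

text \<open>Joint measurability comes from continuity of the routes: \<open>h (clip t)\<close> is
  the limit of values at grid times \<open>k n t / Suc n\<close>, of which there are countably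
  many.\<close>

lemma eval_joint_measurable:
  "(\<lambda>(h, t). h (clip t)) \<in> route_space \<Otimes>\<^sub>M borel \<rightarrow>\<^sub>M borel"
proof -
  define k where "k n t = \<lfloor>real (Suc n) * clip t\<rfloor>" for n t
  define f where "f n x = fst x (clip (real_of_int (k n (snd x)) / Suc n))" for n and x :: "route \<times> real"
  have "f n \<in> route_space \<Otimes>\<^sub>M borel \<rightarrow>\<^sub>M borel" for n
  proof -
    have "(\<lambda>x. fst x (clip (real_of_int i / Suc n))) \<in> route_space \<Otimes>\<^sub>M borel \<rightarrow>\<^sub>M borel" for i by measurable
    moreover have "(\<lambda>x. k n (snd x)) \<in> route_space \<Otimes>\<^sub>M borel \<rightarrow>\<^sub>M count_space UNIV"
      unfolding k_def clip_def by measurable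
    ultimately show ?thesis unfolding f_def by (rule measurable_compose_countable)
  qed
  moreover have "(\<lambda>n. f n x) \<longlonglongrightarrow> (case x of (h, t) \<Rightarrow> h (clip t))" if x: "x \<in> space (route_space \<Otimes>\<^sub>M borel)" for x
  proof -
    obtain h t where ht: "x = (h, t)" by (cases x)
    have h: "is_route h" using x ht by (auto simp: space_pair_measure space_route_space)
    have "(\<lambda>n. real_of_int (k n t) / Suc n) \<longlonglongrightarrow> clip t"
    proof (rule tendsto_sandwich[of "\<lambda>n. clip t - 1 / Suc n" _ _ "\<lambda>n. clip t"])
      have "(\<lambda>n. clip t - 1 / Suc n) \<longlonglongrightarrow> clip t - 0" by (intro tendsto_intros LIMSEQ_Suc[OF lim_1_over_n])
      then show "(\<lambda>n. clip t - 1 / Suc n) \<longlonglongrightarrow> clip t" by simp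
      have "clip t - 1 / Suc n \<le> real_of_int (k n t) / Suc n" for n
      proof -
        have "real (Suc n) * clip t - 1 \<le> real_of_int (k n t)" unfolding k_def by linarith
        then have "(real (Suc n) * clip t - 1) / Suc n \<le> real_of_int (k n t) / Suc n" by (rule divide_right_mono) simp
        then show ?thesis by (simp add: diff_divide_distrib del: of_nat_Suc)
      qed
      then show "\<forall>\<^sub>F n in sequentially. clip t - 1 / Suc n \<le> real_of_int (k n t) / Suc n" by simp
      have "real_of_int (k n t) / Suc n \<le> clip t" for n
      proof -
        have "real_of_int (k n t) \<le> real (Suc n) * clip t" unfolding k_def by linarith
        then have "real_of_int (k n t) / Suc n \<le> real (Suc n) * clip t / Suc n" by (rule divide_right_mono) simp
        then show ?thesis by (simp del: of_nat_Suc)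
      qed
      then show "\<forall>\<^sub>F n in sequentially. real_of_int (k n t) / Suc n \<le> clip t" by simp
    qed simp
    then have "(\<lambda>n. clip (real_of_int (k n t) / Suc n)) \<longlonglongrightarrow> clip t" by (rule clip_tendsto) simp
    then have "(\<lambda>n. h (clip (real_of_int (k n t) / Suc n))) \<longlonglongrightarrow> h (clip t)"
      by (rule continuous_on_tendsto_compose[OF route_cont[OF h]]) simp_all
    then show ?thesis unfolding f_def ht by simp
  qed
  ultimately show ?thesis by (rule borel_measurable_LIMSEQ_metric)
qed

lemma speed_measurable [measurable]: "speed \<in> borel_measurable route_space"
  unfolding borel_measurable_iff_le
proof
  fix a :: real
  have "{h \<in> space route_space. speed h \<le> a} = {h \<in> space route_space. \<forall>p q :: rat.
      dist (h (clip (of_rat p))) (h (clip (of_rat q))) \<le> a * dist (clip (of_rat p)) (clip (of_rat q))}"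
  proof (intro Collect_cong conj_cong refl iffI allI)
    fix h p q assume h: "h \<in> space route_space" and le: "speed h \<le> a"
    have "dist (h (clip (of_rat p))) (h (clip (of_rat q))) \<le> speed h * dist (clip (of_rat p)) (clip (of_rat q))"
      using h by (intro route_lipschitz space_route_space) auto
    also have "\<dots> \<le> a * dist (clip (of_rat p)) (clip (of_rat q))" using le by (intro mult_right_mono) auto
    finally show "dist (h (clip (of_rat p))) (h (clip (of_rat q))) \<le> a * dist (clip (of_rat p)) (clip (of_rat q))" .
  next
    fix h assume h: "h \<in> space route_space" and le: "\<forall>p q :: rat.
      dist (h (clip (of_rat p))) (h (clip (of_rat q))) \<le> a * dist (clip (of_rat p)) (clip (of_rat q))"
    show "speed h \<le> a"
    proof (rule speed_leI)
      fix s t :: real assume st: "s \<in> \<rat>" "t \<in> \<rat>" "s \<in> {0..1}" "t \<in> {0..1}"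
      then obtain p q where "s = of_rat p" "t = of_rat q" by (metis Rats_cases)
      then show "dist (h s) (h t) \<le> a * dist s t" using le[rule_format, of p q] st by (simp add: clip_id)
    qed (rule space_route_space[OF h])
  qed
  also have "\<dots> \<in> sets route_space" by measurable
  finally show "{h \<in> space route_space. speed h \<le> a} \<in> sets route_space" .
qed

text \<open>The time spent in the annulus is an integral over \<open>t\<close> of a jointly
  measurable function.\<close>

lemma annulus_length_measurable [measurable]: "annulus_length \<rho> \<in> borel_measurable route_space"
proof -
  let ?A = "{x::point. \<rho> < norm x \<and> norm x \<le> 2 * \<rho>}"
  have [measurable]: "?A \<in> sets borel" by measurable
  note eval_joint_measurable[measurable]
  have "(\<lambda>h. \<integral>\<^sup>+ t. indicator {0..1} t * indicator ?A ((\<lambda>(h, t). h (clip t)) (h, t)) \<partial>lborel) \<in> borel_measurable route_space"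
    by measurable
  then have "(\<lambda>h. ennreal (speed h) * (\<integral>\<^sup>+ t. indicator {0..1} t * indicator ?A (h (clip t)) \<partial>lborel))
    \<in> borel_measurable route_space" by simp
  moreover have "annulus_length \<rho> h = ennreal (speed h) * (\<integral>\<^sup>+ t. indicator {0..1} t * indicator ?A (h (clip t)) \<partial>lborel)"
    if "h \<in> space route_space" for h
  proof -
    have "(\<integral>\<^sup>+ t. indicator {0..1} t * indicator ?A (h (clip t)) \<partial>lborel) = (\<integral>\<^sup>+ t. indicator (annulus_time \<rho> h) t \<partial>lborel)"
      by (intro nn_integral_cong) (auto simp: annulus_time_def clip_id split: split_indicator)
    also have "\<dots> = emeasure lborel (annulus_time \<rho> h)"
      using annulus_time_borel[OF space_route_space[OF that]] by simp
    finally show ?thesis unfolding annulus_length_def by simp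
  qed
  ultimately show ?thesis by (simp cong: measurable_cong)
qed

section \<open>Events of a sequence of routes\<close>

abbreviation route_seq :: "(nat \<Rightarrow> route) measure" where
  "route_seq \<equiv> \<Pi>\<^sub>M n\<in>UNIV. route_space"

lemma space_route_seq: "g \<in> space route_seq \<Longrightarrow> is_route (g n)"
  using space_route_space by (auto simp: space_PiM)

lemma far_measurable [measurable]: "Measurable.pred route_seq (\<lambda>g. n \<in> far \<rho> g)"
  unfolding far_def mem_Collect_eq by measurable

lemma meets_iff_rat:
  assumes "is_route (g i)" "is_route (g j)"
  shows "meets \<rho> g i j \<longleftrightarrow> (\<forall>n::nat. \<exists>p q :: rat. dist (g i (clip (of_rat p))) (g j (clip (of_rat q))) < 1 / Suc n \<and>
     \<rho> - norm (g i (clip (of_rat p))) < 1 / Suc n)"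
proof -
  \<comment> \<open>Both requirements hold exactly when this maximum is nonpositive. The third
    variable matches the arity of \<open>ex_nonpos_iff_rat\<close>, of which
    \<open>aligned_iff_rat\<close> uses all three.\<close>
  let ?f = "\<lambda>(s, t, u::real). max (dist (g i s) (g j t)) (\<rho> - norm (g i s))"
  have "continuous_on ({0..1} \<times> {0..1} \<times> {0..1}) ?f"
    unfolding case_prod_beta
    by (intro continuous_intros continuous_on_compose2[OF route_cont[OF assms(1)]] continuous_on_compose2[OF route_cont[OF assms(2)]]) auto
  note ex = ex_nonpos_iff_rat[OF this]
  have "meets \<rho> g i j \<longleftrightarrow> (\<exists>s\<in>{0..1}. \<exists>t\<in>{0..1}. g i s = g j t \<and> \<rho> \<le> norm (g i s))"
  proof
    assume "meets \<rho> g i j"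
    then obtain x where x: "x \<in> g i ` {0..1}" "x \<in> g j ` {0..1}" "\<rho> \<le> norm x"
      unfolding meets_def path_image_def by (elim exE conjE)
    obtain s where s: "x = g i s" "s \<in> {0..1}" using x(1) by (elim imageE)
    obtain t where t: "x = g j t" "t \<in> {0..1}" using x(2) by (elim imageE)
    have "g i s = g j t \<and> \<rho> \<le> norm (g i s)" using x(3) s t by simp
    then show "\<exists>s\<in>{0..1}. \<exists>t\<in>{0..1}. g i s = g j t \<and> \<rho> \<le> norm (g i s)" using s t by blast
  next
    assume "\<exists>s\<in>{0..1}. \<exists>t\<in>{0..1}. g i s = g j t \<and> \<rho> \<le> norm (g i s)"
    then obtain s t where st: "s \<in> {0..1}" "t \<in> {0..1}" "g i s = g j t" "\<rho> \<le> norm (g i s)"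
      by (elim bexE conjE)
    have "g i s \<in> g j ` {0..1}" unfolding st(3) using st(2) by (rule imageI)
    moreover have "g i s \<in> g i ` {0..1}" using st(1) by (rule imageI)
    ultimately show "meets \<rho> g i j" unfolding meets_def path_image_def using st(4) by blast
  qed
  also have "\<dots> \<longleftrightarrow> (\<exists>s\<in>{0..1}. \<exists>t\<in>{0..1}. \<exists>u\<in>{0..1}. ?f (s, t, u) \<le> 0)"
    by auto
  finally show ?thesis unfolding ex by simp
qed

lemma meets_measurable [measurable]: "Measurable.pred route_seq (\<lambda>g. meets \<rho> g i j)"
proof -
  have "Measurable.pred route_seq (\<lambda>g. (\<forall>n::nat. \<exists>p q :: rat.
     dist (g i (clip (of_rat p))) (g j (clip (of_rat q))) < 1 / Suc n \<and> \<rho> - norm (g i (clip (of_rat p))) < 1 / Suc n))"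
    by measurable
  then show ?thesis by (simp add: meets_iff_rat space_route_seq cong: measurable_cong)
qed

text \<open>If alignment fails, it fails by a margin \<open>1 / Suc m\<close> for some
  \<open>m\<close>. With this margin fixed, failure is a closed condition on a compact set of
  times.\<close>

lemma aligned_iff_rat:
  assumes "is_route g" "is_route h"
  shows "aligned g h \<longleftrightarrow> (\<forall>m::nat. \<not> (\<forall>n::nat. \<exists>p q r :: rat.
     dist (g (clip (of_rat p))) (h (clip (of_rat q))) < 1 / Suc n \<and>
     1 / Suc m - dist (g (clip (of_rat r) * clip (of_rat p))) (h (clip (of_rat r) * clip (of_rat q))) < 1 / Suc n))"
proof -
  let ?f = "\<lambda>m (s, t, u::real). max (dist (g s) (h t)) (1 / Suc m - dist (g (u * s)) (h (u * t)))"
  have "continuous_on ({0..1} \<times> {0..1} \<times> {0..1}) (?f m)" for m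
    unfolding case_prod_beta
    by (intro continuous_intros continuous_on_compose2[OF route_cont[OF assms(1)]] continuous_on_compose2[OF route_cont[OF assms(2)]])
      (auto intro: mult_le_one)
  note ex = ex_nonpos_iff_rat[OF this]
  have "aligned g h \<longleftrightarrow> (\<forall>m::nat. \<not> (\<exists>s\<in>{0..1}. \<exists>t\<in>{0..1}. \<exists>u\<in>{0..1}. ?f m (s, t, u) \<le> 0))"
  proof
    assume "aligned g h"
    then have "dist (g (u * s)) (h (u * t)) = 0" if "s \<in> {0..1}" "t \<in> {0..1}" "u \<in> {0..1}" "g s = h t" for s t u
      using that unfolding aligned_def by simp
    then show "\<forall>m::nat. \<not> (\<exists>s\<in>{0..1}. \<exists>t\<in>{0..1}. \<exists>u\<in>{0..1}. ?f m (s, t, u) \<le> 0)" by fastforce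
  next
    assume *: "\<forall>m::nat. \<not> (\<exists>s\<in>{0..1}. \<exists>t\<in>{0..1}. \<exists>u\<in>{0..1}. ?f m (s, t, u) \<le> 0)"
    show "aligned g h" unfolding aligned_def
    proof (intro ballI impI, rule ccontr)
      fix s t u :: real assume stu: "s \<in> {0..1}" "t \<in> {0..1}" "g s = h t" "u \<in> {0..1}" "g (u * s) \<noteq> h (u * t)"
      then obtain m where "inverse (real (Suc m)) < dist (g (u * s)) (h (u * t))"
        using reals_Archimedean[of "dist (g (u * s)) (h (u * t))"] by auto
      then have "?f m (s, t, u) \<le> 0" using stu(3) by (simp add: inverse_eq_divide)
      then show False using * stu by blast
    qed
  qed
  then show ?thesis unfolding ex by simp
qed

lemma aligned_measurable [measurable]:
  "Measurable.pred (route_space \<Otimes>\<^sub>M route_space) (\<lambda>x. aligned (fst x) (snd x))"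
proof -
  have [measurable]: "(\<lambda>h. h (clip r * clip p)) \<in> route_space \<rightarrow>\<^sub>M borel" for r p
    by (rule eval_measurable) (auto intro: mult_le_one)
  have "Measurable.pred (route_space \<Otimes>\<^sub>M route_space) (\<lambda>x. (\<forall>m::nat. \<not> (\<forall>n::nat. \<exists>p q r :: rat.
     dist (fst x (clip (of_rat p))) (snd x (clip (of_rat q))) < 1 / Suc n \<and>
     1 / Suc m - dist (fst x (clip (of_rat r) * clip (of_rat p))) (snd x (clip (of_rat r) * clip (of_rat q))) < 1 / Suc n)))"
    by measurable
  moreover have "is_route (fst x)" "is_route (snd x)" if "x \<in> space (route_space \<Otimes>\<^sub>M route_space)" for x
    using that by (auto simp: space_pair_measure space_route_space)
  ultimately show ?thesis by (simp add: aligned_iff_rat cong: measurable_cong)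
qed

lemma countable_finite_sets: "countable {S :: nat set. finite S}"
  by (rule countable_Collect_finite)

lemma apart_measurable [measurable]: "finite S \<Longrightarrow> Measurable.pred route_seq (\<lambda>g. apart \<rho> g S)"
  unfolding apart_def by measurable

lemma crossing_length_measurable [measurable]: "crossing_length \<rho> \<in> borel_measurable route_seq"
proof -
  have "(\<lambda>g. if S \<subseteq> far \<rho> g \<and> apart \<rho> g S then \<Sum>n\<in>S. annulus_length \<rho> (g n) else 0) \<in> borel_measurable route_seq"
    if "finite S" for S
  proof -
    have [measurable]: "Measurable.pred route_seq (\<lambda>g. S \<subseteq> far \<rho> g)"
      unfolding subset_eq using that by measurable
    show ?thesis using that by measurable
  qed
  then show ?thesis unfolding crossing_length_def[abs_def]
    by (intro borel_measurable_SUP countable_finite_sets) auto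
qed

lemma inf_class_measurable [measurable]: "Measurable.pred route_seq (\<lambda>g. inf_class \<rho> g i)"
  unfolding inf_class_def infinite_nat_iff_unbounded_le mem_Collect_eq by measurable

lemma many_classes_measurable [measurable]: "Measurable.pred route_seq (many_classes n)"
proof -
  have 1: "Measurable.pred route_seq (\<lambda>g. \<forall>i\<in>S. inf_class \<rho> g i)" if "finite S" for S \<rho>
    using that by measurable
  \<comment> \<open>Lists replace finite sets because they form a countable type.\<close>
  have "Measurable.pred route_seq (\<lambda>g. \<exists>q::rat. \<exists>xs::nat list. 0 < real_of_rat q \<and> card (set xs) = n \<and>
      (\<forall>i\<in>set xs. inf_class (of_rat q) g i) \<and> apart (of_rat q) g (set xs))"
    using 1 by measurable
  moreover have "many_classes n g \<longleftrightarrow> (\<exists>q::rat. \<exists>xs::nat list. 0 < real_of_rat q \<and> card (set xs) = n \<and>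
      (\<forall>i\<in>set xs. inf_class (of_rat q) g i) \<and> apart (of_rat q) g (set xs))" for g
  proof
    assume "many_classes n g"
    then obtain \<rho> where \<rho>: "\<rho> \<in> \<rat>" "0 < \<rho>" "\<exists>S. finite S \<and> card S = n \<and> (\<forall>i\<in>S. inf_class \<rho> g i) \<and> apart \<rho> g S"
      unfolding many_classes_def by (elim bexE conjE)
    then obtain S where S: "finite S" "card S = n" "\<forall>i\<in>S. inf_class \<rho> g i" "apart \<rho> g S" by (elim exE conjE)
    obtain q where q: "\<rho> = of_rat q" using \<rho>(1) by (rule Rats_cases)
    obtain xs where xs: "set xs = S" using finite_list[OF S(1)] ..
    show "\<exists>q::rat. \<exists>xs::nat list. 0 < real_of_rat q \<and> card (set xs) = n \<and>
      (\<forall>i\<in>set xs. inf_class (of_rat q) g i) \<and> apart (of_rat q) g (set xs)"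
      using S \<rho>(2) unfolding q by (intro exI[of _ q] exI[of _ xs]) (simp add: xs)
  next
    assume "\<exists>q::rat. \<exists>xs::nat list. 0 < real_of_rat q \<and> card (set xs) = n \<and>
      (\<forall>i\<in>set xs. inf_class (of_rat q) g i) \<and> apart (of_rat q) g (set xs)"
    then obtain q :: rat and xs :: "nat list" where "0 < real_of_rat q" "card (set xs) = n"
      "\<forall>i\<in>set xs. inf_class (of_rat q) g i" "apart (of_rat q) g (set xs)" by (elim exE conjE)
    then show "many_classes n g" unfolding many_classes_def
      by (intro bexI[of _ "of_rat q"] conjI exI[of _ "set xs"]) simp_all
  qed
  then have "many_classes n = (\<lambda>g. \<exists>q::rat. \<exists>xs::nat list. 0 < real_of_rat q \<and> card (set xs) = n \<and>
      (\<forall>i\<in>set xs. inf_class (of_rat q) g i) \<and> apart (of_rat q) g (set xs))" by (rule ext)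
  ultimately show ?thesis by simp
qed

lemma branch_beyond_measurable [measurable]: "Measurable.pred route_seq (branch_beyond r)"
proof -
  have "Measurable.pred route_seq (\<lambda>g. \<exists>q::rat. 0 < real_of_rat q \<and>
      (\<exists>i j. inf_class (of_rat q) g i \<and> inf_class (of_rat q) g j \<and> \<not> meets (of_rat q) g i j \<and> meets r g i j))"
    by measurable
  moreover have "branch_beyond r g \<longleftrightarrow> (\<exists>q::rat. 0 < real_of_rat q \<and>
      (\<exists>i j. inf_class (of_rat q) g i \<and> inf_class (of_rat q) g j \<and> \<not> meets (of_rat q) g i j \<and> meets r g i j))" for g
    unfolding branch_beyond_def by (metis Rats_cases Rats_of_rat)
  then have "branch_beyond r = (\<lambda>g. \<exists>q::rat. 0 < real_of_rat q \<and>
      (\<exists>i j. inf_class (of_rat q) g i \<and> inf_class (of_rat q) g j \<and> \<not> meets (of_rat q) g i j \<and> meets r g i j))"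
    by (rule ext)
  ultimately show ?thesis by simp
qed

section \<open>Sorting a locally finite set of points by distance from the origin\<close>

definition rank :: "nat set \<Rightarrow> (nat \<Rightarrow> point) \<Rightarrow> nat \<Rightarrow> nat" where
  "rank I y i = card {j\<in>I. norm (y j) < norm (y i)}"

text \<open>The default of \<open>LEAST\<close> makes this a total function, hence measurable
  without restriction to generic configurations.\<close>

definition nth_nearest :: "nat set \<Rightarrow> (nat \<Rightarrow> point) \<Rightarrow> nat \<Rightarrow> nat" where
  "nth_nearest I y n = (LEAST i. i \<in> I \<and> rank I y i = n)"

definition number_in :: "nat set \<Rightarrow> (nat \<Rightarrow> point) \<Rightarrow> point set \<Rightarrow> nat" where
  "number_in I y A = card {i\<in>I. y i \<in> A}"

text \<open>What listing by distance requires: no ties, finitely many points in each disc,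
  infinitely many in all. The condition \<open>nonzero\<close> keeps the points distinct from the
  origin, which is a site itself.\<close>

locale generic_points =
  fixes I :: "nat set" and y :: "nat \<Rightarrow> point"
  assumes infinite: "infinite I"
    and locally_finite: "finite {i\<in>I. norm (y i) \<le> r}"
    and distinct_norms: "inj_on (\<lambda>i. norm (y i)) I"
    and nonzero: "i \<in> I \<Longrightarrow> y i \<noteq> 0"
begin

lemma finite_nearer: "finite {j\<in>I. norm (y j) < r}"
  by (rule finite_subset[OF _ locally_finite[of r]]) auto

lemma rank_less:
  assumes "i \<in> I" "norm (y i) < norm (y j)"
  shows "rank I y i < rank I y j"
  unfolding rank_def using assms by (intro psubset_card_mono finite_nearer) auto

lemma rank_less_iff:
  assumes "i \<in> I" "j \<in> I"
  shows "rank I y i < rank I y j \<longleftrightarrow> norm (y i) < norm (y j)"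
proof
  assume r: "rank I y i < rank I y j"
  show "norm (y i) < norm (y j)"
  proof (rule ccontr)
    assume "\<not> norm (y i) < norm (y j)"
    then have "norm (y j) < norm (y i) \<or> j = i" using inj_onD[OF distinct_norms, of i j] assms by force
    then show False using rank_less[OF assms(2), of i] r by auto
  qed
qed (rule rank_less[OF assms(1)])

lemma rank_inj: "inj_on (rank I y) I"
proof (rule inj_onI)
  fix i j assume ij: "i \<in> I" "j \<in> I" "rank I y i = rank I y j"
  then have "norm (y i) = norm (y j)" using rank_less_iff[of i j] rank_less_iff[of j i] by simp
  then show "i = j" using inj_onD[OF distinct_norms] ij by simp
qed

text \<open>The farthest of the points nearer than \<open>i\<close> has the preceding rank.\<close>

lemma rank_pred:
  assumes "i \<in> I" "rank I y i = Suc n"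
  shows "\<exists>j\<in>I. rank I y j = n"
proof -
  let ?S = "{j\<in>I. norm (y j) < norm (y i)}"
  have cs: "card ?S = Suc n" using assms(2) unfolding rank_def .
  then have ne: "?S \<noteq> {}" by (metis card.empty nat.distinct(1))
  have fin: "finite ?S" by (rule finite_nearer)
  have "Max ((\<lambda>k. norm (y k)) ` ?S) \<in> (\<lambda>k. norm (y k)) ` ?S" using ne fin by (intro Max_in) auto
  then obtain j where j1: "Max ((\<lambda>k. norm (y k)) ` ?S) = norm (y j)" "j \<in> ?S" by (elim imageE)
  have j2: "norm (y k) \<le> norm (y j)" if "k \<in> ?S" for k
    unfolding j1(1)[symmetric] using that fin by (intro Max_ge finite_imageI imageI)
  note j = j1(2) j2
  have "{k\<in>I. norm (y k) < norm (y j)} = ?S - {j}"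
  proof (intro equalityI subsetI)
    fix k assume k: "k \<in> ?S - {j}"
    then have "norm (y k) \<noteq> norm (y j)" using inj_onD[OF distinct_norms, of k j] j(1) by auto
    then show "k \<in> {k\<in>I. norm (y k) < norm (y j)}" using j(2)[of k] k by auto
  qed (use j(1) in auto)
  then have "rank I y j = n" unfolding rank_def using cs j(1) by (simp add: card_Diff_singleton)
  then show ?thesis using j(1) by blast
qed

text \<open>Ranks are closed downwards by \<open>rank_pred\<close>, and unbounded because they are
  injective on an infinite set.\<close>

lemma rank_surj: "\<exists>i\<in>I. rank I y i = n"
proof -
  have down: "\<exists>j\<in>I. rank I y j = n" if "i \<in> I" "rank I y i = n + m" for i m
    using that
  proof (induction m arbitrary: i)
    case (Suc m)
    then obtain j where "j \<in> I" "rank I y j = n + m" using rank_pred[of i "n + m"] by auto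
    then show ?case by (rule Suc.IH)
  qed auto
  have "infinite (rank I y ` I)" using infinite rank_inj finite_image_iff by blast
  then obtain k where "k \<in> rank I y ` I" "n \<le> k" unfolding infinite_nat_iff_unbounded_le by blast
  then obtain i where i: "i \<in> I" "rank I y i = n + (k - n)" by auto
  then show ?thesis by (rule down)
qed

lemma nth_nearest: "nth_nearest I y n \<in> I" "rank I y (nth_nearest I y n) = n"
proof -
  have "\<exists>i. i \<in> I \<and> rank I y i = n" using rank_surj by blast
  from LeastI_ex[OF this] show "nth_nearest I y n \<in> I" "rank I y (nth_nearest I y n) = n"
    unfolding nth_nearest_def by auto
qed

lemma nth_nearest_rank: "i \<in> I \<Longrightarrow> nth_nearest I y (rank I y i) = i"
  by (rule inj_onD[OF rank_inj]) (simp_all add: nth_nearest)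

lemma nth_nearest_bij: "bij_betw (nth_nearest I y) UNIV I"
  by (rule bij_betwI[of _ _ _ "rank I y"]) (auto simp: nth_nearest nth_nearest_rank)

lemma norm_nth_less: "norm (y (nth_nearest I y m)) < norm (y (nth_nearest I y n)) \<longleftrightarrow> m < n"
  using rank_less_iff[of "nth_nearest I y m" "nth_nearest I y n"] by (simp add: nth_nearest)

lemma number_in_ball: "number_in I y (ball 0 (norm (y (nth_nearest I y n)))) = n"
  using nth_nearest(2)[of n] unfolding rank_def number_in_def by simp

text \<open>The point is isolated by a ring with rational radii that contains no other point. Counts
  in countably many sets thus locate the whole ordered list, so their law determines its
  law.\<close>

lemma nth_nearest_in_iff:
  "y (nth_nearest I y n) \<in> B \<longleftrightarrow> (\<exists>p q :: rat. number_in I y (ball 0 (of_rat p)) = n \<and>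
     number_in I y (ball 0 (of_rat q) - ball 0 (of_rat p)) = 1 \<and>
     number_in I y (B \<inter> (ball 0 (of_rat q) - ball 0 (of_rat p))) = 1)"
proof
  let ?x = "\<lambda>n. y (nth_nearest I y n)"
  assume B: "?x n \<in> B"
  \<comment> \<open>The radius lies strictly between the norms of the previous and the current
    point, or is 0 when there is no previous one; the open ball of radius \<open>p\<close> then
    holds exactly the \<open>n\<close> nearer points.\<close>
  obtain p where p: "real_of_rat p < norm (?x n) \<or> real_of_rat p = norm (?x n)"
      "n > 0 \<Longrightarrow> norm (?x (n - 1)) < real_of_rat p" "0 \<le> real_of_rat p"
  proof (cases n)
    case 0 then show ?thesis using that[of 0] nonzero[OF nth_nearest(1)[of n]] by auto
  next
    case (Suc m)
    then have "norm (?x m) < norm (?x n)" using norm_nth_less by simp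
    from of_rat_dense[OF this] obtain p where "norm (?x m) < real_of_rat p" "real_of_rat p < norm (?x n)" by blast
    moreover from this have "0 \<le> real_of_rat p" using norm_ge_zero[of "?x m"] by linarith
    ultimately show ?thesis using that[of p] Suc by simp
  qed
  have "norm (?x n) < norm (?x (Suc n))" using norm_nth_less by simp
  from of_rat_dense[OF this] obtain q where q: "norm (?x n) < real_of_rat q" "real_of_rat q < norm (?x (Suc n))" by blast
  have lt: "norm (y i) < real_of_rat p \<longleftrightarrow> rank I y i < n" if i: "i \<in> I" for i
  proof
    assume "norm (y i) < real_of_rat p"
    then have "norm (y i) < norm (?x n)" using p(1) by auto
    then have "rank I y i < rank I y (nth_nearest I y n)" using i by (intro rank_less)
    then show "rank I y i < n" by (simp add: nth_nearest)
  next
    assume r: "rank I y i < n"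
    then have "\<not> norm (?x (n - 1)) < norm (y i)"
      using rank_less[OF nth_nearest(1)[of "n - 1"], of i] by (simp add: nth_nearest) linarith
    then show "norm (y i) < real_of_rat p" using p(2) r by linarith
  qed
  have ltq: "norm (y i) < real_of_rat q \<longleftrightarrow> rank I y i \<le> n" if i: "i \<in> I" for i
  proof
    assume "norm (y i) < real_of_rat q"
    then have "norm (y i) < norm (?x (Suc n))" using q by auto
    then have "rank I y i < rank I y (nth_nearest I y (Suc n))" using i by (intro rank_less)
    then show "rank I y i \<le> n" by (simp add: nth_nearest)
  next
    assume r: "rank I y i \<le> n"
    have "\<not> norm (?x n) < norm (y i)"
    proof
      assume "norm (?x n) < norm (y i)"
      then have "rank I y (nth_nearest I y n) < rank I y i" by (rule rank_less[OF nth_nearest(1)])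
      then show False using r by (simp add: nth_nearest)
    qed
    then show "norm (y i) < real_of_rat q" using q by linarith
  qed
  have "{i\<in>I. y i \<in> ball 0 (of_rat p)} = {i\<in>I. norm (y i) < norm (?x n)}"
    using lt rank_less_iff[OF _ nth_nearest(1)[of n]] by (auto simp: nth_nearest)
  then have 1: "number_in I y (ball 0 (of_rat p)) = n" using number_in_ball[of n] unfolding number_in_def by simp
  have "{i\<in>I. y i \<in> ball 0 (of_rat q) - ball 0 (of_rat p)} = {nth_nearest I y n}"
  proof (intro equalityI subsetI)
    fix i assume "i \<in> {i\<in>I. y i \<in> ball 0 (of_rat q) - ball 0 (of_rat p)}"
    then have "i \<in> I" "rank I y i = n" using lt[of i] ltq[of i] by auto
    then show "i \<in> {nth_nearest I y n}" using nth_nearest_rank[of i] by simp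
  next
    fix i assume "i \<in> {nth_nearest I y n}"
    then have "i \<in> I" "rank I y i = n" by (simp_all add: nth_nearest)
    then show "i \<in> {i\<in>I. y i \<in> ball 0 (of_rat q) - ball 0 (of_rat p)}" using lt[of i] ltq[of i] by auto
  qed
  moreover from this have "{i\<in>I. y i \<in> B \<inter> (ball 0 (of_rat q) - ball 0 (of_rat p))} = {nth_nearest I y n}"
    using B by blast
  ultimately show "\<exists>p q :: rat. number_in I y (ball 0 (of_rat p)) = n \<and>
     number_in I y (ball 0 (of_rat q) - ball 0 (of_rat p)) = 1 \<and>
     number_in I y (B \<inter> (ball 0 (of_rat q) - ball 0 (of_rat p))) = 1"
    using 1 unfolding number_in_def by (intro exI[of _ p] exI[of _ q] conjI) simp_all
next
  assume "\<exists>p q :: rat. number_in I y (ball 0 (of_rat p)) = n \<and>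
     number_in I y (ball 0 (of_rat q) - ball 0 (of_rat p)) = 1 \<and>
     number_in I y (B \<inter> (ball 0 (of_rat q) - ball 0 (of_rat p))) = 1"
  then obtain p q :: rat where n: "number_in I y (ball 0 (of_rat p)) = n"
     and R: "number_in I y (ball 0 (of_rat q) - ball 0 (of_rat p)) = 1"
     and BR: "number_in I y (B \<inter> (ball 0 (of_rat q) - ball 0 (of_rat p))) = 1" by (elim exE conjE)
  let ?R = "ball 0 (of_rat q) - ball 0 (of_rat p) :: point set"
  obtain i where i: "{i\<in>I. y i \<in> ?R} = {i}" using R unfolding number_in_def by (rule card_1_singletonE)
  obtain j where j: "{i\<in>I. y i \<in> B \<inter> ?R} = {j}" using BR unfolding number_in_def by (rule card_1_singletonE)
  have "j \<in> {i\<in>I. y i \<in> ?R}" using j by blast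
  then have ji: "j = i" unfolding i by simp
  have iI: "i \<in> I" "y i \<in> B" "y i \<in> ?R" using j unfolding ji by blast+
  have "{k\<in>I. norm (y k) < norm (y i)} = {k\<in>I. y k \<in> ball 0 (of_rat p)}"
  proof (intro equalityI subsetI)
    fix k assume k: "k \<in> {k\<in>I. norm (y k) < norm (y i)}"
    then have "k \<notin> {i\<in>I. y i \<in> ?R}" unfolding i by auto
    then show "k \<in> {k\<in>I. y k \<in> ball 0 (of_rat p)}" using k iI by auto
  qed (use iI in auto)
  then have "rank I y i = n" using n unfolding rank_def number_in_def by simp
  then have "nth_nearest I y n = i" using nth_nearest_rank[OF iI(1)] by simp
  then show "y (nth_nearest I y n) \<in> B" using iI by simp
qed

end

lemma rank_scale: "0 < c \<Longrightarrow> rank I (\<lambda>i. c *\<^sub>R y i) = rank I y"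
  unfolding rank_def by (intro ext) simp

lemma nth_nearest_scale: "0 < c \<Longrightarrow> nth_nearest I (\<lambda>i. c *\<^sub>R y i) = nth_nearest I y"
  unfolding nth_nearest_def by (simp add: rank_scale)

section \<open>Poisson families of points\<close>

definition poisson_prob :: "real \<Rightarrow> nat \<Rightarrow> real" where
  "poisson_prob a k = a ^ k / fact k * exp (- a)"

text \<open>A Poisson process of rate \<open>l\<close>, listed as points \<open>x i\<close> over a
  random index set. Only the joint laws of counts in disjoint bounded sets are prescribed, so that
  the notion also applies to points seen from a random centre and under a conditional
  probability.\<close>

locale poisson_family = prob_space M for M :: "'w measure" +
  fixes l :: real and I :: "'w \<Rightarrow> nat set" and x :: "nat \<Rightarrow> 'w \<Rightarrow> point"
  assumes rate: "0 < l"
    and index_measurable [measurable]: "Measurable.pred M (\<lambda>\<omega>. i \<in> I \<omega>)"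
    and point_measurable [measurable]: "x i \<in> borel_measurable M"
    and AE_locally_finite: "AE \<omega> in M. \<forall>r. finite {i\<in>I \<omega>. norm (x i \<omega>) \<le> r}"
    and joint_law: "finite (J :: nat set) \<Longrightarrow> disjoint_family_on A J \<Longrightarrow>
      (\<And>j. j \<in> J \<Longrightarrow> A j \<in> sets borel \<and> bounded (A j)) \<Longrightarrow>
      prob {\<omega>\<in>space M. \<forall>j\<in>J. number_in (I \<omega>) (\<lambda>i. x i \<omega>) (A j) = k j} =
      (\<Prod>j\<in>J. poisson_prob (l * measure lborel (A j)) (k j))"
begin

abbreviation N :: "point set \<Rightarrow> 'w \<Rightarrow> nat" where
  "N A \<omega> \<equiv> number_in (I \<omega>) (\<lambda>i. x i \<omega>) A"

section \<open>Poisson points are almost surely generic\<close>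

lemma N_measurable [measurable]:
  assumes [measurable]: "A \<in> sets borel"
  shows "N A \<in> M \<rightarrow>\<^sub>M count_space UNIV"
  unfolding number_in_def by measurable

lemma law: "A \<in> sets borel \<Longrightarrow> bounded A \<Longrightarrow> prob {\<omega>\<in>space M. N A \<omega> = k} = poisson_prob (l * measure lborel A) k"
  using joint_law[of "{0}" "\<lambda>_. A" "\<lambda>_. k"] by (simp add: disjoint_family_on_def)

lemma prob_ge_2:
  assumes [measurable]: "A \<in> sets borel" and A: "bounded A"
  shows "prob {\<omega>\<in>space M. 2 \<le> N A \<omega>} \<le> (l * measure lborel A)\<^sup>2"
proof -
  let ?a = "l * measure lborel A"
  have a: "0 \<le> ?a" using rate by simp
  have "{\<omega>\<in>space M. 2 \<le> N A \<omega>} = space M - ({\<omega>\<in>space M. N A \<omega> = 0} \<union> {\<omega>\<in>space M. N A \<omega> = 1})" by auto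
  then have "prob {\<omega>\<in>space M. 2 \<le> N A \<omega>} = 1 - prob ({\<omega>\<in>space M. N A \<omega> = 0} \<union> {\<omega>\<in>space M. N A \<omega> = 1})"
    by (simp add: prob_compl)
  also have "prob ({\<omega>\<in>space M. N A \<omega> = 0} \<union> {\<omega>\<in>space M. N A \<omega> = 1}) =
      prob {\<omega>\<in>space M. N A \<omega> = 0} + prob {\<omega>\<in>space M. N A \<omega> = 1}"
    by (intro finite_measure_Union) auto
  also have "\<dots> = exp (- ?a) * (1 + ?a)" using law[OF assms, of 0] law[OF assms, of 1] unfolding poisson_prob_def by (simp add: field_simps)
  also have "1 - exp (- ?a) * (1 + ?a) \<le> 1 - (1 - ?a) * (1 + ?a)"
    using exp_ge_add_one_self[of "- ?a"] a by (intro diff_left_mono mult_right_mono) auto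
  finally show ?thesis by (simp add: power2_eq_square algebra_simps)
qed

lemma measure_ball_0: "0 \<le> r \<Longrightarrow> measure lborel (ball (0::point) r) = pi * r\<^sup>2"
  using content_ball[of r "0::point"] by (simp add: unit_ball_vol_2)

text \<open>Points of equal norm lie in a common ring. Taking square roots of equally spaced values
  as radii gives \<open>R * ?m\<close> rings of equal area inverse to \<open>?m\<close>; each holds
  two points with probability at most of the order of the squared area, so the union bound is of the
  order \<open>R / ?m\<close>.\<close>

lemma AE_distinct_norms: "AE \<omega> in M. inj_on (\<lambda>i. norm (x i \<omega>)) (I \<omega>)"
proof -
  define B where "B R = {\<omega>\<in>space M. \<exists>i j. i \<noteq> j \<and> i \<in> I \<omega> \<and> j \<in> I \<omega> \<and> norm (x i \<omega>) = norm (x j \<omega>) \<and> (norm (x i \<omega>))\<^sup>2 < real R}" for R :: nat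
  have [measurable]: "B R \<in> sets M" for R unfolding B_def by measurable
  have "prob (B R) = 0" for R
  proof -
    have le: "prob (B R) \<le> real R * (l * pi)\<^sup>2 / real (Suc n)" for n
    proof -
      let ?m = "Suc n"
      define ring where "ring k = ball 0 (sqrt (real (Suc k) / ?m)) - ball (0::point) (sqrt (real k / ?m))" for k
      have ring[measurable]: "ring k \<in> sets borel" "bounded (ring k)" for k
        unfolding ring_def by (auto intro: bounded_subset[OF bounded_ball])
      have in_ring: "v \<in> ring k \<longleftrightarrow> real k / ?m \<le> (norm v)\<^sup>2 \<and> (norm v)\<^sup>2 < real (Suc k) / ?m" for v k
        unfolding ring_def by (auto simp: real_less_rsqrt real_le_lsqrt not_less intro: real_le_rsqrt real_less_lsqrt dest: sqrt_le_D)
          (metis norm_ge_zero real_less_rsqrt real_sqrt_unique real_sqrt_less_iff sqrt_le_D not_less)+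
      have meas: "measure lborel (ring k) = pi / ?m" for k
      proof -
        have sub: "ball (0::point) (sqrt (real k / ?m)) \<subseteq> ball 0 (sqrt (real (Suc k) / ?m))"
          by (intro subset_ball real_sqrt_le_mono divide_right_mono) auto
        have "measure lborel (ring k) = measure lborel (ball (0::point) (sqrt (real (Suc k) / ?m))) - measure lborel (ball (0::point) (sqrt (real k / ?m)))"
          unfolding ring_def using sub emeasure_lborel_ball_finite[of "0::point"]
          by (intro measure_Diff) (auto simp: less_top)
        also have "\<dots> = pi * (real (Suc k) / ?m) - pi * (real k / ?m)"
          by (subst (1 2) measure_ball_0) auto
        also have "\<dots> = pi * ((real (Suc k) - real k) / ?m)" by (simp only: right_diff_distrib diff_divide_distrib)
        finally show ?thesis by simp
      qed
      have "prob (B R) \<le> prob (\<Union>k<R * ?m. {\<omega>\<in>space M. 2 \<le> N (ring k) \<omega>})"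
      proof (rule finite_measure_mono_AE)
        show "AE \<omega> in M. \<omega> \<in> B R \<longrightarrow> \<omega> \<in> (\<Union>k<R * ?m. {\<omega>\<in>space M. 2 \<le> N (ring k) \<omega>})"
          using AE_locally_finite
        proof eventually_elim
          case (elim \<omega>)
          show ?case
          proof
            assume "\<omega> \<in> B R"
            then obtain i j where ij: "\<omega> \<in> space M" "i \<noteq> j" "i \<in> I \<omega>" "j \<in> I \<omega>" "norm (x i \<omega>) = norm (x j \<omega>)" "(norm (x i \<omega>))\<^sup>2 < real R"
              unfolding B_def by blast
            let ?q = "(norm (x i \<omega>))\<^sup>2 * real ?m"
            let ?k = "nat \<lfloor>?q\<rfloor>"
            have q0: "0 \<le> ?q" by simp
            have k: "real ?k \<le> ?q" "?q < real (Suc ?k)" using q0 by linarith+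
            have "?q < real R * real ?m" using ij(6) by (intro mult_strict_right_mono) auto
            then have kR: "?k < R * ?m" using k(1) by (metis le_less_trans of_nat_less_iff of_nat_mult)
            have "x i \<omega> \<in> ring ?k" "x j \<omega> \<in> ring ?k"
              using k unfolding in_ring ij(5)[symmetric] by (auto simp: pos_divide_le_eq pos_less_divide_eq simp del: of_nat_Suc)
            then have sub: "{i, j} \<subseteq> {i\<in>I \<omega>. x i \<omega> \<in> ring ?k}" using ij by auto
            have "finite {i\<in>I \<omega>. x i \<omega> \<in> ring ?k}"
              by (rule finite_subset[OF _ elim[rule_format, of "sqrt (real (Suc ?k) / ?m)"]]) (auto simp: ring_def)
            from card_mono[OF this sub] have "2 \<le> N (ring ?k) \<omega>" unfolding number_in_def using ij(2) by simp
            then show "\<omega> \<in> (\<Union>k<R * ?m. {\<omega>\<in>space M. 2 \<le> N (ring k) \<omega>})" using kR ij(1) by blast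
          qed
        qed
      qed measurable
      also have "\<dots> \<le> (\<Sum>k<R * ?m. prob {\<omega>\<in>space M. 2 \<le> N (ring k) \<omega>})"
        by (intro finite_measure_subadditive_finite) auto
      also have "\<dots> \<le> (\<Sum>k<R * ?m. (l * (pi / ?m))\<^sup>2)"
        using prob_ge_2[OF ring] by (intro sum_mono) (simp add: meas)
      also have "\<dots> = real R * real ?m * ((l * pi)\<^sup>2 / (real ?m)\<^sup>2)"
      proof -
        have "(l * (pi / ?m))\<^sup>2 = (l * pi)\<^sup>2 / (real ?m)\<^sup>2" by (simp only: power_divide times_divide_eq_right)
        then show ?thesis by (simp only: sum_constant card_lessThan of_nat_mult)
      qed
      also have "\<dots> = real R * (l * pi)\<^sup>2 / real ?m" by (simp add: power2_eq_square del: of_nat_Suc)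
      finally show ?thesis .
    qed
    have "(\<lambda>n. real R * (l * pi)\<^sup>2 / real (Suc n)) \<longlonglongrightarrow> 0"
      by (intro LIMSEQ_Suc lim_const_over_n)
    from LIMSEQ_le_const[OF this] le have "prob (B R) \<le> 0" by blast
    then show ?thesis by (simp add: antisym)
  qed
  then have "AE \<omega> in M. \<forall>R. \<omega> \<notin> B R"
    unfolding AE_all_countable by (intro allI AE_not_in) (simp add: null_sets_def emeasure_eq_measure)
  with AE_space show ?thesis
  proof eventually_elim
    case (elim \<omega>)
    show ?case
    proof (rule inj_onI, rule ccontr)
      fix i j assume ij: "i \<in> I \<omega>" "j \<in> I \<omega>" "norm (x i \<omega>) = norm (x j \<omega>)" "i \<noteq> j"
      obtain R :: nat where "(norm (x i \<omega>))\<^sup>2 < real R" using reals_Archimedean2 by blast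
      then have "\<omega> \<in> B R" unfolding B_def using ij elim(1) by blast
      then show False using elim(2) by blast
    qed
  qed
qed

lemma AE_nonzero: "AE \<omega> in M. \<forall>i\<in>I \<omega>. x i \<omega> \<noteq> 0"
proof -
  have "prob {\<omega>\<in>space M. N {0} \<omega> = 0} = 1"
    by (subst law) (auto simp: poisson_prob_def)
  then have "AE \<omega> in M. N {0} \<omega> = 0" by (subst (asm) prob_Collect_eq_1) auto
  with AE_locally_finite show ?thesis
  proof eventually_elim
    case (elim \<omega>)
    have "finite {i\<in>I \<omega>. x i \<omega> \<in> {0}}" by (rule finite_subset[OF _ elim(1)[rule_format, of 0]]) auto
    then show ?case using elim(2) unfolding number_in_def by auto
  qed
qed

text \<open>With a finite index set the counts in growing discs would be eventually constant, while
  the probability of any fixed count tends to 0 as the area grows.\<close>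

lemma AE_infinite: "AE \<omega> in M. infinite (I \<omega>)"
proof -
  define F where "F k R0 = {\<omega>\<in>space M. \<forall>R\<ge>R0. N (ball 0 (real R)) \<omega> = k}" for k R0 :: nat
  have [measurable]: "F k R0 \<in> sets M" for k R0 unfolding F_def by measurable
  have "prob (F k R0) = 0" for k R0
  proof -
    have "prob (F k R0) \<le> poisson_prob (l * (pi * (real R)\<^sup>2)) k" if "R0 \<le> R" for R
    proof -
      have "prob (F k R0) \<le> prob {\<omega>\<in>space M. N (ball 0 (real R)) \<omega> = k}"
        using that by (intro finite_measure_mono) (auto simp: F_def)
      then show ?thesis by (simp add: law measure_ball_0)
    qed
    then have ev: "\<forall>\<^sub>F R in sequentially. prob (F k R0) \<le> poisson_prob (l * (pi * (real R)\<^sup>2)) k"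
      by (rule eventually_sequentiallyI)
    have "filterlim (\<lambda>R. l * (pi * (real R)\<^sup>2)) at_top sequentially"
    proof -
      have "filterlim (\<lambda>R. (l * pi) * (real R)\<^sup>2) at_top sequentially"
        using rate by (intro filterlim_tendsto_pos_mult_at_top[OF tendsto_const] filterlim_pow_at_top filterlim_real_sequentially) auto
      then show ?thesis by (simp add: mult.assoc)
    qed
    from filterlim_compose[OF tendsto_power_div_exp_0 this]
    have "(\<lambda>R. (l * (pi * (real R)\<^sup>2)) ^ k / exp (l * (pi * (real R)\<^sup>2)) / fact k) \<longlonglongrightarrow> 0 / fact k"
      by (intro tendsto_divide tendsto_const) auto
    then have "(\<lambda>R. poisson_prob (l * (pi * (real R)\<^sup>2)) k) \<longlonglongrightarrow> 0"
      unfolding poisson_prob_def by (simp add: exp_minus field_simps)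
    from tendsto_lowerbound[OF this ev] show ?thesis by (simp add: antisym)
  qed
  then have "AE \<omega> in M. \<forall>k R0. \<omega> \<notin> F k R0"
    unfolding AE_all_countable by (intro allI AE_not_in) (simp add: null_sets_def emeasure_eq_measure)
  with AE_space show ?thesis
  proof eventually_elim
    case (elim \<omega>)
    show ?case
    proof
      assume fin: "finite (I \<omega>)"
      obtain R0 :: nat where R0: "Max (insert 0 ((\<lambda>i. norm (x i \<omega>)) ` I \<omega>)) < R0" using reals_Archimedean2 by blast
      have small: "norm (x i \<omega>) < R0" if "i \<in> I \<omega>" for i
      proof -
        have "norm (x i \<omega>) \<le> Max (insert 0 ((\<lambda>i. norm (x i \<omega>)) ` I \<omega>))" using fin that by (intro Max_ge) auto
        then show ?thesis using R0 by linarith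
      qed
      have "N (ball 0 (real R)) \<omega> = card (I \<omega>)" if "R0 \<le> R" for R
      proof -
        have "{i\<in>I \<omega>. x i \<omega> \<in> ball 0 (real R)} = I \<omega>" using small that by force
        then show ?thesis unfolding number_in_def by simp
      qed
      then have "\<omega> \<in> F (card (I \<omega>)) R0" unfolding F_def using elim(1) by blast
      then show False using elim(2) by blast
    qed
  qed
qed

lemma AE_generic: "AE \<omega> in M. generic_points (I \<omega>) (\<lambda>i. x i \<omega>)"
  using AE_locally_finite AE_distinct_norms AE_nonzero AE_infinite
  by eventually_elim (simp add: generic_points_def)

definition index :: "nat \<Rightarrow> 'w \<Rightarrow> nat" where
  "index n \<omega> = nth_nearest (I \<omega>) (\<lambda>i. x i \<omega>) n"

definition sorted :: "'w \<Rightarrow> nat \<Rightarrow> point" where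
  "sorted \<omega> n = x (index n \<omega>) \<omega>"

lemma index_measurable' [measurable]: "index n \<in> M \<rightarrow>\<^sub>M count_space UNIV"
  unfolding index_def nth_nearest_def rank_def by measurable

lemma sorted_nth_measurable [measurable]: "(\<lambda>\<omega>. sorted \<omega> n) \<in> borel_measurable M"
  unfolding sorted_def by (rule measurable_compose_countable) measurable

lemma sorted_measurable [measurable]: "sorted \<in> M \<rightarrow>\<^sub>M (\<Pi>\<^sub>M n\<in>UNIV. borel)"
  by (rule measurable_PiM_single'[where f = "\<lambda>n \<omega>. sorted \<omega> n"]) auto

end

section \<open>The rate determines the law of the counts and of the ordered points\<close>

lemma (in poisson_family) finite_in_bounded:
  "AE \<omega> in M. \<forall>A. bounded A \<longrightarrow> finite {i\<in>I \<omega>. x i \<omega> \<in> A}"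
  using AE_locally_finite
proof eventually_elim
  case (elim \<omega>)
  show ?case
  proof (intro allI impI)
    fix A :: "point set" assume "bounded A"
    then obtain r where "\<And>v. v \<in> A \<Longrightarrow> norm v \<le> r" unfolding bounded_iff by blast
    then have "{i\<in>I \<omega>. x i \<omega> \<in> A} \<subseteq> {i\<in>I \<omega>. norm (x i \<omega>) \<le> r}" by blast
    then show "finite {i\<in>I \<omega>. x i \<omega> \<in> A}" by (rule finite_subset) (rule elim[rule_format])
  qed
qed

abbreviation bounded_borel :: "point set set" where
  "bounded_borel \<equiv> {A \<in> sets borel. bounded A}"

text \<open>Counts are collected in a list because its type is countable: the law is then determined
  by the probabilities of single lists.\<close>

lemma (in poisson_family) list_law:
  assumes As: "set As \<subseteq> bounded_borel"
    and disj: "\<And>i j. i < length As \<Longrightarrow> j < length As \<Longrightarrow> i \<noteq> j \<Longrightarrow> As ! i \<inter> As ! j = {}"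
  shows "prob {\<omega>\<in>space M. map (\<lambda>A. N A \<omega>) As = ks} =
    (if length ks = length As then \<Prod>j<length As. poisson_prob (l * measure lborel (As ! j)) (ks ! j) else 0)"
proof (cases "length ks = length As")
  case True
  have "{\<omega>\<in>space M. map (\<lambda>A. N A \<omega>) As = ks} = {\<omega>\<in>space M. \<forall>j\<in>{..<length As}. N (As ! j) \<omega> = ks ! j}"
    using True by (auto simp: list_eq_iff_nth_eq)
  also have "prob \<dots> = (\<Prod>j<length As. poisson_prob (l * measure lborel (As ! j)) (ks ! j))"
    using As disj by (intro joint_law) (auto simp: disjoint_family_on_def subset_iff)
  finally show ?thesis using True by simp
next
  case False
  then have e: "{\<omega>\<in>space M. map (\<lambda>A. N A \<omega>) As = ks} = {}" by auto
  show ?thesis unfolding e using False by simp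
qed

lemma (in poisson_family) list_measurable:
  assumes "set As \<subseteq> sets borel"
  shows "(\<lambda>\<omega>. map (\<lambda>A. N A \<omega>) As) \<in> M \<rightarrow>\<^sub>M count_space UNIV"
  using assms
proof (induction As)
  case (Cons A As)
  then have [measurable]: "N A \<in> M \<rightarrow>\<^sub>M count_space UNIV" "(\<lambda>\<omega>. map (\<lambda>A. N A \<omega>) As) \<in> M \<rightarrow>\<^sub>M count_space UNIV" by auto
  have "(\<lambda>\<omega>. n # map (\<lambda>A. N A \<omega>) As) \<in> M \<rightarrow>\<^sub>M count_space UNIV" for n
    by (rule measurable_compose[of _ M "count_space UNIV"]) auto
  then have "(\<lambda>\<omega>. N A \<omega> # map (\<lambda>A. N A \<omega>) As) \<in> M \<rightarrow>\<^sub>M count_space UNIV"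
    by (rule measurable_compose_countable) measurable
  then show ?case by simp
qed simp

text \<open>The atoms of the Boolean algebra generated by \<open>\<J>\<close>.\<close>

definition atom :: "'a set set \<Rightarrow> 'a set set \<Rightarrow> 'a set" where
  "atom \<J> S = \<Inter>S - \<Union>(\<J> - S)"

lemma atom_disjoint: "S \<subseteq> \<J> \<Longrightarrow> T \<subseteq> \<J> \<Longrightarrow> S \<noteq> T \<Longrightarrow> atom \<J> S \<inter> atom \<J> T = {}"
  unfolding atom_def by blast

lemma atom_cover: "A \<in> \<J> \<Longrightarrow> v \<in> A \<longleftrightarrow> (\<exists>S\<in>Pow \<J>. A \<in> S \<and> v \<in> atom \<J> S)"
proof
  assume "A \<in> \<J>" "v \<in> A"
  then show "\<exists>S\<in>Pow \<J>. A \<in> S \<and> v \<in> atom \<J> S"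
    by (intro bexI[of _ "{B\<in>\<J>. v \<in> B}"]) (auto simp: atom_def)
qed (auto simp: atom_def)

lemma sum_list_indicator_card:
  assumes "distinct Zs" "\<And>S. S \<in> set Zs \<Longrightarrow> finite (K S)"
    and "\<And>S T. S \<in> set Zs \<Longrightarrow> T \<in> set Zs \<Longrightarrow> S \<noteq> T \<Longrightarrow> K S \<inter> K T = {}"
  shows "(\<Sum>j<length Zs. if P (Zs ! j) then card (K (Zs ! j)) else 0) = card (\<Union>S\<in>{S\<in>set Zs. P S}. K S)"
proof -
  have "(\<Sum>j<length Zs. if P (Zs ! j) then card (K (Zs ! j)) else 0) = (\<Sum>S\<in>set Zs. if P S then card (K S) else 0)"
    using sum.reindex_bij_betw[OF bij_betw_nth[OF assms(1) refl refl], of "\<lambda>S. if P S then card (K S) else 0"] by simp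
  also have "\<dots> = (\<Sum>S\<in>{S\<in>set Zs. P S}. card (K S))" by (rule sum.inter_filter[symmetric]) simp
  also have "\<dots> = card (\<Union>S\<in>{S\<in>set Zs. P S}. K S)" using assms by (intro card_UN_disjoint[symmetric]) auto
  finally show ?thesis .
qed

text \<open>The members of \<open>\<J>\<close> may overlap, while joint laws are prescribed for
  disjoint sets. Each count is therefore written as a sum of counts over atoms.\<close>

lemma poisson_counts_unique:
  assumes "poisson_family M l I x" "poisson_family M' l I' x'" and fin: "finite \<J>" and \<J>: "\<J> \<subseteq> bounded_borel"
  shows "measure M {\<omega>\<in>space M. \<forall>A\<in>\<J>. number_in (I \<omega>) (\<lambda>i. x i \<omega>) A \<in> B A} =
    measure M' {\<omega>\<in>space M'. \<forall>A\<in>\<J>. number_in (I' \<omega>) (\<lambda>i. x' i \<omega>) A \<in> B A}"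
proof -
  \<comment> \<open>The empty subfamily is excluded: its atom is the complement of the union of
    \<open>\<J>\<close>, which is unbounded and disjoint from every member.\<close>
  obtain Zs where Zs: "set Zs = Pow \<J> - {{}}" "distinct Zs"
    using finite_distinct_list[of "Pow \<J> - {{}}"] fin by auto
  let ?As = "map (atom \<J>) Zs"
  \<comment> \<open>The lists of atom counts that satisfy all constraints, so that the event
    concerns a single list.\<close>
  define C where "C = {ks. \<forall>A\<in>\<J>. (\<Sum>j<length Zs. if A \<in> Zs ! j then ks ! j else 0) \<in> B A}"
  have As: "set ?As \<subseteq> bounded_borel"
  proof
    fix a assume "a \<in> set ?As"
    then obtain S where S: "S \<subseteq> \<J>" "S \<noteq> {}" "a = atom \<J> S" using Zs by auto
    have "finite S" using S fin finite_subset by blast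
    moreover have "(\<Inter>A\<in>S. A) \<in> sets borel" using S \<J> calculation by (intro sets.finite_INT) auto
    moreover have "\<Union>(\<J> - S) \<in> sets borel" using \<J> fin by (intro sets.finite_Union) auto
    moreover obtain A where "A \<in> S" using S by blast
    then have "a \<subseteq> A" "bounded A" using S \<J> unfolding atom_def by auto
    ultimately show "a \<in> bounded_borel" unfolding S(3) atom_def using bounded_subset by auto
  qed
  have nth_sub: "Zs ! i \<subseteq> \<J>" if "i < length Zs" for i using nth_mem[OF that] Zs by auto
  have disj: "?As ! i \<inter> ?As ! j = {}" if ij: "i < length ?As" "j < length ?As" "i \<noteq> j" for i j
  proof -
    have "Zs ! i \<noteq> Zs ! j" using ij Zs(2) by (simp add: nth_eq_iff_index_eq)
    then show ?thesis using ij nth_sub atom_disjoint[of "Zs ! i" \<J> "Zs ! j"] by simp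
  qed
  have reduce: "measure M {\<omega>\<in>space M. \<forall>A\<in>\<J>. number_in (I \<omega>) (\<lambda>i. x i \<omega>) A \<in> B A} =
      measure (distr M (count_space UNIV) (\<lambda>\<omega>. map (number_in (I \<omega>) (\<lambda>i. x i \<omega>)) ?As)) C"
    if "poisson_family M l I x" for M :: "'c measure" and I x
  proof -
    interpret poisson_family M l I x by fact
    have "measure M {\<omega>\<in>space M. \<forall>A\<in>\<J>. N A \<omega> \<in> B A} = measure M {\<omega>\<in>space M. map (\<lambda>A. N A \<omega>) ?As \<in> C}"
    proof (rule measure_eq_AE)
      show "AE \<omega> in M. \<omega> \<in> {\<omega>\<in>space M. \<forall>A\<in>\<J>. N A \<omega> \<in> B A} \<longleftrightarrow> \<omega> \<in> {\<omega>\<in>space M. map (\<lambda>A. N A \<omega>) ?As \<in> C}"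
        using finite_in_bounded
      proof eventually_elim
        case (elim \<omega>)
        have eq: "N A \<omega> = (\<Sum>j<length Zs. if A \<in> Zs ! j then map (\<lambda>A. N A \<omega>) ?As ! j else 0)" if A: "A \<in> \<J>" for A
        proof -
          let ?K = "\<lambda>S. {i\<in>I \<omega>. x i \<omega> \<in> atom \<J> S}"
          have "(\<Sum>j<length Zs. if A \<in> Zs ! j then map (\<lambda>A. N A \<omega>) ?As ! j else 0) =
              (\<Sum>j<length Zs. if A \<in> Zs ! j then card (?K (Zs ! j)) else 0)"
            by (intro sum.cong refl) (simp add: number_in_def)
          also have "\<dots> = card (\<Union>S\<in>{S\<in>set Zs. A \<in> S}. ?K S)"
          proof (rule sum_list_indicator_card[OF Zs(2)])
            show "finite (?K S)" if "S \<in> set Zs" for S using As that by (intro elim[rule_format]) auto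
            show "?K S \<inter> ?K T = {}" if "S \<in> set Zs" "T \<in> set Zs" "S \<noteq> T" for S T
              using that Zs atom_disjoint[of S \<J> T] by blast
          qed
          also have "(\<Union>S\<in>{S\<in>set Zs. A \<in> S}. ?K S) = {i\<in>I \<omega>. x i \<omega> \<in> A}"
            unfolding Zs(1) using atom_cover[OF A] by blast
          finally show ?thesis unfolding number_in_def by simp
        qed
        show ?case unfolding C_def mem_Collect_eq
          by (rule conj_cong[OF refl], rule ball_cong[OF refl], subst eq, assumption, rule refl)
      qed
      show "{\<omega>\<in>space M. \<forall>A\<in>\<J>. N A \<omega> \<in> B A} \<in> sets M"
      proof (rule sets.sets_Collect_finite_All[OF _ fin])
        fix A assume "A \<in> \<J>"
        then have [measurable]: "N A \<in> M \<rightarrow>\<^sub>M count_space UNIV" using \<J> by auto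
        show "{\<omega>\<in>space M. N A \<omega> \<in> B A} \<in> sets M" by measurable
      qed
      have "set ?As \<subseteq> sets borel" using As by blast
      from list_measurable[OF this]
      show "{\<omega>\<in>space M. map (\<lambda>A. N A \<omega>) ?As \<in> C} \<in> sets M" by measurable
    qed
    also have "\<dots> = measure (distr M (count_space UNIV) (\<lambda>\<omega>. map (\<lambda>A. N A \<omega>) ?As)) C"
      using As by (subst measure_distr[OF list_measurable]) (auto intro!: arg_cong[where f = "measure M"])
    finally show ?thesis .
  qed
  have "distr M (count_space UNIV) (\<lambda>\<omega>. map (number_in (I \<omega>) (\<lambda>i. x i \<omega>)) ?As) =
      distr M' (count_space UNIV) (\<lambda>\<omega>. map (number_in (I' \<omega>) (\<lambda>i. x' i \<omega>)) ?As)"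
  proof (rule measure_eqI_countable)
    fix ks :: "nat list"
    have atoms: "emeasure (distr M (count_space UNIV) (\<lambda>\<omega>. map (number_in (I \<omega>) (\<lambda>i. x i \<omega>)) ?As)) {ks} =
      ennreal (if length ks = length ?As then \<Prod>j<length ?As. poisson_prob (l * measure lborel (?As ! j)) (ks ! j) else 0)"
      if "poisson_family M l I x" for M :: "'c measure" and I x
    proof -
      interpret poisson_family M l I x by fact
      have "emeasure (distr M (count_space UNIV) (\<lambda>\<omega>. map (\<lambda>A. N A \<omega>) ?As)) {ks} =
          emeasure M {\<omega>\<in>space M. map (\<lambda>A. N A \<omega>) ?As = ks}"
        using As by (subst emeasure_distr[OF list_measurable]) (auto intro!: arg_cong[where f = "emeasure M"])
      also have "\<dots> = ennreal (prob {\<omega>\<in>space M. map (\<lambda>A. N A \<omega>) ?As = ks})"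
        by (rule emeasure_eq_measure)
      also have "prob {\<omega>\<in>space M. map (\<lambda>A. N A \<omega>) ?As = ks} =
          (if length ks = length ?As then \<Prod>j<length ?As. poisson_prob (l * measure lborel (?As ! j)) (ks ! j) else 0)"
        by (rule list_law[OF As disj])
      finally show ?thesis .
    qed
    show "emeasure (distr M (count_space UNIV) (\<lambda>\<omega>. map (number_in (I \<omega>) (\<lambda>i. x i \<omega>)) ?As)) {ks} =
      emeasure (distr M' (count_space UNIV) (\<lambda>\<omega>. map (number_in (I' \<omega>) (\<lambda>i. x' i \<omega>)) ?As)) {ks}"
      unfolding atoms[OF assms(1)] atoms[OF assms(2)] ..
  qed auto
  then show ?thesis unfolding reduce[OF assms(1)] reduce[OF assms(2)] by simp
qed

abbreviation count_space_process :: "(point set \<Rightarrow> nat) measure" where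
  "count_space_process \<equiv> \<Pi>\<^sub>M A\<in>bounded_borel. count_space UNIV"

definition (in poisson_family) counts :: "'w \<Rightarrow> point set \<Rightarrow> nat" where
  "counts \<omega> = (\<lambda>A\<in>bounded_borel. N A \<omega>)"

lemma (in poisson_family) counts_measurable [measurable]: "counts \<in> M \<rightarrow>\<^sub>M count_space_process"
  unfolding counts_def by (rule measurable_restrict) auto

lemma counts_law_unique:
  assumes F: "poisson_family M l I x" "poisson_family M' l I' x'"
  shows "distr M count_space_process (poisson_family.counts I x) = distr M' count_space_process (poisson_family.counts I' x')"
proof (rule measure_eqI_PiM_infinite)
  fix B :: "point set \<Rightarrow> nat set" and \<J>
  assume \<J>: "finite \<J>" "\<J> \<subseteq> bounded_borel"
  have cyl: "emeasure (distr M count_space_process (poisson_family.counts I x))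
      (prod_emb bounded_borel (\<lambda>_. count_space UNIV) \<J> (Pi\<^sub>E \<J> B)) =
    ennreal (measure M {\<omega>\<in>space M. \<forall>A\<in>\<J>. number_in (I \<omega>) (\<lambda>i. x i \<omega>) A \<in> B A})"
    if "poisson_family M l I x" for M :: "'c measure" and I x
  proof -
    interpret poisson_family M l I x by fact
    have "counts -` prod_emb bounded_borel (\<lambda>_. count_space UNIV) \<J> (Pi\<^sub>E \<J> B) \<inter> space M =
        {\<omega>\<in>space M. \<forall>A\<in>\<J>. N A \<omega> \<in> B A}"
      using \<J>(2) by (auto simp: prod_emb_def counts_def PiE_iff subset_iff)
    then show ?thesis using \<J>
      by (subst emeasure_distr[OF counts_measurable]) (auto simp: emeasure_eq_measure intro!: sets_PiM_I)
  qed
  show "emeasure (distr M count_space_process (poisson_family.counts I x))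
      (prod_emb bounded_borel (\<lambda>_. count_space UNIV) \<J> (Pi\<^sub>E \<J> B)) =
    emeasure (distr M' count_space_process (poisson_family.counts I' x'))
      (prod_emb bounded_borel (\<lambda>_. count_space UNIV) \<J> (Pi\<^sub>E \<J> B))"
    unfolding cyl[OF F(1)] cyl[OF F(2)] poisson_counts_unique[OF F \<J>] ..
next
  interpret poisson_family M l I x by fact
  show "finite_measure (distr M count_space_process counts)"
    by (intro finite_measure_distr counts_measurable)
qed simp_all

text \<open>Up to a null set, \<open>nth_nearest_in_iff\<close> turns each cylinder event of the
  ordered list into an event \<open>E\<close> of the counting process.\<close>

lemma sorted_law_unique:
  assumes F: "poisson_family M l I x" "poisson_family M' l I' x'"
  shows "distr M (\<Pi>\<^sub>M n\<in>UNIV. borel) (poisson_family.sorted I x) = distr M' (\<Pi>\<^sub>M n\<in>UNIV. borel) (poisson_family.sorted I' x')"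
proof (rule measure_eqI_PiM_infinite)
  fix B :: "nat \<Rightarrow> point set" and J :: "nat set"
  assume J: "finite J" "\<And>n. n \<in> J \<Longrightarrow> B n \<in> sets borel"
  define E where "E = {\<phi>\<in>space count_space_process. \<forall>n\<in>J. \<exists>p q :: rat. \<phi> (ball 0 (of_rat p)) = n \<and>
     \<phi> (ball 0 (of_rat q) - ball 0 (of_rat p)) = 1 \<and> \<phi> (B n \<inter> (ball 0 (of_rat q) - ball 0 (of_rat p))) = 1}"
  have bb: "ball 0 r \<in> bounded_borel" "ball 0 s - ball 0 r \<in> bounded_borel" for r s :: real
    by (simp_all add: bounded_subset[OF bounded_ball Diff_subset])
  have bbB: "B n \<inter> (ball 0 s - ball 0 r) \<in> bounded_borel" if "n \<in> J" for n and r s :: real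
    using J(2)[OF that] bb(2)[of s r] bounded_subset[OF _ Int_lower2, of "ball 0 s - ball 0 r" "B n"] by simp
  have comp: "(\<lambda>\<phi>. \<phi> A) \<in> count_space_process \<rightarrow>\<^sub>M count_space UNIV" if "A \<in> bounded_borel" for A
    using that by (rule measurable_component_singleton)
  have E[measurable]: "E \<in> sets count_space_process"
    unfolding E_def
  proof (rule sets.sets_Collect_finite_All[OF _ J(1)])
    fix n assume n: "n \<in> J"
    note comp[OF bb(1), measurable] comp[OF bb(2), measurable] comp[OF bbB[OF n], measurable]
    show "{\<phi>\<in>space count_space_process. \<exists>p q :: rat. \<phi> (ball 0 (of_rat p)) = n \<and>
       \<phi> (ball 0 (of_rat q) - ball 0 (of_rat p)) = 1 \<and> \<phi> (B n \<inter> (ball 0 (of_rat q) - ball 0 (of_rat p))) = 1}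
       \<in> sets count_space_process" by measurable
  qed
  have cyl: "emeasure (distr M (\<Pi>\<^sub>M n\<in>UNIV. borel) (poisson_family.sorted I x)) (prod_emb UNIV (\<lambda>_. borel) J (Pi\<^sub>E J B)) =
    emeasure (distr M count_space_process (poisson_family.counts I x)) E"
    if "poisson_family M l I x" for M :: "'c measure" and I x
  proof -
    interpret poisson_family M l I x by fact
    have "emeasure (distr M (\<Pi>\<^sub>M n\<in>UNIV. borel) sorted) (prod_emb UNIV (\<lambda>_. borel) J (Pi\<^sub>E J B)) =
        emeasure M (sorted -` prod_emb UNIV (\<lambda>_. borel) J (Pi\<^sub>E J B) \<inter> space M)"
      using J by (intro emeasure_distr sorted_measurable sets_PiM_I) auto
    also have "\<dots> = emeasure M (counts -` E \<inter> space M)"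
    proof (rule emeasure_eq_AE)
      show "AE \<omega> in M. \<omega> \<in> sorted -` prod_emb UNIV (\<lambda>_. borel) J (Pi\<^sub>E J B) \<inter> space M \<longleftrightarrow> \<omega> \<in> counts -` E \<inter> space M"
        using AE_generic AE_space
      proof eventually_elim
        case (elim \<omega>)
        interpret G: generic_points "I \<omega>" "\<lambda>i. x i \<omega>" by (rule elim)
        have "\<omega> \<in> sorted -` prod_emb UNIV (\<lambda>_. borel) J (Pi\<^sub>E J B) \<inter> space M \<longleftrightarrow> (\<forall>n\<in>J. sorted \<omega> n \<in> B n)"
          using elim(2) by (auto simp: prod_emb_def PiE_iff space_PiM)
        also have "\<dots> \<longleftrightarrow> (\<forall>n\<in>J. \<exists>p q :: rat. counts \<omega> (ball 0 (of_rat p)) = n \<and>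
           counts \<omega> (ball 0 (of_rat q) - ball 0 (of_rat p)) = 1 \<and> counts \<omega> (B n \<inter> (ball 0 (of_rat q) - ball 0 (of_rat p))) = 1)"
        proof (intro ball_cong refl)
          fix n assume n: "n \<in> J"
          have c: "counts \<omega> A = N A \<omega>" if "A \<in> bounded_borel" for A using that unfolding counts_def by simp
          show "sorted \<omega> n \<in> B n \<longleftrightarrow> (\<exists>p q :: rat. counts \<omega> (ball 0 (of_rat p)) = n \<and>
           counts \<omega> (ball 0 (of_rat q) - ball 0 (of_rat p)) = 1 \<and> counts \<omega> (B n \<inter> (ball 0 (of_rat q) - ball 0 (of_rat p))) = 1)"
            unfolding sorted_def index_def G.nth_nearest_in_iff c[OF bb(1)] c[OF bb(2)] c[OF bbB[OF n]] ..
        qed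
        also have "\<dots> \<longleftrightarrow> \<omega> \<in> counts -` E \<inter> space M"
          unfolding E_def using elim(2) measurable_space[OF counts_measurable elim(2)] by blast
        finally show ?case .
      qed
      show "sorted -` prod_emb UNIV (\<lambda>_. borel) J (Pi\<^sub>E J B) \<inter> space M \<in> sets M"
        using J by (intro measurable_sets[OF sorted_measurable] sets_PiM_I) auto
      show "counts -` E \<inter> space M \<in> sets M" by (rule measurable_sets[OF counts_measurable E])
    qed
    also have "\<dots> = emeasure (distr M count_space_process counts) E"
      by (rule emeasure_distr[OF counts_measurable E, symmetric])
    finally show ?thesis .
  qed
  show "emeasure (distr M (\<Pi>\<^sub>M n\<in>UNIV. borel) (poisson_family.sorted I x)) (prod_emb UNIV (\<lambda>_. borel) J (Pi\<^sub>E J B)) =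
    emeasure (distr M' (\<Pi>\<^sub>M n\<in>UNIV. borel) (poisson_family.sorted I' x')) (prod_emb UNIV (\<lambda>_. borel) J (Pi\<^sub>E J B))"
    unfolding cyl[OF F(1)] cyl[OF F(2)] counts_law_unique[OF F] ..
next
  interpret poisson_family M l I x by fact
  show "finite_measure (distr M (\<Pi>\<^sub>M n\<in>UNIV. borel) sorted)"
    by (intro finite_measure_distr sorted_measurable)
qed simp_all

section \<open>Images of a Poisson family under similarities\<close>

lemma measure_affine_preimage:
  fixes A :: "point set"
  assumes A: "A \<in> sets borel" and c: "0 < c"
  shows "measure lborel {v. a + c *\<^sub>R v \<in> A} = measure lborel A / c\<^sup>2"
proof -
  have m: "(\<lambda>v::point. a + c *\<^sub>R v) \<in> borel \<rightarrow>\<^sub>M borel" by measurable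
  have "emeasure lborel A = emeasure (density (distr lborel borel (\<lambda>v. a + c *\<^sub>R v)) (\<lambda>_. ennreal (\<bar>c\<bar> ^ DIM(point)))) A"
    using lborel_affine[of c a] c by simp
  also have "\<dots> = ennreal (c\<^sup>2) * emeasure (distr lborel borel (\<lambda>v. a + c *\<^sub>R v)) A"
    using A c by (subst emeasure_density) (auto simp: nn_integral_cmult_indicator)
  also have "emeasure (distr lborel borel (\<lambda>v. a + c *\<^sub>R v)) A = emeasure lborel {v. a + c *\<^sub>R v \<in> A}"
    using A m by (subst emeasure_distr) (auto simp: vimage_def)
  finally have "measure lborel A = c\<^sup>2 * measure lborel {v. a + c *\<^sub>R v \<in> A}"
    unfolding measure_def by (simp add: enn2real_mult)
  then show ?thesis using c by simp
qed

text \<open>Counts of the moved points in \<open>A j\<close> are counts of the original ones in its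
  preimage; preimages stay disjoint and bounded, and their area is divided by
  \<open>c\<^sup>2\<close>.\<close>

lemma (in poisson_family) similar:
  assumes c: "0 < c"
  shows "poisson_family M (l / c\<^sup>2) I (\<lambda>i \<omega>. a + c *\<^sub>R x i \<omega>)"
proof
  show "0 < l / c\<^sup>2" using rate c by simp
  show "Measurable.pred M (\<lambda>\<omega>. i \<in> I \<omega>)" for i by measurable
  show "(\<lambda>\<omega>. a + c *\<^sub>R x i \<omega>) \<in> borel_measurable M" for i by measurable
  show "AE \<omega> in M. \<forall>r. finite {i\<in>I \<omega>. norm (a + c *\<^sub>R x i \<omega>) \<le> r}"
    using AE_locally_finite
  proof eventually_elim
    case (elim \<omega>)
    show ?case
    proof
      fix r
      have "{i\<in>I \<omega>. norm (a + c *\<^sub>R x i \<omega>) \<le> r} \<subseteq> {i\<in>I \<omega>. norm (x i \<omega>) \<le> (r + norm a) / c}"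
      proof safe
        fix i assume "norm (a + c *\<^sub>R x i \<omega>) \<le> r"
        moreover have "norm (c *\<^sub>R x i \<omega>) \<le> norm (a + c *\<^sub>R x i \<omega>) + norm a"
          using norm_triangle_ineq4[of "a + c *\<^sub>R x i \<omega>" a] by simp
        ultimately show "norm (x i \<omega>) \<le> (r + norm a) / c" using c by (simp add: field_simps)
      qed
      then show "finite {i\<in>I \<omega>. norm (a + c *\<^sub>R x i \<omega>) \<le> r}" by (rule finite_subset) (rule elim[rule_format])
    qed
  qed
  fix J :: "nat set" and A :: "nat \<Rightarrow> point set" and k
  assume J: "finite J" "disjoint_family_on A J" "\<And>j. j \<in> J \<Longrightarrow> A j \<in> sets borel \<and> bounded (A j)"
  let ?A = "\<lambda>j. {v. a + c *\<^sub>R v \<in> A j}"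
  have "{\<omega>\<in>space M. \<forall>j\<in>J. number_in (I \<omega>) (\<lambda>i. a + c *\<^sub>R x i \<omega>) (A j) = k j} =
      {\<omega>\<in>space M. \<forall>j\<in>J. N (?A j) \<omega> = k j}"
    unfolding number_in_def by simp
  also have "prob \<dots> = (\<Prod>j\<in>J. poisson_prob (l * measure lborel (?A j)) (k j))"
  proof (rule joint_law[OF J(1)])
    show "disjoint_family_on ?A J" using J(2) unfolding disjoint_family_on_def by blast
    fix j assume j: "j \<in> J"
    have "?A j = (\<lambda>v. a + c *\<^sub>R v) -` A j \<inter> space borel" by auto
    moreover have "(\<lambda>v::point. a + c *\<^sub>R v) \<in> borel \<rightarrow>\<^sub>M borel" by measurable
    ultimately have "?A j \<in> sets borel" using J(3)[OF j] by (metis measurable_sets)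
    moreover have "bounded (?A j)"
    proof -
      have "?A j \<subseteq> (\<lambda>v. (1 / c) *\<^sub>R (- a + v)) ` A j"
      proof
        fix v assume "v \<in> ?A j"
        then show "v \<in> (\<lambda>v. (1 / c) *\<^sub>R (- a + v)) ` A j" using c
          by (intro rev_image_eqI[of "a + c *\<^sub>R v"]) auto
      qed
      moreover have "bounded ((\<lambda>v. (1 / c) *\<^sub>R (- a + v)) ` A j)"
      proof -
        have "bounded ((*\<^sub>R) (1 / c) ` ((+) (- a) ` A j))" using J(3)[OF j] by (intro bounded_scaling bounded_translation) auto
        then show ?thesis by (simp add: image_image)
      qed
      ultimately show ?thesis by (rule bounded_subset[rotated])
    qed
    ultimately show "?A j \<in> sets borel \<and> bounded (?A j)" by blast
  qed
  also have "\<dots> = (\<Prod>j\<in>J. poisson_prob (l / c\<^sup>2 * measure lborel (A j)) (k j))"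
    using J(3) c by (intro prod.cong refl) (simp add: measure_affine_preimage)
  finally show "prob {\<omega>\<in>space M. \<forall>j\<in>J. number_in (I \<omega>) (\<lambda>i. a + c *\<^sub>R x i \<omega>) (A j) = k j} =
     (\<Prod>j\<in>J. poisson_prob (l / c\<^sup>2 * measure lborel (A j)) (k j))" .
qed

section \<open>Routes between randomly chosen sites\<close>

lemma space_config_space: "z \<in> space (config_space k) \<longleftrightarrow> z \<in> extensional {..<k} \<and> inj_on z {..<k}"
  by (auto simp: config_space_def space_restrict_space space_PiM PiE_def)

lemma pairs_iff: "(i, j) \<in> pairs A \<longleftrightarrow> i \<in> A \<and> j \<in> A \<and> i \<noteq> j"
  by (simp add: pairs_def)

lemma net_route_measurable: "p \<in> pairs {..<k} \<Longrightarrow> (\<lambda>r. r p) \<in> net_space k \<rightarrow>\<^sub>M route_space"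
  unfolding net_space_def by (rule measurable_component_singleton)

lemma net_space_route: "r \<in> space (net_space k) \<Longrightarrow> p \<in> pairs {..<k} \<Longrightarrow> is_route (r p)"
  using measurable_space[OF net_route_measurable, of p k r] space_route_space by blast

text \<open>Only routes leaving the first point are kept, moved to start at 0, which makes families
  around different points comparable.\<close>

definition star_net :: "real \<Rightarrow> nat \<Rightarrow> (nat \<times> nat \<Rightarrow> route) \<Rightarrow> nat \<Rightarrow> route" where
  "star_net c k r = (\<lambda>n\<in>{..<k}. scale c (rebase (r (0, Suc n))))"

lemma star_net_measurable [measurable]:
  assumes "0 < c"
  shows "star_net c k \<in> net_space (Suc k) \<rightarrow>\<^sub>M (\<Pi>\<^sub>M n\<in>{..<k}. route_space)"
  unfolding star_net_def
proof (rule measurable_restrict)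
  fix n assume "n \<in> {..<k}"
  then have [measurable]: "(\<lambda>r. r (0, Suc n)) \<in> net_space (Suc k) \<rightarrow>\<^sub>M route_space"
    by (intro net_route_measurable) (simp add: pairs_iff)
  show "(\<lambda>r. scale c (rebase (r (0, Suc n)))) \<in> net_space (Suc k) \<rightarrow>\<^sub>M route_space"
    using assms by measurable
qed

section \<open>Kernels for recentred and scaled families of routes\<close>

context random_routes
begin

lemma \<mu>_space:
  assumes "z \<in> space (config_space k)"
  shows "prob_space (\<mu> k z)" "sets (\<mu> k z) = sets (net_space k)" "space (\<mu> k z) = space (net_space k)"
proof -
  have "\<mu> k z \<in> space (prob_algebra (net_space k))" by (rule measurable_space[OF kernel assms])
  then show "prob_space (\<mu> k z)" "sets (\<mu> k z) = sets (net_space k)" by (simp_all add: space_prob_algebra)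
  then show "space (\<mu> k z) = space (net_space k)" by (intro sets_eq_imp_space_eq)
qed

text \<open>The kernel extended by 0 to configurations with coinciding points, which yields a
  measurable function on the whole product space.\<close>

definition K :: "nat \<Rightarrow> (nat \<times> nat \<Rightarrow> route) set \<Rightarrow> (nat \<Rightarrow> point) \<Rightarrow> ennreal" where
  "K k B z = (if inj_on z {..<k} then emeasure (\<mu> k z) B else 0)"

lemma K_measurable [measurable]:
  assumes B: "B \<in> sets (net_space k)"
  shows "K k B \<in> borel_measurable (\<Pi>\<^sub>M i\<in>{..<k}. borel)"
proof -
  let ?P = "\<Pi>\<^sub>M i\<in>{..<k}. borel :: point measure"
  have inj: "{z \<in> space ?P. inj_on z {..<k}} \<in> sets ?P"
    unfolding inj_on_def
  proof (intro sets.sets_Collect_finite_All finite_lessThan)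
    fix i j assume ij: "i \<in> {..<k}" "j \<in> {..<k}"
    have "{z \<in> space ?P. z i = z j} \<in> sets ?P"
      by (rule measurable_equality_set[OF measurable_component_singleton[OF ij(1)] measurable_component_singleton[OF ij(2)]])
    then have "space ?P - {z \<in> space ?P. z i = z j} \<in> sets ?P" by (rule sets.compl_sets)
    moreover have "{z \<in> space ?P. z i = z j \<longrightarrow> i = j} =
        (if i = j then space ?P else space ?P - {z \<in> space ?P. z i = z j})" by auto
    ultimately show "{z \<in> space ?P. z i = z j \<longrightarrow> i = j} \<in> sets ?P" by simp
  qed
  then have O: "{z. inj_on z {..<k}} \<inter> space ?P \<in> sets ?P" by (simp add: Int_def conj_commute)
  have "(\<lambda>z. emeasure (\<mu> k z) B) \<in> borel_measurable (config_space k)"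
    by (rule measurable_emeasure_kernel[OF measurable_prob_algebraD[OF kernel] B])
  then have "(\<lambda>z. emeasure (\<mu> k z) B * indicator {z. inj_on z {..<k}} z) \<in> borel_measurable ?P"
    unfolding config_space_def borel_measurable_restrict_space_iff_ennreal[OF O] .
  moreover have "(\<lambda>z. emeasure (\<mu> k z) B * indicator {z. inj_on z {..<k}} z) = K k B"
    by (auto simp: K_def fun_eq_iff split: split_indicator)
  ultimately show ?thesis by simp
qed

lemma K_consistent:
  assumes z: "z \<in> space (config_space m)" and f: "inj_on f {..<k}" "f ` {..<k} \<subseteq> {..<m}" and B: "B \<in> sets (net_space k)"
  shows "K m {r\<in>space (net_space m). (\<lambda>(i, j)\<in>pairs {..<k}. r (f i, f j)) \<in> B} z = K k B (\<lambda>i\<in>{..<k}. z (f i))"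
proof -
  have injz: "inj_on z {..<m}" using z by (simp add: space_config_space)
  have injzf: "inj_on (\<lambda>i\<in>{..<k}. z (f i)) {..<k}"
    using comp_inj_on[OF f(1) inj_on_subset[OF injz f(2)]] by (simp add: inj_on_def)
  have m: "(\<lambda>r. \<lambda>(i, j)\<in>pairs {..<k}. r (f i, f j)) \<in> net_space m \<rightarrow>\<^sub>M net_space k"
    unfolding net_space_def[of k]
  proof (rule measurable_restrict)
    fix p assume p: "p \<in> pairs {..<k}"
    obtain i j where ij: "p = (i, j)" by (cases p)
    have "(f i, f j) \<in> pairs {..<m}" using p f unfolding ij pairs_iff by (auto dest: inj_onD)
    then show "(\<lambda>r. case p of (i, j) \<Rightarrow> r (f i, f j)) \<in> net_space m \<rightarrow>\<^sub>M route_space"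
      unfolding ij by (simp add: net_route_measurable)
  qed
  have "emeasure (\<mu> k (\<lambda>i\<in>{..<k}. z (f i))) B =
      emeasure (distr (\<mu> m z) (net_space k) (\<lambda>r. \<lambda>(i, j)\<in>pairs {..<k}. r (f i, f j))) B"
    by (simp add: consistent[OF z f])
  also have "\<dots> = emeasure (\<mu> m z) ((\<lambda>r. \<lambda>(i, j)\<in>pairs {..<k}. r (f i, f j)) -` B \<inter> space (\<mu> m z))"
    using m B by (intro emeasure_distr) (simp_all add: measurable_cong_sets[OF \<mu>_space(2)[OF z] refl])
  also have "(\<lambda>r. \<lambda>(i, j)\<in>pairs {..<k}. r (f i, f j)) -` B \<inter> space (\<mu> m z) =
      {r\<in>space (net_space m). (\<lambda>(i, j)\<in>pairs {..<k}. r (f i, f j)) \<in> B}"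
    unfolding \<mu>_space(3)[OF z] by blast
  finally show ?thesis unfolding K_def if_P[OF injz] if_P[OF injzf] by (rule sym)
qed

lemma emeasure_invariant:
  assumes inv: "invariant_under \<mu> f" and z: "z \<in> space (config_space k)" and f: "inj f"
    and B: "B \<in> sets (net_space k)" and B': "B' \<in> sets (net_space k)"
    and route: "\<And>h. is_route h \<Longrightarrow> is_route (compose {0..1} f h)"
    and eq: "\<And>r. r \<in> space (net_space k) \<Longrightarrow> (\<lambda>p\<in>pairs {..<k}. compose {0..1} f (r p)) \<in> B' \<longleftrightarrow> r \<in> B"
    and m: "\<And>t. t \<in> {0..1} \<Longrightarrow> (\<lambda>h. f (h t)) \<in> route_space \<rightarrow>\<^sub>M borel"
  shows "emeasure (\<mu> k z) B = emeasure (\<mu> k (\<lambda>i\<in>{..<k}. f (z i))) B'"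
proof -
  have mc: "compose {0..1} f \<in> route_space \<rightarrow>\<^sub>M route_space"
    using m by (intro measurable_into_route_space) (auto simp: compose_def route[unfolded compose_def] space_route_space)
  have "(\<lambda>r. \<lambda>p\<in>pairs {..<k}. compose {0..1} f (r p)) \<in> net_space k \<rightarrow>\<^sub>M net_space k"
    unfolding net_space_def[of k]
    by (rule measurable_restrict, rule measurable_compose[OF _ mc], rule measurable_component_singleton)
  then have mm: "(\<lambda>r. \<lambda>p\<in>pairs {..<k}. compose {0..1} f (r p)) \<in> \<mu> k z \<rightarrow>\<^sub>M net_space k"
    by (simp add: measurable_cong_sets[OF \<mu>_space(2)[OF z] refl])
  have "emeasure (\<mu> k (\<lambda>i\<in>{..<k}. f (z i))) B' =
      emeasure (distr (\<mu> k z) (net_space k) (\<lambda>r. \<lambda>p\<in>pairs {..<k}. compose {0..1} f (r p))) B'"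
    using inv z unfolding invariant_under_def by simp
  also have "\<dots> = emeasure (\<mu> k z) ((\<lambda>r. \<lambda>p\<in>pairs {..<k}. compose {0..1} f (r p)) -` B' \<inter> space (\<mu> k z))"
    by (rule emeasure_distr[OF mm B'])
  also have "(\<lambda>r. \<lambda>p\<in>pairs {..<k}. compose {0..1} f (r p)) -` B' \<inter> space (\<mu> k z) = B"
    unfolding \<mu>_space(3)[OF z] using eq sets.sets_into_space[OF B] by blast
  finally show ?thesis by (rule sym)
qed

definition star_event :: "real \<Rightarrow> nat \<Rightarrow> (nat \<Rightarrow> route) set \<Rightarrow> (nat \<times> nat \<Rightarrow> route) set" where
  "star_event c k B = {r\<in>space (net_space (Suc k)). star_net c k r \<in> B}"

lemma star_event_sets [measurable]:
  "0 < c \<Longrightarrow> B \<in> sets (\<Pi>\<^sub>M n\<in>{..<k}. route_space) \<Longrightarrow> star_event c k B \<in> sets (net_space (Suc k))"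
  using measurable_sets[OF star_net_measurable, of c B k] by (simp add: star_event_def vimage_def Int_def conj_commute)

lemma compose_in_net_space:
  assumes "r \<in> space (net_space k)" "\<And>h. is_route h \<Longrightarrow> is_route (compose {0..1} f h)"
  shows "(\<lambda>p\<in>pairs {..<k}. compose {0..1} f (r p)) \<in> space (net_space k)"
  using net_space_route[OF assms(1)] assms(2)
  unfolding net_space_def space_PiM space_route_space_eq by (auto simp: PiE_iff compose_def)

text \<open>Moving the first point to 0 leaves the recentred routes unchanged, and dilating the
  configuration absorbs the factor \<open>c\<close>. The law therefore depends on the scaled offsets
  alone.\<close>

lemma star_law_similar:
  assumes z: "z \<in> space (config_space (Suc k))" and c: "0 < c" and B: "B \<in> sets (\<Pi>\<^sub>M n\<in>{..<k}. route_space)"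
  shows "K (Suc k) (star_event c k B) z = K (Suc k) (star_event 1 k B) (\<lambda>i\<in>{..<Suc k}. c *\<^sub>R (z i - z 0))"
proof -
  let ?w = "\<lambda>i\<in>{..<Suc k}. z i + - z 0"
  have r1: "is_route (compose {0..1} (\<lambda>x. x + - z 0) h)" if "is_route h" for h
    by (rule is_route_similarity[OF that, of 1 _ "- z 0"]) (simp_all add: compose_def)
  have r2: "is_route (compose {0..1} (\<lambda>x. c *\<^sub>R x) h)" if "is_route h" for h
    by (rule is_route_similarity[OF that, of c _ 0]) (simp_all add: compose_def c)
  have e1: "scale c (rebase (compose {0..1} (\<lambda>x. x + - z 0) h)) = scale c (rebase h)" for h
    by (auto simp: scale_def rebase_def compose_def restrict_def fun_eq_iff)
  have e2: "scale 1 (rebase (compose {0..1} (\<lambda>x. c *\<^sub>R x) h)) = scale c (rebase h)" for h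
    by (auto simp: scale_def rebase_def compose_def restrict_def fun_eq_iff scaleR_diff_right)
  have n1: "star_net c k (\<lambda>p\<in>pairs {..<Suc k}. compose {0..1} (\<lambda>x. x + - z 0) (r p)) = star_net c k r" for r
    unfolding star_net_def by (intro restrict_ext) (simp add: pairs_iff e1 del: add_uminus_conv_diff)
  have n2: "star_net 1 k (\<lambda>p\<in>pairs {..<Suc k}. compose {0..1} (\<lambda>x. c *\<^sub>R x) (r p)) = star_net c k r" for r
    unfolding star_net_def by (intro restrict_ext) (simp add: pairs_iff e2)
  have injz: "inj_on z {..<Suc k}" using z by (simp add: space_config_space)
  then have w: "?w \<in> space (config_space (Suc k))" by (simp add: space_config_space inj_on_def)
  have "emeasure (\<mu> (Suc k) z) (star_event c k B) = emeasure (\<mu> (Suc k) ?w) (star_event c k B)"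
  proof (rule emeasure_invariant[OF translation z])
    show "(\<lambda>h. h t + - z 0) \<in> route_space \<rightarrow>\<^sub>M borel" if "t \<in> {0..1}" for t using that by measurable
    show "(\<lambda>p\<in>pairs {..<Suc k}. compose {0..1} (\<lambda>x. x + - z 0) (r p)) \<in> star_event c k B \<longleftrightarrow> r \<in> star_event c k B"
      if "r \<in> space (net_space (Suc k))" for r
      unfolding star_event_def mem_Collect_eq n1 using compose_in_net_space[OF that r1] that by simp
  qed (use r1 star_event_sets[OF c B] in \<open>auto simp: inj_def\<close>)
  also have "\<dots> = emeasure (\<mu> (Suc k) (\<lambda>i\<in>{..<Suc k}. c *\<^sub>R ?w i)) (star_event 1 k B)"
  proof (rule emeasure_invariant[OF scaling[OF c] w])
    show "(\<lambda>h. c *\<^sub>R h t) \<in> route_space \<rightarrow>\<^sub>M borel" if "t \<in> {0..1}" for t using that by measurable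
    show "(\<lambda>p\<in>pairs {..<Suc k}. compose {0..1} (\<lambda>x. c *\<^sub>R x) (r p)) \<in> star_event 1 k B \<longleftrightarrow> r \<in> star_event c k B"
      if "r \<in> space (net_space (Suc k))" for r
      unfolding star_event_def mem_Collect_eq n2 using compose_in_net_space[OF that r2] that by simp
  qed (use r2 c star_event_sets[OF c B] star_event_sets[of 1 B k] B in \<open>auto simp: inj_def\<close>)
  also have "(\<lambda>i\<in>{..<Suc k}. c *\<^sub>R ?w i) = (\<lambda>i\<in>{..<Suc k}. c *\<^sub>R (z i - z 0))"
    by (intro restrict_ext) simp
  finally have "emeasure (\<mu> (Suc k) z) (star_event c k B) =
    emeasure (\<mu> (Suc k) (\<lambda>i\<in>{..<Suc k}. c *\<^sub>R (z i - z 0))) (star_event 1 k B)" .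
  moreover have "inj_on (\<lambda>i\<in>{..<Suc k}. c *\<^sub>R (z i - z 0)) {..<Suc k}"
    using injz c by (simp add: inj_on_def)
  ultimately show ?thesis unfolding K_def using injz by (simp only: if_True)
qed

text \<open>The law of the first \<open>k\<close> routes from 0 when their ends are at
  \<open>d\<close>; the origin is inserted as site number 0.\<close>

definition star_kernel :: "nat \<Rightarrow> (nat \<Rightarrow> route) set \<Rightarrow> (nat \<Rightarrow> point) \<Rightarrow> ennreal" where
  "star_kernel k B d = K (Suc k) (star_event 1 k B) (\<lambda>i\<in>{..<Suc k}. case i of 0 \<Rightarrow> 0 | Suc n \<Rightarrow> d n)"

lemma star_kernel_measurable [measurable]:
  assumes "B \<in> sets (\<Pi>\<^sub>M n\<in>{..<k}. route_space)"
  shows "star_kernel k B \<in> borel_measurable (\<Pi>\<^sub>M n\<in>UNIV. borel)"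
  unfolding star_kernel_def[abs_def]
proof (rule measurable_compose[OF _ K_measurable[OF star_event_sets]])
  show "(\<lambda>d. \<lambda>i\<in>{..<Suc k}. case i of 0 \<Rightarrow> 0 | Suc n \<Rightarrow> d n) \<in> (\<Pi>\<^sub>M n\<in>UNIV. borel) \<rightarrow>\<^sub>M (\<Pi>\<^sub>M i\<in>{..<Suc k}. borel :: point measure)"
  proof (rule measurable_restrict)
    fix i show "(\<lambda>d. case i of 0 \<Rightarrow> 0 | Suc n \<Rightarrow> d n) \<in> (\<Pi>\<^sub>M n\<in>UNIV. borel) \<rightarrow>\<^sub>M (borel :: point measure)"
      by (cases i) simp_all
  qed
qed (use assms in auto)

end

section \<open>Routes between sites chosen by looking at the points\<close>

definition seq_site :: "nat \<Rightarrow> (nat \<Rightarrow> point \<times> real) \<Rightarrow> point" where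
  "seq_site i y = (case i of 0 \<Rightarrow> 0 | Suc n \<Rightarrow> fst (y n))"

lemma site_seq_site: "site Y i \<omega> = seq_site i (\<lambda>n. Y n \<omega>)"
  unfolding site_def seq_site_def ..

abbreviation point_seq :: "(nat \<Rightarrow> point \<times> real) measure" where
  "point_seq \<equiv> \<Pi>\<^sub>M n\<in>UNIV. borel"

lemma seq_site_measurable [measurable]: "seq_site i \<in> borel_measurable point_seq"
proof (cases i)
  case (Suc n)
  have [measurable]: "fst \<in> (borel :: (point \<times> real) measure) \<rightarrow>\<^sub>M borel"
    by (rule borel_measurable_continuous_onI) (intro continuous_intros)
  have "(\<lambda>y. fst (y n)) \<in> borel_measurable point_seq" by measurable
  then show ?thesis using Suc by (simp add: seq_site_def[abs_def])
qed (simp add: seq_site_def[abs_def])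

text \<open>What remains of \<open>sampled_routes\<close> after conditioning on an event of the
  points: the Poisson law is replaced by distinctness of the sites, and the conditional law is
  kept.\<close>

locale conditional_routes = random_routes \<mu> + prob_space M
  for \<mu> and M :: "'w measure" +
  fixes Y :: "nat \<Rightarrow> 'w \<Rightarrow> point \<times> real" and R :: "nat \<times> nat \<Rightarrow> 'w \<Rightarrow> route"
  assumes Y_nth_measurable [measurable]: "Y n \<in> borel_measurable M"
    and R_measurable: "i \<noteq> j \<Longrightarrow> R (i, j) \<in> M \<rightarrow>\<^sub>M route_space"
    and distinct_sites: "AE \<omega> in M. inj (\<lambda>i. site Y i \<omega>)"
    and cond_law: "A \<in> sets point_seq \<Longrightarrow> B \<in> sets (net_space k) \<Longrightarrow>
      emeasure M {\<omega> \<in> space M. (\<lambda>n. Y n \<omega>) \<in> A \<and> (\<lambda>p\<in>pairs {..<k}. R p \<omega>) \<in> B} =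
      (\<integral>\<^sup>+ \<omega>. indicator A (\<lambda>n. Y n \<omega>) * K k B (\<lambda>i\<in>{..<k}. site Y i \<omega>) \<partial>M)"
begin

lemma Y_measurable [measurable]: "(\<lambda>\<omega> n. Y n \<omega>) \<in> M \<rightarrow>\<^sub>M point_seq"
  by (rule measurable_PiM_single') auto

lemma site_measurable [measurable]: "site Y i \<in> borel_measurable M"
  unfolding site_seq_site[abs_def] by measurable

lemma R_net_measurable [measurable]: "(\<lambda>\<omega>. \<lambda>p\<in>pairs {..<k}. R p \<omega>) \<in> M \<rightarrow>\<^sub>M net_space k"
  unfolding net_space_def by (rule measurable_restrict) (auto simp: pairs_def R_measurable)

text \<open>As the indices depend on the points only, there are countably many possible choices
  \<open>f\<close>. On each of them the conditional law for fixed indices applies, and consistency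
  passes from an initial block of sites to the chosen ones.\<close>

lemma select_law:
  fixes s :: "nat \<Rightarrow> (nat \<Rightarrow> point \<times> real) \<Rightarrow> nat"
  assumes s[measurable]: "\<And>i. s i \<in> point_seq \<rightarrow>\<^sub>M count_space UNIV" and B: "B \<in> sets (net_space k)"
  shows "{\<omega>\<in>space M. inj_on (\<lambda>i. s i (\<lambda>n. Y n \<omega>)) {..<k} \<and>
      (\<lambda>(i, j)\<in>pairs {..<k}. R (s i (\<lambda>n. Y n \<omega>), s j (\<lambda>n. Y n \<omega>)) \<omega>) \<in> B} \<in> sets M"
    and "emeasure M {\<omega>\<in>space M. inj_on (\<lambda>i. s i (\<lambda>n. Y n \<omega>)) {..<k} \<and>
      (\<lambda>(i, j)\<in>pairs {..<k}. R (s i (\<lambda>n. Y n \<omega>), s j (\<lambda>n. Y n \<omega>)) \<omega>) \<in> B} =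
    (\<integral>\<^sup>+ \<omega>. K k B (\<lambda>i\<in>{..<k}. site Y (s i (\<lambda>n. Y n \<omega>)) \<omega>) \<partial>M)"
proof -
  let ?s = "\<lambda>i \<omega>. s i (\<lambda>n. Y n \<omega>)"
  have sm[measurable]: "?s i \<in> M \<rightarrow>\<^sub>M count_space UNIV" for i by measurable
  define F where "F = {f \<in> {..<k} \<rightarrow>\<^sub>E (UNIV::nat set). inj_on f {..<k}}"
  have cF: "countable F" unfolding F_def by (rule countable_subset[OF Collect_restrict]) (intro countable_PiE; simp)
  define X where "X f = {\<omega>\<in>space M. (\<forall>i\<in>{..<k}. ?s i \<omega> = f i) \<and> (\<lambda>(i, j)\<in>pairs {..<k}. R (f i, f j) \<omega>) \<in> B}" for f
  define A where "A f = {y\<in>space point_seq. \<forall>i\<in>{..<k}. s i y = f i}" for f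
  have A[measurable]: "A f \<in> sets point_seq" for f unfolding A_def by measurable
  have X: "X f \<in> sets M" if f: "f \<in> F" for f
  proof -
    have "(\<lambda>\<omega>. \<lambda>(i, j)\<in>pairs {..<k}. R (f i, f j) \<omega>) \<in> M \<rightarrow>\<^sub>M net_space k"
      unfolding net_space_def
    proof (rule measurable_restrict)
      fix p assume p: "p \<in> pairs {..<k}"
      obtain i j where ij: "p = (i, j)" by (cases p)
      have "f i \<noteq> f j" using p f unfolding ij pairs_iff F_def by (auto dest: inj_onD)
      then show "(\<lambda>\<omega>. case p of (i, j) \<Rightarrow> R (f i, f j) \<omega>) \<in> M \<rightarrow>\<^sub>M route_space" unfolding ij by (simp add: R_measurable)
    qed
    then have [measurable]: "Measurable.pred M (\<lambda>\<omega>. (\<lambda>(i, j)\<in>pairs {..<k}. R (f i, f j) \<omega>) \<in> B)"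
      using B by (rule pred_sets2[rotated])
    show ?thesis unfolding X_def by measurable
  qed
  have law: "emeasure M (X f) = (\<integral>\<^sup>+ \<omega>. indicator (A f) (\<lambda>n. Y n \<omega>) * K k B (\<lambda>i\<in>{..<k}. site Y (f i) \<omega>) \<partial>M)"
    if f: "f \<in> F" for f
  proof -
    \<comment> \<open>The conditional law concerns initial blocks of sites, so a block containing
      all chosen indices is taken.\<close>
    obtain m where m: "f ` {..<k} \<subseteq> {..<m}" using finite_nat_bounded[of "f ` {..<k}"] by auto
    have inj: "inj_on f {..<k}" using f unfolding F_def by simp
    let ?B = "{r\<in>space (net_space m). (\<lambda>(i, j)\<in>pairs {..<k}. r (f i, f j)) \<in> B}"
    have mm: "(\<lambda>r. \<lambda>(i, j)\<in>pairs {..<k}. r (f i, f j)) \<in> net_space m \<rightarrow>\<^sub>M net_space k"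
      unfolding net_space_def[of k]
    proof (rule measurable_restrict)
      fix p assume p: "p \<in> pairs {..<k}"
      obtain i j where ij: "p = (i, j)" by (cases p)
      have "(f i, f j) \<in> pairs {..<m}" using p m inj unfolding ij pairs_iff by (auto dest: inj_onD)
      then show "(\<lambda>r. case p of (i, j) \<Rightarrow> r (f i, f j)) \<in> net_space m \<rightarrow>\<^sub>M route_space"
        unfolding ij by (simp add: net_route_measurable)
    qed
    have B': "?B \<in> sets (net_space m)" using measurable_sets[OF mm B] by (simp add: vimage_def Int_def conj_commute)
    have "X f = {\<omega> \<in> space M. (\<lambda>n. Y n \<omega>) \<in> A f \<and> (\<lambda>p\<in>pairs {..<m}. R p \<omega>) \<in> ?B}"
    proof (intro set_eqI)
      fix \<omega>
      have eq: "(\<lambda>(i, j)\<in>pairs {..<k}. (\<lambda>p\<in>pairs {..<m}. R p \<omega>) (f i, f j)) = (\<lambda>(i, j)\<in>pairs {..<k}. R (f i, f j) \<omega>)"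
      proof (rule restrict_ext)
        fix p assume p: "p \<in> pairs {..<k}"
        obtain i j where ij: "p = (i, j)" by (cases p)
        have "(f i, f j) \<in> pairs {..<m}" using p m inj unfolding ij pairs_iff by (auto dest: inj_onD)
        then show "(case p of (i, j) \<Rightarrow> (\<lambda>p\<in>pairs {..<m}. R p \<omega>) (f i, f j)) = (case p of (i, j) \<Rightarrow> R (f i, f j) \<omega>)"
          unfolding ij by simp
      qed
      show "\<omega> \<in> X f \<longleftrightarrow> \<omega> \<in> {\<omega> \<in> space M. (\<lambda>n. Y n \<omega>) \<in> A f \<and> (\<lambda>p\<in>pairs {..<m}. R p \<omega>) \<in> ?B}"
        unfolding X_def A_def mem_Collect_eq eq
        using measurable_space[OF Y_measurable, of \<omega>] measurable_space[OF R_net_measurable, of \<omega> m] by blast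
    qed
    then have "emeasure M (X f) = (\<integral>\<^sup>+ \<omega>. indicator (A f) (\<lambda>n. Y n \<omega>) * K m ?B (\<lambda>i\<in>{..<m}. site Y i \<omega>) \<partial>M)"
      by (simp only: cond_law[OF A B'])
    also have "\<dots> = (\<integral>\<^sup>+ \<omega>. indicator (A f) (\<lambda>n. Y n \<omega>) * K k B (\<lambda>i\<in>{..<k}. site Y (f i) \<omega>) \<partial>M)"
    proof (rule nn_integral_cong_AE)
      show "AE \<omega> in M. indicator (A f) (\<lambda>n. Y n \<omega>) * K m ?B (\<lambda>i\<in>{..<m}. site Y i \<omega>) =
          indicator (A f) (\<lambda>n. Y n \<omega>) * K k B (\<lambda>i\<in>{..<k}. site Y (f i) \<omega>)"
        using distinct_sites
      proof eventually_elim
        case (elim \<omega>)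
        have "(\<lambda>i\<in>{..<m}. site Y i \<omega>) \<in> space (config_space m)"
          using elim by (simp add: space_config_space inj_on_def)
        from K_consistent[OF this inj m B]
        have "K m ?B (\<lambda>i\<in>{..<m}. site Y i \<omega>) = K k B (\<lambda>i\<in>{..<k}. (\<lambda>i\<in>{..<m}. site Y i \<omega>) (f i))" .
        also have "(\<lambda>i\<in>{..<k}. (\<lambda>i\<in>{..<m}. site Y i \<omega>) (f i)) = (\<lambda>i\<in>{..<k}. site Y (f i) \<omega>)"
          using m by (intro restrict_ext) auto
        finally show ?case by (simp only:)
      qed
    qed
    finally show ?thesis .
  qed
  have union: "{\<omega>\<in>space M. inj_on (\<lambda>i. ?s i \<omega>) {..<k} \<and> (\<lambda>(i, j)\<in>pairs {..<k}. R (?s i \<omega>, ?s j \<omega>) \<omega>) \<in> B} = (\<Union>f\<in>F. X f)"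
  proof (intro equalityI subsetI)
    fix \<omega> assume \<omega>: "\<omega> \<in> {\<omega>\<in>space M. inj_on (\<lambda>i. ?s i \<omega>) {..<k} \<and> (\<lambda>(i, j)\<in>pairs {..<k}. R (?s i \<omega>, ?s j \<omega>) \<omega>) \<in> B}"
    let ?f = "\<lambda>i\<in>{..<k}. ?s i \<omega>"
    have "(\<lambda>(i, j)\<in>pairs {..<k}. R (?f i, ?f j) \<omega>) = (\<lambda>(i, j)\<in>pairs {..<k}. R (?s i \<omega>, ?s j \<omega>) \<omega>)"
      by (intro restrict_ext) (auto simp: pairs_def)
    then have "\<omega> \<in> X ?f" using \<omega> unfolding X_def by simp
    moreover have "?f \<in> F" using \<omega> unfolding F_def by (simp add: inj_on_def)
    ultimately show "\<omega> \<in> (\<Union>f\<in>F. X f)" by blast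
  next
    fix \<omega> assume "\<omega> \<in> (\<Union>f\<in>F. X f)"
    then obtain f where f: "f \<in> F" "\<omega> \<in> X f" by blast
    have sf: "?s i \<omega> = f i" if "i < k" for i using f(2) that unfolding X_def by simp
    have "(\<lambda>(i, j)\<in>pairs {..<k}. R (f i, f j) \<omega>) = (\<lambda>(i, j)\<in>pairs {..<k}. R (?s i \<omega>, ?s j \<omega>) \<omega>)"
      by (intro restrict_ext) (auto simp: pairs_def sf)
    moreover have "inj_on (\<lambda>i. ?s i \<omega>) {..<k}" using f(1) sf unfolding F_def by (simp add: inj_on_def)
    ultimately show "\<omega> \<in> {\<omega>\<in>space M. inj_on (\<lambda>i. ?s i \<omega>) {..<k} \<and> (\<lambda>(i, j)\<in>pairs {..<k}. R (?s i \<omega>, ?s j \<omega>) \<omega>) \<in> B}"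
      using f(2) unfolding X_def by simp
  qed
  have "(\<Union>f\<in>F. X f) \<in> sets M" using X by (rule sets.countable_UN''[OF cF])
  then show "{\<omega>\<in>space M. inj_on (\<lambda>i. ?s i \<omega>) {..<k} \<and> (\<lambda>(i, j)\<in>pairs {..<k}. R (?s i \<omega>, ?s j \<omega>) \<omega>) \<in> B} \<in> sets M"
    unfolding union .
  have "emeasure M {\<omega>\<in>space M. inj_on (\<lambda>i. ?s i \<omega>) {..<k} \<and> (\<lambda>(i, j)\<in>pairs {..<k}. R (?s i \<omega>, ?s j \<omega>) \<omega>) \<in> B} =
      emeasure M (\<Union>f\<in>F. X f)" unfolding union ..
  also have "\<dots> = (\<integral>\<^sup>+ f. emeasure M (X f) \<partial>count_space F)"
  proof (rule emeasure_UN_countable[OF X cF])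
    show "disjoint_family_on X F"
      unfolding disjoint_family_on_def
    proof (intro ballI impI)
      fix f f' assume ff: "f \<in> F" "f' \<in> F" "f \<noteq> f'"
      have "f = f'" if "\<forall>i<k. f i = f' i"
        using ff(1,2) that unfolding F_def by (intro PiE_ext[of f "{..<k}" "\<lambda>_. UNIV" f']) auto
      then obtain i where "i < k" "f i \<noteq> f' i" using ff(3) by blast
      then show "X f \<inter> X f' = {}" unfolding X_def by auto
    qed
  qed
  also have "\<dots> = (\<integral>\<^sup>+ f. (\<integral>\<^sup>+ \<omega>. indicator (A f) (\<lambda>n. Y n \<omega>) * K k B (\<lambda>i\<in>{..<k}. site Y (f i) \<omega>) \<partial>M) \<partial>count_space F)"
    by (intro nn_integral_cong) (simp add: law)
  also have "\<dots> = (\<integral>\<^sup>+ \<omega>. (\<integral>\<^sup>+ f. indicator (A f) (\<lambda>n. Y n \<omega>) * K k B (\<lambda>i\<in>{..<k}. site Y (f i) \<omega>) \<partial>count_space F) \<partial>M)"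
  proof (rule nn_integral_count_space_nn_integral[OF cF, symmetric])
    fix f
    have "(\<lambda>\<omega>. \<lambda>i\<in>{..<k}. site Y (f i) \<omega>) \<in> M \<rightarrow>\<^sub>M (\<Pi>\<^sub>M i\<in>{..<k}. borel)" by measurable
    then have [measurable]: "(\<lambda>\<omega>. K k B (\<lambda>i\<in>{..<k}. site Y (f i) \<omega>)) \<in> borel_measurable M"
      by (rule measurable_compose[OF _ K_measurable[OF B]])
    show "(\<lambda>\<omega>. indicator (A f) (\<lambda>n. Y n \<omega>) * K k B (\<lambda>i\<in>{..<k}. site Y (f i) \<omega>)) \<in> borel_measurable M" by measurable
  qed
  also have "\<dots> = (\<integral>\<^sup>+ \<omega>. K k B (\<lambda>i\<in>{..<k}. site Y (?s i \<omega>) \<omega>) \<partial>M)"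
  proof (rule nn_integral_cong)
    fix \<omega> assume \<omega>: "\<omega> \<in> space M"
    let ?f = "\<lambda>i\<in>{..<k}. ?s i \<omega>"
    let ?z = "\<lambda>i\<in>{..<k}. site Y (?s i \<omega>) \<omega>"
    have mem: "(\<lambda>n. Y n \<omega>) \<in> A f \<longleftrightarrow> f = ?f" if "f \<in> F" for f
    proof
      assume "(\<lambda>n. Y n \<omega>) \<in> A f"
      then show "f = ?f" using that unfolding A_def F_def by (intro PiE_ext[of f "{..<k}" "\<lambda>_. UNIV"]) auto
    next
      assume "f = ?f"
      then show "(\<lambda>n. Y n \<omega>) \<in> A f" unfolding A_def using measurable_space[OF Y_measurable \<omega>] by simp
    qed
    have "(\<integral>\<^sup>+ f. indicator (A f) (\<lambda>n. Y n \<omega>) * K k B (\<lambda>i\<in>{..<k}. site Y (f i) \<omega>) \<partial>count_space F) =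
        (\<integral>\<^sup>+ f. K k B ?z * indicator {?f} f \<partial>count_space F)"
    proof (rule nn_integral_cong)
      fix f assume "f \<in> space (count_space F)"
      then have f: "f \<in> F" by simp
      show "indicator (A f) (\<lambda>n. Y n \<omega>) * K k B (\<lambda>i\<in>{..<k}. site Y (f i) \<omega>) = K k B ?z * indicator {?f} f"
      proof (cases "f = ?f")
        case True
        then have "(\<lambda>i\<in>{..<k}. site Y (f i) \<omega>) = ?z" by (auto intro: restrict_ext)
        then show ?thesis using True mem[OF f] by simp
      next
        case False then show ?thesis using mem[OF f] by simp
      qed
    qed
    also have "\<dots> = K k B ?z"
    proof (cases "?f \<in> F")
      case True
      then have "(\<integral>\<^sup>+ f. K k B ?z * indicator {?f} f \<partial>count_space F) = K k B ?z * emeasure (count_space F) {?f}"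
        by (intro nn_integral_cmult_indicator) simp
      then show ?thesis using True by simp
    next
      \<comment> \<open>A repeated index gives a non-injective configuration, where \<open>K\<close>
        is 0; this matches the exclusion of such outcomes from the event.\<close>
      case False
      then have "\<not> inj_on (\<lambda>i. ?s i \<omega>) {..<k}" unfolding F_def by (simp add: inj_on_def)
      then obtain a b where ab: "a < k" "b < k" "a \<noteq> b" "?s a \<omega> = ?s b \<omega>" unfolding inj_on_def by auto
      then have "?z a = ?z b" by simp
      then have "\<not> inj_on ?z {..<k}" using ab inj_onD[of ?z "{..<k}" a b] by auto
      then have "K k B ?z = 0" unfolding K_def by simp
      then show ?thesis by simp
    qed
    finally show "(\<integral>\<^sup>+ f. indicator (A f) (\<lambda>n. Y n \<omega>) * K k B (\<lambda>i\<in>{..<k}. site Y (f i) \<omega>) \<partial>count_space F) = K k B ?z" .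
  qed
  finally show "emeasure M {\<omega>\<in>space M. inj_on (\<lambda>i. ?s i \<omega>) {..<k} \<and> (\<lambda>(i, j)\<in>pairs {..<k}. R (?s i \<omega>, ?s j \<omega>) \<omega>) \<in> B} =
    (\<integral>\<^sup>+ \<omega>. K k B (\<lambda>i\<in>{..<k}. site Y (?s i \<omega>) \<omega>) \<partial>M)" .
qed

text \<open>\<open>R (i, i)\<close> is unconstrained, so random indices must be kept off the diagonal.\<close>

definition safe_route :: "nat \<Rightarrow> nat \<Rightarrow> 'w \<Rightarrow> route" where
  "safe_route i j \<omega> = (if i = j then R (0, 1) \<omega> else R (i, j) \<omega>)"

lemma safe_route_measurable [measurable]: "safe_route i j \<in> M \<rightarrow>\<^sub>M route_space"
  unfolding safe_route_def using R_measurable[of 0 1] R_measurable[of i j] by (cases "i = j") simp_all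

text \<open>The routes from the site selected by \<open>s 0\<close> to the other selected sites,
  moved to start at 0; \<open>offset\<close> lists where they end.\<close>

definition star :: "(nat \<Rightarrow> (nat \<Rightarrow> point \<times> real) \<Rightarrow> nat) \<Rightarrow> 'w \<Rightarrow> nat \<Rightarrow> route" where
  "star s \<omega> n = rebase (safe_route (s 0 (\<lambda>n. Y n \<omega>)) (s (Suc n) (\<lambda>n. Y n \<omega>)) \<omega>)"

definition offset :: "(nat \<Rightarrow> (nat \<Rightarrow> point \<times> real) \<Rightarrow> nat) \<Rightarrow> 'w \<Rightarrow> nat \<Rightarrow> point" where
  "offset s \<omega> n = site Y (s (Suc n) (\<lambda>n. Y n \<omega>)) \<omega> - site Y (s 0 (\<lambda>n. Y n \<omega>)) \<omega>"

context
  fixes s :: "nat \<Rightarrow> (nat \<Rightarrow> point \<times> real) \<Rightarrow> nat"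
  assumes s [measurable]: "\<And>i. s i \<in> point_seq \<rightarrow>\<^sub>M count_space UNIV"
begin

lemma star_nth_measurable [measurable]: "(\<lambda>\<omega>. star s \<omega> n) \<in> M \<rightarrow>\<^sub>M route_space"
proof -
  have "(\<lambda>\<omega>. safe_route i (s (Suc n) (\<lambda>n. Y n \<omega>)) \<omega>) \<in> M \<rightarrow>\<^sub>M route_space" for i
    by (rule measurable_compose_countable) measurable
  then have "(\<lambda>\<omega>. safe_route (s 0 (\<lambda>n. Y n \<omega>)) (s (Suc n) (\<lambda>n. Y n \<omega>)) \<omega>) \<in> M \<rightarrow>\<^sub>M route_space"
    by (rule measurable_compose_countable) measurable
  then show ?thesis unfolding star_def by measurable
qed

lemma scaled_star_measurable:
  "0 < c \<Longrightarrow> (\<lambda>\<omega> n. scale c (star s \<omega> n)) \<in> M \<rightarrow>\<^sub>M route_seq"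
  by (rule measurable_PiM_single') (auto intro: measurable_space)

lemma star_measurable [measurable]: "star s \<in> M \<rightarrow>\<^sub>M route_seq"
  by (rule measurable_PiM_single'[where f = "\<lambda>n \<omega>. star s \<omega> n"]) (auto intro: measurable_space)

lemma offset_measurable [measurable]: "offset s \<in> M \<rightarrow>\<^sub>M (\<Pi>\<^sub>M n\<in>UNIV. borel)"
proof (rule measurable_PiM_single'[where f = "\<lambda>n \<omega>. offset s \<omega> n"])
  have [measurable]: "(\<lambda>\<omega>. site Y (s i (\<lambda>n. Y n \<omega>)) \<omega>) \<in> borel_measurable M" for i
    by (rule measurable_compose_countable) measurable
  show "(\<lambda>\<omega>. offset s \<omega> n) \<in> borel_measurable M" for n unfolding offset_def by measurable
qed auto

text \<open>Injectivity of the selection makes \<open>safe_route\<close> the true route, so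
  \<open>select_law\<close> applies, and \<open>star_law_similar\<close> reduces the configuration
  to its offsets.\<close>

lemma star_law:
  assumes inj: "AE \<omega> in M. inj (\<lambda>i. s i (\<lambda>n. Y n \<omega>))" and c: "0 < c"
    and B: "B \<in> sets (\<Pi>\<^sub>M n\<in>{..<k}. route_space)"
  shows "emeasure M {\<omega>\<in>space M. (\<lambda>n\<in>{..<k}. scale c (star s \<omega> n)) \<in> B} =
    (\<integral>\<^sup>+ \<omega>. star_kernel k B (\<lambda>n. c *\<^sub>R offset s \<omega> n) \<partial>M)"
proof -
  let ?s = "\<lambda>i \<omega>. s i (\<lambda>n. Y n \<omega>)"
  let ?r = "\<lambda>\<omega>. \<lambda>(i, j)\<in>pairs {..<Suc k}. R (?s i \<omega>, ?s j \<omega>) \<omega>"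
  have E: "star_event c k B \<in> sets (net_space (Suc k))" using c B by (rule star_event_sets)
  note sel = select_law[OF s E]
  have "emeasure M {\<omega>\<in>space M. (\<lambda>n\<in>{..<k}. scale c (star s \<omega> n)) \<in> B} =
      emeasure M {\<omega>\<in>space M. inj_on (\<lambda>i. ?s i \<omega>) {..<Suc k} \<and> ?r \<omega> \<in> star_event c k B}"
  proof (rule emeasure_eq_AE)
    show "AE \<omega> in M. \<omega> \<in> {\<omega>\<in>space M. (\<lambda>n\<in>{..<k}. scale c (star s \<omega> n)) \<in> B} \<longleftrightarrow>
        \<omega> \<in> {\<omega>\<in>space M. inj_on (\<lambda>i. ?s i \<omega>) {..<Suc k} \<and> ?r \<omega> \<in> star_event c k B}"
      using inj AE_space
    proof eventually_elim
      case (elim \<omega>)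
      have ne: "?s i \<omega> \<noteq> ?s j \<omega>" if "i \<noteq> j" for i j using injD[OF elim(1), of i j] that by blast
      have "R (?s i \<omega>, ?s j \<omega>) \<omega> \<in> space route_space" if "i \<noteq> j" for i j
        using measurable_space[OF R_measurable[OF ne[OF that]] elim(2)] .
      then have "?r \<omega> \<in> space (net_space (Suc k))"
        unfolding net_space_def space_PiM by (auto simp: PiE_iff pairs_def)
      moreover have "star_net c k (?r \<omega>) = (\<lambda>n\<in>{..<k}. scale c (star s \<omega> n))"
        unfolding star_net_def star_def safe_route_def using ne[of 0]
        by (intro restrict_ext) (simp add: pairs_iff)
      ultimately show ?case
        unfolding star_event_def using elim inj_on_subset[OF elim(1) subset_UNIV] by simp
    qed
    have "(\<lambda>\<omega>. \<lambda>n\<in>{..<k}. scale c (star s \<omega> n)) \<in> M \<rightarrow>\<^sub>M (\<Pi>\<^sub>M n\<in>{..<k}. route_space)"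
      using c by (intro measurable_restrict) measurable
    from measurable_sets[OF this B]
    show "{\<omega>\<in>space M. (\<lambda>n\<in>{..<k}. scale c (star s \<omega> n)) \<in> B} \<in> sets M"
      by (simp add: vimage_def Int_def conj_commute)
  qed (rule sel(1))
  also have "\<dots> = (\<integral>\<^sup>+ \<omega>. K (Suc k) (star_event c k B) (\<lambda>i\<in>{..<Suc k}. site Y (?s i \<omega>) \<omega>) \<partial>M)"
    by (rule sel(2))
  also have "\<dots> = (\<integral>\<^sup>+ \<omega>. star_kernel k B (\<lambda>n. c *\<^sub>R offset s \<omega> n) \<partial>M)"
  proof (rule nn_integral_cong_AE)
    show "AE \<omega> in M. K (Suc k) (star_event c k B) (\<lambda>i\<in>{..<Suc k}. site Y (?s i \<omega>) \<omega>) =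
        star_kernel k B (\<lambda>n. c *\<^sub>R offset s \<omega> n)"
      using inj distinct_sites
    proof eventually_elim
      case (elim \<omega>)
      let ?z = "\<lambda>i\<in>{..<Suc k}. site Y (?s i \<omega>) \<omega>"
      have "site Y (?s i \<omega>) \<omega> \<noteq> site Y (?s j \<omega>) \<omega>" if "i \<noteq> j" for i j
        using injD[OF elim(1), of i j] injD[OF elim(2), of "?s i \<omega>" "?s j \<omega>"] that by blast
      then have "?z \<in> space (config_space (Suc k))" unfolding space_config_space by (auto simp: inj_on_def)
      from star_law_similar[OF this c B]
      have "K (Suc k) (star_event c k B) ?z = K (Suc k) (star_event 1 k B) (\<lambda>i\<in>{..<Suc k}. c *\<^sub>R (?z i - ?z 0))" .
      also have "(\<lambda>i\<in>{..<Suc k}. c *\<^sub>R (?z i - ?z 0)) =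
          (\<lambda>i\<in>{..<Suc k}. case i of 0 \<Rightarrow> 0 | Suc n \<Rightarrow> c *\<^sub>R offset s \<omega> n)"
        by (intro restrict_ext) (auto simp: offset_def split: nat.split)
      finally show ?case unfolding star_kernel_def .
    qed
  qed
  finally show ?thesis .
qed

end

text \<open>Carries almost sure properties from the laws at fixed configurations to the sampled
  routes. The event has to be a condition on the points joined to a condition on the routes, the
  only shape that \<open>cond_law\<close> evaluates.\<close>

lemma null_event_from_kernel:
  assumes A: "A \<in> sets point_seq" and B: "B \<in> sets (net_space k)"
    and null: "\<And>y. y \<in> A \<Longrightarrow> inj (\<lambda>i. seq_site i y) \<Longrightarrow> AE r in \<mu> k (\<lambda>i\<in>{..<k}. seq_site i y). r \<notin> B"
  shows "AE \<omega> in M. \<not> ((\<lambda>n. Y n \<omega>) \<in> A \<and> (\<lambda>p\<in>pairs {..<k}. R p \<omega>) \<in> B)"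
proof -
  let ?E = "{\<omega> \<in> space M. (\<lambda>n. Y n \<omega>) \<in> A \<and> (\<lambda>p\<in>pairs {..<k}. R p \<omega>) \<in> B}"
  have [measurable]: "Measurable.pred M (\<lambda>\<omega>. (\<lambda>n. Y n \<omega>) \<in> A)" "Measurable.pred M (\<lambda>\<omega>. (\<lambda>p\<in>pairs {..<k}. R p \<omega>) \<in> B)"
    using pred_sets2[OF A Y_measurable] pred_sets2[OF B R_net_measurable] by simp_all
  have "emeasure M ?E = (\<integral>\<^sup>+ \<omega>. indicator A (\<lambda>n. Y n \<omega>) * K k B (\<lambda>i\<in>{..<k}. site Y i \<omega>) \<partial>M)"
    by (rule cond_law[OF A B])
  also have "\<dots> = (\<integral>\<^sup>+ \<omega>. 0 \<partial>M)"
  proof (rule nn_integral_cong_AE)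
    show "AE \<omega> in M. indicator A (\<lambda>n. Y n \<omega>) * K k B (\<lambda>i\<in>{..<k}. site Y i \<omega>) = 0"
      using distinct_sites
    proof eventually_elim
      case (elim \<omega>)
      show ?case
      proof (cases "(\<lambda>n. Y n \<omega>) \<in> A")
        case True
        let ?z = "\<lambda>i\<in>{..<k}. site Y i \<omega>"
        have z: "?z \<in> space (config_space k)" unfolding space_config_space using elim by (auto simp: inj_on_def)
        have "AE r in \<mu> k ?z. r \<notin> B" using null[OF True] elim unfolding site_seq_site by simp
        moreover have "B \<in> sets (\<mu> k ?z)" using B \<mu>_space(2)[OF z] by simp
        ultimately have "B \<in> null_sets (\<mu> k ?z)" using AE_iff_null_sets by blast
        then have "emeasure (\<mu> k ?z) B = 0" by (simp add: null_sets_def)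
        then show ?thesis unfolding K_def by simp
      qed simp
    qed
  qed
  finally have "emeasure M ?E = 0" by simp
  moreover have "?E \<in> sets M" by measurable
  ultimately have "?E \<in> null_sets M" by (simp add: null_sets_def)
  then have "AE \<omega> in M. \<omega> \<notin> ?E" by (rule AE_not_in)
  with AE_space show ?thesis by eventually_elim blast
qed

section \<open>Ends and alignment of the sampled routes\<close>

lemma feasible_at:
  assumes "inj (\<lambda>i. seq_site i y)"
  shows "AE r in \<mu> k (\<lambda>i\<in>{..<k}. seq_site i y). feasible_subnetwork {..<k} (\<lambda>i\<in>{..<k}. seq_site i y) r"
proof (rule feasible)
  show "(\<lambda>i\<in>{..<k}. seq_site i y) \<in> space (config_space k)"
    unfolding space_config_space using assms by (auto simp: inj_on_def)
qed

text \<open>Equality of a route end with a random site is not an event of the product shape. Over a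
  countable basis it becomes countably many such events: whenever the site lies in \<open>U\<close>,
  so does the end of the route.\<close>

lemma AE_route_end:
  assumes ij: "i \<noteq> j"
  shows "AE \<omega> in M. R (i, j) \<omega> 0 = site Y i \<omega> \<and> R (i, j) \<omega> 1 = site Y j \<omega>"
proof -
  obtain \<B> :: "point set set" where \<B>: "countable \<B>" "topological_basis \<B>" using ex_countable_basis by blast
  let ?k = "Suc (max i j)"
  have p: "(i, j) \<in> pairs {..<?k}" using ij by (auto simp: pairs_iff)
  have null: "AE \<omega> in M. site Y m \<omega> \<in> U \<longrightarrow> R (i, j) \<omega> t \<in> U" if U: "U \<in> \<B>" and t: "(t, m) \<in> {(0, i), (1, j)}" for U t m
  proof -
    have t01: "t \<in> {0..1}" and m: "m < ?k" using t by auto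
    have oU: "open U" using topological_basis_open[OF \<B>(2) U] .
    let ?A = "{y\<in>space point_seq. seq_site m y \<in> U}"
    let ?B = "{r\<in>space (net_space ?k). r (i, j) t \<notin> U}"
    have "U \<in> sets borel" using oU by simp
    then have A: "?A \<in> sets point_seq"
      using measurable_sets[OF seq_site_measurable, of U m] by (simp add: vimage_def Int_def conj_commute)
    have "(\<lambda>r. r (i, j) t) \<in> net_space ?k \<rightarrow>\<^sub>M borel"
      by (rule measurable_compose[OF net_route_measurable[OF p] eval_measurable[OF t01]])
    from measurable_sets[OF this, of "- U"] have B: "?B \<in> sets (net_space ?k)"
      using \<open>U \<in> sets borel\<close> by (simp add: vimage_def Int_def conj_commute)
    have "AE \<omega> in M. \<not> ((\<lambda>n. Y n \<omega>) \<in> ?A \<and> (\<lambda>p\<in>pairs {..<?k}. R p \<omega>) \<in> ?B)"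
    proof (rule null_event_from_kernel[OF A B])
      fix y assume y: "y \<in> ?A" "inj (\<lambda>i. seq_site i y)"
      show "AE r in \<mu> ?k (\<lambda>i\<in>{..<?k}. seq_site i y). r \<notin> ?B"
        using feasible_at[OF y(2), of ?k]
      proof eventually_elim
        case (elim r)
        then have "pathstart (r (i, j)) = seq_site i y" "pathfinish (r (i, j)) = seq_site j y"
          using p unfolding feasible_subnetwork_def by (auto simp: less_Suc_eq_le)
        then have "r (i, j) t = seq_site m y" using t unfolding pathstart_def pathfinish_def by auto
        then show ?case using y(1) by simp
      qed
    qed
    with AE_space show ?thesis
    proof eventually_elim
      case (elim \<omega>)
      then show ?case using p measurable_space[OF Y_measurable elim(1)] measurable_space[OF R_net_measurable elim(1), of ?k]
        unfolding site_seq_site by auto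
    qed
  qed
  have sep: "x = z" if "\<And>U. U \<in> \<B> \<Longrightarrow> x \<in> U \<Longrightarrow> z \<in> U" for x z :: point
  proof (rule ccontr)
    assume "x \<noteq> z"
    then have "open (- {z})" "x \<in> - {z}" by auto
    then obtain U where "U \<in> \<B>" "x \<in> U" "U \<subseteq> - {z}" by (rule topological_basisE[OF \<B>(2)])
    then show False using that by blast
  qed
  have "AE \<omega> in M. \<forall>U\<in>\<B>. site Y i \<omega> \<in> U \<longrightarrow> R (i, j) \<omega> 0 \<in> U"
    using null by (intro AE_ball_countable' \<B>(1)) auto
  moreover have "AE \<omega> in M. \<forall>U\<in>\<B>. site Y j \<omega> \<in> U \<longrightarrow> R (i, j) \<omega> 1 \<in> U"
    using null by (intro AE_ball_countable' \<B>(1)) auto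
  ultimately show ?thesis
  proof eventually_elim
    case (elim \<omega>)
    have "site Y i \<omega> = R (i, j) \<omega> 0" by (rule sep) (use elim in blast)
    moreover have "site Y j \<omega> = R (i, j) \<omega> 1" by (rule sep) (use elim in blast)
    ultimately show ?case by simp
  qed
qed

text \<open>Compatibility is exchanged for \<open>aligned\<close> while still at a fixed
  configuration, because the latter is a measurable condition to which the transfer applies.\<close>

lemma AE_aligned:
  assumes "i \<noteq> j" "i \<noteq> m"
  shows "AE \<omega> in M. aligned (rebase (R (i, j) \<omega>)) (rebase (R (i, m) \<omega>))"
proof -
  let ?k = "Suc (max i (max j m))"
  have p: "(i, j) \<in> pairs {..<?k}" "(i, m) \<in> pairs {..<?k}" using assms by (auto simp: pairs_iff)
  let ?B = "{r\<in>space (net_space ?k). \<not> aligned (rebase (r (i, j))) (rebase (r (i, m)))}"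
  have "(\<lambda>r. (rebase (r (i, j)), rebase (r (i, m)))) \<in> net_space ?k \<rightarrow>\<^sub>M route_space \<Otimes>\<^sub>M route_space"
    using p by (intro measurable_Pair measurable_compose[OF net_route_measurable rebase_measurable])
  from measurable_compose[OF this aligned_measurable]
  have [measurable]: "Measurable.pred (net_space ?k) (\<lambda>r. aligned (rebase (r (i, j))) (rebase (r (i, m))))" by simp
  have B: "?B \<in> sets (net_space ?k)" by measurable
  have "AE \<omega> in M. \<not> ((\<lambda>n. Y n \<omega>) \<in> space point_seq \<and> (\<lambda>p\<in>pairs {..<?k}. R p \<omega>) \<in> ?B)"
  proof (rule null_event_from_kernel[OF sets.top B])
    fix y assume y: "inj (\<lambda>i. seq_site i y)"
    show "AE r in \<mu> ?k (\<lambda>i\<in>{..<?k}. seq_site i y). r \<notin> ?B"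
      using feasible_at[OF y(1), of ?k]
    proof eventually_elim
      case (elim r)
      then have r: "is_route (r q) \<and> pathstart (r q) = (\<lambda>i\<in>{..<?k}. seq_site i y) (fst q)"
        and c: "compatible (r q) (r q')" if "q \<in> pairs {..<?k}" "q' \<in> pairs {..<?k}" for q q'
        using that unfolding feasible_subnetwork_def by fastforce+
      have "aligned (r (i, j)) (r (i, m))"
        using r[OF p(1,1)] r[OF p(2,2)] by (intro compatible_aligned c p) (auto simp: pathstart_def)
      moreover have "r (i, j) 0 = r (i, m) 0" using r[OF p(1,1)] r[OF p(2,2)] by (simp add: pathstart_def)
      ultimately have "aligned (rebase (r (i, j))) (rebase (r (i, m)))"
        unfolding aligned_def by (simp add: rebase_eval mult_le_one)
      then show ?case by simp
    qed
  qed
  with AE_space show ?thesis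
  proof eventually_elim
    case (elim \<omega>)
    then show ?case using p measurable_space[OF Y_measurable elim(1)] measurable_space[OF R_net_measurable elim(1), of ?k] by auto
  qed
qed

end

text \<open>The two sides may live on different probability spaces and select different sites. Their
  finite-dimensional probabilities are integrals of the same kernel against the law of the scaled
  offsets.\<close>

lemma star_law_unique:
  assumes 1: "conditional_routes \<mu> M Y R" "\<And>i. s i \<in> point_seq \<rightarrow>\<^sub>M count_space UNIV"
    "AE \<omega> in M. inj (\<lambda>i. s i (\<lambda>n. Y n \<omega>))" "0 < c"
    and 2: "conditional_routes \<mu> M' Y' R'" "\<And>i. s' i \<in> point_seq \<rightarrow>\<^sub>M count_space UNIV"
    "AE \<omega> in M'. inj (\<lambda>i. s' i (\<lambda>n. Y' n \<omega>))" "0 < c'"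
    and eq: "distr M (\<Pi>\<^sub>M n\<in>UNIV. borel) (\<lambda>\<omega> n. c *\<^sub>R conditional_routes.offset Y s \<omega> n) =
      distr M' (\<Pi>\<^sub>M n\<in>UNIV. borel) (\<lambda>\<omega> n. c' *\<^sub>R conditional_routes.offset Y' s' \<omega> n)"
  shows "distr M route_seq (\<lambda>\<omega> n. scale c (conditional_routes.star Y R s \<omega> n)) =
    distr M' route_seq (\<lambda>\<omega> n. scale c' (conditional_routes.star Y' R' s' \<omega> n))"
proof (rule measure_eqI_PiM_infinite)
  fix A :: "nat \<Rightarrow> route set" and J :: "nat set"
  assume J: "finite J" "\<And>n. n \<in> J \<Longrightarrow> A n \<in> sets route_space"
  obtain k where k: "J \<subseteq> {..<k}" using finite_nat_bounded[OF J(1)] by blast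
  let ?B = "prod_emb {..<k} (\<lambda>_. route_space) J (Pi\<^sub>E J A)"
  have B: "?B \<in> sets (\<Pi>\<^sub>M n\<in>{..<k}. route_space)" using J k by (intro sets_PiM_I) auto
  have cyl: "emeasure (distr M route_seq (\<lambda>\<omega> n. scale c (conditional_routes.star Y R s \<omega> n)))
      (prod_emb UNIV (\<lambda>_. route_space) J (Pi\<^sub>E J A)) =
    (\<integral>\<^sup>+ d. random_routes.star_kernel \<mu> k ?B d \<partial>distr M (\<Pi>\<^sub>M n\<in>UNIV. borel) (\<lambda>\<omega> n. c *\<^sub>R conditional_routes.offset Y s \<omega> n))"
    if 1: "conditional_routes \<mu> M Y R" "\<And>i. s i \<in> point_seq \<rightarrow>\<^sub>M count_space UNIV"
      "AE \<omega> in M. inj (\<lambda>i. s i (\<lambda>n. Y n \<omega>))" "0 < c" for M :: "'c measure" and Y R s c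
  proof -
    interpret conditional_routes \<mu> M Y R by fact
    note ms = scaled_star_measurable[OF 1(2,4)]
    have mo: "(\<lambda>\<omega> n. c *\<^sub>R offset s \<omega> n) \<in> M \<rightarrow>\<^sub>M (\<Pi>\<^sub>M n\<in>UNIV. borel)"
    proof (rule measurable_PiM_single')
      note offset_measurable[OF 1(2), measurable]
      show "(\<lambda>\<omega>. c *\<^sub>R offset s \<omega> n) \<in> borel_measurable M" for n by measurable
    qed auto
    have "emeasure (distr M route_seq (\<lambda>\<omega> n. scale c (star s \<omega> n))) (prod_emb UNIV (\<lambda>_. route_space) J (Pi\<^sub>E J A)) =
        emeasure M ((\<lambda>\<omega> n. scale c (star s \<omega> n)) -` prod_emb UNIV (\<lambda>_. route_space) J (Pi\<^sub>E J A) \<inter> space M)"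
      using J by (intro emeasure_distr[OF ms] sets_PiM_I) auto
    also have "(\<lambda>\<omega> n. scale c (star s \<omega> n)) -` prod_emb UNIV (\<lambda>_. route_space) J (Pi\<^sub>E J A) \<inter> space M =
        {\<omega>\<in>space M. (\<lambda>n\<in>{..<k}. scale c (star s \<omega> n)) \<in> ?B}"
    proof -
      have "scale c (star s \<omega> n) \<in> space route_space" if "\<omega> \<in> space M" for \<omega> n
        using measurable_space[OF ms that] by (simp add: space_PiM PiE_iff)
      then show ?thesis using k by (auto simp: prod_emb_def PiE_iff space_PiM subset_iff)
    qed
    also have "emeasure M \<dots> = (\<integral>\<^sup>+ \<omega>. star_kernel k ?B (\<lambda>n. c *\<^sub>R offset s \<omega> n) \<partial>M)"
      by (rule star_law[OF 1(2,3,4) B])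
    also have "\<dots> = (\<integral>\<^sup>+ d. star_kernel k ?B d \<partial>distr M (\<Pi>\<^sub>M n\<in>UNIV. borel) (\<lambda>\<omega> n. c *\<^sub>R offset s \<omega> n))"
      by (rule nn_integral_distr[OF mo, symmetric]) (simp add: star_kernel_measurable[OF B])
    finally show ?thesis .
  qed
  show "emeasure (distr M route_seq (\<lambda>\<omega> n. scale c (conditional_routes.star Y R s \<omega> n)))
      (prod_emb UNIV (\<lambda>_. route_space) J (Pi\<^sub>E J A)) =
    emeasure (distr M' route_seq (\<lambda>\<omega> n. scale c' (conditional_routes.star Y' R' s' \<omega> n)))
      (prod_emb UNIV (\<lambda>_. route_space) J (Pi\<^sub>E J A))"
    unfolding cyl[OF 1] cyl[OF 2] eq ..
next
  interpret conditional_routes \<mu> M Y R by fact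
  show "finite_measure (distr M route_seq (\<lambda>\<omega> n. scale c (star s \<omega> n)))"
    by (intro finite_measure_distr scaled_star_measurable 1)
qed simp_all

text \<open>The conditioning event concerns the points only, so in the conditional law it is
  absorbed into \<open>A\<close>.\<close>

lemma conditional_routes_uniform:
  assumes "conditional_routes \<mu> M Y R" and A0: "A0 \<in> sets point_seq"
    and pos: "emeasure M {\<omega>\<in>space M. (\<lambda>n. Y n \<omega>) \<in> A0} \<noteq> 0"
  shows "conditional_routes \<mu> (uniform_measure M {\<omega>\<in>space M. (\<lambda>n. Y n \<omega>) \<in> A0}) Y R"
proof -
  interpret conditional_routes \<mu> M Y R by fact
  let ?E = "{\<omega>\<in>space M. (\<lambda>n. Y n \<omega>) \<in> A0}"
  have E[measurable]: "?E \<in> sets M"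
    using measurable_sets[OF Y_measurable A0] by (simp add: vimage_def Int_def conj_commute)
  interpret U: prob_space "uniform_measure M ?E"
    using pos by (intro prob_space_uniform_measure) auto
  show ?thesis
  proof
    show "Y n \<in> borel_measurable (uniform_measure M ?E)" for n by simp
    show "R (i, j) \<in> uniform_measure M ?E \<rightarrow>\<^sub>M route_space" if "i \<noteq> j" for i j using R_measurable[OF that] by simp
    show "AE \<omega> in uniform_measure M ?E. inj (\<lambda>i. site Y i \<omega>)"
      using distinct_sites by (intro AE_uniform_measureI) auto
    fix A B k assume A: "A \<in> sets point_seq" and B: "B \<in> sets (net_space k)"
    have "(\<lambda>\<omega>. \<lambda>i\<in>{..<k}. site Y i \<omega>) \<in> M \<rightarrow>\<^sub>M (\<Pi>\<^sub>M i\<in>{..<k}. borel)" by measurable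
    then have K[measurable]: "(\<lambda>\<omega>. K k B (\<lambda>i\<in>{..<k}. site Y i \<omega>)) \<in> borel_measurable M"
      by (rule measurable_compose[OF _ K_measurable[OF B]])
    have [measurable]: "(\<lambda>\<omega>. indicator A (\<lambda>n. Y n \<omega>) :: ennreal) \<in> borel_measurable M"
      using A by (intro measurable_compose[OF Y_measurable] borel_measurable_indicator)
    have S: "{\<omega> \<in> space M. (\<lambda>n. Y n \<omega>) \<in> A \<and> (\<lambda>p\<in>pairs {..<k}. R p \<omega>) \<in> B} \<in> sets M"
    proof -
      have [measurable]: "Measurable.pred M (\<lambda>\<omega>. (\<lambda>n. Y n \<omega>) \<in> A)" "Measurable.pred M (\<lambda>\<omega>. (\<lambda>p\<in>pairs {..<k}. R p \<omega>) \<in> B)"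
        using pred_sets2[OF A Y_measurable] pred_sets2[OF B R_net_measurable] by simp_all
      show ?thesis by measurable
    qed
    have "emeasure (uniform_measure M ?E) {\<omega> \<in> space (uniform_measure M ?E). (\<lambda>n. Y n \<omega>) \<in> A \<and> (\<lambda>p\<in>pairs {..<k}. R p \<omega>) \<in> B} =
        emeasure M (?E \<inter> {\<omega> \<in> space M. (\<lambda>n. Y n \<omega>) \<in> A \<and> (\<lambda>p\<in>pairs {..<k}. R p \<omega>) \<in> B}) / emeasure M ?E"
      using E S by simp
    also have "?E \<inter> {\<omega> \<in> space M. (\<lambda>n. Y n \<omega>) \<in> A \<and> (\<lambda>p\<in>pairs {..<k}. R p \<omega>) \<in> B} =
        {\<omega> \<in> space M. (\<lambda>n. Y n \<omega>) \<in> A0 \<inter> A \<and> (\<lambda>p\<in>pairs {..<k}. R p \<omega>) \<in> B}" by blast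
    also have "emeasure M \<dots> = (\<integral>\<^sup>+ \<omega>. indicator (A0 \<inter> A) (\<lambda>n. Y n \<omega>) * K k B (\<lambda>i\<in>{..<k}. site Y i \<omega>) \<partial>M)"
      using A0 A by (intro cond_law B) simp
    also have "\<dots> = (\<integral>\<^sup>+ \<omega>. indicator A (\<lambda>n. Y n \<omega>) * K k B (\<lambda>i\<in>{..<k}. site Y i \<omega>) * indicator ?E \<omega> \<partial>M)"
      by (intro nn_integral_cong) (auto split: split_indicator)
    also have "\<dots> / emeasure M ?E = (\<integral>\<^sup>+ \<omega>. indicator A (\<lambda>n. Y n \<omega>) * K k B (\<lambda>i\<in>{..<k}. site Y i \<omega>) \<partial>uniform_measure M ?E)"
      by (rule nn_integral_uniform_measure[symmetric]) measurable
    finally show "emeasure (uniform_measure M ?E) {\<omega> \<in> space (uniform_measure M ?E). (\<lambda>n. Y n \<omega>) \<in> A \<and> (\<lambda>p\<in>pairs {..<k}. R p \<omega>) \<in> B} =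
       (\<integral>\<^sup>+ \<omega>. indicator A (\<lambda>n. Y n \<omega>) * K k B (\<lambda>i\<in>{..<k}. site Y i \<omega>) \<partial>uniform_measure M ?E)" .
  qed
qed

section \<open>The Poisson points and the routes from the origin\<close>

definition seq_arrived :: "real \<Rightarrow> (nat \<Rightarrow> point \<times> real) \<Rightarrow> nat set" where
  "seq_arrived l y = {Suc n |n. snd (y n) \<le> l}"

definition origin_indices :: "real \<Rightarrow> nat \<Rightarrow> (nat \<Rightarrow> point \<times> real) \<Rightarrow> nat" where
  "origin_indices l i y = (case i of 0 \<Rightarrow> 0 | Suc n \<Rightarrow> nth_nearest (seq_arrived l y) (\<lambda>i. seq_site i y) n)"

lemma arrived_seq_arrived: "arrived Y l \<omega> = seq_arrived l (\<lambda>n. Y n \<omega>)"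
  unfolding arrived_def seq_arrived_def ..

lemma Suc_in_seq_arrived: "Suc n \<in> seq_arrived l y \<longleftrightarrow> snd (y n) \<le> l"
  and zero_notin_seq_arrived: "0 \<notin> seq_arrived l y"
  by (auto simp: seq_arrived_def)

lemma snd_nth_measurable [measurable]: "(\<lambda>y. snd (y n)) \<in> borel_measurable point_seq"
proof -
  have [measurable]: "snd \<in> (borel :: (point \<times> real) measure) \<rightarrow>\<^sub>M borel"
    by (rule borel_measurable_continuous_onI) (intro continuous_intros)
  show ?thesis by measurable
qed

lemma seq_arrived_measurable [measurable]: "Measurable.pred point_seq (\<lambda>y. i \<in> seq_arrived l y)"
proof (cases i)
  case 0 then show ?thesis by (simp add: zero_notin_seq_arrived)
next
  case (Suc n)
  show ?thesis unfolding Suc Suc_in_seq_arrived by measurable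
qed

lemma nth_nearest_measurable:
  assumes [measurable]: "\<And>i. Measurable.pred N (\<lambda>y. i \<in> I y)" "\<And>i. x i \<in> borel_measurable N"
  shows "(\<lambda>y. nth_nearest (I y) (\<lambda>i. x i y) n) \<in> N \<rightarrow>\<^sub>M count_space UNIV"
  unfolding nth_nearest_def rank_def by measurable

lemma origin_indices_measurable [measurable]: "origin_indices l i \<in> point_seq \<rightarrow>\<^sub>M count_space UNIV"
proof (cases i)
  case (Suc n)
  show ?thesis unfolding Suc origin_indices_def[abs_def] nat.case by (rule nth_nearest_measurable) measurable
qed (simp add: origin_indices_def[abs_def])

lemma emeasure_space_time:
  assumes "A \<in> sets borel" "T \<in> sets borel"
  shows "emeasure space_time (A \<times> T) = emeasure lborel A * emeasure lborel (T \<inter> {0..})"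
proof -
  have AT: "A \<times> T \<in> sets borel" "A \<times> (T \<inter> {0..}) \<in> sets (borel \<Otimes>\<^sub>M borel)" "(UNIV \<times> {0..} :: (point \<times> real) set) \<in> sets borel"
    using assms by (auto simp: borel_Times intro!: pair_measureI borel_closed closed_Times)
  have "emeasure space_time (A \<times> T) = (\<integral>\<^sup>+ z. indicator (UNIV \<times> {0..}) z * indicator (A \<times> T) z \<partial>lborel)"
    unfolding space_time_def using AT by (intro emeasure_density) auto
  also have "\<dots> = (\<integral>\<^sup>+ z. indicator (A \<times> (T \<inter> {0..})) z \<partial>lborel)"
    by (intro nn_integral_cong) (auto split: split_indicator)
  also have "\<dots> = emeasure lborel (A \<times> (T \<inter> {0..}))"
    using assms by (intro nn_integral_indicator) (simp add: borel_Times)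
  also have "\<dots> = emeasure (lborel \<Otimes>\<^sub>M lborel) (A \<times> (T \<inter> {0..}))" by (simp add: lborel_prod)
  also have "\<dots> = emeasure lborel A * emeasure lborel (T \<inter> {0..})"
    using assms by (intro lborel.emeasure_pair_measure_Times) auto
  finally show ?thesis .
qed

lemma sets_space_time [simp]: "sets space_time = sets borel"
  by (simp add: space_time_def)

lemma measure_space_time_until: "A \<in> sets borel \<Longrightarrow> 0 < l \<Longrightarrow> measure space_time (A \<times> {..l}) = l * measure lborel A"
proof -
  assume A: "A \<in> sets borel" and l: "0 < l"
  have "{..l} \<inter> {0..} = {0..l}" by auto
  then have "emeasure space_time (A \<times> {..l}) = emeasure lborel A * ennreal l"
    using emeasure_space_time[OF A, of "{..l}"] l by simp
  then show ?thesis unfolding measure_def using l by (simp add: enn2real_mult mult.commute)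
qed

lemma measure_space_time_unit: "A \<in> sets borel \<Longrightarrow> 0 < l \<Longrightarrow> measure space_time (A \<times> {l<..l + 1}) = measure lborel A"
proof -
  assume A: "A \<in> sets borel" and l: "0 < l"
  have "{l<..l + 1} \<inter> {0..} = {l<..l + 1}" using l by auto
  then have "emeasure space_time (A \<times> {l<..l + 1}) = emeasure lborel A"
    using emeasure_space_time[OF A, of "{l<..l + 1}"] by simp
  then show ?thesis unfolding measure_def by simp
qed

lemma finite_space_time:
  assumes "A \<in> sets borel" "bounded A" "T \<in> sets borel" "emeasure lborel (T \<inter> {0..}) < \<infinity>"
  shows "emeasure space_time (A \<times> T) < \<infinity>"
  using emeasure_space_time[OF assms(1,3)] emeasure_bounded_finite[OF assms(2)] assms(4)
  by (simp add: ennreal_mult_less_top)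

section \<open>Counts and genericity of the arrived points\<close>

context sampled_routes
begin

lemma Y_nth_borel [measurable]: "Y n \<in> borel_measurable M"
proof -
  have "Y n \<in> M \<rightarrow>\<^sub>M space_time" using poisson unfolding poisson_points_def by blast
  then show ?thesis by (simp add: measurable_cong_sets[OF refl sets_space_time])
qed

lemma Y_seq_measurable [measurable]: "(\<lambda>\<omega> n. Y n \<omega>) \<in> M \<rightarrow>\<^sub>M point_seq"
  by (rule measurable_PiM_single') auto

lemma count_measurable [measurable]:
  assumes [measurable]: "A \<in> sets borel"
  shows "(\<lambda>\<omega>. card {n. Y n \<omega> \<in> A}) \<in> M \<rightarrow>\<^sub>M count_space UNIV"
    and "Measurable.pred M (\<lambda>\<omega>. finite {n. Y n \<omega> \<in> A})"
proof -
  have m: "Measurable.pred M (\<lambda>\<omega>. Y i \<omega> \<in> A)" for i by measurable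
  show "(\<lambda>\<omega>. card {n. Y n \<omega> \<in> A}) \<in> M \<rightarrow>\<^sub>M count_space UNIV"
    using m by (intro measurable_card) (simp add: pred_def)
  note m[measurable]
  show "Measurable.pred M (\<lambda>\<omega>. finite {n. Y n \<omega> \<in> A})"
    unfolding finite_nat_set_iff_bounded Ball_def mem_Collect_eq by measurable
qed

lemma count_law:
  assumes "A \<in> sets borel" "emeasure space_time A < \<infinity>"
  shows "prob {\<omega> \<in> space M. finite {n. Y n \<omega> \<in> A} \<and> card {n. Y n \<omega> \<in> A} = k} = poisson_prob (measure space_time A) k"
  using poisson assms unfolding poisson_points_def poisson_prob_def by simp

text \<open>The prescribed law counts only finite outcomes, and the Poisson weights sum to
  1.\<close>

lemma AE_count_finite:
  assumes A: "A \<in> sets borel" "emeasure space_time A < \<infinity>"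
  shows "AE \<omega> in M. finite {n. Y n \<omega> \<in> A}"
proof -
  note A(1)[measurable]
  let ?a = "measure space_time A"
  let ?F = "\<lambda>k. {\<omega> \<in> space M. finite {n. Y n \<omega> \<in> A} \<and> card {n. Y n \<omega> \<in> A} = k}"
  have F[measurable]: "?F k \<in> sets M" for k by measurable
  have "(\<lambda>k. prob (?F k)) sums prob (\<Union>k. ?F k)"
    by (rule finite_measure_UNION) (auto simp: disjoint_family_on_def F)
  moreover have "(\<lambda>k. prob (?F k)) sums 1"
  proof -
    have "(\<lambda>k. ?a ^ k / fact k * exp (- ?a)) sums (exp ?a * exp (- ?a))"
      using exp_converges[of ?a] by (intro sums_mult2) (simp add: divide_inverse scaleR_conv_of_real mult.commute)
    then show ?thesis unfolding count_law[OF A] poisson_prob_def by (simp add: exp_minus)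
  qed
  ultimately have "prob (\<Union>k. ?F k) = 1" by (rule sums_unique2)
  moreover have "(\<Union>k. ?F k) \<in> events" by measurable
  ultimately have "AE \<omega> in M. \<omega> \<in> (\<Union>k. ?F k)" by (simp add: prob_eq_1)
  then show ?thesis by eventually_elim auto
qed

text \<open>\<open>card\<close> is 0 on infinite sets, so bare counts have the Poisson law only
  after the null set of infinite counts is discarded.\<close>

lemma joint_counts:
  fixes C :: "nat \<Rightarrow> (point \<times> real) set"
  assumes J: "finite J" "disjoint_family_on C J" "\<And>j. j \<in> J \<Longrightarrow> C j \<in> sets borel \<and> emeasure space_time (C j) < \<infinity>"
  shows "prob {\<omega>\<in>space M. \<forall>j\<in>J. card {n. Y n \<omega> \<in> C j} = k j} = (\<Prod>j\<in>J. poisson_prob (measure space_time (C j)) (k j))"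
proof (cases "J = {}")
  case True then show ?thesis by (simp add: prob_space)
next
  case False
  have ind: "indep_vars (\<lambda>_. count_space UNIV) (\<lambda>j \<omega>. card {n. Y n \<omega> \<in> C j}) J"
    using poisson J unfolding poisson_points_def by simp
  have "{\<omega>\<in>space M. \<forall>j\<in>J. card {n. Y n \<omega> \<in> C j} = k j} =
      (\<Inter>j\<in>J. (\<lambda>\<omega>. card {n. Y n \<omega> \<in> C j}) -` {k j} \<inter> space M)" using False by auto
  also have "prob \<dots> = (\<Prod>j\<in>J. prob ((\<lambda>\<omega>. card {n. Y n \<omega> \<in> C j}) -` {k j} \<inter> space M))"
    by (rule indep_varsD_finite[OF ind False J(1)]) simp
  also have "\<dots> = (\<Prod>j\<in>J. poisson_prob (measure space_time (C j)) (k j))"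
  proof (intro prod.cong refl)
    fix j assume j: "j \<in> J"
    then have C: "C j \<in> sets borel" "emeasure space_time (C j) < \<infinity>" using J(3) by auto
    note C(1)[measurable]
    have "prob ((\<lambda>\<omega>. card {n. Y n \<omega> \<in> C j}) -` {k j} \<inter> space M) =
        prob {\<omega> \<in> space M. finite {n. Y n \<omega> \<in> C j} \<and> card {n. Y n \<omega> \<in> C j} = k j}"
    proof (rule measure_eq_AE)
      show "AE \<omega> in M. \<omega> \<in> (\<lambda>\<omega>. card {n. Y n \<omega> \<in> C j}) -` {k j} \<inter> space M \<longleftrightarrow>
          \<omega> \<in> {\<omega> \<in> space M. finite {n. Y n \<omega> \<in> C j} \<and> card {n. Y n \<omega> \<in> C j} = k j}"
        using AE_count_finite[OF C] by eventually_elim auto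
      show "(\<lambda>\<omega>. card {n. Y n \<omega> \<in> C j}) -` {k j} \<inter> space M \<in> events"
        by (rule measurable_sets[OF count_measurable(1)[OF C(1)]]) simp
      show "{\<omega> \<in> space M. finite {n. Y n \<omega> \<in> C j} \<and> card {n. Y n \<omega> \<in> C j} = k j} \<in> events"
        by measurable
    qed
    then show "prob ((\<lambda>\<omega>. card {n. Y n \<omega> \<in> C j}) -` {k j} \<inter> space M) = poisson_prob (measure space_time (C j)) (k j)"
      by (simp only: count_law[OF C])
  qed
  finally show ?thesis .
qed

lemma number_in_arrived:
  "number_in (arrived Y l \<omega>) (\<lambda>i. site Y i \<omega>) A = card {n. Y n \<omega> \<in> A \<times> {..l}}"
proof -
  have "{i\<in>arrived Y l \<omega>. site Y i \<omega> \<in> A} = Suc ` {n. Y n \<omega> \<in> A \<times> {..l}}"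
    by (auto simp: arrived_def site_def mem_Times_iff)
  then show ?thesis unfolding number_in_def by (simp add: card_image)
qed

lemma arrived_pred [measurable]: "Measurable.pred M (\<lambda>\<omega>. i \<in> arrived Y l \<omega>)"
  unfolding arrived_seq_arrived by measurable

lemma site_borel [measurable]: "site Y i \<in> borel_measurable M"
  unfolding site_seq_site[abs_def] by measurable

lemma AE_arrived_locally_finite:
  assumes l: "0 < l"
  shows "AE \<omega> in M. \<forall>r. finite {i\<in>arrived Y l \<omega>. norm (site Y i \<omega>) \<le> r}"
proof -
  have "AE \<omega> in M. \<forall>R::nat. finite {n. Y n \<omega> \<in> cball 0 (real R) \<times> {..l}}"
    unfolding AE_all_countable
  proof
    fix R :: nat
    have "{..l} \<inter> {0..} = {0..l}" by auto
    then have "emeasure space_time (cball 0 (real R) \<times> {..l}) < \<infinity>"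
      using l by (intro finite_space_time) auto
    then show "AE \<omega> in M. finite {n. Y n \<omega> \<in> cball 0 (real R) \<times> {..l}}"
      by (intro AE_count_finite borel_closed closed_Times) auto
  qed
  then show ?thesis
  proof eventually_elim
    case (elim \<omega>)
    show ?case
    proof
      fix r :: real
      obtain R :: nat where R: "r \<le> R" using real_arch_simple by blast
      have "{i\<in>arrived Y l \<omega>. norm (site Y i \<omega>) \<le> r} \<subseteq> Suc ` {n. Y n \<omega> \<in> cball 0 (real R) \<times> {..l}}"
        using R by (auto simp: arrived_def site_def mem_Times_iff)
      then show "finite {i\<in>arrived Y l \<omega>. norm (site Y i \<omega>) \<le> r}"
        by (rule finite_subset) (rule finite_imageI, rule elim[rule_format])
    qed
  qed
qed

lemma arrived_poisson:
  assumes l: "0 < l"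
  shows "poisson_family M l (arrived Y l) (site Y)"
proof
  show "0 < l" by fact
  show "AE \<omega> in M. \<forall>r. finite {i\<in>arrived Y l \<omega>. norm (site Y i \<omega>) \<le> r}" by (rule AE_arrived_locally_finite[OF l])
  fix J :: "nat set" and A :: "nat \<Rightarrow> point set" and k
  assume J: "finite J" "disjoint_family_on A J" "\<And>j. j \<in> J \<Longrightarrow> A j \<in> sets borel \<and> bounded (A j)"
  have "prob {\<omega>\<in>space M. \<forall>j\<in>J. card {n. Y n \<omega> \<in> A j \<times> {..l}} = k j} = (\<Prod>j\<in>J. poisson_prob (measure space_time (A j \<times> {..l})) (k j))"
  proof (rule joint_counts[OF J(1)])
    show "disjoint_family_on (\<lambda>j. A j \<times> {..l}) J" using J(2) unfolding disjoint_family_on_def by blast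
    have "{..l} \<inter> {0..} = {0..l}" by auto
    then show "A j \<times> {..l} \<in> sets borel \<and> emeasure space_time (A j \<times> {..l}) < \<infinity>" if "j \<in> J" for j
      using J(3)[OF that] l by (intro conjI borel_Times finite_space_time) auto
  qed
  also have "\<dots> = (\<Prod>j\<in>J. poisson_prob (l * measure lborel (A j)) (k j))"
    using J(3) l by (intro prod.cong refl) (simp add: measure_space_time_until)
  finally show "prob {\<omega>\<in>space M. \<forall>j\<in>J. number_in (arrived Y l \<omega>) (\<lambda>i. site Y i \<omega>) (A j) = k j} =
      (\<Prod>j\<in>J. poisson_prob (l * measure lborel (A j)) (k j))"
    unfolding number_in_arrived .
qed measurable

lemma AE_generic:
  assumes "0 < l"
  shows "AE \<omega> in M. generic_points (arrived Y l \<omega>) (\<lambda>i. site Y i \<omega>)"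
  by (rule poisson_family.AE_generic[OF arrived_poisson[OF assms]])

text \<open>Any two points have arrived by a common time, at which the configuration is generic;
  site 0 is distinguished by \<open>nonzero\<close>.\<close>

lemma AE_distinct_sites: "AE \<omega> in M. inj (\<lambda>i. site Y i \<omega>)"
proof -
  have "AE \<omega> in M. \<forall>l::nat. generic_points (arrived Y (real (Suc l)) \<omega>) (\<lambda>i. site Y i \<omega>)"
    unfolding AE_all_countable by (intro allI AE_generic) simp
  then show ?thesis
  proof eventually_elim
    case (elim \<omega>)
    have arr: "\<exists>l0::nat. \<forall>l\<ge>l0. i = 0 \<or> i \<in> arrived Y (real (Suc l)) \<omega>" for i
    proof (cases i)
      case (Suc n)
      obtain l0 :: nat where "snd (Y n \<omega>) \<le> l0" using real_arch_simple by blast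
      then have "\<forall>l\<ge>l0. i \<in> arrived Y (real (Suc l)) \<omega>" unfolding Suc arrived_seq_arrived Suc_in_seq_arrived by auto
      then show ?thesis by blast
    qed simp
    show ?case
    proof (rule injI)
      fix i j assume eq: "site Y i \<omega> = site Y j \<omega>"
      obtain a where a: "\<forall>l\<ge>a. i = 0 \<or> i \<in> arrived Y (real (Suc l)) \<omega>" using arr by blast
      obtain b where b: "\<forall>l\<ge>b. j = 0 \<or> j \<in> arrived Y (real (Suc l)) \<omega>" using arr by blast
      let ?l = "max a b"
      interpret generic_points "arrived Y (real (Suc ?l)) \<omega>" "\<lambda>i. site Y i \<omega>" by (rule elim[rule_format])
      have i: "i = 0 \<or> i \<in> arrived Y (real (Suc ?l)) \<omega>" using a[rule_format, of ?l] by simp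
      have j: "j = 0 \<or> j \<in> arrived Y (real (Suc ?l)) \<omega>" using b[rule_format, of ?l] by simp
      have s0: "site Y 0 \<omega> = 0" by (simp add: site_def)
      show "i = j"
      proof (cases "i = 0 \<or> j = 0")
        case True then show ?thesis using i j eq s0 nonzero by metis
      next
        case False
        then show ?thesis using inj_onD[OF distinct_norms, of i j] i j eq by simp
      qed
    qed
  qed
qed

lemma conditional: "conditional_routes \<mu> M Y R"
proof
  show "AE \<omega> in M. inj (\<lambda>i. site Y i \<omega>)" by (rule AE_distinct_sites)
  fix A B k assume A: "A \<in> sets point_seq" and B: "B \<in> sets (net_space k)"
  have "emeasure M {\<omega> \<in> space M. (\<lambda>n. Y n \<omega>) \<in> A \<and> (\<lambda>p\<in>pairs {..<k}. R p \<omega>) \<in> B} =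
      (\<integral>\<^sup>+ \<omega>. indicator A (\<lambda>n. Y n \<omega>) * emeasure (\<mu> k (\<lambda>i\<in>{..<k}. site Y i \<omega>)) B \<partial>M)"
    by (rule conditional_law[OF A B])
  also have "\<dots> = (\<integral>\<^sup>+ \<omega>. indicator A (\<lambda>n. Y n \<omega>) * K k B (\<lambda>i\<in>{..<k}. site Y i \<omega>) \<partial>M)"
  proof (rule nn_integral_cong_AE)
    show "AE \<omega> in M. indicator A (\<lambda>n. Y n \<omega>) * emeasure (\<mu> k (\<lambda>i\<in>{..<k}. site Y i \<omega>)) B =
        indicator A (\<lambda>n. Y n \<omega>) * K k B (\<lambda>i\<in>{..<k}. site Y i \<omega>)"
      using AE_distinct_sites
    proof eventually_elim
      case (elim \<omega>)
      then have "inj_on (\<lambda>i\<in>{..<k}. site Y i \<omega>) {..<k}" by (auto simp: inj_on_def)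
      then show ?case unfolding K_def by (simp only: if_True)
    qed
  qed
  finally show "emeasure M {\<omega> \<in> space M. (\<lambda>n. Y n \<omega>) \<in> A \<and> (\<lambda>p\<in>pairs {..<k}. R p \<omega>) \<in> B} =
      (\<integral>\<^sup>+ \<omega>. indicator A (\<lambda>n. Y n \<omega>) * K k B (\<lambda>i\<in>{..<k}. site Y i \<omega>) \<partial>M)" .
qed (use route_measurable in measurable)

sublocale conditional_routes \<mu> M Y R
  by (rule conditional)

section \<open>The routes from the origin, listed by the distance of their ends\<close>

lemma origin_indices_eq:
  "origin_indices l (Suc n) (\<lambda>n. Y n \<omega>) = nth_nearest (arrived Y l \<omega>) (\<lambda>i. site Y i \<omega>) n"
  "origin_indices l 0 y = 0"
  unfolding origin_indices_def arrived_seq_arrived site_seq_site by simp_all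

lemma AE_origin_indices_inj:
  assumes "0 < l"
  shows "AE \<omega> in M. inj (\<lambda>i. origin_indices l i (\<lambda>n. Y n \<omega>))"
  using AE_generic[OF assms]
proof eventually_elim
  case (elim \<omega>)
  interpret generic_points "arrived Y l \<omega>" "\<lambda>i. site Y i \<omega>" by (rule elim)
  let ?j = "nth_nearest (arrived Y l \<omega>) (\<lambda>i. site Y i \<omega>)"
  have pos: "origin_indices l (Suc n) (\<lambda>n. Y n \<omega>) \<noteq> 0" for n
    using nth_nearest(1)[of n] zero_notin_seq_arrived unfolding origin_indices_eq arrived_seq_arrived by metis
  show ?case
  proof (rule injI)
    fix i j assume eq: "origin_indices l i (\<lambda>n. Y n \<omega>) = origin_indices l j (\<lambda>n. Y n \<omega>)"
    show "i = j"
    proof (cases i; cases j)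
      fix m n assume ij: "i = Suc m" "j = Suc n"
      have "?j m = ?j n" using eq unfolding ij origin_indices_eq .
      then show "i = j" using nth_nearest_bij unfolding ij bij_betw_def by (auto dest: injD)
    qed (use eq pos origin_indices_eq(2) in metis)+
  qed
qed

lemma offset_origin: "offset (origin_indices l) \<omega> = poisson_family.sorted (arrived Y l) (site Y) \<omega>" if "0 < l"
proof -
  interpret P: poisson_family M l "arrived Y l" "site Y" by (rule arrived_poisson[OF that])
  show ?thesis unfolding offset_def P.sorted_def P.index_def origin_indices_eq by (simp add: site_def)
qed

lemma scale_1_star: "\<omega> \<in> space M \<Longrightarrow> (\<And>i. s i \<in> point_seq \<rightarrow>\<^sub>M count_space UNIV) \<Longrightarrow> scale 1 (star s \<omega> n) = star s \<omega> n"
  using measurable_space[OF star_nth_measurable, of s \<omega> n] unfolding space_route_space_eq scale_def compose_def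
  by (auto simp: fun_eq_iff extensional_def)

text \<open>The dilated points form a Poisson process of rate \<open>l / c\<^sup>2\<close>, and
  dilation preserves the order by distance. So the scaled offsets have the law of the offsets at the
  new rate.\<close>

lemma star_scaling:
  assumes l: "0 < l" and c: "0 < c"
  shows "distr M route_seq (\<lambda>\<omega> n. scale c (star (origin_indices l) \<omega> n)) = distr M route_seq (star (origin_indices (l / c\<^sup>2)))"
proof -
  let ?l = "l / c\<^sup>2"
  have l': "0 < ?l" using l c by simp
  interpret P: poisson_family M l "arrived Y l" "site Y" by (rule arrived_poisson[OF l])
  have F: "poisson_family M ?l (arrived Y l) (\<lambda>i \<omega>. c *\<^sub>R site Y i \<omega>)" using P.similar[OF c, of 0] by simp
  interpret Q: poisson_family M ?l "arrived Y l" "\<lambda>i \<omega>. c *\<^sub>R site Y i \<omega>" by (rule F)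
  have "(\<lambda>\<omega> n. c *\<^sub>R offset (origin_indices l) \<omega> n) = Q.sorted"
    unfolding offset_origin[OF l] Q.sorted_def P.sorted_def P.index_def Q.index_def nth_nearest_scale[OF c] by (intro ext) simp
  then have "distr M (\<Pi>\<^sub>M n\<in>UNIV. borel) (\<lambda>\<omega> n. c *\<^sub>R offset (origin_indices l) \<omega> n) =
      distr M (\<Pi>\<^sub>M n\<in>UNIV. borel) (\<lambda>\<omega> n. 1 *\<^sub>R offset (origin_indices ?l) \<omega> n)"
    using sorted_law_unique[OF F arrived_poisson[OF l']] offset_origin[OF l'] by simp
  from star_law_unique[OF conditional origin_indices_measurable AE_origin_indices_inj[OF l] c
      conditional origin_indices_measurable AE_origin_indices_inj[OF l'] zero_less_one this]
  have "distr M route_seq (\<lambda>\<omega> n. scale c (star (origin_indices l) \<omega> n)) =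
      distr M route_seq (\<lambda>\<omega> n. scale 1 (star (origin_indices ?l) \<omega> n))" .
  also have "\<dots> = distr M route_seq (star (origin_indices ?l))"
    by (rule distr_cong) (auto simp: scale_1_star)
  finally show ?thesis .
qed

text \<open>These routes start at 0 already, so recentring does not change them, and the list
  enumerates the actual routes to the arrived points.\<close>

lemma AE_origin_star:
  assumes "0 < l"
  shows "AE \<omega> in M. origin_routes (star (origin_indices l) \<omega>) \<and>
    range (star (origin_indices l) \<omega>) = (\<lambda>j. R (0, j) \<omega>) ` arrived Y l \<omega>"
proof -
  have ends: "AE \<omega> in M. \<forall>j. 0 \<noteq> j \<longrightarrow> R (0, j) \<omega> 0 = site Y 0 \<omega> \<and> R (0, j) \<omega> 1 = site Y j \<omega>"
    unfolding AE_all_countable using AE_route_end by auto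
  have al: "AE \<omega> in M. \<forall>j m. 0 \<noteq> j \<longrightarrow> 0 \<noteq> m \<longrightarrow> aligned (rebase (R (0, j) \<omega>)) (rebase (R (0, m) \<omega>))"
    unfolding AE_all_countable using AE_aligned by auto
  show ?thesis
    using AE_generic[OF assms] ends al AE_space
  proof eventually_elim
    case (elim \<omega>)
    interpret generic_points "arrived Y l \<omega>" "\<lambda>i. site Y i \<omega>" by (rule elim)
    let ?j = "\<lambda>n. nth_nearest (arrived Y l \<omega>) (\<lambda>i. site Y i \<omega>) n"
    let ?g = "star (origin_indices l) \<omega>"
    have j0: "0 \<noteq> ?j n" for n
      using nth_nearest(1)[of n] zero_notin_seq_arrived unfolding arrived_seq_arrived by metis
    have sr: "R (0, ?j n) \<omega> \<in> space route_space" for n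
      by (rule measurable_space[OF R_measurable[OF j0] elim(4)])
    have g: "?g n = rebase (R (0, ?j n) \<omega>)" for n
      unfolding star_def origin_indices_eq safe_route_def using j0[of n] by simp
    have R0: "R (0, ?j n) \<omega> 0 = 0" for n using elim(2) j0[of n] by (simp add: site_def)
    then have gR: "?g n = R (0, ?j n) \<omega>" for n
      unfolding g rebase_def compose_def using sr[of n] by (auto simp: space_route_space_eq fun_eq_iff extensional_def)
    have "origin_routes ?g"
    proof
      show "is_route (?g n)" for n unfolding gR by (rule space_route_space[OF sr])
      show "?g n 0 = 0" for n unfolding gR R0 ..
      show "aligned (?g i) (?g j)" for i j unfolding g using elim(3) j0 by blast
      fix r
      have "?g n 1 = site Y (?j n) \<omega>" for n unfolding gR using elim(2) j0[of n] by simp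
      then have "{n. norm (?g n 1) \<le> r} \<subseteq> ?j -` {i\<in>arrived Y l \<omega>. norm (site Y i \<omega>) \<le> r}" using nth_nearest(1) by auto
      moreover have "finite (?j -` {i\<in>arrived Y l \<omega>. norm (site Y i \<omega>) \<le> r})"
        using nth_nearest_bij by (intro finite_vimageI locally_finite) (auto simp: bij_betw_def)
      ultimately show "finite {n. norm (?g n 1) \<le> r}" by (rule finite_subset)
    qed
    moreover have "range ?g = (\<lambda>j. R (0, j) \<omega>) ` range ?j" unfolding image_image gR ..
    moreover have "range ?j = arrived Y l \<omega>" using nth_nearest_bij unfolding bij_betw_def by simp
    ultimately show ?case by simp
  qed
qed

end

section \<open>A typical point in place of the origin\<close>

text \<open>Routes that do not meet beyond \<rho> have disjoint traces in the annulus, so their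
  lengths add up inside the union.\<close>

lemma crossing_length_le_len:
  assumes route: "\<And>n. is_route (g n)"
  shows "crossing_length \<rho> g \<le> len (\<Union>n\<in>far \<rho> g. g n ` annulus_time \<rho> (g n))"
  unfolding crossing_length_def
proof (rule SUP_least)
  fix S :: "nat set" assume "S \<in> {S. finite S}"
  then have fin: "finite S" by simp
  show "(if S \<subseteq> far \<rho> g \<and> apart \<rho> g S then \<Sum>n\<in>S. annulus_length \<rho> (g n) else 0) \<le>
      len (\<Union>n\<in>far \<rho> g. g n ` annulus_time \<rho> (g n))"
  proof (cases "S \<subseteq> far \<rho> g \<and> apart \<rho> g S")
    case True
    have "(\<Sum>n\<in>S. annulus_length \<rho> (g n)) \<le> len (\<Union>n\<in>far \<rho> g. g n ` annulus_time \<rho> (g n))"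
      unfolding annulus_length_def
    proof (rule len_ge_routes[OF fin])
      fix i j assume ij: "i \<in> S" "j \<in> S" "i \<noteq> j"
      then have "\<not> meets \<rho> g i j" using True unfolding apart_def by blast
      then have "norm x \<le> \<rho>" if "x \<in> path_image (g i)" "x \<in> path_image (g j)" for x
        using that unfolding meets_def by (meson linear)
      then have "norm (g i t) \<le> \<rho>" if "t \<in> {0..1}" "u \<in> {0..1}" "g i t = g j u" for t u
        using that unfolding path_image_def by (metis imageI)
      then show "g i ` annulus_time \<rho> (g i) \<inter> g j ` annulus_time \<rho> (g j) = {}"
        unfolding annulus_time_def by fastforce
    next
      fix i assume i: "i \<in> S"
      show "is_route (g i)" by (rule route)
      show "annulus_time \<rho> (g i) \<in> sets borel" by (rule annulus_time_borel[OF route])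
      show "annulus_time \<rho> (g i) \<subseteq> {0..1}" unfolding annulus_time_def by blast
      show "g i ` annulus_time \<rho> (g i) \<subseteq> (\<Union>n\<in>far \<rho> g. g n ` annulus_time \<rho> (g n))" using True i by blast
    qed
    then show ?thesis unfolding if_P[OF True] .
  next
    case False
    then show ?thesis unfolding if_not_P[OF False] by simp
  qed
qed

text \<open>The radius is small enough for the disc of radius 2 about any of its points to lie in
  \<open>cball 0 3\<close>, and positive area gives the conditioning event positive
  probability.\<close>

definition near_origin :: "point set" where "near_origin = cball 0 (1 / 4)"

text \<open>Arrivals after time \<open>l\<close> are independent of the points of \<Xi>(l), and
  those up to \<open>l + 1\<close> belong to \<Xi>(l + 1).\<close>

definition window :: "real \<Rightarrow> (point \<times> real) set" where
  "window l = near_origin \<times> {l<..l + 1}"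

text \<open>A site index, hence the shift by one. It is used on \<open>one_centre\<close>, where the
  point in the window is unique.\<close>

definition centre_index :: "real \<Rightarrow> (nat \<Rightarrow> point \<times> real) \<Rightarrow> nat" where
  "centre_index l y = (LEAST i. \<exists>n. i = Suc n \<and> y n \<in> window l)"

definition one_centre :: "real \<Rightarrow> (nat \<Rightarrow> point \<times> real) set" where
  "one_centre l = {y \<in> space point_seq. card {n. y n \<in> window l} = 1}"

text \<open>The view from a typical point, as under a Palm distribution: the centre comes first,
  then the points of \<Xi>(l), to which it does not belong, by distance from it.\<close>

definition palm_indices :: "real \<Rightarrow> nat \<Rightarrow> (nat \<Rightarrow> point \<times> real) \<Rightarrow> nat" where
  "palm_indices l i y = (case i of 0 \<Rightarrow> centre_index l y
     | Suc n \<Rightarrow> nth_nearest (seq_arrived l y) (\<lambda>i. seq_site i y - seq_site (centre_index l y) y) n)"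

lemma near_origin_borel [measurable]: "near_origin \<in> sets borel"
  by (simp add: near_origin_def)

lemma window_borel [measurable]: "window l \<in> sets borel"
  unfolding window_def by (intro borel_Times) auto

lemma window_pred [measurable]: "Measurable.pred point_seq (\<lambda>y. y n \<in> window l)"
  by (rule pred_sets2[OF window_borel]) (rule measurable_component_singleton, simp)

lemma centre_index_measurable [measurable]: "centre_index l \<in> point_seq \<rightarrow>\<^sub>M count_space UNIV"
proof -
  have "Measurable.pred point_seq (\<lambda>y. \<exists>n. i = Suc n \<and> y n \<in> window l)" for i by measurable
  then show ?thesis unfolding centre_index_def[abs_def] by (rule measurable_Least)
qed

lemma centre_measurable [measurable]: "(\<lambda>y. seq_site (centre_index l y) y) \<in> borel_measurable point_seq"
  by (rule measurable_compose_countable) measurable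

lemma one_centre_sets [measurable]: "one_centre l \<in> sets point_seq"
proof -
  have "(\<lambda>y. card {n. y n \<in> window l}) \<in> point_seq \<rightarrow>\<^sub>M count_space UNIV"
    using window_pred[of _ l] by (intro measurable_card) (simp add: pred_def)
  then show ?thesis unfolding one_centre_def by measurable
qed

lemma palm_indices_measurable [measurable]: "palm_indices l i \<in> point_seq \<rightarrow>\<^sub>M count_space UNIV"
proof (cases i)
  case 0 then show ?thesis by (simp add: palm_indices_def[abs_def])
next
  case (Suc n)
  show ?thesis unfolding Suc palm_indices_def[abs_def] nat.case by (rule nth_nearest_measurable) measurable
qed

lemma one_centreD:
  assumes "y \<in> one_centre l"
  shows "\<exists>n. {n. y n \<in> window l} = {n} \<and> centre_index l y = Suc n"
proof -
  have "card {n. y n \<in> window l} = 1" using assms unfolding one_centre_def by simp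
  then obtain n where n: "{n. y n \<in> window l} = {n}" by (rule card_1_singletonE)
  have iff: "y k \<in> window l \<longleftrightarrow> k = n" for k
    using n by (metis mem_Collect_eq singleton_iff)
  have "(\<lambda>i. \<exists>n. i = Suc n \<and> y n \<in> window l) = (\<lambda>i. i = Suc n)" unfolding iff by auto
  then have "centre_index l y = (LEAST i. i = Suc n)" unfolding centre_index_def by simp
  also have "\<dots> = Suc n" by (rule Least_equality) auto
  finally show ?thesis using n by blast
qed

text \<open>Meant for events about later arrivals, which are independent of all the counts
  concerned.\<close>

lemma poisson_family_uniform:
  assumes F: "poisson_family M l I x" and E[measurable]: "E \<in> sets M" and pos: "measure M E \<noteq> 0"
    and ind: "\<And>J (A :: nat \<Rightarrow> point set) k. finite J \<Longrightarrow> disjoint_family_on A J \<Longrightarrow> (\<And>j. j \<in> J \<Longrightarrow> A j \<in> sets borel \<and> bounded (A j)) \<Longrightarrow>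
      measure M (E \<inter> {\<omega>\<in>space M. \<forall>j\<in>J. number_in (I \<omega>) (\<lambda>i. x i \<omega>) (A j) = k j}) =
      measure M E * (\<Prod>j\<in>J. poisson_prob (l * measure lborel (A j)) (k j))"
  shows "poisson_family (uniform_measure M E) l I x"
proof -
  interpret poisson_family M l I x by fact
  have pos': "emeasure M E \<noteq> 0" "emeasure M E \<noteq> \<infinity>" using pos by (auto simp: emeasure_eq_measure)
  interpret U: prob_space "uniform_measure M E" using pos' by (rule prob_space_uniform_measure)
  show ?thesis
  proof
    show "0 < l" by (rule rate)
    show "Measurable.pred (uniform_measure M E) (\<lambda>\<omega>. i \<in> I \<omega>)" for i
      using index_measurable[of i] by (simp add: pred_def)
    show "x i \<in> borel_measurable (uniform_measure M E)" for i by simp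
    show "AE \<omega> in uniform_measure M E. \<forall>r. finite {i \<in> I \<omega>. norm (x i \<omega>) \<le> r}"
      using AE_locally_finite by (intro AE_uniform_measureI) auto
    fix J :: "nat set" and A :: "nat \<Rightarrow> point set" and k
    assume J: "finite J" "disjoint_family_on A J" "\<And>j. j \<in> J \<Longrightarrow> A j \<in> sets borel \<and> bounded (A j)"
    let ?F = "{\<omega>\<in>space M. \<forall>j\<in>J. N (A j) \<omega> = k j}"
    have F: "?F \<in> sets M"
    proof (rule sets.sets_Collect_finite_All[OF _ J(1)])
      fix j assume "j \<in> J"
      then have [measurable]: "A j \<in> sets borel" using J(3) by blast
      show "{\<omega>\<in>space M. N (A j) \<omega> = k j} \<in> sets M" by measurable
    qed
    have "measure (uniform_measure M E) ?F = measure M (E \<inter> ?F) / measure M E"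
      by (rule measure_uniform_measure[OF pos' F])
    also have "measure M (E \<inter> ?F) = measure M E * (\<Prod>j\<in>J. poisson_prob (l * measure lborel (A j)) (k j))"
      by (rule ind[OF J])
    also have "\<dots> / measure M E = (\<Prod>j\<in>J. poisson_prob (l * measure lborel (A j)) (k j))"
      using pos by simp
    finally show "measure (uniform_measure M E) {\<omega>\<in>space (uniform_measure M E). \<forall>j\<in>J. N (A j) \<omega> = k j} =
        (\<Prod>j\<in>J. poisson_prob (l * measure lborel (A j)) (k j))" by simp
  qed
qed

section \<open>Independence of the centre from the earlier points\<close>

context sampled_routes
begin

context
  fixes l :: real
  assumes l: "0 < l"
begin

abbreviation centre :: "'w \<Rightarrow> point" where
  "centre \<omega> \<equiv> seq_site (centre_index l (\<lambda>n. Y n \<omega>)) (\<lambda>n. Y n \<omega>)"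

abbreviation E0 :: "'w set" where
  "E0 \<equiv> {\<omega>\<in>space M. (\<lambda>n. Y n \<omega>) \<in> one_centre l}"

abbreviation X :: "'w \<Rightarrow> nat \<Rightarrow> point" where
  "X \<equiv> poisson_family.sorted (arrived Y l) (site Y)"

lemma centre_borel [measurable]: "centre \<in> borel_measurable M"
  by measurable

lemma E0_sets [measurable]: "E0 \<in> sets M"
  using measurable_sets[OF Y_seq_measurable one_centre_sets] by (simp add: vimage_def Int_def conj_commute)

lemma E0_centre:
  assumes "\<omega> \<in> E0"
  obtains n where "{n. Y n \<omega> \<in> window l} = {n}" "centre_index l (\<lambda>n. Y n \<omega>) = Suc n" "centre \<omega> = fst (Y n \<omega>)"
    "fst (Y n \<omega>) \<in> near_origin" "l < snd (Y n \<omega>)" "snd (Y n \<omega>) \<le> l + 1"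
proof -
  obtain n where n: "{n. Y n \<omega> \<in> window l} = {n}" "centre_index l (\<lambda>n. Y n \<omega>) = Suc n"
    using one_centreD assms by blast
  have "Y n \<omega> \<in> window l" using n(1) by blast
  then show ?thesis using n that[of n] unfolding window_def by (auto simp: seq_site_def mem_Times_iff)
qed

lemma window_sub:
  assumes [measurable]: "B \<in> sets borel"
  shows "(B \<inter> near_origin) \<times> {l<..l + 1} \<in> sets borel \<and> emeasure space_time ((B \<inter> near_origin) \<times> {l<..l + 1}) < \<infinity>"
proof -
  have "{l<..l + 1} \<inter> {0..} = {l<..l + 1}" using l by auto
  moreover have "bounded (B \<inter> near_origin)" by (rule bounded_subset[of near_origin]) (auto simp: near_origin_def)
  ultimately show ?thesis by (intro conjI borel_Times finite_space_time) auto
qed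

text \<open>The event is a statement about independent counts: one point in the part of the window
  over \<open>B\<close>, none in the rest of the window, and the given counts up to time
  \<open>l\<close>.\<close>

lemma centre_in_prob:
  fixes A :: "nat \<Rightarrow> point set"
  assumes B[measurable]: "B \<in> sets borel"
    and J: "finite J" "disjoint_family_on A J" "\<And>j. j \<in> J \<Longrightarrow> A j \<in> sets borel \<and> bounded (A j)"
  shows "prob ({\<omega>\<in>E0. centre \<omega> \<in> B} \<inter> {\<omega>\<in>space M. \<forall>j\<in>J. number_in (arrived Y l \<omega>) (\<lambda>i. site Y i \<omega>) (A j) = k j}) =
    poisson_prob (measure lborel (B \<inter> near_origin)) 1 * poisson_prob (measure lborel (- B \<inter> near_origin)) 0 *
    (\<Prod>j\<in>J. poisson_prob (l * measure lborel (A j)) (k j))"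
proof -
  let ?I = "{l<..l + 1}"
  \<comment> \<open>Indices 0 and 1 are reserved for the two parts of the window, so
    \<open>A j\<close> moves to index \<open>j + 2\<close>.\<close>
  define C where "C m = (case m of 0 \<Rightarrow> (B \<inter> near_origin) \<times> ?I | Suc m' \<Rightarrow>
    (case m' of 0 \<Rightarrow> (- B \<inter> near_origin) \<times> ?I | Suc j \<Rightarrow> A j \<times> {..l}))" for m
  define k' where "k' m = (case m of 0 \<Rightarrow> 1 | Suc m' \<Rightarrow> (case m' of 0 \<Rightarrow> 0 | Suc j \<Rightarrow> k j))" for m
  have C_simps: "C 0 = (B \<inter> near_origin) \<times> ?I" "C (Suc 0) = (- B \<inter> near_origin) \<times> ?I" "C (Suc (Suc j)) = A j \<times> {..l}" for j
    by (simp_all add: C_def)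
  have k_simps: "k' 0 = 1" "k' (Suc 0) = 0" "k' (Suc (Suc j)) = k j" for j by (simp_all add: k'_def)
  let ?J = "insert 0 (insert (Suc 0) ((\<lambda>j. Suc (Suc j)) ` J))"
  have CC: "C m \<in> sets borel \<and> emeasure space_time (C m) < \<infinity>" if "m \<in> ?J" for m
  proof -
    have "{..l} \<inter> {0..} = {0..l}" by auto
    then have "A j \<times> {..l} \<in> sets borel \<and> emeasure space_time (A j \<times> {..l}) < \<infinity>" if "j \<in> J" for j
      using J(3)[OF that] l by (intro conjI borel_Times finite_space_time) auto
    moreover have "- B \<in> sets borel" by measurable
    ultimately show ?thesis using that window_sub[OF B] window_sub[of "- B"] by (auto simp: C_simps)
  qed
  have disj: "disjoint_family_on C ?J"
    unfolding disjoint_family_on_def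
  proof (intro ballI impI)
    fix a b assume ab: "a \<in> ?J" "b \<in> ?J" "a \<noteq> b"
    have AA: "A i \<inter> A j = {}" if "i \<in> J" "j \<in> J" "i \<noteq> j" for i j using J(2) that unfolding disjoint_family_on_def by blast
    show "C a \<inter> C b = {}" using ab AA by (elim insertE imageE) (auto simp: C_simps)
  qed
  have "prob {\<omega>\<in>space M. \<forall>m\<in>?J. card {n. Y n \<omega> \<in> C m} = k' m} = (\<Prod>m\<in>?J. poisson_prob (measure space_time (C m)) (k' m))"
    using J(1) CC by (intro joint_counts disj) auto
  also have "\<dots> = poisson_prob (measure space_time (C 0)) (k' 0) * (poisson_prob (measure space_time (C (Suc 0))) (k' (Suc 0)) *
      (\<Prod>j\<in>J. poisson_prob (measure space_time (C (Suc (Suc j)))) (k' (Suc (Suc j)))))"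
    using J(1) by (subst prod.insert, simp, fastforce)+ (simp add: prod.reindex inj_on_def)
  also have "(\<Prod>j\<in>J. poisson_prob (measure space_time (C (Suc (Suc j)))) (k' (Suc (Suc j)))) =
      (\<Prod>j\<in>J. poisson_prob (l * measure lborel (A j)) (k j))"
    using J(3) l by (intro prod.cong refl) (simp add: C_simps k_simps measure_space_time_until)
  also have "measure space_time (C 0) = measure lborel (B \<inter> near_origin)"
    unfolding C_simps by (intro measure_space_time_unit l) measurable
  also have "measure space_time (C (Suc 0)) = measure lborel (- B \<inter> near_origin)"
    unfolding C_simps by (intro measure_space_time_unit l) measurable
  finally have val: "prob {\<omega>\<in>space M. \<forall>m\<in>?J. card {n. Y n \<omega> \<in> C m} = k' m} =
      poisson_prob (measure lborel (B \<inter> near_origin)) 1 * poisson_prob (measure lborel (- B \<inter> near_origin)) 0 *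
      (\<Prod>j\<in>J. poisson_prob (l * measure lborel (A j)) (k j))"
    by (simp only: k_simps mult.assoc)
  let ?F = "{\<omega>\<in>space M. \<forall>j\<in>J. number_in (arrived Y l \<omega>) (\<lambda>i. site Y i \<omega>) (A j) = k j}"
  have "prob ({\<omega>\<in>E0. centre \<omega> \<in> B} \<inter> ?F) = prob {\<omega>\<in>space M. \<forall>m\<in>?J. card {n. Y n \<omega> \<in> C m} = k' m}"
  proof (rule measure_eq_AE)
    have fin: "AE \<omega> in M. finite {n. Y n \<omega> \<in> C 0} \<and> finite {n. Y n \<omega> \<in> C (Suc 0)}"
      using AE_count_finite CC[of 0] CC[of "Suc 0"] by auto
    show "AE \<omega> in M. \<omega> \<in> {\<omega>\<in>E0. centre \<omega> \<in> B} \<inter> ?F \<longleftrightarrow> \<omega> \<in> {\<omega>\<in>space M. \<forall>m\<in>?J. card {n. Y n \<omega> \<in> C m} = k' m}"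
      using fin AE_space
    proof eventually_elim
      case (elim \<omega>)
      have W: "{n. Y n \<omega> \<in> window l} = {n. Y n \<omega> \<in> C 0} \<union> {n. Y n \<omega> \<in> C (Suc 0)}"
        unfolding window_def C_simps by auto
      have "\<omega> \<in> {\<omega>\<in>E0. centre \<omega> \<in> B} \<longleftrightarrow> card {n. Y n \<omega> \<in> C 0} = 1 \<and> card {n. Y n \<omega> \<in> C (Suc 0)} = 0"
      proof
        assume \<omega>: "\<omega> \<in> {\<omega>\<in>E0. centre \<omega> \<in> B}"
        then have "\<omega> \<in> E0" by blast
        then obtain n where n: "{n. Y n \<omega> \<in> window l} = {n}" "centre \<omega> = fst (Y n \<omega>)" by (rule E0_centre)
        have "n \<in> {n. Y n \<omega> \<in> window l}" using n(1) by blast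
        then have "Y n \<omega> \<in> C 0" using n(2) \<omega> unfolding window_def C_simps by (auto simp: mem_Times_iff)
        moreover have "Y m \<omega> \<notin> C (Suc 0)" for m
        proof
          assume m: "Y m \<omega> \<in> C (Suc 0)"
          then have "m \<in> {n. Y n \<omega> \<in> window l}" unfolding W by blast
          then have "m = n" unfolding n(1) by simp
          then show False using m \<open>Y n \<omega> \<in> C 0\<close> unfolding C_simps by auto
        qed
        ultimately have "{n. Y n \<omega> \<in> C 0} = {n}" "{n. Y n \<omega> \<in> C (Suc 0)} = {}" using n(1) W by blast+
        then show "card {n. Y n \<omega> \<in> C 0} = 1 \<and> card {n. Y n \<omega> \<in> C (Suc 0)} = 0" by simp
      next
        assume c: "card {n. Y n \<omega> \<in> C 0} = 1 \<and> card {n. Y n \<omega> \<in> C (Suc 0)} = 0"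
        then have "{n. Y n \<omega> \<in> C (Suc 0)} = {}" using elim(1) by simp
        then have WC: "{n. Y n \<omega> \<in> window l} = {n. Y n \<omega> \<in> C 0}" unfolding W by simp
        then have "(\<lambda>n. Y n \<omega>) \<in> one_centre l"
          unfolding one_centre_def using c measurable_space[OF Y_seq_measurable elim(2)] by simp
        then have E: "\<omega> \<in> E0" using elim(2) by simp
        then obtain n where n: "{n. Y n \<omega> \<in> window l} = {n}" "centre \<omega> = fst (Y n \<omega>)" by (rule E0_centre)
        have "Y n \<omega> \<in> C 0" using n(1) unfolding WC by blast
        then have "centre \<omega> \<in> B" unfolding n(2) C_simps by (auto simp: mem_Times_iff)
        then show "\<omega> \<in> {\<omega>\<in>E0. centre \<omega> \<in> B}" using E by simp
      qed
      moreover have "\<omega> \<in> ?F \<longleftrightarrow> (\<forall>j\<in>J. card {n. Y n \<omega> \<in> C (Suc (Suc j))} = k j)"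
        unfolding C_simps number_in_arrived using elim(2) by simp
      ultimately show ?case using elim(2) by (auto simp: k_simps)
    qed
    show "{\<omega>\<in>E0. centre \<omega> \<in> B} \<inter> ?F \<in> events"
    proof (rule sets.Int)
      show "{\<omega>\<in>E0. centre \<omega> \<in> B} \<in> events" by measurable
      show "?F \<in> events"
      proof (rule sets.sets_Collect_finite_All[OF _ J(1)])
        fix j assume "j \<in> J"
        then have [measurable]: "A j \<times> {..l} \<in> sets borel" using J(3) by (intro borel_Times) auto
        show "{\<omega>\<in>space M. number_in (arrived Y l \<omega>) (\<lambda>i. site Y i \<omega>) (A j) = k j} \<in> events"
          unfolding number_in_arrived by measurable
      qed
    qed
    show "{\<omega>\<in>space M. \<forall>m\<in>?J. card {n. Y n \<omega> \<in> C m} = k' m} \<in> events"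
    proof (rule sets.sets_Collect_finite_All)
      fix m assume "m \<in> ?J"
      then have [measurable]: "C m \<in> sets borel" using CC by blast
      show "{\<omega>\<in>space M. card {n. Y n \<omega> \<in> C m} = k' m} \<in> events" by measurable
    qed (use J(1) in simp)
  qed
  then show ?thesis using val by simp
qed

lemma prob_E0: "prob E0 = poisson_prob (measure lborel near_origin) 1" "0 < prob E0"
proof -
  have "prob ({\<omega>\<in>E0. centre \<omega> \<in> UNIV} \<inter> {\<omega>\<in>space M. \<forall>j\<in>({}::nat set). number_in (arrived Y l \<omega>) (\<lambda>i. site Y i \<omega>) ((\<lambda>_. {}) j) = (\<lambda>_. 0) j}) =
      poisson_prob (measure lborel (UNIV \<inter> near_origin)) 1 * poisson_prob (measure lborel (- UNIV \<inter> near_origin)) 0 *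
      (\<Prod>j\<in>({}::nat set). poisson_prob (l * measure lborel ((\<lambda>_. {} :: point set) j)) ((\<lambda>_. 0) j))"
    by (rule centre_in_prob) (auto simp: disjoint_family_on_def)
  moreover have "{\<omega>\<in>E0. centre \<omega> \<in> UNIV} \<inter> {\<omega>\<in>space M. \<forall>j\<in>({}::nat set). number_in (arrived Y l \<omega>) (\<lambda>i. site Y i \<omega>) ((\<lambda>_. {}) j) = (\<lambda>_. 0) j} = E0" by auto
  ultimately show p: "prob E0 = poisson_prob (measure lborel near_origin) 1" by (simp add: poisson_prob_def)
  have "measure lborel near_origin = pi * (1 / 4)\<^sup>2"
    unfolding near_origin_def using content_cball[of "1 / 4" "0::point"] by (simp add: unit_ball_vol_2)
  then show "0 < prob E0" unfolding p poisson_prob_def by simp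
qed

lemma X_measurable [measurable]: "X \<in> M \<rightarrow>\<^sub>M (\<Pi>\<^sub>M n\<in>UNIV. borel)"
  by (rule poisson_family.sorted_measurable[OF arrived_poisson[OF l]])

text \<open>Conditioned on a centre in \<open>B\<close>, the points of \<Xi>(l) are still a Poisson
  family of rate \<open>l\<close>, so by uniqueness their ordered list keeps its unconditioned law;
  this is independence.\<close>

lemma centre_independent:
  assumes B[measurable]: "B \<in> sets borel" and C[measurable]: "C \<in> sets (\<Pi>\<^sub>M n\<in>UNIV. borel)"
  shows "prob ({\<omega>\<in>E0. centre \<omega> \<in> B} \<inter> {\<omega>\<in>space M. X \<omega> \<in> C}) = prob {\<omega>\<in>E0. centre \<omega> \<in> B} * prob {\<omega>\<in>space M. X \<omega> \<in> C}"
proof (cases "prob {\<omega>\<in>E0. centre \<omega> \<in> B} = 0")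
  case True
  have "prob ({\<omega>\<in>E0. centre \<omega> \<in> B} \<inter> {\<omega>\<in>space M. X \<omega> \<in> C}) \<le> prob {\<omega>\<in>E0. centre \<omega> \<in> B}"
    by (intro finite_measure_mono) (blast, measurable)
  then have "prob ({\<omega>\<in>E0. centre \<omega> \<in> B} \<inter> {\<omega>\<in>space M. X \<omega> \<in> C}) = 0"
    using True measure_nonneg[of M "{\<omega>\<in>E0. centre \<omega> \<in> B} \<inter> {\<omega>\<in>space M. X \<omega> \<in> C}"] by linarith
  then show ?thesis using True by simp
next
  case False
  let ?E = "{\<omega>\<in>E0. centre \<omega> \<in> B}"
  have E[measurable]: "?E \<in> sets M" by measurable
  have pE: "prob ?E = poisson_prob (measure lborel (B \<inter> near_origin)) 1 * poisson_prob (measure lborel (- B \<inter> near_origin)) 0"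
  proof -
    have "prob (?E \<inter> {\<omega>\<in>space M. \<forall>j\<in>({}::nat set). number_in (arrived Y l \<omega>) (\<lambda>i. site Y i \<omega>) ((\<lambda>_. {}) j) = (\<lambda>_. 0) j}) =
        poisson_prob (measure lborel (B \<inter> near_origin)) 1 * poisson_prob (measure lborel (- B \<inter> near_origin)) 0 *
        (\<Prod>j\<in>({}::nat set). poisson_prob (l * measure lborel ((\<lambda>_. {} :: point set) j)) ((\<lambda>_. 0) j))"
      by (rule centre_in_prob[OF B]) (auto simp: disjoint_family_on_def)
    moreover have "?E \<inter> {\<omega>\<in>space M. \<forall>j\<in>({}::nat set). number_in (arrived Y l \<omega>) (\<lambda>i. site Y i \<omega>) ((\<lambda>_. {}) j) = (\<lambda>_. 0) j} = ?E" by auto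
    ultimately show ?thesis by simp
  qed
  have F: "poisson_family (uniform_measure M ?E) l (arrived Y l) (site Y)"
  proof (rule poisson_family_uniform[OF arrived_poisson[OF l] E False])
    fix J and A :: "nat \<Rightarrow> point set" and k
    assume J: "finite J" "disjoint_family_on A J" "\<And>j. j \<in> J \<Longrightarrow> A j \<in> sets borel \<and> bounded (A j)"
    show "prob (?E \<inter> {\<omega>\<in>space M. \<forall>j\<in>J. number_in (arrived Y l \<omega>) (\<lambda>i. site Y i \<omega>) (A j) = k j}) =
      prob ?E * (\<Prod>j\<in>J. poisson_prob (l * measure lborel (A j)) (k j))"
      unfolding pE by (rule centre_in_prob[OF B J])
  qed
  have pos': "emeasure M ?E \<noteq> 0" "emeasure M ?E \<noteq> \<infinity>" using False by (auto simp: emeasure_eq_measure)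
  have XC[measurable]: "{\<omega>\<in>space M. X \<omega> \<in> C} \<in> sets M" by measurable
  have XE: "X -` C \<inter> space M = {\<omega>\<in>space M. X \<omega> \<in> C}" by blast
  have "measure (distr (uniform_measure M ?E) (\<Pi>\<^sub>M n\<in>UNIV. borel) X) C = measure (distr M (\<Pi>\<^sub>M n\<in>UNIV. borel) X) C"
    by (simp only: sorted_law_unique[OF F arrived_poisson[OF l]])
  moreover have "measure (distr (uniform_measure M ?E) (\<Pi>\<^sub>M n\<in>UNIV. borel) X) C = measure (uniform_measure M ?E) {\<omega>\<in>space M. X \<omega> \<in> C}"
    using XE by (subst measure_distr) auto
  moreover have "measure (distr M (\<Pi>\<^sub>M n\<in>UNIV. borel) X) C = prob {\<omega>\<in>space M. X \<omega> \<in> C}"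
    using XE by (subst measure_distr) auto
  moreover have "measure (uniform_measure M ?E) {\<omega>\<in>space M. X \<omega> \<in> C} = prob (?E \<inter> {\<omega>\<in>space M. X \<omega> \<in> C}) / prob ?E"
    by (rule measure_uniform_measure[OF pos' XC])
  ultimately show ?thesis using False by (simp add: field_simps)
qed

abbreviation U :: "'w measure" where
  "U \<equiv> uniform_measure M E0"

lemma E0_pos: "emeasure M E0 \<noteq> 0" "emeasure M E0 \<noteq> \<infinity>"
  using prob_E0(2) by (auto simp: emeasure_eq_measure)

lemma prob_space_U: "prob_space U"
  by (rule prob_space_uniform_measure[OF E0_pos])

lemma AE_U: "AE \<omega> in M. P \<omega> \<Longrightarrow> AE \<omega> in U. P \<omega> \<and> \<omega> \<in> E0"
  by (rule AE_uniform_measureI) (auto elim: eventually_mono)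

lemma centre_X_law:
  "distr U borel centre \<Otimes>\<^sub>M distr M (\<Pi>\<^sub>M n\<in>UNIV. borel) X = distr U (borel \<Otimes>\<^sub>M (\<Pi>\<^sub>M n\<in>UNIV. borel)) (\<lambda>\<omega>. (centre \<omega>, X \<omega>))"
proof (rule pair_measure_eqI)
  interpret U: prob_space U by (rule prob_space_U)
  show "sigma_finite_measure (distr U borel centre)"
    by (intro prob_space_imp_sigma_finite U.prob_space_distr) simp
  show "sigma_finite_measure (distr M (\<Pi>\<^sub>M n\<in>UNIV. borel) X)"
    by (intro prob_space_imp_sigma_finite prob_space_distr) simp
  fix B :: "point set" and C assume BC: "B \<in> sets (distr U borel centre)" "C \<in> sets (distr M (\<Pi>\<^sub>M n\<in>UNIV. borel) X)"
  then have B[measurable]: "B \<in> sets borel" and C[measurable]: "C \<in> sets (\<Pi>\<^sub>M n\<in>UNIV. borel)" by simp_all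
  have XC[measurable]: "{\<omega>\<in>space M. X \<omega> \<in> C} \<in> sets M" by measurable
  have cB[measurable]: "{\<omega>\<in>space M. centre \<omega> \<in> B} \<in> sets M" by measurable
  have e1: "E0 \<inter> {\<omega>\<in>space M. centre \<omega> \<in> B} = {\<omega>\<in>E0. centre \<omega> \<in> B}" by blast
  have e2: "E0 \<inter> {\<omega>\<in>space M. centre \<omega> \<in> B \<and> X \<omega> \<in> C} = {\<omega>\<in>E0. centre \<omega> \<in> B} \<inter> {\<omega>\<in>space M. X \<omega> \<in> C}" by blast
  have v1: "centre -` B \<inter> space M = {\<omega>\<in>space M. centre \<omega> \<in> B}" "X -` C \<inter> space M = {\<omega>\<in>space M. X \<omega> \<in> C}"
    "(\<lambda>\<omega>. (centre \<omega>, X \<omega>)) -` (B \<times> C) \<inter> space M = {\<omega>\<in>space M. centre \<omega> \<in> B \<and> X \<omega> \<in> C}" by auto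
  have m3: "{\<omega>\<in>space M. centre \<omega> \<in> B \<and> X \<omega> \<in> C} \<in> sets M" by measurable
  have "emeasure (distr U borel centre) B = emeasure U {\<omega>\<in>space M. centre \<omega> \<in> B}"
    by (subst emeasure_distr) (simp_all add: v1)
  also have "\<dots> = ennreal (prob {\<omega>\<in>E0. centre \<omega> \<in> B} / prob E0)"
    using measure_uniform_measure[OF E0_pos cB] unfolding e1 U.emeasure_eq_measure by simp
  finally have 1: "emeasure (distr U borel centre) B = ennreal (prob {\<omega>\<in>E0. centre \<omega> \<in> B} / prob E0)" .
  have 2: "emeasure (distr M (\<Pi>\<^sub>M n\<in>UNIV. borel) X) C = ennreal (prob {\<omega>\<in>space M. X \<omega> \<in> C})"
    by (subst emeasure_distr) (simp_all add: v1 emeasure_eq_measure)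
  have "emeasure (distr U (borel \<Otimes>\<^sub>M (\<Pi>\<^sub>M n\<in>UNIV. borel)) (\<lambda>\<omega>. (centre \<omega>, X \<omega>))) (B \<times> C) =
      emeasure U {\<omega>\<in>space M. centre \<omega> \<in> B \<and> X \<omega> \<in> C}"
    by (subst emeasure_distr) (simp_all add: v1)
  also have "\<dots> = ennreal (prob {\<omega>\<in>E0. centre \<omega> \<in> B} * prob {\<omega>\<in>space M. X \<omega> \<in> C} / prob E0)"
    using measure_uniform_measure[OF E0_pos m3] unfolding e2 U.emeasure_eq_measure centre_independent[OF B C] by simp
  finally show "emeasure (distr U borel centre) B * emeasure (distr M (\<Pi>\<^sub>M n\<in>UNIV. borel) X) C =
      emeasure (distr U (borel \<Otimes>\<^sub>M (\<Pi>\<^sub>M n\<in>UNIV. borel)) (\<lambda>\<omega>. (centre \<omega>, X \<omega>))) (B \<times> C)"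
    unfolding 1 2 by (simp add: ennreal_mult[symmetric])
qed simp

lemma number_in_sorted:
  assumes "generic_points (arrived Y l \<omega>) (\<lambda>i. site Y i \<omega>)"
  shows "number_in (arrived Y l \<omega>) (\<lambda>i. site Y i \<omega> - v) A = card {n. X \<omega> n - v \<in> A}"
proof -
  interpret generic_points "arrived Y l \<omega>" "\<lambda>i. site Y i \<omega>" by fact
  interpret P: poisson_family M l "arrived Y l" "site Y" by (rule arrived_poisson[OF l])
  define j where "j = nth_nearest (arrived Y l \<omega>) (\<lambda>i. site Y i \<omega>)"
  have X: "X \<omega> n = site Y (j n) \<omega>" for n unfolding P.sorted_def P.index_def j_def ..
  have inj: "inj j" and ran: "arrived Y l \<omega> = range j" using nth_nearest_bij unfolding bij_betw_def j_def by auto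
  have "{i\<in>arrived Y l \<omega>. site Y i \<omega> - v \<in> A} = j ` {n. X \<omega> n - v \<in> A}"
    unfolding ran X Compr_image_eq by simp
  then show ?thesis unfolding number_in_def using inj by (simp add: card_image inj_on_subset)
qed

text \<open>By independence the probability is an average over the position \<open>v\<close> of the
  centre. For fixed \<open>v\<close> translation invariance gives the Poisson value, which does not
  depend on \<open>v\<close>.\<close>

lemma shifted_poisson: "poisson_family U l (arrived Y l) (\<lambda>i \<omega>. site Y i \<omega> - centre \<omega>)"
proof -
  interpret U: prob_space U by (rule prob_space_U)
  show ?thesis
  proof
    show "0 < l" by (rule l)
    show "Measurable.pred U (\<lambda>\<omega>. i \<in> arrived Y l \<omega>)" for i using arrived_pred[of i l] by (simp add: pred_def)
    show "(\<lambda>\<omega>. site Y i \<omega> - centre \<omega>) \<in> borel_measurable U" for i by simp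
    show "AE \<omega> in U. \<forall>r. finite {i \<in> arrived Y l \<omega>. norm (site Y i \<omega> - centre \<omega>) \<le> r}"
      using AE_U[OF AE_arrived_locally_finite[OF l]]
    proof eventually_elim
      case (elim \<omega>)
      show ?case
      proof
        fix r :: real
        have "{i \<in> arrived Y l \<omega>. norm (site Y i \<omega> - centre \<omega>) \<le> r} \<subseteq> {i \<in> arrived Y l \<omega>. norm (site Y i \<omega>) \<le> r + norm (centre \<omega>)}"
        proof safe
          fix i assume "norm (site Y i \<omega> - centre \<omega>) \<le> r"
          then show "norm (site Y i \<omega>) \<le> r + norm (centre \<omega>)"
            using norm_triangle_sub[of "site Y i \<omega>" "centre \<omega>"] by linarith
        qed
        then show "finite {i \<in> arrived Y l \<omega>. norm (site Y i \<omega> - centre \<omega>) \<le> r}"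
          by (rule finite_subset) (rule elim[THEN conjunct1, rule_format])
      qed
    qed
    fix J :: "nat set" and A :: "nat \<Rightarrow> point set" and k
    assume J: "finite J" "disjoint_family_on A J" "\<And>j. j \<in> J \<Longrightarrow> A j \<in> sets borel \<and> bounded (A j)"
    let ?S = "borel \<Otimes>\<^sub>M (\<Pi>\<^sub>M n\<in>UNIV. borel) :: (point \<times> (nat \<Rightarrow> point)) measure"
    let ?p = "\<Prod>j\<in>J. poisson_prob (l * measure lborel (A j)) (k j)"
    \<comment> \<open>The counts around the centre are expressed through the centre and the ordered
      list \<open>X\<close>, the pair whose joint law is a product.\<close>
    define H where "H = {z\<in>space ?S. \<forall>j\<in>J. card {n. snd z n - fst z \<in> A j} = k j}"
    have H[measurable]: "H \<in> sets ?S"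
      unfolding H_def
    proof (rule sets.sets_Collect_finite_All[OF _ J(1)])
      fix j assume "j \<in> J"
      then have [measurable]: "A j \<in> sets borel" using J(3) by blast
      have "Measurable.pred ?S (\<lambda>z. snd z n - fst z \<in> A j)" for n by measurable
      then have [measurable]: "(\<lambda>z. card {n. snd z n - fst z \<in> A j}) \<in> ?S \<rightarrow>\<^sub>M count_space UNIV"
        by (intro measurable_card) (simp add: pred_def)
      show "{z\<in>space ?S. card {n. snd z n - fst z \<in> A j} = k j} \<in> sets ?S" by measurable
    qed
    let ?F = "{\<omega>\<in>space U. \<forall>j\<in>J. number_in (arrived Y l \<omega>) (\<lambda>i. site Y i \<omega> - centre \<omega>) (A j) = k j}"
    have Fm: "{\<omega>\<in>space M. \<forall>j\<in>J. number_in (arrived Y l \<omega>) (\<lambda>i. site Y i \<omega> - v \<omega>) (A j) = k j} \<in> sets M"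
      if [measurable]: "v \<in> borel_measurable M" for v
    proof (rule sets.sets_Collect_finite_All[OF _ J(1)])
      fix j assume "j \<in> J"
      then have [measurable]: "A j \<in> sets borel" using J(3) by blast
      have "Measurable.pred M (\<lambda>\<omega>. i \<in> arrived Y l \<omega> \<and> site Y i \<omega> - v \<omega> \<in> A j)" for i by measurable
      then have [measurable]: "(\<lambda>\<omega>. number_in (arrived Y l \<omega>) (\<lambda>i. site Y i \<omega> - v \<omega>) (A j)) \<in> M \<rightarrow>\<^sub>M count_space UNIV"
        unfolding number_in_def by (intro measurable_card) (simp add: pred_def)
      show "{\<omega>\<in>space M. number_in (arrived Y l \<omega>) (\<lambda>i. site Y i \<omega> - v \<omega>) (A j) = k j} \<in> sets M" by measurable
    qed
    have pairm: "(\<lambda>\<omega>. (centre \<omega>, X \<omega>)) \<in> M \<rightarrow>\<^sub>M ?S" by measurable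
    have "emeasure U ?F = emeasure U ((\<lambda>\<omega>. (centre \<omega>, X \<omega>)) -` H \<inter> space U)"
    proof (rule emeasure_eq_AE)
      show "AE \<omega> in U. \<omega> \<in> ?F \<longleftrightarrow> \<omega> \<in> (\<lambda>\<omega>. (centre \<omega>, X \<omega>)) -` H \<inter> space U"
        using AE_U[OF AE_generic[OF l]] AE_space
      proof eventually_elim
        case (elim \<omega>)
        then have "\<omega> \<in> space M" by simp
        from measurable_space[OF pairm this] have "(centre \<omega>, X \<omega>) \<in> space ?S" .
        then show ?case unfolding H_def using elim number_in_sorted by simp
      qed
      show "?F \<in> sets U" using Fm[of centre] by simp
      show "(\<lambda>\<omega>. (centre \<omega>, X \<omega>)) -` H \<inter> space U \<in> sets U" using measurable_sets[OF pairm H] by simp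
    qed
    also have "\<dots> = emeasure (distr U ?S (\<lambda>\<omega>. (centre \<omega>, X \<omega>))) H"
      using pairm H by (intro emeasure_distr[symmetric]) simp_all
    also have "\<dots> = emeasure (distr U borel centre \<Otimes>\<^sub>M distr M (\<Pi>\<^sub>M n\<in>UNIV. borel) X) H" unfolding centre_X_law ..
    also have "\<dots> = (\<integral>\<^sup>+ v. emeasure (distr M (\<Pi>\<^sub>M n\<in>UNIV. borel) X) (Pair v -` H) \<partial>distr U borel centre)"
    proof (rule sigma_finite_measure.emeasure_pair_measure_alt)
      show "sigma_finite_measure (distr M (\<Pi>\<^sub>M n\<in>UNIV. borel) X)"
        by (intro prob_space_imp_sigma_finite prob_space_distr) simp
      show "H \<in> sets (distr U borel centre \<Otimes>\<^sub>M distr M (\<Pi>\<^sub>M n\<in>UNIV. borel) X)"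
        using H by (simp add: sets_pair_measure_cong[OF sets_distr sets_distr])
    qed
    also have "\<dots> = (\<integral>\<^sup>+ v. ennreal ?p \<partial>distr U borel centre)"
    proof (rule nn_integral_cong)
      fix v :: point
      have Hv: "Pair v -` H \<in> sets (\<Pi>\<^sub>M n\<in>UNIV. borel)" by (rule sets_Pair1[OF H])
      have "emeasure (distr M (\<Pi>\<^sub>M n\<in>UNIV. borel) X) (Pair v -` H) = emeasure M (X -` (Pair v -` H) \<inter> space M)"
        by (rule emeasure_distr[OF X_measurable Hv])
      also have "\<dots> = emeasure M {\<omega>\<in>space M. \<forall>j\<in>J. number_in (arrived Y l \<omega>) (\<lambda>i. site Y i \<omega> - v) (A j) = k j}"
      proof (rule emeasure_eq_AE)
        show "AE \<omega> in M. \<omega> \<in> X -` (Pair v -` H) \<inter> space M \<longleftrightarrow>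
            \<omega> \<in> {\<omega>\<in>space M. \<forall>j\<in>J. number_in (arrived Y l \<omega>) (\<lambda>i. site Y i \<omega> - v) (A j) = k j}"
          using AE_generic[OF l] AE_space
        proof eventually_elim
          case (elim \<omega>)
          have "(v, X \<omega>) \<in> space ?S" using measurable_space[OF X_measurable elim(2)] by (simp add: space_pair_measure)
          then show ?case unfolding H_def using elim number_in_sorted by simp
        qed
        show "X -` (Pair v -` H) \<inter> space M \<in> sets M" by (rule measurable_sets[OF X_measurable Hv])
        show "{\<omega>\<in>space M. \<forall>j\<in>J. number_in (arrived Y l \<omega>) (\<lambda>i. site Y i \<omega> - v) (A j) = k j} \<in> sets M"
          using Fm[of "\<lambda>_. v"] by simp
      qed
      also have "\<dots> = ennreal ?p"
      proof -
        interpret P: poisson_family M l "arrived Y l" "site Y" by (rule arrived_poisson[OF l])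
        have "poisson_family M (l / 1\<^sup>2) (arrived Y l) (\<lambda>i \<omega>. - v + 1 *\<^sub>R site Y i \<omega>)" by (rule P.similar) simp
        then have "poisson_family M l (arrived Y l) (\<lambda>i \<omega>. site Y i \<omega> - v)" by simp
        from poisson_family.joint_law[OF this J] show ?thesis by (simp add: emeasure_eq_measure)
      qed
      finally show "emeasure (distr M (\<Pi>\<^sub>M n\<in>UNIV. borel) X) (Pair v -` H) = ennreal ?p" .
    qed
    also have "\<dots> = ennreal ?p"
    proof -
      interpret D: prob_space "distr U borel centre" by (intro U.prob_space_distr) simp
      show ?thesis using D.emeasure_space_1 by simp
    qed
    finally have "emeasure U ?F = ennreal ?p" .
    moreover have "0 \<le> ?p" using l by (intro prod_nonneg) (simp add: poisson_prob_def)
    ultimately show "U.prob ?F = ?p" by (simp add: U.emeasure_eq_measure)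
  qed
qed

section \<open>The routes from the centre\<close>

lemma palm_indices_eq:
  "palm_indices l 0 (\<lambda>n. Y n \<omega>) = centre_index l (\<lambda>n. Y n \<omega>)"
  "palm_indices l (Suc n) (\<lambda>n. Y n \<omega>) = nth_nearest (arrived Y l \<omega>) (\<lambda>i. site Y i \<omega> - centre \<omega>) n"
  unfolding palm_indices_def arrived_seq_arrived site_seq_site by simp_all

lemma centre_index_arrived:
  assumes "\<omega> \<in> E0"
  shows "centre_index l (\<lambda>n. Y n \<omega>) \<notin> arrived Y l \<omega>" "centre_index l (\<lambda>n. Y n \<omega>) \<in> arrived Y (l + 1) \<omega>"
proof -
  obtain n where n: "centre_index l (\<lambda>n. Y n \<omega>) = Suc n" "l < snd (Y n \<omega>)" "snd (Y n \<omega>) \<le> l + 1"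
    using assms by (rule E0_centre)
  show "centre_index l (\<lambda>n. Y n \<omega>) \<notin> arrived Y l \<omega>" "centre_index l (\<lambda>n. Y n \<omega>) \<in> arrived Y (l + 1) \<omega>"
    unfolding n(1) arrived_seq_arrived Suc_in_seq_arrived using n by simp_all
qed

lemma AE_in_E0: "AE \<omega> in U. \<omega> \<in> E0 \<and> \<omega> \<in> space M"
  using AE_U[OF AE_space] by eventually_elim blast

text \<open>The centre arrives after time \<open>l\<close>, so it differs from all points of
  \<Xi>(l).\<close>

lemma AE_palm_indices_inj: "AE \<omega> in U. inj (\<lambda>i. palm_indices l i (\<lambda>n. Y n \<omega>))"
  using poisson_family.AE_generic[OF shifted_poisson] AE_in_E0
proof eventually_elim
  case (elim \<omega>)
  interpret generic_points "arrived Y l \<omega>" "\<lambda>i. site Y i \<omega> - centre \<omega>" by (rule elim)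
  define j where "j = nth_nearest (arrived Y l \<omega>) (\<lambda>i. site Y i \<omega> - centre \<omega>)"
  define c where "c = centre_index l (\<lambda>n. Y n \<omega>)"
  have c: "c \<notin> arrived Y l \<omega>" unfolding c_def using centre_index_arrived(1) elim(2) by blast
  have "inj j" "j n \<in> arrived Y l \<omega>" for n using nth_nearest_bij unfolding bij_betw_def j_def by auto
  then have j: "inj j" "j n \<noteq> c" for n using c by metis+
  have eq: "palm_indices l i (\<lambda>n. Y n \<omega>) = (case i of 0 \<Rightarrow> c | Suc n \<Rightarrow> j n)" for i
    unfolding c_def j_def by (cases i) (simp_all add: palm_indices_eq)
  show ?case unfolding eq
  proof (rule injI)
    fix a b assume "(case a of 0 \<Rightarrow> c | Suc n \<Rightarrow> j n) = (case b of 0 \<Rightarrow> c | Suc n \<Rightarrow> j n)"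
    then show "a = b" using j(2) j(2)[symmetric] injD[OF j(1)] by (cases a; cases b) simp_all
  qed
qed

lemma offset_palm: "offset (palm_indices l) \<omega> = poisson_family.sorted (arrived Y l) (\<lambda>i \<omega>. site Y i \<omega> - centre \<omega>) \<omega>"
proof -
  interpret P: poisson_family U l "arrived Y l" "\<lambda>i \<omega>. site Y i \<omega> - centre \<omega>" by (rule shifted_poisson)
  show ?thesis unfolding offset_def P.sorted_def P.index_def palm_indices_eq by (simp add: site_seq_site)
qed

text \<open>Offsets from the centre under \<open>U\<close> and offsets from 0 under \<open>M\<close>
  are ordered lists of Poisson families of the same rate.\<close>

lemma palm_star_law:
  "distr U route_seq (star (palm_indices l)) = distr M route_seq (star (origin_indices l))"
proof -
  have cond: "conditional_routes \<mu> U Y R"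
    by (rule conditional_routes_uniform[OF conditional one_centre_sets E0_pos(1)])
  have "distr U (\<Pi>\<^sub>M n\<in>UNIV. borel) (\<lambda>\<omega> n. 1 *\<^sub>R offset (palm_indices l) \<omega> n) =
      distr M (\<Pi>\<^sub>M n\<in>UNIV. borel) (\<lambda>\<omega> n. 1 *\<^sub>R offset (origin_indices l) \<omega> n)"
    unfolding offset_palm offset_origin[OF l] scaleR_one by (rule sorted_law_unique[OF shifted_poisson arrived_poisson[OF l]])
  then have "distr U route_seq (\<lambda>\<omega> n. scale 1 (star (palm_indices l) \<omega> n)) =
      distr M route_seq (\<lambda>\<omega> n. scale 1 (star (origin_indices l) \<omega> n))"
    by (intro star_law_unique[OF cond palm_indices_measurable AE_palm_indices_inj zero_less_one
        conditional origin_indices_measurable AE_origin_indices_inj[OF l] zero_less_one])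
  moreover have "distr U route_seq (\<lambda>\<omega> n. scale 1 (star (palm_indices l) \<omega> n)) = distr U route_seq (star (palm_indices l))"
  proof (rule distr_cong)
    fix \<omega> assume "\<omega> \<in> space U"
    then have "\<omega> \<in> space M" by simp
    then show "(\<lambda>n. scale 1 (star (palm_indices l) \<omega> n)) = star (palm_indices l) \<omega>"
      by (intro ext scale_1_star) (assumption, rule palm_indices_measurable)
  qed simp_all
  moreover have "distr M route_seq (\<lambda>\<omega> n. scale 1 (star (origin_indices l) \<omega> n)) = distr M route_seq (star (origin_indices l))"
  proof (rule distr_cong)
    fix \<omega> assume "\<omega> \<in> space M"
    then show "(\<lambda>n. scale 1 (star (origin_indices l) \<omega> n)) = star (origin_indices l) \<omega>"
      by (intro ext scale_1_star) (assumption, rule origin_indices_measurable)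
  qed simp_all
  ultimately show ?thesis by simp
qed

text \<open>Moved back to the centre, the far routes are routes between points of \<Xi>(l + 1). In
  the annulus they are more than 1 from the centre, and more than 4 - 2 from their other ends, so
  the excluded unit discs are avoided.\<close>

lemma palm_crossing_le:
  "AE \<omega> in U. crossing_length 1 (star (palm_indices l) \<omega>) \<le> len (long_range_edges Y R (l + 1) 1 \<omega> \<inter> cball 0 3)"
proof -
  have ends: "AE \<omega> in M. \<forall>i j. i \<noteq> j \<longrightarrow> R (i, j) \<omega> 0 = site Y i \<omega> \<and> R (i, j) \<omega> 1 = site Y j \<omega>"
    unfolding AE_all_countable using AE_route_end by auto
  show ?thesis
    using poisson_family.AE_generic[OF shifted_poisson] AE_in_E0 AE_U[OF ends]
  proof eventually_elim
    case (elim \<omega>)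
    interpret generic_points "arrived Y l \<omega>" "\<lambda>i. site Y i \<omega> - centre \<omega>" by (rule elim)
    define j where "j n = palm_indices l (Suc n) (\<lambda>n. Y n \<omega>)" for n
    define c where "c = centre_index l (\<lambda>n. Y n \<omega>)"
    define g where "g = star (palm_indices l) \<omega>"
    have E0: "\<omega> \<in> E0" and \<omega>: "\<omega> \<in> space M" using elim(2) by blast+
    have c: "c \<notin> arrived Y l \<omega>" "c \<in> arrived Y (l + 1) \<omega>" unfolding c_def using centre_index_arrived[OF E0] .
    have j: "j n \<in> arrived Y l \<omega>" for n unfolding j_def palm_indices_eq by (rule nth_nearest(1))
    have "arrived Y l \<omega> \<subseteq> arrived Y (l + 1) \<omega>" unfolding arrived_def by force
    then have pair: "(c, j n) \<in> pairs (arrived Y (l + 1) \<omega>)" and cj: "c \<noteq> j n" for n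
      using j[of n] c unfolding pairs_def by auto
    have site_c: "site Y c \<omega> = centre \<omega>" unfolding c_def site_seq_site ..
    have cent: "norm (centre \<omega>) \<le> 1 / 4"
    proof -
      obtain n where "centre \<omega> = fst (Y n \<omega>)" "fst (Y n \<omega>) \<in> near_origin" using E0 by (rule E0_centre)
      then show ?thesis unfolding near_origin_def by simp
    qed
    have ends_j: "R (c, j n) \<omega> 0 = centre \<omega>" "R (c, j n) \<omega> 1 = site Y (j n) \<omega>" for n
      using elim(3) cj[of n] site_c by auto
    have gn: "g n = rebase (R (c, j n) \<omega>)" for n
      unfolding g_def star_def safe_route_def j_def c_def palm_indices_eq(1)
      using cj[of n, unfolded j_def c_def] by simp
    have eval: "R (c, j n) \<omega> t = centre \<omega> + g n t" if "t \<in> {0..1}" for n t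
      unfolding gn rebase_eval[OF that] ends_j by simp
    have site_j: "site Y (j n) \<omega> = centre \<omega> + g n 1" for n using eval[of 1 n] ends_j(2)[of n] by simp
    have route: "is_route (g n)" for n
      unfolding g_def by (rule space_route_space) (rule measurable_space[OF star_nth_measurable[OF palm_indices_measurable] \<omega>])
    have "crossing_length 1 g \<le> len (\<Union>n\<in>far 1 g. g n ` annulus_time 1 (g n))"
      by (rule crossing_length_le_len[OF route])
    also have "\<dots> \<le> len ((+) (centre \<omega>) ` (\<Union>n\<in>far 1 g. g n ` annulus_time 1 (g n)))"
      by (rule len_translation_le)
    also have "\<dots> \<le> len (long_range_edges Y R (l + 1) 1 \<omega> \<inter> cball 0 3)"
    proof (rule len_mono, rule subsetI)
      fix x assume "x \<in> (+) (centre \<omega>) ` (\<Union>n\<in>far 1 g. g n ` annulus_time 1 (g n))"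
      then obtain n t where n: "n \<in> far 1 g" and t: "t \<in> annulus_time 1 (g n)" and x: "x = centre \<omega> + g n t" by blast
      have t01: "t \<in> {0..1}" and n1: "1 < norm (g n t)" "norm (g n t) \<le> 2" using t unfolding annulus_time_def by auto
      have n4: "4 < norm (g n 1)" using n unfolding far_def by simp
      have "x \<in> path_image (R (c, j n) \<omega>)" unfolding x eval[OF t01, symmetric] path_image_def using t01 by blast
      moreover have "x \<notin> cball (site Y c \<omega>) 1" using n1 unfolding x site_c by (simp add: dist_norm)
      moreover have "norm (g n 1) \<le> norm (g n 1 - g n t) + norm (g n t)" using norm_triangle_sub[of "g n 1" "g n t"] by simp
      then have "1 < norm (g n 1 - g n t)" using n4 n1 by linarith
      then have "x \<notin> cball (site Y (j n) \<omega>) 1" unfolding x site_j by (simp add: dist_norm)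
      \<comment> \<open>The centre has norm at most 1/4 and the annulus reaches to 2.\<close>
      moreover have "norm x \<le> 3" unfolding x using norm_triangle_ineq[of "centre \<omega>" "g n t"] cent n1 by linarith
      ultimately show "x \<in> long_range_edges Y R (l + 1) 1 \<omega> \<inter> cball 0 3"
        unfolding long_range_edges_def using pair[of n] by (intro IntI UN_I[of "(c, j n)"]) simp_all
    qed
    finally show ?case unfolding g_def .
  qed
qed

text \<open>Given that a single point arrives near the origin during \<open>(l,l+1]\<close>, the points of
  \<open>\<Xi>(l)\<close> seen from it are again a Poisson process of rate \<open>l\<close>.\<close>

lemma mean_crossing_length_le:
  "(\<integral>\<^sup>+ \<omega>. crossing_length 1 (star (origin_indices l) \<omega>) \<partial>M) \<le>
    (\<integral>\<^sup>+ \<omega>. len (long_range_edges Y R (l + 1) 1 \<omega> \<inter> cball 0 3) \<partial>M) / poisson_prob (measure lborel near_origin) 1"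
proof -
  let ?L = "\<lambda>\<omega>. len (long_range_edges Y R (l + 1) 1 \<omega> \<inter> cball 0 3)"
  let ?W = "\<lambda>\<omega>. crossing_length 1 (star (palm_indices l) \<omega>)"
  have pm: "star (palm_indices l) \<in> M \<rightarrow>\<^sub>M route_seq"
    by (rule star_measurable) (rule palm_indices_measurable)
  have om: "star (origin_indices l) \<in> M \<rightarrow>\<^sub>M route_seq"
    by (rule star_measurable) (rule origin_indices_measurable)
  have W: "?W \<in> borel_measurable M"
    by (rule measurable_compose[OF pm crossing_length_measurable])
  have "(\<integral>\<^sup>+ \<omega>. crossing_length 1 (star (origin_indices l) \<omega>) \<partial>M) =
      (\<integral>\<^sup>+ g. crossing_length 1 g \<partial>distr M route_seq (star (origin_indices l)))"
    by (intro nn_integral_distr[symmetric] om) simp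
  also have "\<dots> = (\<integral>\<^sup>+ g. crossing_length 1 g \<partial>distr U route_seq (star (palm_indices l)))"
    unfolding palm_star_law ..
  also have "\<dots> = (\<integral>\<^sup>+ \<omega>. ?W \<omega> \<partial>U)"
    using pm by (intro nn_integral_distr) simp_all
  also have "\<dots> = (\<integral>\<^sup>+ \<omega>. ?W \<omega> * indicator E0 \<omega> \<partial>M) / emeasure M E0"
    by (rule nn_integral_uniform_measure[OF W E0_sets])
  also have "\<dots> \<le> (\<integral>\<^sup>+ \<omega>. ?L \<omega> \<partial>M) / emeasure M E0"
  proof (rule divide_right_mono_ennreal, rule nn_integral_mono_AE)
    have fin: "emeasure M E0 < \<infinity>" by (simp add: emeasure_eq_measure)
    have "AE \<omega> in M. \<omega> \<in> E0 \<longrightarrow> ?W \<omega> \<le> ?L \<omega>"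
      by (rule iffD1[OF AE_uniform_measure[OF E0_pos(1) fin] palm_crossing_le])
    then show "AE \<omega> in M. ?W \<omega> * indicator E0 \<omega> \<le> ?L \<omega>"
      by eventually_elim (simp split: split_indicator)
  qed
  also have "emeasure M E0 = ennreal (poisson_prob (measure lborel near_origin) 1)"
    unfolding emeasure_eq_measure prob_E0(1) ..
  finally show ?thesis .
qed

end

end

section \<open>The number of geodesics\<close>

text \<open>The difference of nested events of equal probability is null. This is how monotonicity
  in \<open>l\<close> combines with invariance in law.\<close>

lemma (in prob_space) AE_iff_of_prob_eq:
  assumes [measurable]: "Measurable.pred M P" "Measurable.pred M Q" and imp: "AE \<omega> in M. P \<omega> \<longrightarrow> Q \<omega>"
    and eq: "prob {\<omega>\<in>space M. P \<omega>} = prob {\<omega>\<in>space M. Q \<omega>}"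
  shows "AE \<omega> in M. P \<omega> \<longleftrightarrow> Q \<omega>"
proof -
  have "prob {\<omega>\<in>space M. Q \<omega>} = prob {\<omega>\<in>space M. P \<omega> \<and> Q \<omega>} + prob {\<omega>\<in>space M. Q \<omega> \<and> \<not> P \<omega>}"
    by (subst finite_measure_Union[symmetric]) (auto intro!: arg_cong[where f = prob])
  moreover have "prob {\<omega>\<in>space M. P \<omega> \<and> Q \<omega>} = prob {\<omega>\<in>space M. P \<omega>}"
    using imp by (intro measure_eq_AE) auto
  ultimately have "prob {\<omega>\<in>space M. Q \<omega> \<and> \<not> P \<omega>} = 0" using eq by simp
  then have "AE \<omega> in M. \<omega> \<notin> {\<omega>\<in>space M. Q \<omega> \<and> \<not> P \<omega>}" by (subst (asm) prob_eq_0) auto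
  then show ?thesis using imp AE_space by eventually_elim blast
qed

lemma many_le_card:
  assumes "finite T"
  shows "(\<exists>\<X>. finite \<X> \<and> card \<X> = n \<and> \<X> \<subseteq> T) \<longleftrightarrow> n \<le> card T"
proof
  assume "\<exists>\<X>. finite \<X> \<and> card \<X> = n \<and> \<X> \<subseteq> T"
  then show "n \<le> card T" using card_mono[OF assms] by (elim exE conjE) blast
next
  assume "n \<le> card T"
  then obtain \<X> where "\<X> \<subseteq> T" "card \<X> = n" "finite \<X>" by (rule obtain_subset_with_card_n)
  then show "\<exists>\<X>. finite \<X> \<and> card \<X> = n \<and> \<X> \<subseteq> T" by (intro exI conjI)
qed

lemma infinite_geodesics_mono:
  assumes "l \<le> l'"
  shows "infinite_geodesics Y R l \<omega> \<subseteq> infinite_geodesics Y R l' \<omega>"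
proof -
  have "arrived Y l \<omega> \<subseteq> arrived Y l' \<omega>" unfolding arrived_def using assms by force
  then have *: "(\<exists>j\<in>arrived Y l' \<omega>. is_subroute \<gamma> s t (R (0, j) \<omega>))"
    if "\<exists>j\<in>arrived Y l \<omega>. is_subroute \<gamma> s t (R (0, j) \<omega>)" for \<gamma> s t
    using that by (elim bexE) (intro bexI, assumption, rule subsetD)
  show ?thesis unfolding infinite_geodesics_def
  proof (intro subsetI, elim CollectE exE conjE)
    fix X \<gamma> assume \<gamma>: "X = \<gamma> ` {0..}" "continuous_on {0..} \<gamma>" "inj_on \<gamma> {0..}" "\<gamma> 0 = 0" "len (\<gamma> ` {0..}) = \<infinity>"
      and sub: "\<forall>s t. 0 \<le> s \<and> s < t \<longrightarrow> (\<exists>j\<in>arrived Y l \<omega>. is_subroute \<gamma> s t (R (0, j) \<omega>))"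
    have "\<forall>s t. 0 \<le> s \<and> s < t \<longrightarrow> (\<exists>j\<in>arrived Y l' \<omega>. is_subroute \<gamma> s t (R (0, j) \<omega>))"
      by (intro allI impI *) (rule sub[rule_format])
    with \<gamma> show "X \<in> {\<gamma> ` {0..} |\<gamma>. continuous_on {0..} \<gamma> \<and> inj_on \<gamma> {0..} \<and> \<gamma> 0 = 0 \<and> len (\<gamma> ` {0..}) = \<infinity> \<and>
        (\<forall>s t. 0 \<le> s \<and> s < t \<longrightarrow> (\<exists>j\<in>arrived Y l' \<omega>. is_subroute \<gamma> s t (R (0, j) \<omega>)))}"
      by (intro CollectI exI[of _ \<gamma>] conjI)
  qed
qed

lemma long_range_edges_mono:
  assumes "l \<le> l'"
  shows "long_range_edges Y R l r \<omega> \<subseteq> long_range_edges Y R l' r \<omega>"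
proof -
  have "arrived Y l \<omega> \<subseteq> arrived Y l' \<omega>" unfolding arrived_def using assms by force
  then have "pairs (arrived Y l \<omega>) \<subseteq> pairs (arrived Y l' \<omega>)" unfolding pairs_def by blast
  then show ?thesis unfolding long_range_edges_def by (rule UN_mono) simp
qed

lemma branch_beyond_mono: "branch_beyond r' g \<Longrightarrow> r \<le> r' \<Longrightarrow> branch_beyond r g"
  unfolding branch_beyond_def by (elim bexE exE conjE, intro bexI exI conjI) (assumption | rule meets_mono)+

section \<open>Geodesics as rays of the listed routes\<close>

context sampled_routes
begin

abbreviation origin_star :: "real \<Rightarrow> 'w \<Rightarrow> nat \<Rightarrow> route" where
  "origin_star l \<equiv> star (origin_indices l)"

lemma origin_star_measurable [measurable]: "origin_star l \<in> M \<rightarrow>\<^sub>M route_seq"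
  by (rule star_measurable) (rule origin_indices_measurable)

lemma origin_star_route: "\<omega> \<in> space M \<Longrightarrow> is_route (origin_star l \<omega> n)"
  using measurable_space[OF star_nth_measurable[OF origin_indices_measurable]] by (rule space_route_space)

lemma scaled_origin_star_measurable [measurable]:
  "0 < c \<Longrightarrow> (\<lambda>\<omega> n. scale c (origin_star l \<omega> n)) \<in> M \<rightarrow>\<^sub>M route_seq"
  by (rule scaled_star_measurable[OF origin_indices_measurable])

lemma prob_origin_star_scaling:
  assumes l: "0 < l" and c: "0 < c" and P: "Measurable.pred route_seq P"
  shows "prob {\<omega>\<in>space M. P (\<lambda>n. scale c (origin_star l \<omega> n))} = prob {\<omega>\<in>space M. P (origin_star (l / c\<^sup>2) \<omega>)}"
proof -
  have S: "{g\<in>space route_seq. P g} \<in> sets route_seq" using P by (simp add: pred_def)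
  have meas: "measure (distr M route_seq f) {g\<in>space route_seq. P g} = prob {\<omega>\<in>space M. P (f \<omega>)}"
    if f: "f \<in> M \<rightarrow>\<^sub>M route_seq" for f
  proof -
    have "f -` {g\<in>space route_seq. P g} \<inter> space M = {\<omega>\<in>space M. P (f \<omega>)}"
      using measurable_space[OF f] by blast
    then show ?thesis using measure_distr[OF f S] by simp
  qed
  show ?thesis
    using meas[OF scaled_origin_star_measurable[OF c, of l]] meas[OF origin_star_measurable[of "l / c\<^sup>2"]]
    unfolding star_scaling[OF l c] by simp
qed

lemma AE_geodesics:
  assumes "0 < l"
  shows "AE \<omega> in M. infinite_geodesics Y R l \<omega> = ray_traces (origin_star l \<omega>)"
  using AE_origin_star[OF assms]
proof eventually_elim
  case (elim \<omega>)
  interpret origin_routes "origin_star l \<omega>" by (rule conjunct1[OF elim])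
  have "(\<exists>j\<in>arrived Y l \<omega>. P (R (0, j) \<omega>)) \<longleftrightarrow> (\<exists>n. P (origin_star l \<omega> n))" for P
  proof -
    have "(\<exists>j\<in>arrived Y l \<omega>. P (R (0, j) \<omega>)) \<longleftrightarrow> (\<exists>h\<in>(\<lambda>j. R (0, j) \<omega>) ` arrived Y l \<omega>. P h)" by simp
    also have "\<dots> \<longleftrightarrow> (\<exists>h\<in>range (origin_star l \<omega>). P h)" unfolding conjunct2[OF elim] ..
    finally show ?thesis by simp
  qed
  then show ?case unfolding infinite_geodesics_def ray_traces_eq by simp
qed

end

section \<open>Mean bounds and almost sure finiteness\<close>

context sirsn
begin

text \<open>Radius \<rho> at one rate is the dilation of radius 1 at another rate, at the cost of a
  factor \<rho>. As the bound at radius 1 is the same for all rates, the constant is uniform in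
  \<open>l\<close>.\<close>

lemma mean_crossing_length_linear:
  "\<exists>C\<ge>0. \<forall>l>0. \<forall>\<rho>>0. (\<integral>\<^sup>+ \<omega>. crossing_length \<rho> (origin_star l \<omega>) \<partial>M) \<le> ennreal (C * \<rho>)"
proof -
  obtain x p where x: "x < \<infinity>" and lim: "(p \<longlongrightarrow> x) at_top"
    and p: "\<And>l. 0 < l \<Longrightarrow> has_edge_intensity M (long_range_edges Y R l 1) (p l)"
    using limit_intensity_finite unfolding has_limit_intensity_def by (elim exE conjE) metis
  let ?a = "emeasure lborel (cball (0 :: point) 3)"
  let ?q = "poisson_prob (measure lborel near_origin) 1"
  have a: "?a < \<infinity>" by (rule emeasure_bounded_finite) simp
  have q: "0 < ?q" using prob_E0[of 1] by simp
  \<comment> \<open>Intensities are eventually below any finite \<open>y\<close> above the limit.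
    Since the edge sets grow with \<open>l\<close>, the resulting estimate passes to smaller
    rates.\<close>
  obtain y where y: "x < y" "y < \<infinity>" using dense[OF x] by blast
  have ev: "eventually (\<lambda>l. p l < y) at_top" by (rule order_tendstoD(2)[OF lim y(1)])
  \<comment> \<open>Intensity times the area of the disc of radius 3, divided by the probability
    that exactly one point falls into the window.\<close>
  define C where "C = enn2real (y * ?a / ?q)"
  have "0 \<le> C" unfolding C_def by simp
  have "y * ?a < top" using y a by (simp add: ennreal_mult_less_top)
  then obtain z where "y * ?a = ennreal z" "0 \<le> z" unfolding less_top_ennreal by (elim exE conjE) metis
  then have "y * ?a / ?q < top" using q by (simp add: divide_ennreal)
  then have C: "ennreal C = y * ?a / ?q" unfolding C_def by simp
  have unit: "(\<integral>\<^sup>+ \<omega>. crossing_length 1 (origin_star l \<omega>) \<partial>M) \<le> ennreal C" if l: "0 < l" for l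
  proof -
    obtain l' where l': "l + 1 \<le> l'" "p l' < y"
      using eventually_conj[OF eventually_ge_at_top[of "l + 1"] ev] unfolding eventually_at_top_linorder by blast
    have "(\<integral>\<^sup>+ \<omega>. len (long_range_edges Y R (l + 1) 1 \<omega> \<inter> cball 0 3) \<partial>M) \<le>
        (\<integral>\<^sup>+ \<omega>. len (long_range_edges Y R l' 1 \<omega> \<inter> cball 0 3) \<partial>M)"
      by (intro nn_integral_mono len_mono Int_mono long_range_edges_mono l') simp
    also have "\<dots> = p l' * ?a" using p[of l'] l l'(1) unfolding has_edge_intensity_def by simp
    also have "\<dots> \<le> y * ?a" using l'(2) by (intro mult_right_mono) auto
    finally have "(\<integral>\<^sup>+ \<omega>. len (long_range_edges Y R (l + 1) 1 \<omega> \<inter> cball 0 3) \<partial>M) / ?q \<le> ennreal C"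
      unfolding C by (rule divide_right_mono_ennreal)
    then show ?thesis using mean_crossing_length_le[OF l] by (rule order_trans[rotated])
  qed
  have "(\<integral>\<^sup>+ \<omega>. crossing_length \<rho> (origin_star l \<omega>) \<partial>M) \<le> ennreal (C * \<rho>)" if l: "0 < l" and \<rho>: "0 < \<rho>" for l \<rho>
  proof -
    \<comment> \<open>The rate that dilation by \<rho> turns into \<open>l\<close>.\<close>
    define l0 where "l0 = l * \<rho>\<^sup>2"
    have l0: "0 < l0" "l = l0 / \<rho>\<^sup>2" unfolding l0_def using l \<rho> by simp_all
    have "(\<integral>\<^sup>+ \<omega>. crossing_length \<rho> (origin_star l \<omega>) \<partial>M) =
        (\<integral>\<^sup>+ g. crossing_length \<rho> g \<partial>distr M route_seq (origin_star l))"
      by (intro nn_integral_distr[symmetric] origin_star_measurable) simp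
    also have "\<dots> = (\<integral>\<^sup>+ g. crossing_length \<rho> g \<partial>distr M route_seq (\<lambda>\<omega> n. scale \<rho> (origin_star l0 \<omega> n)))"
      unfolding star_scaling[OF l0(1) \<rho>] l0(2)[symmetric] ..
    also have "\<dots> = (\<integral>\<^sup>+ \<omega>. crossing_length \<rho> (\<lambda>n. scale \<rho> (origin_star l0 \<omega> n)) \<partial>M)"
      by (intro nn_integral_distr scaled_origin_star_measurable \<rho>) simp
    also have "\<dots> = (\<integral>\<^sup>+ \<omega>. ennreal \<rho> * crossing_length 1 (origin_star l0 \<omega>) \<partial>M)"
    proof (rule nn_integral_cong)
      fix \<omega> assume "\<omega> \<in> space M"
      from crossing_length_scale[OF origin_star_route[OF this] \<rho>, where \<rho> = 1]
      show "crossing_length \<rho> (\<lambda>n. scale \<rho> (origin_star l0 \<omega> n)) = ennreal \<rho> * crossing_length 1 (origin_star l0 \<omega>)" by simp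
    qed
    also have "\<dots> = ennreal \<rho> * (\<integral>\<^sup>+ \<omega>. crossing_length 1 (origin_star l0 \<omega>) \<partial>M)"
      by (intro nn_integral_cmult measurable_compose[OF origin_star_measurable]) simp
    also have "\<dots> \<le> ennreal \<rho> * ennreal C" by (intro mult_left_mono unit l0) simp
    also have "\<dots> = ennreal (C * \<rho>)" using \<rho> \<open>0 \<le> C\<close> by (simp add: ennreal_mult[symmetric] mult.commute[of \<rho>])
    finally show ?thesis .
  qed
  then show ?thesis using \<open>0 \<le> C\<close> by blast
qed

lemma crossing_length_origin_star_measurable [measurable]:
  "(\<lambda>\<omega>. crossing_length \<rho> (origin_star l \<omega>)) \<in> borel_measurable M"
  by (rule measurable_compose[OF origin_star_measurable]) simp

text \<open>Along the dyadic shells of the disc of radius \<open>m\<close> the mean crossing lengths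
  are dominated by a geometric series with sum \<open>C * m\<close>.\<close>

lemma AE_tame:
  assumes l: "0 < l"
  shows "AE \<omega> in M. tame_routes (origin_star l \<omega>)"
proof -
  obtain C where C: "0 \<le> C" "\<And>\<rho>. 0 < \<rho> \<Longrightarrow> (\<integral>\<^sup>+ \<omega>. crossing_length \<rho> (origin_star l \<omega>) \<partial>M) \<le> ennreal (C * \<rho>)"
    using mean_crossing_length_linear l by blast
  let ?S = "\<lambda>m \<omega>. \<Sum>k. crossing_length (real m / 2 ^ (k + 1)) (origin_star l \<omega>)"
  have "AE \<omega> in M. 0 < m \<longrightarrow> ?S m \<omega> \<noteq> \<infinity>" for m :: nat
  proof (cases "0 < m")
    case True
    have "(\<integral>\<^sup>+ \<omega>. ?S m \<omega> \<partial>M) = (\<Sum>k. \<integral>\<^sup>+ \<omega>. crossing_length (real m / 2 ^ (k + 1)) (origin_star l \<omega>) \<partial>M)"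
      by (rule nn_integral_suminf) simp
    also have "\<dots> \<le> (\<Sum>k. ennreal (C * (real m / 2 ^ (k + 1))))"
      using True by (intro suminf_le C(2)) simp_all
    also have "\<dots> = (\<Sum>k. ennreal (C * real m / 2 * (1 / 2) ^ k))"
      by (simp add: power_divide)
    also have "\<dots> < \<infinity>"
      using C(1) by (subst suminf_ennreal2) (auto intro!: summable_mult summable_geometric)
    finally have "(\<integral>\<^sup>+ \<omega>. ?S m \<omega> \<partial>M) \<noteq> \<infinity>" by simp
    then have "AE \<omega> in M. ?S m \<omega> \<noteq> \<infinity>" by (intro nn_integral_PInf_AE) simp_all
    then show ?thesis by eventually_elim simp
  qed simp
  then have "AE \<omega> in M. \<forall>m::nat. 0 < m \<longrightarrow> ?S m \<omega> \<noteq> \<infinity>" unfolding AE_all_countable by blast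
  then show ?thesis using AE_origin_star[OF l]
  proof eventually_elim
    case (elim \<omega>)
    show ?case
    proof (rule tame_routes.intro[OF conjunct1[OF elim(2)]], unfold_locales)
      show "?S m \<omega> < \<infinity>" if "0 < m" for m using elim(1) that by (simp add: less_top)
    qed
  qed
qed

definition tame_geodesics :: "real \<Rightarrow> 'w \<Rightarrow> bool" where
  "tame_geodesics l \<omega> \<longleftrightarrow> tame_routes (origin_star l \<omega>) \<and>
     infinite_geodesics Y R l \<omega> = ray_traces (origin_star l \<omega>) \<and> finite (infinite_geodesics Y R l \<omega>)"

text \<open>The number of geodesics is dominated by a measurable \<open>F\<close>, the lower limit
  of crossing length per radius, instead of being integrated itself; Fatou's lemma bounds the mean
  of \<open>F\<close> by \<open>C\<close>. Finiteness of \<open>F\<close> also excludes infinitely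
  many geodesics, as it bounds all finite subsets.\<close>

lemma AE_count_bound:
  assumes l: "0 < l"
  shows "\<exists>F\<in>borel_measurable M. (\<integral>\<^sup>+ \<omega>. F \<omega> \<partial>M) < \<infinity> \<and>
    (AE \<omega> in M. tame_geodesics l \<omega> \<and> of_nat (card (infinite_geodesics Y R l \<omega>)) \<le> F \<omega>)"
proof -
  obtain C where C: "0 \<le> C" "\<And>\<rho>. 0 < \<rho> \<Longrightarrow> (\<integral>\<^sup>+ \<omega>. crossing_length \<rho> (origin_star l \<omega>) \<partial>M) \<le> ennreal (C * \<rho>)"
    using mean_crossing_length_linear l by blast
  let ?f = "\<lambda>m \<omega>. crossing_length (real m) (origin_star l \<omega>) / ennreal (real m)"
  define F where "F = (\<lambda>\<omega>. liminf (\<lambda>m. ?f m \<omega>))"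
  have F[measurable]: "F \<in> borel_measurable M" unfolding F_def by measurable
  have "(\<integral>\<^sup>+ \<omega>. F \<omega> \<partial>M) \<le> liminf (\<lambda>m. \<integral>\<^sup>+ \<omega>. ?f m \<omega> \<partial>M)" unfolding F_def
    by (rule nn_integral_liminf) simp
  also have "\<dots> \<le> limsup (\<lambda>m. \<integral>\<^sup>+ \<omega>. ?f m \<omega> \<partial>M)" by (rule Liminf_le_Limsup) simp
  also have "\<dots> \<le> ennreal C"
  proof (rule Limsup_bounded)
    show "\<forall>\<^sub>F m in sequentially. (\<integral>\<^sup>+ \<omega>. ?f m \<omega> \<partial>M) \<le> ennreal C"
      using eventually_gt_at_top[of 0]
    proof eventually_elim
      case (elim m)
      have "(\<integral>\<^sup>+ \<omega>. ?f m \<omega> \<partial>M) = (\<integral>\<^sup>+ \<omega>. crossing_length (real m) (origin_star l \<omega>) \<partial>M) / ennreal (real m)"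
        by (rule nn_integral_divide) simp
      also have "\<dots> \<le> ennreal (C * real m) / ennreal (real m)"
        using elim by (intro divide_right_mono_ennreal C(2)) simp
      also have "\<dots> = ennreal C" using elim C(1) by (simp add: divide_ennreal)
      finally show ?case .
    qed
  qed
  finally have int: "(\<integral>\<^sup>+ \<omega>. F \<omega> \<partial>M) < \<infinity>" by (simp add: le_less_trans)
  then have "AE \<omega> in M. F \<omega> \<noteq> \<infinity>" by (intro nn_integral_PInf_AE F) simp
  then have "AE \<omega> in M. tame_geodesics l \<omega> \<and> of_nat (card (infinite_geodesics Y R l \<omega>)) \<le> F \<omega>"
    using AE_tame[OF l] AE_geodesics[OF l]
  proof eventually_elim
    case (elim \<omega>)
    interpret tame_routes "origin_star l \<omega>" by (rule elim)
    have bound: "of_nat (card \<X>) \<le> F \<omega>" if "finite \<X>" "\<X> \<subseteq> ray_traces (origin_star l \<omega>)" for \<X>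
      unfolding F_def by (rule card_traces_le[OF that])
    have fin: "finite (ray_traces (origin_star l \<omega>))"
    proof (rule ccontr)
      assume inf: "infinite (ray_traces (origin_star l \<omega>))"
      have "F \<omega> < top" using elim(1) by (simp add: less_top)
      then obtain n where n: "F \<omega> < of_nat n" using ennreal_Ex_less_of_nat by blast
      obtain \<X> where "\<X> \<subseteq> ray_traces (origin_star l \<omega>)" "finite \<X>" "card \<X> = n"
        using infinite_arbitrarily_large[OF inf, of n] by blast
      then show False using bound n by (metis leD)
    qed
    show ?case unfolding tame_geodesics_def using elim fin bound by simp
  qed
  then show ?thesis using F int by blast
qed

lemma AE_tame_geodesics: "0 < l \<Longrightarrow> AE \<omega> in M. tame_geodesics l \<omega>"
proof -
  assume "0 < l"
  from AE_count_bound[OF this] obtain F where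
    "AE \<omega> in M. tame_geodesics l \<omega> \<and> of_nat (card (infinite_geodesics Y R l \<omega>)) \<le> (F \<omega> :: ennreal)" by (elim bexE conjE)
  then show ?thesis by eventually_elim (rule conjunct1)
qed

section \<open>Invariance under the rate and branching at the origin\<close>

lemma many_classes_geodesics:
  assumes "tame_geodesics l \<omega>"
  shows "many_classes n (origin_star l \<omega>) \<longleftrightarrow> n \<le> card (infinite_geodesics Y R l \<omega>)"
proof -
  have eq: "infinite_geodesics Y R l \<omega> = ray_traces (origin_star l \<omega>)" and fin: "finite (ray_traces (origin_star l \<omega>))"
    using assms unfolding tame_geodesics_def by auto
  interpret tame_routes "origin_star l \<omega>" using assms unfolding tame_geodesics_def by blast
  show ?thesis unfolding many_classes_iff eq by (rule many_le_card[OF fin])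
qed

lemma branch_beyond_geodesics:
  assumes "tame_geodesics l \<omega>" "0 < r"
  shows "branch_beyond r (origin_star l \<omega>) \<longleftrightarrow> (\<exists>X\<in>infinite_geodesics Y R l \<omega>. \<exists>Y\<in>infinite_geodesics Y R l \<omega>.
    X \<noteq> Y \<and> (\<exists>q\<in>X \<inter> Y. r \<le> norm q))"
proof -
  have eq: "infinite_geodesics Y R l \<omega> = ray_traces (origin_star l \<omega>)"
    using assms unfolding tame_geodesics_def by blast
  interpret tame_routes "origin_star l \<omega>" using assms unfolding tame_geodesics_def by blast
  show ?thesis unfolding eq by (rule branch_beyond_iff[OF assms(2)])
qed

text \<open>Two distinct geodesics have a bounded set of common points, and there are finitely many
  pairs.\<close>

lemma not_branch_beyond_far:
  assumes "tame_geodesics l \<omega>" "0 < r"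
  shows "\<exists>m::nat. \<not> branch_beyond (real (Suc m) * r) (origin_star l \<omega>)"
proof -
  let ?T = "ray_traces (origin_star l \<omega>)"
  have eq: "infinite_geodesics Y R l \<omega> = ?T" and fin: "finite ?T"
    using assms unfolding tame_geodesics_def by auto
  interpret tame_routes "origin_star l \<omega>" using assms unfolding tame_geodesics_def by blast
  let ?P = "{p\<in>?T \<times> ?T. fst p \<noteq> snd p}"
  have "bounded (\<Union>p\<in>?P. fst p \<inter> snd p)"
  proof (rule bounded_UN)
    show "finite ?P" using fin by simp
    show "\<forall>p\<in>?P. bounded (fst p \<inter> snd p)"
    proof
      fix p assume "p \<in> ?P"
      then have "fst p \<in> ?T" "snd p \<in> ?T" "fst p \<noteq> snd p" by auto
      then obtain m :: nat where "\<And>q. q \<in> fst p \<Longrightarrow> q \<in> snd p \<Longrightarrow> norm q < m" by (rule common_points_bounded) metis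
      then have "norm q \<le> real m" if "q \<in> fst p \<inter> snd p" for q using that by force
      then show "bounded (fst p \<inter> snd p)" unfolding bounded_iff by blast
    qed
  qed
  then obtain b where b: "\<And>q. q \<in> (\<Union>p\<in>?P. fst p \<inter> snd p) \<Longrightarrow> norm q \<le> b" unfolding bounded_iff by blast
  obtain m :: nat where "b < real m * r" using reals_Archimedean3[OF assms(2)] by blast
  moreover have "real m * r \<le> real (Suc m) * r" using assms(2) by (intro mult_right_mono) simp_all
  ultimately have m: "b < real (Suc m) * r" by linarith
  have pos: "0 < real (Suc m) * r" using assms(2) by simp
  have "\<not> branch_beyond (real (Suc m) * r) (origin_star l \<omega>)"
  proof
    assume "branch_beyond (real (Suc m) * r) (origin_star l \<omega>)"
    then obtain X Z q where XZ: "X \<in> ?T" "Z \<in> ?T" "X \<noteq> Z" "q \<in> X \<inter> Z" "real (Suc m) * r \<le> norm q"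
      unfolding branch_beyond_iff[OF pos] by blast
    have "norm q \<le> b" using XZ by (intro b UN_I[of "(X, Z)"]) simp_all
    then show False using XZ(5) m by linarith
  qed
  then show ?thesis ..
qed

text \<open>Both rates are compared with rate 1, by the dilations with factors \<open>n\<close> and
  \<open>1 / n\<close>.\<close>

lemma prob_many_classes:
  assumes "0 < (n::nat)"
  shows "prob {\<omega>\<in>space M. many_classes k (origin_star (1 / (real n)\<^sup>2) \<omega>)} = prob {\<omega>\<in>space M. many_classes k (origin_star ((real n)\<^sup>2) \<omega>)}"
proof -
  let ?p = "\<lambda>l. prob {\<omega>\<in>space M. many_classes k (origin_star l \<omega>)}"
  have "?p 1 = ?p (1 / c\<^sup>2)" if "0 < c" "c \<in> \<rat>" for c
    using prob_origin_star_scaling[OF zero_less_one that(1) many_classes_measurable, of k]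
    unfolding many_classes_scale[OF that] .
  from this[of "real n"] this[of "1 / real n"] show ?thesis using assms by (simp add: power_divide)
qed

text \<open>The count at the lower rate never exceeds the count at the higher one and has the same
  law, so the two agree almost surely; nested finite sets of equal cardinality coincide.\<close>

lemma AE_constant_up_to:
  assumes n: "0 < (n::nat)"
  shows "AE \<omega> in M. infinite_geodesics Y R (1 / (real n)\<^sup>2) \<omega> = infinite_geodesics Y R ((real n)\<^sup>2) \<omega>"
proof -
  let ?a = "1 / (real n)\<^sup>2" and ?b = "(real n)\<^sup>2"
  have ab: "0 < ?a" "0 < ?b" using n by simp_all
  have "1 \<le> ?b" using n by simp
  then have "?a \<le> 1" using n by (simp add: field_simps)
  then have "?a \<le> ?b" using \<open>1 \<le> ?b\<close> by (rule order_trans)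
  then have sub: "infinite_geodesics Y R ?a \<omega> \<subseteq> infinite_geodesics Y R ?b \<omega>" for \<omega> by (rule infinite_geodesics_mono)
  have "AE \<omega> in M. many_classes k (origin_star ?a \<omega>) \<longleftrightarrow> many_classes k (origin_star ?b \<omega>)" for k
  proof (rule AE_iff_of_prob_eq)
    show "Measurable.pred M (\<lambda>\<omega>. many_classes k (origin_star ?a \<omega>))" by measurable
    show "Measurable.pred M (\<lambda>\<omega>. many_classes k (origin_star ?b \<omega>))" by measurable
    show "prob {\<omega>\<in>space M. many_classes k (origin_star ?a \<omega>)} = prob {\<omega>\<in>space M. many_classes k (origin_star ?b \<omega>)}"
      by (rule prob_many_classes[OF n])
    show "AE \<omega> in M. many_classes k (origin_star ?a \<omega>) \<longrightarrow> many_classes k (origin_star ?b \<omega>)"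
      using AE_tame_geodesics[OF ab(1)] AE_tame_geodesics[OF ab(2)]
    proof eventually_elim
      case (elim \<omega>)
      have "card (infinite_geodesics Y R ?a \<omega>) \<le> card (infinite_geodesics Y R ?b \<omega>)"
        using elim(2) unfolding tame_geodesics_def by (intro card_mono sub) blast
      then show ?case unfolding many_classes_geodesics[OF elim(1)] many_classes_geodesics[OF elim(2)] by simp
    qed
  qed
  then have "AE \<omega> in M. \<forall>k. many_classes k (origin_star ?a \<omega>) \<longleftrightarrow> many_classes k (origin_star ?b \<omega>)"
    unfolding AE_all_countable by blast
  then show ?thesis using AE_tame_geodesics[OF ab(1)] AE_tame_geodesics[OF ab(2)]
  proof eventually_elim
    case (elim \<omega>)
    have "\<And>k. k \<le> card (infinite_geodesics Y R ?a \<omega>) \<longleftrightarrow> k \<le> card (infinite_geodesics Y R ?b \<omega>)"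
      using elim(1) unfolding many_classes_geodesics[OF elim(2)] many_classes_geodesics[OF elim(3)] by blast
    then have "card (infinite_geodesics Y R ?a \<omega>) = card (infinite_geodesics Y R ?b \<omega>)"
      by (meson order_antisym order_refl)
    moreover have "finite (infinite_geodesics Y R ?b \<omega>)" using elim(3) unfolding tame_geodesics_def by blast
    ultimately show ?case using sub by (intro card_subset_eq)
  qed
qed

text \<open>Every rate lies between \<open>1 / n\<^sup>2\<close> and \<open>n\<^sup>2\<close> for
  some \<open>n\<close>. By monotonicity countably many almost sure equalities control all real
  \<open>l\<close> at once.\<close>

lemma AE_constant: "AE \<omega> in M. \<forall>l>0. infinite_geodesics Y R l \<omega> = infinite_geodesics Y R 1 \<omega>"
proof -
  have "AE \<omega> in M. \<forall>n::nat. infinite_geodesics Y R (1 / (real (Suc n))\<^sup>2) \<omega> = infinite_geodesics Y R ((real (Suc n))\<^sup>2) \<omega>"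
    unfolding AE_all_countable
  proof
    fix n :: nat
    show "AE \<omega> in M. infinite_geodesics Y R (1 / (real (Suc n))\<^sup>2) \<omega> = infinite_geodesics Y R ((real (Suc n))\<^sup>2) \<omega>"
      by (rule AE_constant_up_to) (rule zero_less_Suc)
  qed
  then show ?thesis
  proof eventually_elim
    case (elim \<omega>)
    show ?case
    proof (intro allI impI)
      fix l :: real assume l: "0 < l"
      obtain n :: nat where n: "max l (1 / l) \<le> real n" using real_arch_simple by blast
      let ?b = "(real (Suc n))\<^sup>2"
      have b: "real n \<le> ?b" "1 \<le> ?b" using self_le_power[of "real (Suc n)" 2] by simp_all
      have lb: "l \<le> ?b" "1 / l \<le> ?b" using order_trans[OF n b(1)] by simp_all
      have al: "1 / ?b \<le> l" using lb(2) l b(2) by (simp add: field_simps)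
      have a1: "1 / ?b \<le> 1" using b(2) by simp
      have eq: "infinite_geodesics Y R (1 / ?b) \<omega> = infinite_geodesics Y R ?b \<omega>" by (rule elim[rule_format])
      have "infinite_geodesics Y R l \<omega> = infinite_geodesics Y R ?b \<omega>"
        using infinite_geodesics_mono[OF al, of Y R \<omega>] infinite_geodesics_mono[OF lb(1), of Y R \<omega>] unfolding eq by (rule equalityI[rotated])
      moreover have "infinite_geodesics Y R 1 \<omega> = infinite_geodesics Y R ?b \<omega>"
        using infinite_geodesics_mono[OF a1, of Y R \<omega>] infinite_geodesics_mono[OF b(2), of Y R \<omega>] unfolding eq by (rule equalityI[rotated])
      ultimately show "infinite_geodesics Y R l \<omega> = infinite_geodesics Y R 1 \<omega>" by simp
    qed
  qed
qed

text \<open>Since the geodesics do not depend on the rate, scaling shows that branching beyond \<open>r\<close> has the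
  same probability for all \<open>r\<close>; but finitely many geodesics branch within a bounded region.\<close>

lemma AE_not_branch_beyond:
  assumes r: "0 < r"
  shows "AE \<omega> in M. \<not> branch_beyond r (origin_star 1 \<omega>)"
proof -
  let ?B = "\<lambda>m. {\<omega>\<in>space M. branch_beyond (real (Suc m) * r) (origin_star 1 \<omega>)}"
  have B[measurable]: "?B m \<in> sets M" for m by measurable
  have const: "prob (?B m) = prob {\<omega>\<in>space M. branch_beyond r (origin_star 1 \<omega>)}" for m
  proof -
    let ?c = "real (Suc m)"
    have c: "0 < ?c" "?c \<in> \<rat>" by (simp, rule Rats_of_nat)
    have l: "0 < 1 / ?c\<^sup>2" by simp
    have "prob {\<omega>\<in>space M. branch_beyond r (origin_star 1 \<omega>)} =
        prob {\<omega>\<in>space M. branch_beyond (?c * r) (\<lambda>n. scale ?c (origin_star 1 \<omega> n))}"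
      unfolding branch_beyond_scale[OF c] ..
    also have "\<dots> = prob {\<omega>\<in>space M. branch_beyond (?c * r) (origin_star (1 / ?c\<^sup>2) \<omega>)}"
      by (rule prob_origin_star_scaling[OF zero_less_one c(1) branch_beyond_measurable])
    also have "\<dots> = prob (?B m)"
    proof (rule measure_eq_AE)
      have cr: "0 < ?c * r" using r by simp
      show "AE \<omega> in M. \<omega> \<in> {\<omega>\<in>space M. branch_beyond (?c * r) (origin_star (1 / ?c\<^sup>2) \<omega>)} \<longleftrightarrow> \<omega> \<in> ?B m"
        using AE_tame_geodesics[OF zero_less_one] AE_tame_geodesics[OF l] AE_constant
      proof eventually_elim
        case (elim \<omega>)
        have "infinite_geodesics Y R (1 / ?c\<^sup>2) \<omega> = infinite_geodesics Y R 1 \<omega>" using elim(3) l by blast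
        then show ?case
          unfolding mem_Collect_eq branch_beyond_geodesics[OF elim(1) cr] branch_beyond_geodesics[OF elim(2) cr] by simp
      qed
    qed measurable
    finally show ?thesis ..
  qed
  have "decseq ?B"
  proof (rule decseq_SucI, rule subsetI)
    fix m \<omega> assume "\<omega> \<in> ?B (Suc m)"
    moreover have "real (Suc m) * r \<le> real (Suc (Suc m)) * r" using r by (intro mult_right_mono) simp_all
    ultimately show "\<omega> \<in> ?B m" using branch_beyond_mono by blast
  qed
  then have "(\<lambda>m. prob (?B m)) \<longlonglongrightarrow> prob (\<Inter>m. ?B m)"
    by (intro finite_Lim_measure_decseq) auto
  moreover have "prob (\<Inter>m. ?B m) = 0"
  proof -
    have "AE \<omega> in M. \<omega> \<notin> (\<Inter>m. ?B m)"
      using AE_tame_geodesics[OF zero_less_one]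
    proof eventually_elim
      case (elim \<omega>)
      obtain m :: nat where "\<not> branch_beyond (real (Suc m) * r) (origin_star 1 \<omega>)"
        using not_branch_beyond_far[OF elim r] ..
      then show ?case by blast
    qed
    then show ?thesis by (subst prob_eq_0) auto
  qed
  ultimately have "prob {\<omega>\<in>space M. branch_beyond r (origin_star 1 \<omega>)} = 0"
    unfolding const by (simp add: LIMSEQ_const_iff)
  then have "AE \<omega> in M. \<omega> \<notin> {\<omega>\<in>space M. branch_beyond r (origin_star 1 \<omega>)}" by (subst (asm) prob_eq_0) auto
  then show ?thesis using AE_space by eventually_elim blast
qed

text \<open>The countably many radii \<open>inverse (real (Suc n))\<close> suffice, since any common
  point other than 0 lies beyond one of them.\<close>

lemma AE_branch_at_origin:
  "AE \<omega> in M. \<forall>X\<in>infinite_geodesics Y R 1 \<omega>. \<forall>Z\<in>infinite_geodesics Y R 1 \<omega>. X \<noteq> Z \<longrightarrow> X \<inter> Z = {0}"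
proof -
  have "AE \<omega> in M. \<forall>n. \<not> branch_beyond (inverse (real (Suc n))) (origin_star 1 \<omega>)"
    unfolding AE_all_countable by (intro allI AE_not_branch_beyond) simp
  then show ?thesis using AE_tame_geodesics[OF zero_less_one]
  proof eventually_elim
    case (elim \<omega>)
    interpret tame_routes "origin_star 1 \<omega>" using elim(2) unfolding tame_geodesics_def by blast
    have eq: "infinite_geodesics Y R 1 \<omega> = ray_traces (origin_star 1 \<omega>)"
      using elim(2) unfolding tame_geodesics_def by blast
    show ?case
    proof (intro ballI impI)
      fix X Z assume XZ: "X \<in> infinite_geodesics Y R 1 \<omega>" "Z \<in> infinite_geodesics Y R 1 \<omega>" "X \<noteq> Z"
      have "0 \<in> X \<inter> Z" using XZ zero_in_trace unfolding eq by blast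
      moreover have "q = 0" if q: "q \<in> X \<inter> Z" for q
      proof (rule ccontr)
        assume "q \<noteq> 0"
        then obtain n where n: "inverse (real (Suc n)) < norm q" using reals_Archimedean[of "norm q"] by auto
        have "0 < inverse (real (Suc n))" by simp
        from branch_beyond_geodesics[OF elim(2) this] have "branch_beyond (inverse (real (Suc n))) (origin_star 1 \<omega>)"
          using XZ q n by (meson less_imp_le)
        then show False using elim(1) by blast
      qed
      ultimately show "X \<inter> Z = {0}" by blast
    qed
  qed
qed

end

theorem corollary23:
  fixes \<mu> :: "nat \<Rightarrow> (nat \<Rightarrow> point) \<Rightarrow> (nat \<times> nat \<Rightarrow> route) measure"
    and M :: "'w measure"
    and Y :: "nat \<Rightarrow> 'w \<Rightarrow> point \<times> real"
    and R :: "nat \<times> nat \<Rightarrow> 'w \<Rightarrow> route"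
  assumes "sirsn \<mu> M Y R"
  shows "\<exists>G :: 'w \<Rightarrow> nat.
    G \<in> M \<rightarrow>\<^sub>M count_space UNIV \<and> integrable M (\<lambda>\<omega>. real (G \<omega>)) \<and>
    (AE \<omega> in M.
       (\<forall>l>0. finite (infinite_geodesics Y R l \<omega>)) \<and>
       mono_on {0<..} (\<lambda>l. card (infinite_geodesics Y R l \<omega>)) \<and>
       ((\<lambda>l. card (infinite_geodesics Y R l \<omega>)) \<longlongrightarrow> G \<omega>) at_top \<and>
       (1 < G \<omega> \<longrightarrow>
          (\<forall>\<gamma>\<in>\<Union>l\<in>{0<..}. infinite_geodesics Y R l \<omega>.
           \<forall>\<gamma>'\<in>\<Union>l\<in>{0<..}. infinite_geodesics Y R l \<omega>.
             \<gamma> \<noteq> \<gamma>' \<longrightarrow> \<gamma> \<inter> \<gamma>' = {0})))"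
proof -
  interpret sirsn \<mu> M Y R by fact
  let ?T = "\<lambda>l \<omega>. infinite_geodesics Y R l \<omega>"
  \<comment> \<open>Built from measurable events to be a random variable everywhere. It equals the
    number \<open>k\<close> of geodesics almost surely, because \<open>Suc n \<le> k\<close> holds
    for exactly \<open>k\<close> values of \<open>n\<close>.\<close>
  define G where "G \<omega> = card {n. many_classes (Suc n) (origin_star 1 \<omega>)}" for \<omega>
  have Gm: "G \<in> M \<rightarrow>\<^sub>M count_space UNIV"
  proof -
    have "Measurable.pred M (\<lambda>\<omega>. many_classes (Suc n) (origin_star 1 \<omega>))" for n by measurable
    then show ?thesis unfolding G_def by (intro measurable_card) (simp add: pred_def)
  qed
  have G: "AE \<omega> in M. G \<omega> = card (?T 1 \<omega>)"
    using AE_tame_geodesics[OF zero_less_one]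
  proof eventually_elim
    case (elim \<omega>)
    show ?case unfolding G_def many_classes_geodesics[OF elim] by (simp add: Suc_le_eq)
  qed
  obtain F where F: "F \<in> borel_measurable M" "(\<integral>\<^sup>+ \<omega>. F \<omega> \<partial>M) < \<infinity>" "AE \<omega> in M. of_nat (card (?T 1 \<omega>)) \<le> F \<omega>"
  proof -
    from AE_count_bound[OF zero_less_one] obtain F where F: "F \<in> borel_measurable M" "(\<integral>\<^sup>+ \<omega>. F \<omega> \<partial>M) < \<infinity>"
      "AE \<omega> in M. tame_geodesics 1 \<omega> \<and> of_nat (card (?T 1 \<omega>)) \<le> F \<omega>" by (elim bexE conjE)
    from F(3) have "AE \<omega> in M. of_nat (card (?T 1 \<omega>)) \<le> F \<omega>" by eventually_elim (rule conjunct2)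
    then show ?thesis by (rule that[OF F(1,2)])
  qed
  have "integrable M (\<lambda>\<omega>. real (G \<omega>))"
  proof (rule integrableI_bounded)
    show "(\<lambda>\<omega>. real (G \<omega>)) \<in> borel_measurable M" using Gm by measurable
    have "AE \<omega> in M. ennreal (norm (real (G \<omega>))) \<le> F \<omega>"
      using G F(3) by eventually_elim (simp add: ennreal_of_nat_eq_real_of_nat)
    then have "(\<integral>\<^sup>+ \<omega>. ennreal (norm (real (G \<omega>))) \<partial>M) \<le> (\<integral>\<^sup>+ \<omega>. F \<omega> \<partial>M)"
      by (rule nn_integral_mono_AE)
    then show "(\<integral>\<^sup>+ \<omega>. ennreal (norm (real (G \<omega>))) \<partial>M) < \<infinity>" using F(2) by (rule le_less_trans)
  qed
  moreover have "AE \<omega> in M. (\<forall>l>0. finite (?T l \<omega>)) \<and> mono_on {0<..} (\<lambda>l. card (?T l \<omega>)) \<and>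
      ((\<lambda>l. card (?T l \<omega>)) \<longlongrightarrow> G \<omega>) at_top \<and>
      (1 < G \<omega> \<longrightarrow> (\<forall>\<gamma>\<in>\<Union>l\<in>{0<..}. ?T l \<omega>. \<forall>\<gamma>'\<in>\<Union>l\<in>{0<..}. ?T l \<omega>. \<gamma> \<noteq> \<gamma>' \<longrightarrow> \<gamma> \<inter> \<gamma>' = {0}))"
    using AE_tame_geodesics[OF zero_less_one] AE_constant G AE_branch_at_origin
  proof eventually_elim
    case (elim \<omega>)
    have G1: "G \<omega> = card (?T 1 \<omega>)" by (rule elim(3))
    have const: "?T l \<omega> = ?T 1 \<omega>" if "0 < l" for l using elim(2) that by blast
    have fin: "finite (?T 1 \<omega>)" using elim(1) unfolding tame_geodesics_def by blast
    have "finite (?T l \<omega>)" if "0 < l" for l unfolding const[OF that] by (rule fin)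
    then have "\<forall>l>0. finite (?T l \<omega>)" by blast
    moreover have "mono_on {0<..} (\<lambda>l. card (?T l \<omega>))"
    proof (rule mono_onI)
      fix l l' :: real assume "l \<in> {0<..}" "l' \<in> {0<..}"
      then have pos: "0 < l" "0 < l'" by simp_all
      show "card (?T l \<omega>) \<le> card (?T l' \<omega>)" unfolding const[OF pos(1)] const[OF pos(2)] ..
    qed
    moreover have "((\<lambda>l. card (?T l \<omega>)) \<longlongrightarrow> G \<omega>) at_top"
    proof (rule tendsto_eventually)
      show "\<forall>\<^sub>F l in at_top. card (?T l \<omega>) = G \<omega>"
        using eventually_gt_at_top[of 0]
      proof eventually_elim
        case (elim l)
        show ?case unfolding const[OF elim] G1 ..
      qed
    qed
    moreover have "(\<Union>l\<in>{0<..}. ?T l \<omega>) = ?T 1 \<omega>"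
    proof (intro equalityI subsetI)
      fix X assume "X \<in> (\<Union>l\<in>{0<..}. ?T l \<omega>)"
      then obtain l where l: "l \<in> {0<..}" "X \<in> ?T l \<omega>" by (rule UN_E)
      then have "0 < l" by simp
      then show "X \<in> ?T 1 \<omega>" using l(2) const[of l] by metis
    next
      fix X assume "X \<in> ?T 1 \<omega>"
      then show "X \<in> (\<Union>l\<in>{0<..}. ?T l \<omega>)" by (intro UN_I[of 1]) simp_all
    qed
    ultimately show ?case using elim(4) by metis
  qed
  ultimately show ?thesis using Gm by blast
qed

end
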